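(* Let $R\in(0,\infty)$ and let $\mathcal O\subset\mathbb R\times B_R$ be a bounded domain in $\mathbb R^{d+1}$. Let $a$ (symmetric nonnegative definite $d\times d$-matrix valued), $b$ ($\mathbb R^d$-valued), $c\ge0$, $r\ge0$ be Borel functions on $\mathcal O$. Let $p_0,q_0\in[1,\infty]$ with $\nu_0:=1-\frac d{p_0}-\frac1{q_0}\ge0$, and suppose there is a Borel $h\in L_{(q_0,p_0)}$ such that $$|b|\le r^{1/q_0}(\det a)^{1/p_0}c^{\nu_0}h\quad\text{in }\mathcal O,$$ where $\alpha^0:=1$ for $\alpha\ge0$. Suppose $r+\operatorname{tr}a+c>0$ a.e. in $\mathcal O$. Let $p,q\in(1,\infty)$ with $\nu:=1-\frac dp-\frac1q\ge0$ and let $u\in W^{1,2}_{(q,p),\mathrm{loc}}(\mathcal O)\cap C(\bar{\mathcal O})$. Then on $\mathcal O$ $$u\le\sup_{\partial'\mathcal O}u_++N(d,p_0)\,C\,\big\|c^{-\nu}r^{-1/q}(\det a)^{-1/p}(\mathcal Lu)_-\big\|_{L_{(q,p)}(\mathcal O)},$$ where $N(d,p_0)$ depends only on $d,p_0$, and $$C=\Big(R+\|h\|_{L_{(q_0,p_0)}}^{p_0/(p_0-d)}\Big)^{d/p}\ \text{ if }p_0>d,\qquad C=N(d,\|h\|_{L_{(\infty,d)}})\,R^{d/p}\ \text{ if }p_0=d$$ (with $p_0/(p_0-d):=1$ for $p_0=\infty$).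
   Context: $d\ge2$, $B_R=\{|x|<R\}\subset\mathbb R^d$, $$\mathcal Lu=r\,\partial_tu+\tfrac12a^{ij}D_{ij}u+b^iD_iu-cu,$$ $f_\pm=(|f|\pm f)/2$. The norm on the right is taken only over the set $\{\mathcal Lu<0\}\cap\mathcal O$, even if the factor of $(\mathcal Lu)_-$ is infinite ($0^{-1}$) outside this set (the norm is infinite if the factor is infinite on a subset of $\{\mathcal Lu<0\}$ of positive measure); if $\nu=0$, then $c^{-\nu}:=1$ even where $c=0$. The parabolic boundary $\partial'\mathcal O$ is the set of all $(t_0,x_0)\in\partial\mathcal O$ for which there are a continuous $\mathbb R^d$-valued function $x_t$ and $\epsilon>0$ with $x_{t_0}=x_0$ and $(t,x_t)\in\mathcal O$ for $t\in[t_0-\epsilon,t_0)$. $\|f\|_{L_{(q,p)}}=\big(\int_{\mathbb R}(\int_{\mathbb R^d}|f|^pdx)^{q/p}dt\big)^{1/q}$ if $p>q$ and $=\big(\int_{\mathbb R^d}(\int_{\mathbb R}|f|^qdt)^{p/q}dx\big)^{1/p}$ if $q\ge p$ (sup for infinite exponents); $\|f\|_{L_{(q,p)}(\mathcal O)}=\|fI_{\mathcal O}\|_{L_{(q,p)}}$. $W^{1,2}_{(q,p)}(\mathcal O)$: functions with $u$ and Sobolev derivatives $\partial_tu,Du,D^2u$ in $L_{(q,p)}(\mathcal O)$; "loc": in $W^{1,2}_{(q,p)}(\mathcal O')$ for every open $\mathcal O'$ with $\bar{\mathcal O'}\subset\mathcal O$ compact. *)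

theory Defs
  imports "HOL-Analysis.Analysis" "HOL-Probability.Essential_Supremum"
begin

(* Space-time is real * (real^'n), time first; the dimension is d = CARD('n). *)

(* x^0 = 1 also at x = 0, whereas 0 powr 0 = 0 in the library. *)
definition rpow :: "real \<Rightarrow> real \<Rightarrow> real" where
  "rpow x s = (if s = 0 then 1 else x powr s)"

(* The same on [0,\<infinity>], with 0^s = \<infinity> and \<infinity>^s = 0 for s < 0. *)
definition epow :: "ennreal \<Rightarrow> real \<Rightarrow> ennreal" where
  "epow x s =
    (if s = 0 then 1
     else if x = 0 then (if s > 0 then 0 else top)
     else if x = top then (if s > 0 then top else 0)
     else ennreal (enn2real x powr s))"

(* 1/p for an exponent p in [1,\<infinity>], with 1/\<infinity> = 0. *)
definition recip :: "ennreal \<Rightarrow> real" where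
  "recip p = enn2real (inverse p)"

definition Lp_norm :: "'a measure \<Rightarrow> ennreal \<Rightarrow> ('a \<Rightarrow> ennreal) \<Rightarrow> ennreal" where
  "Lp_norm M p F =
    (if p = top then esssup M F
     else epow (\<integral>\<^sup>+ x. epow (F x) (enn2real p) \<partial>M) (recip p))"

(* Values in [0,\<infinity>] are allowed, so that functions with singular weights have a norm.
   The larger exponent is integrated first. *)
definition mixed_norm ::
  "ennreal \<Rightarrow> ennreal \<Rightarrow> (real \<times> (real^'n) \<Rightarrow> ennreal) \<Rightarrow> ennreal" where
  "mixed_norm q p F =
    (if p > q then Lp_norm lborel q (\<lambda>t. Lp_norm lborel p (\<lambda>x. F (t, x)))
     else Lp_norm lborel p (\<lambda>x. Lp_norm lborel q (\<lambda>t. F (t, x))))"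

definition mixed_norm_on ::
  "ennreal \<Rightarrow> ennreal \<Rightarrow> (real \<times> (real^'n)) set \<Rightarrow> (real \<times> (real^'n) \<Rightarrow> ennreal) \<Rightarrow> ennreal" where
  "mixed_norm_on q p \<Omega> F = mixed_norm q p (\<lambda>z. indicator \<Omega> z * F z)"

definition mixed_L ::
  "ennreal \<Rightarrow> ennreal \<Rightarrow> (real \<times> (real^'n)) set \<Rightarrow> (real \<times> (real^'n) \<Rightarrow> real) set" where
  "mixed_L q p \<Omega> =
    {f. f \<in> borel_measurable (restrict_space borel \<Omega>) \<and>
        mixed_norm_on q p \<Omega> (\<lambda>z. ennreal \<bar>f z\<bar>) < top}"

definition dir_deriv :: "'a::euclidean_space \<Rightarrow> ('a \<Rightarrow> real) \<Rightarrow> 'a \<Rightarrow> real" where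
  "dir_deriv v f x = frechet_derivative f (at x) v"

abbreviation dir_derivs :: "'a::euclidean_space list \<Rightarrow> ('a \<Rightarrow> real) \<Rightarrow> 'a \<Rightarrow> real" where
  "dir_derivs vs f \<equiv> foldr dir_deriv vs f"

(* f is C^\<infinity>: every iterated directional derivative (the empty list gives f itself)
   is differentiable everywhere. *)
definition smooth :: "('a::euclidean_space \<Rightarrow> real) \<Rightarrow> bool" where
  "smooth f \<longleftrightarrow> (\<forall>vs x. dir_derivs vs f differentiable (at x))"

definition test_functions :: "'a::euclidean_space set \<Rightarrow> ('a \<Rightarrow> real) set" where
  "test_functions \<Omega> =
    {\<phi>. smooth \<phi> \<and> compact (closure {x. \<phi> x \<noteq> 0}) \<and> closure {x. \<phi> x \<noteq> 0} \<subseteq> \<Omega>}"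

definition locally_integrable_on :: "'a::euclidean_space set \<Rightarrow> ('a \<Rightarrow> real) \<Rightarrow> bool" where
  "locally_integrable_on \<Omega> f \<longleftrightarrow>
    (\<forall>K. compact K \<and> K \<subseteq> \<Omega> \<longrightarrow> set_integrable lborel K f)"

(* v is a version of the weak derivative of u in the directions vs, in the open set \<Omega>. *)
definition weak_deriv ::
  "'a::euclidean_space set \<Rightarrow> 'a list \<Rightarrow> ('a \<Rightarrow> real) \<Rightarrow> ('a \<Rightarrow> real) \<Rightarrow> bool" where
  "weak_deriv \<Omega> vs u v \<longleftrightarrow>
    locally_integrable_on \<Omega> u \<and> locally_integrable_on \<Omega> v \<and>
    (\<forall>\<phi>\<in>test_functions \<Omega>.
      set_lebesgue_integral lborel \<Omega> (\<lambda>z. u z * dir_derivs vs \<phi> z) =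
      (- 1) ^ length vs * set_lebesgue_integral lborel \<Omega> (\<lambda>z. v z * \<phi> z))"

definition sobolev_derivs ::
  "(real \<times> (real^'n)) set \<Rightarrow> (real \<times> (real^'n) \<Rightarrow> real) \<Rightarrow> (real \<times> (real^'n) \<Rightarrow> real) \<Rightarrow>
   (real \<times> (real^'n) \<Rightarrow> real^'n) \<Rightarrow> (real \<times> (real^'n) \<Rightarrow> real^'n^'n) \<Rightarrow> bool" where
  "sobolev_derivs \<Omega> u ut Du D2u \<longleftrightarrow>
    weak_deriv \<Omega> [(1, 0)] u ut \<and>
    (\<forall>i. weak_deriv \<Omega> [(0, axis i 1)] u (\<lambda>z. Du z $ i)) \<and>
    (\<forall>i j. weak_deriv \<Omega> [(0, axis i 1), (0, axis j 1)] u (\<lambda>z. D2u z $ i $ j))"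

definition W12 ::
  "ennreal \<Rightarrow> ennreal \<Rightarrow> (real \<times> (real^'n)) set \<Rightarrow> (real \<times> (real^'n) \<Rightarrow> real) set" where
  "W12 q p \<Omega> =
    {u. u \<in> mixed_L q p \<Omega> \<and>
      (\<exists>ut Du D2u. sobolev_derivs \<Omega> u ut Du D2u \<and> ut \<in> mixed_L q p \<Omega> \<and>
        (\<forall>i. (\<lambda>z. Du z $ i) \<in> mixed_L q p \<Omega>) \<and>
        (\<forall>i j. (\<lambda>z. D2u z $ i $ j) \<in> mixed_L q p \<Omega>))}"

definition W12_loc ::
  "ennreal \<Rightarrow> ennreal \<Rightarrow> (real \<times> (real^'n)) set \<Rightarrow> (real \<times> (real^'n) \<Rightarrow> real) set" where
  "W12_loc q p \<Omega> =
    {u. \<forall>\<Omega>'. open \<Omega>' \<and> compact (closure \<Omega>') \<and> closure \<Omega>' \<subseteq> \<Omega> \<longrightarrow> u \<in> W12 q p \<Omega>'}"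

(* The derivatives of u are passed explicitly, since they are determined only a.e. *)
definition parabolic_op ::
  "(real \<times> (real^'n) \<Rightarrow> real^'n^'n) \<Rightarrow> (real \<times> (real^'n) \<Rightarrow> real^'n) \<Rightarrow>
   (real \<times> (real^'n) \<Rightarrow> real) \<Rightarrow> (real \<times> (real^'n) \<Rightarrow> real) \<Rightarrow>
   (real \<times> (real^'n) \<Rightarrow> real) \<Rightarrow> (real \<times> (real^'n) \<Rightarrow> real) \<Rightarrow>
   (real \<times> (real^'n) \<Rightarrow> real^'n) \<Rightarrow> (real \<times> (real^'n) \<Rightarrow> real^'n^'n) \<Rightarrow>
   real \<times> (real^'n) \<Rightarrow> real" where
  "parabolic_op a b c r u ut Du D2u z =
    r z * ut z + (1/2) * (\<Sum>i\<in>UNIV. \<Sum>j\<in>UNIV. a z $ i $ j * D2u z $ i $ j)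
    + (\<Sum>i\<in>UNIV. b z $ i * Du z $ i) - c z * u z"

definition pos_part :: "real \<Rightarrow> real" where
  "pos_part x = (\<bar>x\<bar> + x) / 2"

definition neg_part :: "real \<Rightarrow> real" where
  "neg_part x = (\<bar>x\<bar> - x) / 2"

(* The curve approaches the boundary point from earlier times: the operator is backward
   parabolic. *)
definition parabolic_boundary :: "(real \<times> (real^'n)) set \<Rightarrow> (real \<times> (real^'n)) set" where
  "parabolic_boundary \<Omega> =
    {(t0, x0). (t0, x0) \<in> frontier \<Omega> \<and>
      (\<exists>(x :: real \<Rightarrow> real^'n) \<epsilon>. \<epsilon> > 0 \<and> continuous_on UNIV x \<and> x t0 = x0 \<and>
        (\<forall>t\<in>{t0 - \<epsilon>..<t0}. (t, x t) \<in> \<Omega>))}"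

end

(* Let v = u - sup u_+ (over the parabolic boundary), M = v(z0) > 0, and let a point (t,x) be a contact point
   if the affine function of the space variable that is tangent to v(t,.) at x lies above v at all later times.
   The map Phi(t,x) = (v - x.Dv, Dv) sends the contact points onto almost all of [M/2, 5M/8] x {|xi| <= M/(4R)}, and its
   Jacobian is |v_t| det(-D^2 v). Where the equation bounds a product |v_t|^(1/q) det(-D^2 v)^(1/p) v^nu,
   mixed-norm Hoelder bounds the measure of the image, because |v_t| integrates to at most M over each line in time
   and det(-D^2 v) to at most c rho^d over each time slice, where |Dv| <= rho. The drift is absorbed by
   restricting the slopes to a small ball if p0 > d, and to a suitable dyadic annulus, found by the pigeonhole
   principle, if p0 = d. Since u is not smooth, all this is done for mollifications; convolutions of the second
   derivatives are equi-integrable in the mixed norm, so the part of the contact set where the limiting equation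
   says nothing contributes arbitrarily little. *)
theory Submission
  imports Defs
begin

section \<open>Determinants and traces of positive semidefinite matrices\<close>

text \<open>The exponents satisfy 1/q + d/p + nu = 1, and likewise for p0 and q0. Hence weighted
  products of the coefficients with -u_t, det(-D^2 u) and u - sup u_+ are at most twice the sum of
  the nonnegative terms in -Lu, and at each point either (Lu)_- or the drift controls that sum. The
  coefficients are merely Borel and may degenerate, so the equation itself cannot be mollified; only
  this scalar alternative passes to the approximations, at the cost of a factor 2. Heights in
  [M/2, 5M/8] and slopes up to M/(4R) keep a plane at or above M/4 on the cylinder and at most 7M/8
  at z0. It therefore misses the parabolic boundary and meets the graph. With c = M omega rho^d the
  planes used have measure at least c/16. The drift may take c/64, the two approximation losses
  c/128 each, and c/32 is left for (Lu)_-. The share of the drift carries the factor (rho/M)^(1 -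
  d/p0), which a small rho makes small only if p0 > d; at p0 = d it is scale invariant, and a good
  scale has to be found instead.\<close>

definition psd :: "real^'n^'n \<Rightarrow> bool" where
  "psd A \<longleftrightarrow> transpose A = A \<and> (\<forall>x. 0 \<le> x \<bullet> (A *v x))"

lemma symmetric_inner: "transpose A = A \<Longrightarrow> (x::real^'n) \<bullet> (A *v y) = (A *v x) \<bullet> y"
  by (metis dot_lmul_matrix transpose_matrix_vector)

text \<open>The quadratic form of A attains its maximum on the unit sphere of the orthogonal
  complement V of E. Since E consists of eigenvectors, the residual w = A x - l x at a maximiser
  lies in V again, so it is an admissible direction of variation and must vanish.\<close>

lemma eigenvector_orthogonal_exists:
  fixes A :: "real^'n^'n"
  assumes sym: "transpose A = A"
    and E: "finite E" "card E < CARD('n)"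
    and eig: "\<And>e. e \<in> E \<Longrightarrow> \<exists>l. A *v e = l *\<^sub>R e"
  shows "\<exists>x. norm x = 1 \<and> (\<forall>e\<in>E. orthogonal x e) \<and> (\<exists>l. A *v x = l *\<^sub>R x)"
proof -
  define V where "V = {x. \<forall>e\<in>E. orthogonal x e}"
  have V_add: "x + y \<in> V" "c *\<^sub>R x \<in> V" if "x \<in> V" "y \<in> V" for x y and c :: real
    using that by (auto simp: V_def orthogonal_def inner_left_distrib)
  have "dim (span E) < DIM(real^'n)"
    using E dim_le_card'[OF E(1)] by (simp add: DIM_cart)
  then have "dim E < DIM(real^'n)" using \<open>dim (span E) < DIM(real^'n)\<close> by simp
  then obtain a where a: "a \<noteq> 0" "\<And>x. x \<in> span E \<Longrightarrow> orthogonal a x"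
    using orthogonal_to_subspace_exists by blast
  have aV: "(1 / norm a) *\<^sub>R a \<in> V"
    using a(2)[OF span_base] by (auto simp: V_def orthogonal_def)
  define S where "S = V \<inter> sphere 0 1"
  have "closed V"
  proof -
    have "V = (\<Inter>e\<in>E. {x. x \<bullet> e = 0})" by (auto simp: V_def orthogonal_def)
    moreover have "closed {x. x \<bullet> e = (0::real)}" for e :: "real^'n"
      by (intro closed_Collect_eq continuous_intros)
    ultimately show ?thesis by auto
  qed
  then have "compact S" by (auto simp: S_def intro: closed_Int_compact)
  moreover have "S \<noteq> {}"
    using aV a by (auto simp: S_def intro!: exI[of _ "(1 / norm a) *\<^sub>R a"])
  moreover have "continuous_on S (\<lambda>x. x \<bullet> (A *v x))"
    by (intro continuous_intros matrix_vector_mult_linear_continuous_on)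
  ultimately obtain x where x: "x \<in> S" "\<And>y. y \<in> S \<Longrightarrow> y \<bullet> (A *v y) \<le> x \<bullet> (A *v x)"
    using continuous_attains_sup[of S] by metis
  define l where "l = x \<bullet> (A *v x)"
  have x1: "norm x = 1" "x \<in> V" "x \<bullet> x = 1"
    using x by (auto simp: S_def dot_square_norm)
  have max: "y \<bullet> (A *v y) \<le> l * (y \<bullet> y)" if "y \<in> V" for y
  proof (cases "y = 0")
    case False
    have "(1 / norm y) *\<^sub>R y \<in> S"
      using that False by (auto simp: S_def V_add)
    from x(2)[OF this] have "(1 / norm y)^2 * (y \<bullet> (A *v y)) \<le> l"
      by (simp add: l_def scaleR_matrix_vector_assoc[symmetric] matrix_vector_mult_scaleR power2_eq_square)
    then show ?thesis using False
      by (simp add: power_divide dot_square_norm divide_simps mult.commute)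
  qed simp
  define w where "w = A *v x - l *\<^sub>R x"
  have wE: "w \<bullet> e = 0" if e: "e \<in> E" for e
  proof -
    obtain m where m: "A *v e = m *\<^sub>R e" using eig[OF e] by blast
    have "(A *v x) \<bullet> e = x \<bullet> (A *v e)" by (simp add: symmetric_inner[OF sym])
    then show ?thesis using x1(2) e
      by (simp add: w_def inner_diff_left m V_def orthogonal_def)
  qed
  have wV: "w \<in> V" using wE by (simp add: V_def orthogonal_def)
  have wx: "w \<bullet> x = 0"
    using inner_commute[of "A *v x" x] by (simp add: w_def inner_diff_left x1 l_def)
  \<comment> \<open>Maximality tested at x + s w: the terms of order zero cancel, and
    \<open>wx\<close> removes the mixed term on the right.\<close>
  have quad: "2 * s * (w \<bullet> (A *v x)) \<le> s^2 * (l * (w \<bullet> w) - w \<bullet> (A *v w))" for s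
  proof -
    have "x + s *\<^sub>R w \<in> V" using V_add x1 wV by blast
    from max[OF this] show ?thesis
      by (simp add: matrix_vector_right_distrib matrix_vector_mult_scaleR inner_left_distrib
          inner_right_distrib wx inner_commute[of x w] x1 l_def[symmetric] power2_eq_square
          symmetric_inner[OF sym, of x w] inner_commute[of "A *v x" w] algebra_simps)
  qed
  have "w \<bullet> (A *v x) = 0"
  proof (rule ccontr)
    assume ne: "w \<bullet> (A *v x) \<noteq> 0"
    define g where "g = w \<bullet> (A *v x)"
    define k where "k = l * (w \<bullet> w) - w \<bullet> (A *v w)"
    \<comment> \<open>Small enough that the quadratic term is at most s * g, half of the linear term
      2 * s * g.\<close>
    define s where "s = g / (\<bar>k\<bar> + 1)"
    have "2 * s * g \<le> s^2 * k" using quad[of s] by (simp add: g_def k_def)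
    also have "\<dots> \<le> s^2 * (\<bar>k\<bar> + 1)" by (intro mult_left_mono) auto
    also have "\<dots> = s * g" by (simp add: s_def power2_eq_square)
    finally have "s * g \<le> 0" by (simp add: mult.commute)
    moreover have "s * g > 0" using ne by (auto simp: s_def g_def zero_less_mult_iff zero_less_divide_iff)
    ultimately show False by simp
  qed
  then have "w \<bullet> w = 0"
    using wx by (subst (2) w_def) (simp add: inner_diff_right)
  then have "A *v x = l *\<^sub>R x" by (simp add: w_def)
  then show ?thesis using x1 by (auto simp: V_def)
qed

lemma orthonormal_eigenvectors:
  fixes A :: "real^'n^'n"
  assumes sym: "transpose A = A" and "k \<le> CARD('n)"
  shows "\<exists>E. finite E \<and> card E = k \<and> pairwise orthogonal E \<and>
    (\<forall>e\<in>E. norm e = 1 \<and> (\<exists>l. A *v e = l *\<^sub>R e))"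
  using assms(2)
proof (induction k)
  case 0
  then show ?case by (intro exI[of _ "{}"]) auto
next
  case (Suc k)
  then obtain E where E: "finite E" "card E = k" "pairwise orthogonal E"
    "\<forall>e\<in>E. norm e = 1 \<and> (\<exists>l. A *v e = l *\<^sub>R e)" by auto
  then obtain x where x: "norm x = 1" "\<forall>e\<in>E. orthogonal x e" "\<exists>l. A *v x = l *\<^sub>R x"
    using eigenvector_orthogonal_exists[OF sym E(1)] Suc.prems by auto
  have "x \<notin> E" using x by (metis norm_zero orthogonal_self zero_neq_one)
  with E x show ?case
    by (intro exI[of _ "insert x E"]) (auto simp: pairwise_insert orthogonal_commute)
qed

definition diag :: "('n \<Rightarrow> real) \<Rightarrow> real^'n^'n" where
  "diag f = (\<chi> i j. if i = j then f i else 0)"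

lemma det_diag: "det (diag f) = (\<Prod>i\<in>UNIV. f i)"
  by (subst det_diagonal) (auto simp: diag_def)

lemma trace_diag: "trace (diag f) = (\<Sum>i\<in>UNIV. f i)"
  by (simp add: trace_def diag_def)

lemma diag_mult: "diag f ** diag g = diag (\<lambda>i. f i * g i)"
  by (simp add: diag_def matrix_matrix_mult_def vec_eq_iff mult_delta_left)

lemma spectral_theorem:
  fixes A :: "real^'n^'n"
  assumes sym: "transpose A = A"
  obtains Q l where "orthogonal_matrix Q" "A = Q ** diag l ** transpose Q"
    "\<And>i. A *v column i Q = l i *\<^sub>R column i Q" "\<And>i. norm (column i Q) = 1"
proof -
  obtain E where E: "finite E" "card E = CARD('n)" "pairwise orthogonal E"
    "\<forall>e\<in>E. norm e = 1 \<and> (\<exists>l. A *v e = l *\<^sub>R e)"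
    using orthonormal_eigenvectors[OF sym, of "CARD('n)"] by blast
  obtain f :: "'n \<Rightarrow> real^'n" where f: "bij_betw f UNIV E"
    using finite_same_card_bij[of "UNIV :: 'n set" E] E by auto
  define l where "l i = (SOME l. A *v f i = l *\<^sub>R f i)" for i
  have fE: "f i \<in> E" for i using f by (auto simp: bij_betw_def)
  have fl: "A *v f i = l i *\<^sub>R f i" for i
    unfolding l_def using E(4) fE by (rule_tac someI_ex) blast
  define Q where "Q = (\<chi> i j. f j $ i)"
  have col: "column i Q = f i" for i by (simp add: Q_def column_def)
  have orth: "orthogonal_matrix Q"
    unfolding orthogonal_matrix_orthonormal_columns
  proof (intro conjI allI impI)
    show "norm (column i Q) = 1" for i using fE E(4) by (simp add: col)
    fix i j :: 'n assume "i \<noteq> j"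
    then have "f i \<noteq> f j" using f by (auto simp: bij_betw_def inj_on_def)
    then show "orthogonal (column i Q) (column j Q)"
      using E(3) fE by (simp add: col pairwise_def)
  qed
  have "A ** Q = Q ** diag l"
  proof -
    have "(A ** Q) $ i $ j = (A *v f j) $ i" for i j
      by (simp add: matrix_matrix_mult_def matrix_vector_mult_def Q_def)
    moreover have "(Q ** diag l) $ i $ j = (l j *\<^sub>R f j) $ i" for i j
      by (simp add: matrix_matrix_mult_def diag_def Q_def if_distrib cong: if_cong)
    ultimately show ?thesis by (simp add: vec_eq_iff fl)
  qed
  then have "A = Q ** diag l ** transpose Q"
    using orth by (simp add: orthogonal_matrix_def flip: matrix_mul_assoc)
      (simp add: matrix_mul_assoc flip: \<open>A ** Q = Q ** diag l\<close>, simp add: flip: matrix_mul_assoc)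
  moreover have "A *v column i Q = l i *\<^sub>R column i Q" "norm (column i Q) = 1" for i
    using fE E(4) by (simp_all add: col fl)
  ultimately show thesis using orth that by blast
qed

lemma orthogonal_matrix_cancel:
  fixes Q :: "real^'n^'n"
  assumes "orthogonal_matrix Q"
  shows "transpose Q ** Q = mat 1" "Q ** transpose Q = mat 1"
  using assms by (auto simp: orthogonal_matrix_def)

lemma det_orthogonal_conj:
  fixes Q :: "real^'n^'n"
  assumes "orthogonal_matrix Q"
  shows "det (Q ** X ** transpose Q) = det X"
proof -
  have "det Q * det Q = 1"
    using det_orthogonal_matrix[OF assms] by auto
  then show ?thesis by (simp add: det_mul det_transpose)
qed

lemma trace_orthogonal_conj:
  fixes Q :: "real^'n^'n"
  assumes "orthogonal_matrix Q"
  shows "trace (Q ** X ** transpose Q) = trace X"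
proof -
  have "trace (Q ** X ** transpose Q) = trace (transpose Q ** (Q ** X))" by (rule trace_mul_sym)
  then show ?thesis by (simp add: matrix_mul_assoc orthogonal_matrix_cancel[OF assms])
qed

lemma psd_spectral:
  fixes A :: "real^'n^'n"
  assumes "psd A"
  obtains Q l where "orthogonal_matrix Q" "A = Q ** diag l ** transpose Q" "\<And>i. 0 \<le> l i"
proof -
  obtain Q l where Q: "orthogonal_matrix Q" "A = Q ** diag l ** transpose Q"
    "\<And>i. A *v column i Q = l i *\<^sub>R column i Q" "\<And>i. norm (column i Q) = 1"
    using spectral_theorem[of A] assms by (metis psd_def)
  have "0 \<le> l i" for i
  proof -
    have "0 \<le> column i Q \<bullet> (A *v column i Q)" using assms by (simp add: psd_def)
    then show ?thesis using Q(4)[of i] by (simp add: Q(3) dot_square_norm)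
  qed
  then show thesis using that Q by blast
qed

section \<open>Determinant and trace inequalities\<close>

lemma psd_det_nonneg: "psd A \<Longrightarrow> 0 \<le> det A"
  by (auto simp: det_orthogonal_conj det_diag intro!: prod_nonneg elim!: psd_spectral)

lemma psd_trace_nonneg: "psd A \<Longrightarrow> 0 \<le> trace A"
  by (auto simp: trace_orthogonal_conj trace_diag intro!: sum_nonneg elim!: psd_spectral)

text \<open>A crude form of the inequality of arithmetic and geometric means: each eigenvalue is at
  most the trace.\<close>

lemma psd_det_le_trace_power:
  fixes A :: "real^'n^'n"
  assumes "psd A"
  shows "det A \<le> trace A ^ CARD('n)"
proof -
  obtain Q l where Q: "orthogonal_matrix Q" "A = Q ** diag l ** transpose Q" "\<And>i. 0 \<le> l i"
    using psd_spectral[OF assms] by blast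
  have "(\<Prod>i\<in>UNIV. l i) \<le> (\<Prod>i\<in>(UNIV::'n set). \<Sum>i\<in>UNIV. l i)"
    using Q(3) by (intro prod_mono) (auto intro: member_le_sum)
  then show ?thesis
    by (simp add: Q det_orthogonal_conj trace_orthogonal_conj det_diag trace_diag)
qed

lemma psd_sqrt:
  fixes A :: "real^'n^'n"
  assumes "psd A"
  obtains P where "transpose P = P" "A = P ** P"
proof -
  obtain Q l where Q: "orthogonal_matrix Q" "A = Q ** diag l ** transpose Q" "\<And>i. 0 \<le> l i"
    using psd_spectral[OF assms] by blast
  define P where "P = Q ** diag (\<lambda>i. sqrt (l i)) ** transpose Q"
  have td: "transpose (diag f) = diag f" for f :: "'n \<Rightarrow> real"
    by (auto simp: transpose_def diag_def vec_eq_iff)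
  have "transpose P = P"
    by (simp add: P_def matrix_transpose_mul td matrix_mul_assoc)
  moreover have "P ** P = Q ** diag (\<lambda>i. sqrt (l i)) ** (transpose Q ** Q) ** diag (\<lambda>i. sqrt (l i)) ** transpose Q"
    by (simp add: P_def matrix_mul_assoc)
  then have "P ** P = A"
    by (simp add: orthogonal_matrix_cancel[OF Q(1)] Q(2) Q(3) diag_mult matrix_mul_assoc[symmetric])
  ultimately show thesis by (intro that[of P]) simp_all
qed

lemma psd_congruence:
  assumes "psd B" "transpose P = P"
  shows "psd (P ** B ** P)"
proof -
  have "x \<bullet> (P ** B ** P *v x) = (P *v x) \<bullet> (B *v (P *v x))" for x
    by (simp only: matrix_vector_mul_assoc[symmetric] symmetric_inner[OF assms(2)])
  moreover have "transpose (P ** B ** P) = P ** B ** P"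
    using assms by (simp only: psd_def matrix_transpose_mul matrix_mul_assoc)
  ultimately show ?thesis using assms(1) by (simp add: psd_def)
qed

text \<open>With A = P P for a symmetric P, the matrix P B P is positive semidefinite, has
  determinant det A * det B and has the trace of A B. This is how the second-order part of the
  operator controls det(-D^2 u).\<close>

lemma psd_det_mult_le:
  fixes A B :: "real^'n^'n"
  assumes A: "psd A" and B: "psd B"
  shows "det A * det B \<le> trace (A ** B) ^ CARD('n)" "0 \<le> trace (A ** B)"
proof -
  obtain P where P: "transpose P = P" "A = P ** P" using psd_sqrt[OF A] .
  have C: "psd (P ** B ** P)" by (rule psd_congruence[OF B P(1)])
  have t: "trace (P ** B ** P) = trace (A ** B)"
    using trace_mul_sym[of "P ** B" P] by (simp add: P(2) matrix_mul_assoc)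
  show "det A * det B \<le> trace (A ** B) ^ CARD('n)"
    using psd_det_le_trace_power[OF C] by (simp add: t) (simp add: P(2) det_mul mult_ac)
  show "0 \<le> trace (A ** B)"
    using psd_trace_nonneg[OF C] by (simp add: t)
qed

text \<open>All eigenvalues move up by e. It allows a multiple of the identity to be added to a
  gradient map to make it injective.\<close>

lemma psd_det_le_det_add:
  fixes A :: "real^'n^'n"
  assumes A: "psd A" and e: "0 \<le> e"
  shows "det A \<le> det (A + e *\<^sub>R mat 1)"
proof -
  obtain Q l where Q: "orthogonal_matrix Q" "A = Q ** diag l ** transpose Q" "\<And>i. 0 \<le> l i"
    using psd_spectral[OF assms(1)] by blast
  have 1: "diag (\<lambda>i. l i + e) = diag l + e *\<^sub>R mat 1"
    by (simp add: diag_def vec_eq_iff mat_def)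
  have 2: "Q ** (e *\<^sub>R mat 1) ** transpose Q = e *\<^sub>R mat 1"
  proof -
    have "Q ** (e *\<^sub>R mat 1) ** transpose Q = e *\<^sub>R (Q ** transpose Q)"
      by (simp add: matrix_scalar_ac flip: scalar_matrix_assoc)
    then show ?thesis by (simp add: orthogonal_matrix_cancel[OF Q(1)])
  qed
  have "A + e *\<^sub>R mat 1 = Q ** diag (\<lambda>i. l i + e) ** transpose Q"
  proof -
    have rd: "(X + Y) ** Z = X ** Z + Y ** Z" for X Y Z :: "real^'n^'n"
      by (simp add: matrix_matrix_mult_def vec_eq_iff sum.distrib algebra_simps)
    show ?thesis by (simp only: 1 Q(2) matrix_add_ldistrib rd 2)
  qed
  then have "det (A + e *\<^sub>R mat 1) = (\<Prod>i\<in>UNIV. l i + e)"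
    by (simp add: det_orthogonal_conj[OF Q(1)] det_diag)
  moreover have "det A = (\<Prod>i\<in>UNIV. l i)"
    by (simp add: Q det_orthogonal_conj[OF Q(1)] det_diag)
  ultimately show ?thesis using Q(3) e by (auto intro: prod_mono)
qed

text \<open>In an eigenbasis of B the trace of A B is the sum of the diagonal entries of A weighted
  by the eigenvalues of B. If all weights were positive, these entries and with them trace A would
  vanish. It settles the points where the equation carries no information.\<close>

lemma psd_trace_mult_eq_0:
  fixes A B :: "real^'n^'n"
  assumes A: "psd A" and B: "psd B" and 0: "trace (A ** B) = 0" and A0: "0 < trace A"
  shows "det B = 0"
proof (rule ccontr)
  assume nz: "det B \<noteq> 0"
  obtain Q l where Q: "orthogonal_matrix Q" "B = Q ** diag l ** transpose Q" "\<And>i. 0 \<le> l i"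
    using psd_spectral[OF B] by blast
  have "(\<Prod>i\<in>UNIV. l i) \<noteq> 0"
    using nz by (simp add: Q det_orthogonal_conj[OF Q(1)] det_diag)
  then have lpos: "0 < l i" for i
    using Q(3)[of i] by (auto simp: less_le)
  define C where "C = transpose Q ** A ** Q"
  have C: "C $ i $ i = column i Q \<bullet> (A *v column i Q)" for i
  proof -
    have "C $ i $ i = (\<Sum>k\<in>UNIV. \<Sum>j\<in>UNIV. Q$j$i * A$j$k * Q$k$i)"
      by (simp add: C_def matrix_matrix_mult_def transpose_def sum_distrib_right)
    also have "\<dots> = (\<Sum>j\<in>UNIV. \<Sum>k\<in>UNIV. Q$j$i * A$j$k * Q$k$i)" by (rule sum.swap)
    also have "\<dots> = column i Q \<bullet> (A *v column i Q)"
      by (simp add: column_def inner_vec_def matrix_vector_mult_def sum_distrib_left mult.assoc)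
    finally show ?thesis .
  qed
  then have Cnn: "0 \<le> C $ i $ i" for i using A by (simp add: psd_def)
  have "trace (A ** B) = trace (C ** diag l)"
    using trace_mul_sym[of "A ** Q ** diag l" "transpose Q"] by (simp add: C_def Q(2) matrix_mul_assoc)
  also have "\<dots> = (\<Sum>i\<in>UNIV. C $ i $ i * l i)"
    by (simp add: trace_def matrix_matrix_mult_def diag_def if_distrib cong: if_cong)
  finally have "(\<Sum>i\<in>UNIV. C $ i $ i * l i) = 0" using 0 by simp
  then have "C $ i $ i = 0" for i
    using Cnn lpos by (subst (asm) sum_nonneg_eq_0_iff) (auto simp: less_le)
  then have "trace C = 0" by (simp add: trace_def)
  moreover have "trace C = trace A"
    using trace_mul_sym[of "transpose Q" "A ** Q"]
    by (simp add: C_def matrix_mul_assoc[symmetric] orthogonal_matrix_cancel[OF Q(1)])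
  ultimately show False using A0 by simp
qed

section \<open>Area inequalities\<close>

(* The change of variables theorems of the library need a well-ordered index type. *)
typedef (overloaded) ('a::euclidean_space) bidx = "{..<DIM('a)}"
  by (auto intro!: exI[of _ 0] simp: DIM_positive)

setup_lifting type_definition_bidx

instantiation bidx :: (euclidean_space) linorder
begin
lift_definition less_eq_bidx :: "'a bidx \<Rightarrow> 'a bidx \<Rightarrow> bool" is "(\<le>)" .
lift_definition less_bidx :: "'a bidx \<Rightarrow> 'a bidx \<Rightarrow> bool" is "(<)" .
instance by standard (transfer; auto)+
end

lemma bij_Rep_bidx: "bij_betw (Rep_bidx :: 'a::euclidean_space bidx \<Rightarrow> nat) UNIV {..<DIM('a)}"
  using type_definition.Rep_range[OF type_definition_bidx]
  by (auto simp: bij_betw_def inj_on_def Rep_bidx_inject)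

instance bidx :: (euclidean_space) "{finite, wellorder}"
proof
  show "finite (UNIV :: 'a bidx set)"
    using bij_betw_finite[OF bij_Rep_bidx] finite_lessThan by blast
  fix P :: "'a bidx \<Rightarrow> bool" and a
  assume step: "\<And>x. (\<And>y. y < x \<Longrightarrow> P y) \<Longrightarrow> P x"
  show "P a"
    by (induction "Rep_bidx a" arbitrary: a rule: less_induct) (rule step, simp add: less_bidx.rep_eq)
qed

section \<open>Orthonormal coordinates over the well-ordered index type\<close>

definition bvec :: "'a::euclidean_space bidx \<Rightarrow> 'a" where
  "bvec = (SOME f. bij_betw f UNIV Basis)"

lemma bij_bvec: "bij_betw (bvec :: 'a::euclidean_space bidx \<Rightarrow> 'a) UNIV Basis"
proof -
  have "card (UNIV :: 'a bidx set) = DIM('a)"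
    using bij_betw_same_card[OF bij_Rep_bidx] by (simp only: card_lessThan)
  then have "\<exists>f. bij_betw f (UNIV :: 'a bidx set) (Basis :: 'a set)"
    by (intro finite_same_card_bij finite_class.finite_UNIV finite_Basis)
  then show ?thesis unfolding bvec_def by (rule someI_ex)
qed

definition toE :: "real^('a::euclidean_space bidx) \<Rightarrow> 'a" where
  "toE y = (\<Sum>i\<in>UNIV. y $ i *\<^sub>R bvec i)"

definition fromE :: "'a::euclidean_space \<Rightarrow> real^('a bidx)" where
  "fromE x = (\<chi> i. x \<bullet> bvec i)"

lemma bvec_Basis: "bvec i \<in> Basis"
  using bij_bvec by (auto simp: bij_betw_def)

lemma inner_bvec: "bvec i \<bullet> bvec j = (if i = j then 1 else 0)"
  using bij_bvec by (auto simp: inner_Basis[OF bvec_Basis bvec_Basis] bij_betw_def inj_on_def)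

lemma fromE_toE [simp]: "fromE (toE y) = y"
  by (simp add: fromE_def toE_def inner_sum_left inner_bvec vec_eq_iff if_distrib cong: if_cong)

lemma toE_fromE [simp]: "toE (fromE x) = x"
proof -
  have "toE (fromE x) = (\<Sum>b\<in>Basis. (x \<bullet> b) *\<^sub>R b)"
    unfolding toE_def fromE_def by (simp add: sum.reindex_bij_betw[OF bij_bvec, of "\<lambda>b. (x \<bullet> b) *\<^sub>R b"])
  then show ?thesis by (simp add: euclidean_representation)
qed

lemma linear_toE: "linear toE"
  by (rule linearI) (simp_all add: toE_def scaleR_add_left sum.distrib scaleR_sum_right)

lemma linear_fromE: "linear fromE"
  by (rule linearI) (simp_all add: fromE_def vec_eq_iff inner_add_left)

lemma continuous_toE: "continuous_on S toE"
  by (intro linear_continuous_on linear_toE[unfolded linear_conv_bounded_linear])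

lemma measurable_toE [measurable]: "toE \<in> borel_measurable borel"
  by (intro borel_measurable_continuous_onI continuous_toE)

text \<open>Boxes go to boxes with the same side lengths, because \<open>toE\<close> only renames
  coordinates. Statements about volume can therefore be transported through
  \<open>toE\<close>.\<close>

lemma distr_toE: "distr lborel borel toE = (lborel :: 'a::euclidean_space measure)"
proof (rule lborel_eqI[symmetric])
  fix l u :: 'a assume le: "\<And>b. b \<in> Basis \<Longrightarrow> l \<bullet> b \<le> u \<bullet> b"
  have comp: "toE y \<bullet> bvec i = y $ i" for y :: "real^('a bidx)" and i
    using fromE_toE[of y] by (metis fromE_def vec_lambda_beta)
  have inBox: "x \<in> box l u \<longleftrightarrow> (\<forall>i. l \<bullet> bvec i < x \<bullet> bvec i \<and> x \<bullet> bvec i < u \<bullet> bvec i)" for x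
    using bij_bvec unfolding mem_box bij_betw_def by (metis (no_types, lifting) UNIV_I bvec_Basis imageE)
  have "toE -` box l u = box (fromE l) (fromE u)"
    by (auto simp: inBox comp mem_box_cart fromE_def)
  then have "emeasure (distr lborel borel toE) (box l u) = emeasure lborel (box (fromE l) (fromE u))"
    by (simp add: emeasure_distr)
  also have "\<dots> = (\<Prod>b\<in>Basis. (fromE u - fromE l) \<bullet> b)"
    using le[OF bvec_Basis] by (intro emeasure_lborel_box) (auto simp: Basis_vec_def inner_axis fromE_def)
  also have "(\<Prod>b\<in>Basis. (fromE u - fromE l) \<bullet> b) = (\<Prod>i\<in>UNIV. (u - l) \<bullet> bvec i)"
  proof -
    have "bij_betw (\<lambda>i::'a bidx. axis i (1::real)) UNIV Basis"
      by (auto simp: bij_betw_def inj_on_def axis_eq_axis Basis_vec_def)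
    from prod.reindex_bij_betw[OF this, of "\<lambda>b. (fromE u - fromE l) \<bullet> b"] show ?thesis
      by (simp add: inner_axis fromE_def inner_diff_left)
  qed
  also have "\<dots> = (\<Prod>b\<in>Basis. (u - l) \<bullet> b)"
    by (rule prod.reindex_bij_betw[OF bij_bvec])
  finally show "emeasure (distr lborel borel toE) (box l u) = (\<Prod>b\<in>Basis. (u - l) \<bullet> b)" .
qed simp

lemma emeasure_toE_vimage:
  "A \<in> sets borel \<Longrightarrow> emeasure lborel (toE -` A) = emeasure lborel (A :: 'a::euclidean_space set)"
  by (subst (2) distr_toE[symmetric]) (simp add: emeasure_distr)

text \<open>The absolute Jacobian of a linear map, available on any Euclidean space and in
  particular on space-time, which is a product type.\<close>

definition ldet :: "('a::euclidean_space \<Rightarrow> 'a) \<Rightarrow> real" where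
  "ldet f = \<bar>det (matrix (fromE \<circ> f \<circ> toE))\<bar>"

lemma ldet_nonneg: "0 \<le> ldet f" by (simp add: ldet_def)

lemma linear_conj_toE: "linear f \<Longrightarrow> linear (fromE \<circ> f \<circ> toE)"
  by (intro linear_compose linear_toE linear_fromE)

lemma ldet_compose:
  assumes "linear f" "linear g"
  shows "ldet (f \<circ> g) = ldet f * ldet g"
proof -
  have "fromE \<circ> (f \<circ> g) \<circ> toE = (fromE \<circ> f \<circ> toE) \<circ> (fromE \<circ> g \<circ> toE)" by auto
  then show ?thesis
    unfolding ldet_def
    by (simp only: matrix_compose[OF linear_conj_toE linear_conj_toE, OF assms(2,1)] det_mul abs_mult)
qed

lemma ldet_id: "ldet (\<lambda>x::'a::euclidean_space. x) = 1"
proof -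
  have "fromE \<circ> (\<lambda>x::'a. x) \<circ> toE = (\<lambda>x. x)" by auto
  then show ?thesis
    using matrix_of_matrix_vector_mul[of "mat 1 :: real^('a bidx)^('a bidx)"]
    by (simp add: ldet_def del: o_apply fun.map_comp)
qed

lemma vimage_toE_image: "toE -` (f ` S) = (fromE \<circ> f \<circ> toE) ` (toE -` S)"
proof -
  have "y \<in> (fromE \<circ> f \<circ> toE) ` (toE -` S)" if "toE y = f x" "x \<in> S" for x y
    using that by (intro image_eqI[of _ _ "fromE x"]) (auto simp flip: that(1))
  then show ?thesis by auto
qed

lemma measure_lebesgue_eq_emeasure_lborel:
  assumes "X \<in> lmeasurable" "X \<in> sets borel"
  shows "ennreal (measure lebesgue X) = emeasure lborel X"
proof -
  have "emeasure lebesgue X = ennreal (measure lebesgue X)"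
    using assms(1) by (rule emeasure_eq_measure2)
  moreover have "emeasure lebesgue X = emeasure lborel X" using assms(2) by simp
  ultimately show ?thesis by (rule trans[OF sym])
qed

text \<open>Applied to the unit cube this determines \<open>ldet\<close> by a volume; several
  Jacobians below are computed in that way rather than by expanding a matrix.\<close>

lemma emeasure_linear_image_ldet:
  fixes f :: "'a::euclidean_space \<Rightarrow> 'a"
  assumes f: "linear f" and K: "compact K"
  shows "emeasure lborel (f ` K) = ennreal (ldet f) * emeasure lborel K"
proof -
  let ?F = "fromE \<circ> f \<circ> toE"
  have fK: "compact (f ` K)"
    using K f by (intro compact_continuous_image linear_continuous_on) (auto simp: linear_conv_bounded_linear)
  have K': "compact (toE -` K)"
  proof -
    have "toE -` K = fromE ` K" by (auto simp: image_iff) (metis fromE_toE)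
    then show ?thesis
      using K linear_fromE by (auto intro!: compact_continuous_image linear_continuous_on simp: linear_conv_bounded_linear)
  qed
  have m: "toE -` K \<in> lmeasurable" using K' by (rule lmeasurable_compact)
  have "emeasure lborel (f ` K) = emeasure lborel (?F ` (toE -` K))"
    using emeasure_toE_vimage[OF borel_compact[OF fK]] by (simp only: vimage_toE_image)
  also have "\<dots> = emeasure lebesgue (?F ` (toE -` K))"
  proof -
    have "continuous_on X ?F" for X
      using linear_conj_toE[OF f] by (simp only: linear_conv_bounded_linear linear_continuous_on)
    then have "compact (?F ` (toE -` K))" using K' by (rule compact_continuous_image)
    from borel_compact[OF this] show ?thesis by simp
  qed
  also have "\<dots> = ennreal (measure lebesgue (?F ` (toE -` K)))"
    using measurable_linear_image[OF linear_conj_toE[OF f] m] by (simp add: emeasure_eq_measure2)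
  also have "\<dots> = ennreal (ldet f * measure lebesgue (toE -` K))"
    by (subst measure_linear_image[OF linear_conj_toE[OF f] m]) (simp add: ldet_def)
  also have "\<dots> = ennreal (ldet f) * ennreal (measure lebesgue (toE -` K))"
    by (simp add: ennreal_mult ldet_nonneg)
  also have "ennreal (measure lebesgue (toE -` K)) = emeasure lborel (toE -` K)"
    by (rule measure_lebesgue_eq_emeasure_lborel[OF m borel_compact[OF K']])
  also have "\<dots> = emeasure lborel K" using K by (simp add: emeasure_toE_vimage borel_compact)
  finally show ?thesis .
qed

lemma has_derivative_conj_toE:
  assumes "(f has_derivative f') (at (toE y) within S)"
  shows "((fromE \<circ> f \<circ> toE) has_derivative (fromE \<circ> f' \<circ> toE)) (at y within (toE -` S))"
proof -
  have 1: "(toE has_derivative toE) (at y within (toE -` S))"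
    by (intro bounded_linear_imp_has_derivative linear_toE[unfolded linear_conv_bounded_linear])
  have "(f has_derivative f') (at (toE y) within (toE ` (toE -` S)))"
    using assms by (rule has_derivative_subset) auto
  from diff_chain_within[OF 1 this] have 2: "((f \<circ> toE) has_derivative (f' \<circ> toE)) (at y within (toE -` S))" .
  have "(fromE has_derivative fromE) (at ((f \<circ> toE) y) within X)" for X
    by (intro bounded_linear_imp_has_derivative linear_fromE[unfolded linear_conv_bounded_linear])
  from diff_chain_within[OF 2 this] show ?thesis by (simp only: o_assoc)
qed

text \<open>A point of the image counts once on the left, but as often as it is hit on the right, so
  an inequality holds without injectivity. The change of variables is done in the coordinates of
  \<open>toE\<close>.\<close>

lemma emeasure_image_le_nn_integral_ldet:
  fixes f :: "'a::euclidean_space \<Rightarrow> 'a"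
  assumes S: "S \<in> sets borel" and fS: "f ` S \<in> sets borel"
    and deriv: "\<And>x. x \<in> S \<Longrightarrow> (f has_derivative f' x) (at x within S)"
    and J: "\<And>x. x \<in> S \<Longrightarrow> ldet (f' x) = J x"
    and meas: "(\<lambda>x. indicator S x * J x) \<in> borel_measurable borel"
  shows "emeasure lborel (f ` S) \<le> (\<integral>\<^sup>+x. indicator S x * ennreal (J x) \<partial>lborel)"
proof (cases "(\<integral>\<^sup>+x. indicator S x * ennreal (J x) \<partial>lborel) = top")
  case False
  let ?F = "fromE \<circ> f \<circ> toE"
  let ?S = "toE -` S"
  define r where "r = enn2real (\<integral>\<^sup>+x. indicator S x * ennreal (J x) \<partial>lborel)"
  have r: "(\<integral>\<^sup>+x. indicator S x * ennreal (J x) \<partial>lborel) = ennreal r"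
    using False by (simp add: r_def less_top)
  have J0: "0 \<le> indicator S x * J x" for x
    using J ldet_nonneg by (metis indicator_simps mult_1 mult_zero_left order_refl)
  have eq: "indicator S x * ennreal (J x) = ennreal (indicator S x * J x)" for x
    by (auto simp: indicator_def)
  have "(\<integral>\<^sup>+y. ennreal (indicator S (toE y) * J (toE y)) \<partial>lborel)
      = (\<integral>\<^sup>+x. ennreal (indicator S x * J x) \<partial>distr lborel borel toE)"
    using meas by (subst nn_integral_distr) auto
  then have r': "(\<integral>\<^sup>+y. ennreal (indicator S (toE y) * J (toE y)) \<partial>lborel) = ennreal r"
    using r by (simp add: distr_toE eq)
  have "((\<lambda>y. indicator S (toE y) * J (toE y)) has_integral r) UNIV"
    using meas J0 r' by (intro nn_integral_has_integral) (auto simp: r_def)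
  then have "((\<lambda>y. if y \<in> ?S then J (toE y) else 0) has_integral r) UNIV"
    by (rule has_integral_eq[rotated]) (auto simp: indicator_def)
  then have hi: "((\<lambda>y. J (toE y)) has_integral r) ?S"
    by (simp only: has_integral_restrict_UNIV)
  have hi': "((\<lambda>y. \<bar>det (matrix (fromE \<circ> f' (toE y) \<circ> toE))\<bar>) has_integral r) ?S"
    by (rule has_integral_eq[OF _ hi]) (simp add: J[symmetric] ldet_def)
  have S': "?S \<in> sets lebesgue"
    using measurable_sets[OF measurable_toE S] by simp
  have d: "(?F has_derivative (fromE \<circ> f' (toE y) \<circ> toE)) (at y within ?S)" if "y \<in> ?S" for y
    using that by (intro has_derivative_conj_toE deriv) auto
  have 1: "?F ` ?S \<in> lmeasurable" and 2: "measure lebesgue (?F ` ?S) \<le> r"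
    using measurable_differentiable_image[OF S' d has_integral_integrable[OF hi']]
      measure_differentiable_image[OF S' d has_integral_integrable[OF hi']]
      integral_unique[OF hi'] by auto
  have "emeasure lborel (f ` S) = emeasure lborel (?F ` ?S)"
    using emeasure_toE_vimage[OF fS] by (simp only: vimage_toE_image)
  also have "\<dots> = emeasure lebesgue (?F ` ?S)"
    using measurable_sets[OF measurable_toE fS] by (simp add: vimage_toE_image)
  also have "\<dots> \<le> ennreal r"
    using 1 2 by (simp add: emeasure_eq_measure2 ennreal_leI)
  finally show ?thesis by (simp add: r)
qed simp

text \<open>The reverse direction: injectivity excludes multiple counting, so the integral of the
  Jacobian equals the measure of the image, which lies in B.\<close>

lemma nn_integral_ldet_le_emeasure:
  fixes f :: "'a::euclidean_space \<Rightarrow> 'a"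
  assumes S: "S \<in> sets borel" and B: "B \<in> sets borel" "bounded B" "f ` S \<subseteq> B"
    and deriv: "\<And>x. x \<in> S \<Longrightarrow> (f has_derivative f' x) (at x within S)"
    and inj: "inj_on f S"
    and J: "\<And>x. x \<in> S \<Longrightarrow> ldet (f' x) = J x"
    and meas: "(\<lambda>x. indicator S x * J x) \<in> borel_measurable borel"
  shows "(\<integral>\<^sup>+x. indicator S x * ennreal (J x) \<partial>lborel) \<le> emeasure lborel B"
proof -
  let ?F = "fromE \<circ> f \<circ> toE"
  let ?S = "toE -` S"
  let ?d = "\<lambda>y. \<bar>det (matrix (fromE \<circ> f' (toE y) \<circ> toE))\<bar>"
  have eq: "indicator S x * ennreal (J x) = ennreal (indicator S x * J x)" for x
    by (auto simp: indicator_def)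
  have S': "?S \<in> sets lebesgue"
    using measurable_sets[OF measurable_toE S] by simp
  have d: "(?F has_derivative (fromE \<circ> f' (toE y) \<circ> toE)) (at y within ?S)" if "y \<in> ?S" for y
    using that by (intro has_derivative_conj_toE deriv) auto
  have inj': "inj_on ?F ?S"
    using inj by (auto simp: inj_on_def) (metis fromE_toE toE_fromE)
  have B': "bounded (toE -` B)" "toE -` B \<in> sets borel"
  proof -
    have "toE -` B = fromE ` B" by (auto simp: image_iff) (metis fromE_toE)
    then show "bounded (toE -` B)"
      using B(2) linear_fromE by (auto intro!: bounded_linear_image simp: linear_conv_bounded_linear)
    show "toE -` B \<in> sets borel" using measurable_sets[OF measurable_toE B(1)] by simp
  qed
  then have B'': "toE -` B \<in> lmeasurable" by (simp add: bounded_set_imp_lmeasurable)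
  have sub: "?F ` ?S \<subseteq> toE -` B" using B(3) by auto
  have "?F ` ?S \<in> sets lebesgue"
    using d by (intro differentiable_image_in_sets_lebesgue[OF S']) (auto simp: differentiable_on_def differentiable_def)
  then have m: "?F ` ?S \<in> lmeasurable"
    using sub B' by (intro bounded_set_imp_lmeasurable) (auto intro: bounded_subset)
  \<comment> \<open>The image has finite measure because B is bounded; the equality form of the
    change of variables turns this into integrability of the Jacobian.\<close>
  then have int: "?d integrable_on ?S"
    using measurable_differentiable_image_eq[OF S' d inj'] by blast
  have "measure lebesgue (?F ` ?S) = integral ?S ?d"
    by (rule measure_differentiable_image_eq[OF S' d inj' int])
  then have hi: "(?d has_integral measure lebesgue (?F ` ?S)) ?S"
    using int by (simp add: has_integral_iff)
  have "(\<integral>\<^sup>+x. indicator S x * ennreal (J x) \<partial>lborel)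
      = (\<integral>\<^sup>+y. ennreal (indicator S (toE y) * J (toE y)) \<partial>lborel)"
    using meas by (subst distr_toE[symmetric], subst nn_integral_distr) (auto simp: eq)
  also have "\<dots> = (\<integral>\<^sup>+y. ennreal (?d y) * indicator ?S y \<partial>lborel)"
    by (intro nn_integral_cong) (auto simp: indicator_def J[symmetric] ldet_def)
  also have "\<dots> = ennreal (measure lebesgue (?F ` ?S))"
    by (rule nn_integral_has_integral_lebesgue'[OF _ hi]) simp
  also have "\<dots> \<le> ennreal (measure lebesgue (toE -` B))"
    using sub m B'' by (intro ennreal_leI measure_mono_fmeasurable) auto
  also have "\<dots> = emeasure lborel (toE -` B)"
    by (rule measure_lebesgue_eq_emeasure_lborel[OF B'' B'(2)])
  also have "\<dots> = emeasure lborel B" using B by (simp add: emeasure_toE_vimage)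
  finally show ?thesis .
qed

section \<open>Jacobians of diagonal, symmetric, shear and space-time maps\<close>

lemma emeasure_unit_cbox: "emeasure lborel (cbox 0 (One::'a::euclidean_space)) = 1"
  by (subst emeasure_lborel_cbox) (auto simp: inner_sum_left_Basis)

lemma ldet_diag: "ldet (\<lambda>x. diag l *v x) = (\<Prod>i\<in>UNIV. \<bar>l i\<bar>)"
proof -
  let ?K = "cbox 0 One :: (real^'n) set"
  have eq: "(\<lambda>x. diag l *v x) = (\<lambda>x. \<chi> k. l k * x $ k)"
    by (simp add: fun_eq_iff vec_eq_iff matrix_vector_mult_def diag_def mult_delta_left)
  have lin: "linear (\<lambda>x. diag l *v x)" by simp
  have c: "compact ((\<lambda>x. diag l *v x) ` ?K)"
    by (intro compact_continuous_image linear_continuous_on) (auto simp: linear_conv_bounded_linear[symmetric])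
  have K1: "measure lebesgue ?K = 1"
    using emeasure_unit_cbox[where 'a="real^'n"] by (simp add: measure_def)
  have "ennreal (ldet (\<lambda>x. diag l *v x)) = emeasure lborel ((\<lambda>x. diag l *v x) ` ?K)"
    by (simp add: emeasure_linear_image_ldet[OF lin] emeasure_unit_cbox)
  also have "\<dots> = emeasure lebesgue ((\<lambda>x. diag l *v x) ` ?K)"
    using c by (simp add: borel_compact)
  also have "\<dots> = ennreal (measure lebesgue ((\<lambda>x. diag l *v x) ` ?K))"
    using c by (simp add: emeasure_eq_measure2 lmeasurable_compact)
  also have "\<dots> = ennreal \<bar>prod l UNIV\<bar>"
    unfolding eq by (subst measure_stretch) (simp_all add: K1)
  finally show ?thesis by (simp add: ldet_nonneg abs_prod prod_nonneg)
qed

text \<open>Diagonalise A orthogonally. The two orthogonal factors compose to the identity, so by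
  multiplicativity their Jacobians cancel without being computed separately.\<close>

lemma ldet_symmetric_matrix:
  fixes A :: "real^'n^'n"
  assumes "transpose A = A"
  shows "ldet (\<lambda>x. A *v x) = \<bar>det A\<bar>"
proof -
  obtain Q l where Q: "orthogonal_matrix Q" "A = Q ** diag l ** transpose Q"
    using spectral_theorem[OF assms] by blast
  have lin: "linear (\<lambda>x. M *v x)" for M :: "real^'n^'n" by simp
  have comp: "(\<lambda>x. (M ** N) *v x) = (\<lambda>x. M *v x) \<circ> (\<lambda>x. N *v x)" for M N :: "real^'n^'n"
    by (simp add: fun_eq_iff matrix_vector_mul_assoc)
  have ld: "ldet (\<lambda>x. (M ** N) *v x) = ldet (\<lambda>x. M *v x) * ldet (\<lambda>x. N *v x)" for M N :: "real^'n^'n"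
    unfolding comp by (intro ldet_compose lin)
  have "ldet (\<lambda>x. (Q ** transpose Q) *v x) = 1"
    by (simp add: orthogonal_matrix_cancel[OF Q(1)] ldet_id)
  then have "ldet (\<lambda>x. Q *v x) * ldet (\<lambda>x. transpose Q *v x) = 1" by (simp only: ld)
  then have "ldet (\<lambda>x. A *v x) = ldet (\<lambda>x. diag l *v x)"
    unfolding Q(2) ld by (metis mult.commute mult.left_commute mult_1)
  also have "\<dots> = \<bar>det A\<bar>"
    by (simp add: ldet_diag Q(2) det_orthogonal_conj[OF Q(1)] det_diag abs_prod)
  finally show ?thesis .
qed

text \<open>Conjugate maps have equal Jacobians, so that of f equals its own square and is 0 or 1;
  the left inverse k excludes 0.\<close>

lemma ldet_eq_1_if_conj_square:
  assumes lin: "linear f" "linear g" "linear h" and gh: "g \<circ> h = (\<lambda>x. x)" and sq: "g \<circ> f \<circ> h = f \<circ> f"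
    and inv: "linear k" "k \<circ> f = (\<lambda>x. x)"
  shows "ldet f = 1"
proof -
  have "ldet f * ldet f = ldet g * ldet f * ldet h"
    by (metis ldet_compose linear_compose lin sq)
  also have "\<dots> = ldet f * ldet (g \<circ> h)" by (simp add: ldet_compose lin)
  also have "\<dots> = ldet f" by (simp add: gh ldet_id)
  finally have "ldet f = 0 \<or> ldet f = 1" by simp
  moreover have "ldet k * ldet f = 1"
    using inv lin by (metis ldet_compose ldet_id)
  ultimately show ?thesis by auto
qed

(* A shear is conjugate to its square by the dilation of one factor. *)
lemma ldet_shear_fst: "ldet (\<lambda>(k::real, z::real^'n). (k - x \<bullet> z, z)) = 1"
  by (rule ldet_eq_1_if_conj_square[where g = "\<lambda>(k, z). (2 * k, z)" and h = "\<lambda>(k, z). (k / 2, z)"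
        and k = "\<lambda>(k, z). (k + x \<bullet> z, z)"])
     (auto intro!: linearI simp: fun_eq_iff algebra_simps inner_add_right add_divide_distrib)

lemma ldet_shear_snd: "ldet (\<lambda>(k::real, z::real^'n). (k, z + k *\<^sub>R g)) = 1"
  by (rule ldet_eq_1_if_conj_square[where g = "\<lambda>(k, z). (k, 2 *\<^sub>R z)" and h = "\<lambda>(k, z). (k, (1/2) *\<^sub>R z)"
        and k = "\<lambda>(k, z). (k, z - k *\<^sub>R g)"])
     (auto intro!: linearI simp: fun_eq_iff scaleR_2 scaleR_add_left scaleR_add_right scaleR_diff_left scaleR_diff_right add_ac)

lemma linear_pair_maps:
  "linear (\<lambda>(k::real, z::real^'n). (k - x \<bullet> z, z))"
  "linear (\<lambda>(k::real, z::real^'n). (k, z + k *\<^sub>R g))"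
  "linear (\<lambda>(k::real, z::real^'n). (s * k, A *v z + k *\<^sub>R g))"
  by (auto intro!: linearI simp: algebra_simps inner_add_right matrix_vector_right_distrib
      matrix_vector_mult_scaleR scaleR_add_left scaleR_add_right)

lemma ldet_product:
  fixes A :: "real^'n^'n"
  assumes "transpose A = A"
  shows "ldet (\<lambda>(k::real, z). (s * k, A *v z)) = \<bar>s\<bar> * \<bar>det A\<bar>"
proof -
  let ?f = "\<lambda>(k::real, z::real^'n). (s * k, A *v z)"
  let ?g = "\<lambda>z::real^'n. A *v z"
  let ?K = "cbox 0 One :: (real^'n) set"
  have lin: "linear ?f" using linear_pair_maps(3)[of s A 0] by simp
  have ling: "linear ?g" by simp
  have prod: "emeasure lborel (X \<times> Y) = emeasure lborel X * emeasure lborel Y"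
    if "compact X" "compact Y" for X :: "real set" and Y :: "(real^'n) set"
    using that by (simp add: lborel_prod[symmetric] lborel.emeasure_pair_measure_Times borel_compact)
  have cK: "compact (?g ` ?K)"
    by (intro compact_continuous_image linear_continuous_on) (auto simp: linear_conv_bounded_linear[symmetric])
  have cs: "compact ((\<lambda>k. s * k) ` {0..1})"
    by (intro compact_continuous_image continuous_intros) auto
  have es: "emeasure lborel ((\<lambda>k. s * k) ` {0..1}) = ennreal \<bar>s\<bar>"
  proof -
    have "(\<lambda>k. s * k) ` {0..1} = (if s \<ge> 0 then {0..s} else {s..0})"
      using image_mult_atLeastAtMost_if[of s 0 1] by auto
    then show ?thesis by simp
  qed
  have "ennreal (ldet ?f) = emeasure lborel (?f ` ({0..1} \<times> ?K))"
    by (subst emeasure_linear_image_ldet[OF lin]) (auto simp: prod emeasure_unit_cbox intro: compact_Times)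
  also have "?f ` ({0..1} \<times> ?K) = ((\<lambda>k. s * k) ` {0..1}) \<times> (?g ` ?K)"
    by (force simp: image_iff)
  also have "emeasure lborel \<dots> = ennreal \<bar>s\<bar> * ennreal (ldet ?g)"
    by (simp add: prod cK cs es emeasure_linear_image_ldet[OF ling] emeasure_unit_cbox)
  also have "\<dots> = ennreal (\<bar>s\<bar> * \<bar>det A\<bar>)"
    by (simp add: ldet_symmetric_matrix[OF assms] ennreal_mult)
  finally show ?thesis by (simp add: ldet_nonneg)
qed

text \<open>This linear map is the derivative of \<open>contact_map\<close>, with s the time
  derivative, A the Hessian and g the mixed derivative. It is a product map composed with two
  shears, so x and g disappear from its Jacobian.\<close>

lemma ldet_space_time:
  fixes A :: "real^'n^'n"
  assumes sym: "transpose A = A"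
  shows "ldet (\<lambda>(k::real, z). (s * k - x \<bullet> (A *v z + k *\<^sub>R g), A *v z + k *\<^sub>R g)) = \<bar>s\<bar> * \<bar>det A\<bar>"
proof -
  let ?sh = "\<lambda>(k::real, z::real^'n). (k - x \<bullet> z, z)"
  let ?h = "\<lambda>(k::real, z). (s * k, A *v z + k *\<^sub>R g)"
  have "(\<lambda>(k::real, z). (s * k - x \<bullet> (A *v z + k *\<^sub>R g), A *v z + k *\<^sub>R g)) = ?sh \<circ> ?h"
    by (auto simp: fun_eq_iff)
  then have "ldet (\<lambda>(k::real, z). (s * k - x \<bullet> (A *v z + k *\<^sub>R g), A *v z + k *\<^sub>R g)) = ldet ?h"
    by (simp only: ldet_compose[OF linear_pair_maps(1,3)] ldet_shear_fst mult_1)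
  also have "ldet ?h = \<bar>s\<bar> * \<bar>det A\<bar>"
  proof (cases "s = 0")
    case False
    have "?h = (\<lambda>(k, z). (k, z + k *\<^sub>R ((1/s) *\<^sub>R g))) \<circ> (\<lambda>(k, z). (s * k, A *v z))"
      using False by (auto simp: fun_eq_iff)
    moreover have "linear (\<lambda>(k::real, z). (s * k, A *v z))"
      using linear_pair_maps(3)[of s A 0] by simp
    ultimately show ?thesis
      by (simp only: ldet_compose[OF linear_pair_maps(2)] ldet_shear_snd ldet_product[OF sym] mult_1)
  next
    \<comment> \<open>The second shear would need 1 / s. Here the image lies in the null hyperplane
      {0} x UNIV instead, so its volume is 0 like the right-hand side.\<close>
    case True
    let ?K = "{0..1} \<times> cbox 0 One :: (real \<times> (real^'n)) set"
    have cK: "compact ?K" by (intro compact_Times) auto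
    have n: "{0} \<times> UNIV \<in> null_sets (lborel :: (real \<times> (real^'n)) measure)"
      by (simp add: null_sets_def lborel_prod[symmetric] lborel.emeasure_pair_measure_Times)
    have "emeasure lborel (?h ` ?K) = 0"
    proof -
      have "compact (?h ` ?K)"
        using linear_pair_maps(3)[of s A g] cK
        by (intro compact_continuous_image linear_continuous_on) (auto simp: linear_conv_bounded_linear)
      moreover have "?h ` ?K \<subseteq> {0} \<times> UNIV" using True by auto
      ultimately show ?thesis by (intro emeasure_eq_0[OF null_setsD2[OF n] null_setsD1[OF n]])
    qed
    moreover have "emeasure lborel ?K = 1"
      by (simp add: lborel_prod[symmetric] lborel.emeasure_pair_measure_Times emeasure_unit_cbox)
    ultimately show ?thesis
      using emeasure_linear_image_ldet[OF linear_pair_maps(3)[of s A g] cK] True ldet_nonneg[of ?h] by simp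
  qed
  finally show ?thesis .
qed

section \<open>Powers and mixed norms\<close>

lemma ennreal_cases3 [case_names zero top pos]:
  fixes x :: ennreal
  obtains "x = 0" | "x = top" | r where "0 < r" "x = ennreal r"
  by (cases x) (auto simp: less_le)

lemma epow_0 [simp]: "epow x 0 = 1" by (simp add: epow_def)

lemma epow_of_0 [simp]: "epow 0 s = (if s = 0 then 1 else if s > 0 then 0 else top)"
  by (simp add: epow_def)

lemma epow_of_top [simp]: "epow top s = (if s = 0 then 1 else if s > 0 then top else 0)"
  by (simp add: epow_def)

lemma epow_ennreal_pos: "0 < r \<Longrightarrow> epow (ennreal r) s = ennreal (r powr s)"
  by (simp add: epow_def)

lemma epow_ennreal: "0 \<le> r \<Longrightarrow> 0 < s \<Longrightarrow> epow (ennreal r) s = ennreal (r powr s)"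
  by (cases "r = 0") (auto simp: epow_ennreal_pos)

lemma epow_1 [simp]: "epow x 1 = x"
  by (cases x rule: ennreal_cases3) (auto simp: epow_ennreal_pos)

lemma epow_one [simp]: "epow 1 s = 1"
  using epow_ennreal_pos[of 1 s] by simp

lemma epow_eq_0_iff: "0 < s \<Longrightarrow> epow x s = 0 \<longleftrightarrow> x = 0"
  by (cases x rule: ennreal_cases3) (auto simp: epow_ennreal_pos)

lemma epow_eq_top_iff: "0 < s \<Longrightarrow> epow x s = top \<longleftrightarrow> x = top"
  by (cases x rule: ennreal_cases3) (auto simp: epow_ennreal_pos)

lemma epow_less_top: "0 \<le> s \<Longrightarrow> x < top \<Longrightarrow> epow x s < top"
  by (cases "s = 0") (auto simp: less_top[symmetric] epow_eq_top_iff)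

lemma epow_mono: "0 \<le> s \<Longrightarrow> x \<le> y \<Longrightarrow> epow x s \<le> epow y s"
  by (cases x rule: ennreal_cases3; cases y rule: ennreal_cases3)
     (auto simp: epow_ennreal_pos top_unique intro!: ennreal_leI powr_mono2)

lemma epow_mult: "0 \<le> s \<Longrightarrow> epow (x * y) s = epow x s * epow y s"
  by (cases x rule: ennreal_cases3; cases y rule: ennreal_cases3)
     (auto simp: epow_ennreal_pos ennreal_mult[symmetric] powr_mult ennreal_mult_top ennreal_top_mult)

lemma epow_epow: "0 \<le> a \<Longrightarrow> 0 \<le> b \<Longrightarrow> epow (epow x a) b = epow x (a * b)"
  by (cases x rule: ennreal_cases3)
     (auto simp: epow_ennreal_pos powr_powr zero_less_mult_iff mult_nonneg_nonneg less_le)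

lemma epow_add: "0 \<le> a \<Longrightarrow> 0 \<le> b \<Longrightarrow> epow x (a + b) = epow x a * epow x b"
  by (cases x rule: ennreal_cases3)
     (auto simp: epow_ennreal_pos powr_add ennreal_mult add_nonneg_eq_0_iff ennreal_mult_top ennreal_top_mult)

lemma epow_cancel: "0 < s \<Longrightarrow> epow (epow x s) (1 / s) = x" "0 < s \<Longrightarrow> epow (epow x (1 / s)) s = x"
  by (simp_all add: epow_epow)

lemma epow_le_iff: "0 < s \<Longrightarrow> epow x s \<le> epow y s \<longleftrightarrow> x \<le> y"
  using epow_mono[of s x y] epow_mono[of "1/s" "epow x s" "epow y s"] by (auto simp: epow_cancel)

text \<open>After division by x + y it is the inequality t <= t^s on [0, 1], applied to the two
  fractions that add up to 1.\<close>

lemma epow_subadditive: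
  assumes s: "0 \<le> s" "s \<le> 1"
  shows "epow (x + y) s \<le> epow x s + epow y s"
proof (cases "s = 0")
  case False
  then have s': "0 < s" using s by auto
  show ?thesis
  proof (cases "x = top \<or> y = top \<or> x + y = 0")
    case True then show ?thesis using s' by auto
  next
    case False
    then obtain a b where ab: "0 \<le> a" "0 \<le> b" "x = ennreal a" "y = ennreal b"
      by (cases x; cases y) auto
    then have pos: "0 < a + b" using False by (auto simp: ennreal_plus[symmetric] simp del: ennreal_plus) 
    have le: "t \<le> t powr s" if "0 \<le> t" "t \<le> 1" for t :: real
    proof (cases "t = 0")
      case False
      then show ?thesis using that s powr_mono'[of s 1 t] by auto
    qed auto
    have "1 = a / (a + b) + b / (a + b)" using pos by (simp add: add_divide_distrib[symmetric])
    also have "\<dots> \<le> (a / (a + b)) powr s + (b / (a + b)) powr s"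
      using ab pos by (intro add_mono le) (auto simp: divide_simps)
    finally have "(a + b) powr s \<le> a powr s + b powr s"
      using ab pos by (simp add: powr_divide divide_simps add_divide_distrib[symmetric])
    then show ?thesis
      using ab s' by (simp add: epow_ennreal ennreal_plus[symmetric] del: ennreal_plus) 
  qed
qed simp

lemma epow_max: "0 \<le> s \<Longrightarrow> epow (max x y) s = max (epow x s) (epow y s)"
  using epow_mono[of s x y] epow_mono[of s y x] by (auto simp: max_def)

lemma measurable_epow [measurable]:
  assumes [measurable]: "f \<in> borel_measurable M"
  shows "(\<lambda>x. epow (f x) s) \<in> borel_measurable M"
  unfolding epow_def by measurable

lemma young_ennreal:
  assumes t: "0 < t" "t < 1"
  shows "epow x (1 - t) * epow y t \<le> ennreal (1 - t) * x + ennreal t * y"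
proof (cases x rule: ennreal_cases3)
  case top then show ?thesis using t by (simp add: ennreal_mult_top)
next
  case (pos a)
  show ?thesis
  proof (cases y rule: ennreal_cases3)
    case top then show ?thesis using t by (simp add: ennreal_mult_top)
  next
    case (pos b)
    have "a powr (1 - t) * b powr t \<le> (1 - t) * a + t * b"
      using t pos \<open>0 < a\<close> by (intro Youngs_inequality_0) auto
    then show ?thesis
      using t pos \<open>0 < a\<close> \<open>x = ennreal a\<close>
      by (simp add: epow_ennreal_pos ennreal_mult[symmetric] ennreal_plus[symmetric] ennreal_leI del: ennreal_plus)
  qed (use t in auto)
qed (use t in auto)

text \<open>The endpoint t = 1 is included so that equal inner and outer exponents are covered; the
  power 0 makes the first factor 1 there, even where f is infinite.\<close>

lemma holder_nn_integral:
  assumes t: "0 < t" "t \<le> 1" and [measurable]: "f \<in> borel_measurable M" "g \<in> borel_measurable M"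
  shows "(\<integral>\<^sup>+x. epow (f x) (1 - t) * epow (g x) t \<partial>M)
    \<le> epow (\<integral>\<^sup>+x. f x \<partial>M) (1 - t) * epow (\<integral>\<^sup>+x. g x \<partial>M) t"
proof (cases "t = 1")
  case False
  then have t1: "t < 1" using t by auto
  define F where "F = (\<integral>\<^sup>+x. f x \<partial>M)"
  define G where "G = (\<integral>\<^sup>+x. g x \<partial>M)"
  have zero: "(\<integral>\<^sup>+x. epow (f x) (1 - t) * epow (g x) t \<partial>M) = 0" if "F = 0 \<or> G = 0"
  proof -
    have "AE x in M. f x = 0 \<or> g x = 0"
      using that by (auto simp: F_def G_def nn_integral_0_iff_AE)
    then show ?thesis
      using t t1 by (subst nn_integral_0_iff_AE) (auto elim!: eventually_mono)
  qed
  show ?thesis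
  proof (cases "F = 0 \<or> G = 0 \<or> F = top \<or> G = top")
    case True
    then show ?thesis using zero t t1
      by (cases "F = 0 \<or> G = 0") (auto simp: F_def[symmetric] G_def[symmetric] epow_eq_0_iff ennreal_top_mult ennreal_mult_top)
  next
    case False
    then obtain a b where ab: "0 < a" "0 < b" "F = ennreal a" "G = ennreal b"
      by (cases F rule: ennreal_cases3; cases G rule: ennreal_cases3) auto
    \<comment> \<open>Both integrals are normalised to 1, so that the integrated Young inequality
      has total 1.\<close>
    have K: "epow (f x) (1 - t) * epow (g x) t
      = epow F (1 - t) * epow G t * (epow (ennreal (1/a) * f x) (1 - t) * epow (ennreal (1/b) * g x) t)" for x
    proof -
      have 1: "F * ennreal (1/a) = 1" "G * ennreal (1/b) = 1"
        using ab by (simp_all add: ennreal_mult[symmetric])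
      have "epow (f x) (1 - t) = epow F (1 - t) * epow (ennreal (1/a) * f x) (1 - t)"
        using t t1 1 by (simp add: epow_mult[symmetric] mult.assoc[symmetric])
      moreover have "epow (g x) t = epow G t * epow (ennreal (1/b) * g x) t"
        using t t1 1 by (simp add: epow_mult[symmetric] mult.assoc[symmetric])
      ultimately show ?thesis by (simp add: mult_ac)
    qed
    have "(\<integral>\<^sup>+x. epow (f x) (1 - t) * epow (g x) t \<partial>M)
      \<le> (\<integral>\<^sup>+x. epow F (1 - t) * epow G t * (ennreal (1 - t) * (ennreal (1/a) * f x) + ennreal t * (ennreal (1/b) * g x)) \<partial>M)"
      by (subst K, intro nn_integral_mono mult_left_mono young_ennreal t t1) auto
    also have "\<dots> = epow F (1 - t) * epow G t * (ennreal (1 - t) * (ennreal (1/a) * F) + ennreal t * (ennreal (1/b) * G))"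
      by (simp add: nn_integral_cmult nn_integral_add F_def G_def)
    also have "ennreal (1 - t) * (ennreal (1/a) * F) + ennreal t * (ennreal (1/b) * G) = 1"
      using ab t t1 by (simp add: ennreal_mult[symmetric] ennreal_plus[symmetric] del: ennreal_plus)
    finally show ?thesis by (simp add: F_def G_def)
  qed
qed simp

(* Here 1/Q and 1/P are the exponents of the outer and the inner variable. *)
lemma mixed_holder:
  assumes M: "sigma_finite_measure M1" "sigma_finite_measure M2"
    and Q: "0 < Q" "Q \<le> P"
    and [measurable]: "\<gamma> \<in> borel_measurable (M1 \<Otimes>\<^sub>M M2)" "\<kappa> \<in> borel_measurable (M1 \<Otimes>\<^sub>M M2)" "G \<in> borel_measurable (M1 \<Otimes>\<^sub>M M2)"
    and A: "\<And>y. y \<in> space M1 \<Longrightarrow> (\<integral>\<^sup>+w. \<gamma> (y, w) \<partial>M2) \<le> A"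
    and G: "\<And>z. z \<in> space (M1 \<Otimes>\<^sub>M M2) \<Longrightarrow> epow (\<kappa> z) (1 / Q) * epow (\<gamma> z) (1 / P) \<le> G z"
  shows "(\<integral>\<^sup>+y. \<integral>\<^sup>+w. \<kappa> (y, w) * \<gamma> (y, w) \<partial>M2 \<partial>M1)
    \<le> epow A (1 - Q / P) * (\<integral>\<^sup>+y. epow (\<integral>\<^sup>+w. epow (G (y, w)) P \<partial>M2) (Q / P) \<partial>M1)"
proof -
  interpret pair_sigma_finite M1 M2 using M by (simp add: pair_sigma_finite_def)
  have P: "0 < P" using Q by auto
  have th: "0 < Q / P" "Q / P \<le> 1" "0 \<le> 1 - Q / P" using Q P by (auto simp: divide_simps)
  have "(\<integral>\<^sup>+y. \<integral>\<^sup>+w. \<kappa> (y, w) * \<gamma> (y, w) \<partial>M2 \<partial>M1)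
     \<le> (\<integral>\<^sup>+y. epow A (1 - Q / P) * epow (\<integral>\<^sup>+w. epow (G (y, w)) P \<partial>M2) (Q / P) \<partial>M1)"
  proof (intro nn_integral_mono)
    fix y assume y: "y \<in> space M1"
    have [measurable]: "(\<lambda>w. \<gamma> (y, w)) \<in> borel_measurable M2" "(\<lambda>w. \<kappa> (y, w)) \<in> borel_measurable M2" "(\<lambda>w. G (y, w)) \<in> borel_measurable M2"
      using y by measurable
    have "(\<integral>\<^sup>+w. \<kappa> (y, w) * \<gamma> (y, w) \<partial>M2)
      \<le> (\<integral>\<^sup>+w. epow (\<gamma> (y, w)) (1 - Q / P) * epow (epow (G (y, w)) P) (Q / P) \<partial>M2)"
    proof (intro nn_integral_mono)
      fix w assume w: "w \<in> space M2"
      \<comment> \<open>The factor \<open>\<gamma>\<close> is split so that the part paired with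
        \<open>\<kappa>\<close> becomes a Q-th power bounded by G. The remaining power 1 - Q / P is
        absorbed by Hoelder in w and the slice bound A.\<close>
      have "\<kappa> (y, w) * \<gamma> (y, w)
        = epow (\<gamma> (y, w)) (1 - Q / P) * epow (epow (\<kappa> (y, w)) (1 / Q) * epow (\<gamma> (y, w)) (1 / P)) Q"
        using Q P th epow_add[of "1 - Q/P" "Q/P" "\<gamma> (y, w)"]
        by (simp add: epow_mult epow_epow mult_ac)
      also have "\<dots> \<le> epow (\<gamma> (y, w)) (1 - Q / P) * epow (G (y, w)) Q"
        using Q y w by (intro mult_left_mono epow_mono G) (auto simp: space_pair_measure)
      also have "epow (G (y, w)) Q = epow (epow (G (y, w)) P) (Q / P)"
        using P th by (simp add: epow_epow)
      finally show "\<kappa> (y, w) * \<gamma> (y, w) \<le> epow (\<gamma> (y, w)) (1 - Q / P) * epow (epow (G (y, w)) P) (Q / P)" .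
    qed
    also have "\<dots> \<le> epow (\<integral>\<^sup>+w. \<gamma> (y, w) \<partial>M2) (1 - Q / P) * epow (\<integral>\<^sup>+w. epow (G (y, w)) P \<partial>M2) (Q / P)"
      using th by (intro holder_nn_integral) auto
    also have "\<dots> \<le> epow A (1 - Q / P) * epow (\<integral>\<^sup>+w. epow (G (y, w)) P \<partial>M2) (Q / P)"
      using th y by (intro mult_right_mono epow_mono A) auto
    finally show "(\<integral>\<^sup>+w. \<kappa> (y, w) * \<gamma> (y, w) \<partial>M2)
      \<le> epow A (1 - Q / P) * epow (\<integral>\<^sup>+w. epow (G (y, w)) P \<partial>M2) (Q / P)" .
  qed
  also have "\<dots> = epow A (1 - Q / P) * (\<integral>\<^sup>+y. epow (\<integral>\<^sup>+w. epow (G (y, w)) P \<partial>M2) (Q / P) \<partial>M1)"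
    by (intro nn_integral_cmult) measurable
  finally show ?thesis .
qed

text \<open>The essential supremum is at most c exactly where the slice of {c < G} has measure zero,
  and slice measures depend measurably on y.\<close>

lemma measurable_esssup_pair:
  fixes G :: "_ \<Rightarrow> ennreal"
  assumes M: "sigma_finite_measure M2" and [measurable]: "G \<in> borel_measurable (M1 \<Otimes>\<^sub>M M2)"
  shows "(\<lambda>y. esssup M2 (\<lambda>w. G (y, w))) \<in> borel_measurable M1"
proof (rule borel_measurableI_le)
  interpret sigma_finite_measure M2 by fact
  fix c
  have "esssup M2 (\<lambda>w. G (y, w)) \<le> c \<longleftrightarrow> emeasure M2 {w \<in> space M2. c < G (y, w)} = 0" if y: "y \<in> space M1" for y
  proof -
    have [measurable]: "(\<lambda>w. G (y, w)) \<in> borel_measurable M2" using y by measurable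
    have "esssup M2 (\<lambda>w. G (y, w)) \<le> c \<longleftrightarrow> (AE w in M2. G (y, w) \<le> c)"
      using esssup_AE[of "\<lambda>w. G (y, w)" M2] esssup_I[of "\<lambda>w. G (y, w)" M2 c]
      by (auto elim!: eventually_mono intro: order_trans)
    also have "\<dots> \<longleftrightarrow> emeasure M2 {w \<in> space M2. \<not> G (y, w) \<le> c} = 0"
      by (intro AE_iff_measurable) auto
    finally show ?thesis by (simp add: not_le)
  qed
  then have "{y \<in> space M1. esssup M2 (\<lambda>w. G (y, w)) \<le> c} = {y \<in> space M1. emeasure M2 {w \<in> space M2. c < G (y, w)} = 0}"
    by auto
  also have "\<dots> \<in> sets M1" by measurable
  finally show "{y \<in> space M1. esssup M2 (\<lambda>w. G (y, w)) \<le> c} \<in> sets M1" .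
qed

text \<open>The limit P = \<infinity> of \<open>mixed_holder\<close>: the slice bound A now enters
  with its full power. The bound by G is asked only where \<open>\<gamma>\<close> is nonzero, since
  the integrand vanishes elsewhere.\<close>

lemma mixed_holder_esssup:
  assumes M: "sigma_finite_measure M1" "sigma_finite_measure M2"
    and Q: "0 < Q"
    and [measurable]: "\<gamma> \<in> borel_measurable (M1 \<Otimes>\<^sub>M M2)" "\<kappa> \<in> borel_measurable (M1 \<Otimes>\<^sub>M M2)" "G \<in> borel_measurable (M1 \<Otimes>\<^sub>M M2)"
    and A: "\<And>y. y \<in> space M1 \<Longrightarrow> (\<integral>\<^sup>+w. \<gamma> (y, w) \<partial>M2) \<le> A"
    and G: "\<And>z. z \<in> space (M1 \<Otimes>\<^sub>M M2) \<Longrightarrow> \<gamma> z \<noteq> 0 \<Longrightarrow> epow (\<kappa> z) (1 / Q) \<le> G z"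
  shows "(\<integral>\<^sup>+y. \<integral>\<^sup>+w. \<kappa> (y, w) * \<gamma> (y, w) \<partial>M2 \<partial>M1)
    \<le> A * (\<integral>\<^sup>+y. epow (esssup M2 (\<lambda>w. G (y, w))) Q \<partial>M1)"
proof -
  interpret pair_sigma_finite M1 M2 using M by (simp add: pair_sigma_finite_def)
  have [measurable]: "(\<lambda>y. esssup M2 (\<lambda>w. G (y, w))) \<in> borel_measurable M1"
    using M(2) by (rule measurable_esssup_pair) measurable
  have "(\<integral>\<^sup>+y. \<integral>\<^sup>+w. \<kappa> (y, w) * \<gamma> (y, w) \<partial>M2 \<partial>M1)
     \<le> (\<integral>\<^sup>+y. A * epow (esssup M2 (\<lambda>w. G (y, w))) Q \<partial>M1)"
  proof (intro nn_integral_mono)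
    fix y assume y: "y \<in> space M1"
    have [measurable]: "(\<lambda>w. \<gamma> (y, w)) \<in> borel_measurable M2"
      using y by measurable
    have "(\<integral>\<^sup>+w. \<kappa> (y, w) * \<gamma> (y, w) \<partial>M2)
      \<le> (\<integral>\<^sup>+w. epow (esssup M2 (\<lambda>w. G (y, w))) Q * \<gamma> (y, w) \<partial>M2)"
    proof (intro nn_integral_mono_AE, use esssup_AE[of "\<lambda>w. G (y, w)" M2] AE_space in eventually_elim)
      case (elim w)
      show ?case
      proof (cases "\<gamma> (y, w) = 0")
        case False
        have "\<kappa> (y, w) = epow (epow (\<kappa> (y, w)) (1 / Q)) Q" using Q by (simp add: epow_cancel)
        also have "\<dots> \<le> epow (esssup M2 (\<lambda>w. G (y, w))) Q"
          using Q y elim False by (intro epow_mono order_trans[OF G elim(1)]) (auto simp: space_pair_measure)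
        finally show ?thesis by (intro mult_right_mono) auto
      qed simp
    qed
    also have "\<dots> = epow (esssup M2 (\<lambda>w. G (y, w))) Q * (\<integral>\<^sup>+w. \<gamma> (y, w) \<partial>M2)"
      by (intro nn_integral_cmult) measurable
    also have "\<dots> \<le> epow (esssup M2 (\<lambda>w. G (y, w))) Q * A"
      using y by (intro mult_left_mono A) auto
    finally show "(\<integral>\<^sup>+w. \<kappa> (y, w) * \<gamma> (y, w) \<partial>M2) \<le> A * epow (esssup M2 (\<lambda>w. G (y, w))) Q"
      by (simp add: mult.commute)
  qed
  also have "\<dots> = A * (\<integral>\<^sup>+y. epow (esssup M2 (\<lambda>w. G (y, w))) Q \<partial>M1)"
    by (intro nn_integral_cmult) measurable
  finally show ?thesis .
qed

text \<open>A proof without duality. With N s the P-norm of G in w, Hoelder in s with weight N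
  bounds the P-th power of the integral of G by A^(P-1) times the integral of G^P / N^(P-1), where A
  is the integral of N; integrating over w gives A^P.\<close>

lemma minkowski_nn_integral:
  assumes M: "sigma_finite_measure S" "sigma_finite_measure W" and S1: "emeasure S (space S) = 1" and P: "1 \<le> P"
    and [measurable]: "G \<in> borel_measurable (S \<Otimes>\<^sub>M W)"
  shows "epow (\<integral>\<^sup>+w. epow (\<integral>\<^sup>+s. G (s, w) \<partial>S) P \<partial>W) (1 / P)
    \<le> (\<integral>\<^sup>+s. epow (\<integral>\<^sup>+w. epow (G (s, w)) P \<partial>W) (1 / P) \<partial>S)"
proof (cases "P = 1")
  case True
  interpret S: sigma_finite_measure S by fact
  interpret W: sigma_finite_measure W by fact
  interpret pair_sigma_finite S W ..
  show ?thesis using True Fubini'[of "\<lambda>s w. G (s, w)"] by simp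
next
  case False
  then have P1: "1 < P" using P by auto
  interpret S: sigma_finite_measure S by fact
  interpret W: sigma_finite_measure W by fact
  interpret pair_sigma_finite S W ..
  define N where "N s = epow (\<integral>\<^sup>+w. epow (G (s, w)) P \<partial>W) (1 / P)" for s
  have [measurable]: "N \<in> borel_measurable S" unfolding N_def by measurable
  have NP: "epow (N s) P = (\<integral>\<^sup>+w. epow (G (s, w)) P \<partial>W)" for s
    using P1 by (simp add: N_def epow_cancel)
  have th: "0 < 1 / P" "1 / P \<le> 1" "0 \<le> 1 - 1 / P" "0 \<le> P" "0 \<le> P - 1" "P \<noteq> 0" using P1 by auto
  show ?thesis
  proof (cases "(\<integral>\<^sup>+s. N s \<partial>S) = top")
    case True then show ?thesis by (simp add: N_def[symmetric])
  next
    case False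
    have "epow (\<integral>\<^sup>+w. epow (\<integral>\<^sup>+s. G (s, w) \<partial>S) P \<partial>W) (1 / P) \<le> (\<integral>\<^sup>+s. N s \<partial>S) + ennreal e" if e: "0 < e" for e
    proof -
      \<comment> \<open>The shift keeps the weight away from 0, so that it can be divided by; it
        costs only e because S has total mass one.\<close>
      define a where "a s = N s + ennreal e" for s
      have [measurable]: "a \<in> borel_measurable S" unfolding a_def by measurable
      define A where "A = (\<integral>\<^sup>+s. a s \<partial>S)"
      have A: "A = (\<integral>\<^sup>+s. N s \<partial>S) + ennreal e"
        by (simp add: A_def a_def nn_integral_add S1)
      have Nfin: "AE s in S. N s \<noteq> top" 
        using nn_integral_noteq_infinite[of N S] False by simp
      then have afin: "AE s in S. a s \<noteq> top" by (simp add: a_def)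
      have a0: "a s \<noteq> 0" for s using e by (simp add: a_def)
      define H where "H z = epow (G z) P * inverse (epow (a (fst z)) (P - 1))" for z
      have [measurable]: "H \<in> borel_measurable (S \<Otimes>\<^sub>M W)" unfolding H_def by measurable
      have inv: "epow (a s) (P - 1) * inverse (epow (a s) (P - 1)) = 1" if nt: "a s \<noteq> top" for s
      proof -
        obtain r where "0 < r" "a s = ennreal r"
          using a0 nt by (cases "a s" rule: ennreal_cases3) auto
        then show ?thesis by (simp add: epow_ennreal_pos inverse_ennreal ennreal_mult[symmetric])
      qed
      have Geq: "G (s, w) = epow (a s) (1 - 1 / P) * epow (H (s, w)) (1 / P)" if "a s \<noteq> top" for s w
      proof -
        have "G (s, w) = epow (epow (a s) (P - 1) * inverse (epow (a s) (P - 1)) * epow (G (s, w)) P) (1 / P)"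
          using P1 by (simp add: inv that epow_cancel)
        also have "\<dots> = epow (epow (a s) (P - 1)) (1 / P) * epow (H (s, w)) (1 / P)"
          using th by (simp add: H_def epow_mult mult_ac)
        also have "epow (epow (a s) (P - 1)) (1 / P) = epow (a s) (1 - 1 / P)"
        proof -
          have "(P - 1) * (1 / P) = 1 - 1 / P" using th by (simp add: field_simps)
          then show ?thesis using th by (simp only: epow_epow)
        qed
        finally show ?thesis .
      qed
      have "(\<integral>\<^sup>+w. epow (\<integral>\<^sup>+s. G (s, w) \<partial>S) P \<partial>W) \<le> (\<integral>\<^sup>+w. epow A (P - 1) * (\<integral>\<^sup>+s. H (s, w) \<partial>S) \<partial>W)"
      proof (intro nn_integral_mono)
        fix w assume w: "w \<in> space W"
        have [measurable]: "(\<lambda>s. H (s, w)) \<in> borel_measurable S" using w by measurable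
        have "(\<integral>\<^sup>+s. G (s, w) \<partial>S) = (\<integral>\<^sup>+s. epow (a s) (1 - 1 / P) * epow (H (s, w)) (1 / P) \<partial>S)"
          using afin by (intro nn_integral_cong_AE) (auto elim!: eventually_mono simp: Geq)
        also have "\<dots> \<le> epow A (1 - 1 / P) * epow (\<integral>\<^sup>+s. H (s, w) \<partial>S) (1 / P)"
          unfolding A_def using th by (intro holder_nn_integral) auto
        finally have "epow (\<integral>\<^sup>+s. G (s, w) \<partial>S) P \<le> epow (epow A (1 - 1 / P) * epow (\<integral>\<^sup>+s. H (s, w) \<partial>S) (1 / P)) P"
          using th by (intro epow_mono)
        also have "\<dots> = epow A ((1 - 1 / P) * P) * (\<integral>\<^sup>+s. H (s, w) \<partial>S)"
          using th by (simp only: epow_mult epow_epow) simp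
        also have "(1 - 1 / P) * P = P - 1" using th by (simp add: algebra_simps)
        finally show "epow (\<integral>\<^sup>+s. G (s, w) \<partial>S) P \<le> epow A (P - 1) * (\<integral>\<^sup>+s. H (s, w) \<partial>S)" .
      qed
      also have "\<dots> = epow A (P - 1) * (\<integral>\<^sup>+w. \<integral>\<^sup>+s. H (s, w) \<partial>S \<partial>W)"
        by (intro nn_integral_cmult) measurable
      also have "(\<integral>\<^sup>+w. \<integral>\<^sup>+s. H (s, w) \<partial>S \<partial>W) = (\<integral>\<^sup>+s. \<integral>\<^sup>+w. H (s, w) \<partial>W \<partial>S)"
        by (rule Fubini') simp
      also have "\<dots> \<le> (\<integral>\<^sup>+s. a s \<partial>S)"
      proof (intro nn_integral_mono_AE, use afin AE_space in eventually_elim)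
        case (elim s)
        have [measurable]: "(\<lambda>w. G (s, w)) \<in> borel_measurable W" using elim by measurable
        have "(\<integral>\<^sup>+w. H (s, w) \<partial>W) = epow (N s) P * inverse (epow (a s) (P - 1))"
          by (simp add: H_def nn_integral_multc NP)
        also have "\<dots> \<le> epow (a s) P * inverse (epow (a s) (P - 1))"
          using th by (intro mult_right_mono epow_mono) (auto simp: a_def)
        also have "epow (a s) P = a s * epow (a s) (P - 1)"
          using epow_add[of 1 "P - 1" "a s"] th by simp
        also have "a s * epow (a s) (P - 1) * inverse (epow (a s) (P - 1)) = a s"
          using inv[OF elim(1)] by (simp add: mult.assoc)
        finally show ?case .
      qed
      also have "epow A (P - 1) * (\<integral>\<^sup>+s. a s \<partial>S) = epow A P"
        using epow_add[of "P - 1" 1 A] th by (simp add: A_def)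
      finally have "(\<integral>\<^sup>+w. epow (\<integral>\<^sup>+s. G (s, w) \<partial>S) P \<partial>W) \<le> epow A P" by (simp add: mult_left_mono)
      then have "epow (\<integral>\<^sup>+w. epow (\<integral>\<^sup>+s. G (s, w) \<partial>S) P \<partial>W) (1 / P) \<le> epow (epow A P) (1 / P)"
        using th by (intro epow_mono) auto
      then show ?thesis using P1 by (simp add: epow_cancel A)
    qed
    note le = this
    have "epow (\<integral>\<^sup>+w. epow (\<integral>\<^sup>+s. G (s, w) \<partial>S) P \<partial>W) (1 / P) \<le> (\<integral>\<^sup>+s. N s \<partial>S)"
      by (rule ennreal_le_epsilon) (rule le)
    then show ?thesis by (simp add: N_def[symmetric])
  qed
qed

section \<open>Mixed norms of convolutions\<close>

lemma nn_integral_lborel_translate: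
  fixes f :: "'a::euclidean_space \<Rightarrow> ennreal"
  assumes [measurable]: "f \<in> borel_measurable borel"
  shows "(\<integral>\<^sup>+x. f (x - c) \<partial>lborel) = (\<integral>\<^sup>+x. f x \<partial>lborel)"
proof -
  have "(\<integral>\<^sup>+x. f x \<partial>lborel) = (\<integral>\<^sup>+x. f x \<partial>distr lborel borel ((+) (- c)))"
    by (simp add: lborel_distr_plus)
  also have "\<dots> = (\<integral>\<^sup>+x. f (x - c) \<partial>lborel)"
    by (subst nn_integral_distr) auto
  finally show ?thesis by simp
qed

text \<open>The Q-th power of a mixed norm: the first component is the outer variable with exponent
  Q, the second the inner one with exponent P.\<close>

definition mixed_int :: "real \<Rightarrow> real \<Rightarrow> ('a::euclidean_space \<times> 'b::euclidean_space \<Rightarrow> ennreal) \<Rightarrow> ennreal" where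
  "mixed_int Q P g = (\<integral>\<^sup>+y. epow (\<integral>\<^sup>+w. epow (g (y, w)) P \<partial>lborel) (Q / P) \<partial>lborel)"

definition nnconv :: "'a::euclidean_space measure \<Rightarrow> ('a \<Rightarrow> ennreal) \<Rightarrow> 'a \<Rightarrow> ennreal" where
  "nnconv \<mu> g z = (\<integral>\<^sup>+s. g (z - s) \<partial>\<mu>)"

lemma measurable_lborel_pairD:
  "g \<in> borel_measurable borel \<Longrightarrow> g \<in> borel_measurable (lborel \<Otimes>\<^sub>M lborel)"
  by (simp add: lborel_prod)

lemma measurable_nnconv:
  assumes [measurable]: "g \<in> borel_measurable borel" and [measurable_cong]: "sets \<mu> = sets borel" and "sigma_finite_measure \<mu>"
  shows "nnconv \<mu> g \<in> borel_measurable borel"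
proof -
  interpret sigma_finite_measure \<mu> by fact
  show ?thesis unfolding nnconv_def[abs_def] by measurable
qed

text \<open>Minkowski is applied first to the inner and then to the outer norm; translation
  invariance makes each shifted norm equal to the original one, and a probability measure averages
  them without a factor.\<close>

lemma mixed_int_nnconv_le:
  fixes g :: "'a::euclidean_space \<times> 'b::euclidean_space \<Rightarrow> ennreal"
  assumes g: "g \<in> borel_measurable borel" and mu: "sets \<mu> = sets borel" "emeasure \<mu> UNIV = 1"
    and Q: "1 \<le> Q" "Q \<le> P"
  shows "mixed_int Q P (nnconv \<mu> g) \<le> mixed_int Q P g"
proof -
  note [measurable_cong] = mu(1)
  note [measurable] = g
  have spc: "space \<mu> = UNIV" using sets_eq_imp_space_eq[OF mu(1)] by simp
  interpret finite_measure \<mu> by (rule finite_measureI) (simp add: spc mu)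
  have P: "1 \<le> P" "0 < P" "0 < Q" using Q by auto
  define N where "N y = epow (\<integral>\<^sup>+w. epow (g (y, w)) P \<partial>lborel) (1 / P)" for y
  have Nm[measurable]: "N \<in> borel_measurable borel" unfolding N_def by measurable
  have 1: "epow (\<integral>\<^sup>+w. epow (nnconv \<mu> g (y, w)) P \<partial>lborel) (1 / P) \<le> (\<integral>\<^sup>+s. N (y - fst s) \<partial>\<mu>)" for y
  proof -
    have "epow (\<integral>\<^sup>+w. epow (nnconv \<mu> g (y, w)) P \<partial>lborel) (1 / P)
      \<le> (\<integral>\<^sup>+s. epow (\<integral>\<^sup>+w. epow (g ((y, w) - s)) P \<partial>lborel) (1 / P) \<partial>\<mu>)"
    proof -
      have "(\<lambda>(s, w). g ((y, w) - s)) \<in> borel_measurable (\<mu> \<Otimes>\<^sub>M lborel)" by measurable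
      from minkowski_nn_integral[OF sigma_finite_measure_axioms sigma_finite_lborel _ P(1) this] show ?thesis
        using mu spc by (simp add: nnconv_def)
    qed
    also have "\<dots> = (\<integral>\<^sup>+s. N (y - fst s) \<partial>\<mu>)"
    proof (intro nn_integral_cong)
      fix s :: "'a \<times> 'b"
      have "(\<integral>\<^sup>+w. epow (g ((y, w) - s)) P \<partial>lborel) = (\<integral>\<^sup>+w. epow (g (y - fst s, w - snd s)) P \<partial>lborel)"
        by (simp add: minus_prod_def)
      also have "\<dots> = (\<integral>\<^sup>+w. epow (g (y - fst s, w)) P \<partial>lborel)"
        by (rule nn_integral_lborel_translate) simp
      finally show "epow (\<integral>\<^sup>+w. epow (g ((y, w) - s)) P \<partial>lborel) (1 / P) = N (y - fst s)"
        by (simp add: N_def)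
    qed
    finally show ?thesis .
  qed
  have "mixed_int Q P (nnconv \<mu> g) = (\<integral>\<^sup>+y. epow (epow (\<integral>\<^sup>+w. epow (nnconv \<mu> g (y, w)) P \<partial>lborel) (1 / P)) Q \<partial>lborel)"
    unfolding mixed_int_def using P by (simp add: epow_epow)
  also have "\<dots> \<le> (\<integral>\<^sup>+y. epow (\<integral>\<^sup>+s. N (y - fst s) \<partial>\<mu>) Q \<partial>lborel)"
    using P by (intro nn_integral_mono epow_mono 1) auto
  finally have "epow (mixed_int Q P (nnconv \<mu> g)) (1 / Q) \<le> epow (\<integral>\<^sup>+y. epow (\<integral>\<^sup>+s. N (y - fst s) \<partial>\<mu>) Q \<partial>lborel) (1 / Q)"
    using P by (intro epow_mono) auto
  also have "\<dots> \<le> (\<integral>\<^sup>+s. epow (\<integral>\<^sup>+y. epow (N (y - fst s)) Q \<partial>lborel) (1 / Q) \<partial>\<mu>)"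
  proof -
    have [measurable]: "fst \<in> \<mu> \<rightarrow>\<^sub>M borel"
      unfolding measurable_cong_sets[OF mu(1) refl] by (intro borel_measurable_continuous_onI continuous_intros)
    have "(\<lambda>z. fst (fst z)) \<in> \<mu> \<Otimes>\<^sub>M lborel \<rightarrow>\<^sub>M borel"
      by (rule measurable_compose[OF measurable_fst]) simp
    then have "(\<lambda>z. N (snd z - fst (fst z))) \<in> borel_measurable (\<mu> \<Otimes>\<^sub>M lborel)" by measurable
    then have "(\<lambda>(s, y). N (y - fst s)) \<in> borel_measurable (\<mu> \<Otimes>\<^sub>M lborel)"
      by (simp add: split_beta')
    from minkowski_nn_integral[OF sigma_finite_measure_axioms sigma_finite_lborel _ Q(1) this] show ?thesis
      using mu spc by simp
  qed
  also have "\<dots> = (\<integral>\<^sup>+s. epow (\<integral>\<^sup>+y. epow (N y) Q \<partial>lborel) (1 / Q) \<partial>\<mu>)"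
    using nn_integral_lborel_translate[of "\<lambda>y. epow (N y) Q"] by simp
  also have "\<dots> = epow (mixed_int Q P g) (1 / Q)"
    unfolding mixed_int_def N_def using P by (simp add: epow_epow spc mu)
  finally show ?thesis using P by (simp add: epow_le_iff)
qed

lemma mixed_int_mono: "0 \<le> Q \<Longrightarrow> 0 < P \<Longrightarrow> (\<And>z. f z \<le> g z) \<Longrightarrow> mixed_int Q P f \<le> mixed_int Q P g"
  unfolding mixed_int_def by (intro nn_integral_mono epow_mono) auto

text \<open>Powers commute with a maximum, so there is no constant as there would be for a sum; only
  the concave outer power Q / P <= 1 has to be split.\<close>

lemma mixed_int_max_le:
  assumes [measurable]: "f \<in> borel_measurable borel" "g \<in> borel_measurable borel" and Q: "0 < Q" "Q \<le> P"
  shows "mixed_int Q P (\<lambda>z. max (f z) (g z)) \<le> mixed_int Q P f + mixed_int Q P g"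
proof -
  have P: "0 < P" "Q / P \<le> 1" using Q by auto
  have "mixed_int Q P (\<lambda>z. max (f z) (g z))
    \<le> (\<integral>\<^sup>+y. epow (\<integral>\<^sup>+w. epow (f (y, w)) P \<partial>lborel) (Q / P) + epow (\<integral>\<^sup>+w. epow (g (y, w)) P \<partial>lborel) (Q / P) \<partial>lborel)"
    unfolding mixed_int_def
  proof (intro nn_integral_mono)
    fix y :: 'a
    have "(\<integral>\<^sup>+w. epow (max (f (y, w)) (g (y, w))) P \<partial>lborel)
      \<le> (\<integral>\<^sup>+w. epow (f (y, w)) P + epow (g (y, w)) P \<partial>lborel)"
      using P by (intro nn_integral_mono) (simp add: epow_max)
    also have "\<dots> = (\<integral>\<^sup>+w. epow (f (y, w)) P \<partial>lborel) + (\<integral>\<^sup>+w. epow (g (y, w)) P \<partial>lborel)"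
      by (intro nn_integral_add) auto
    finally have "epow (\<integral>\<^sup>+w. epow (max (f (y, w)) (g (y, w))) P \<partial>lborel) (Q / P)
      \<le> epow ((\<integral>\<^sup>+w. epow (f (y, w)) P \<partial>lborel) + (\<integral>\<^sup>+w. epow (g (y, w)) P \<partial>lborel)) (Q / P)"
      using P Q by (intro epow_mono) auto
    also have "\<dots> \<le> epow (\<integral>\<^sup>+w. epow (f (y, w)) P \<partial>lborel) (Q / P) + epow (\<integral>\<^sup>+w. epow (g (y, w)) P \<partial>lborel) (Q / P)"
      using P Q by (intro epow_subadditive) auto
    finally show "epow (\<integral>\<^sup>+w. epow (max (f (y, w)) (g (y, w))) P \<partial>lborel) (Q / P)
      \<le> epow (\<integral>\<^sup>+w. epow (f (y, w)) P \<partial>lborel) (Q / P) + epow (\<integral>\<^sup>+w. epow (g (y, w)) P \<partial>lborel) (Q / P)" .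
  qed
  also have "\<dots> = mixed_int Q P f + mixed_int Q P g"
    unfolding mixed_int_def by (intro nn_integral_add) auto
  finally show ?thesis .
qed

lemma mixed_int_cmult:
  assumes [measurable]: "f \<in> borel_measurable borel" and Q: "0 < Q" "Q \<le> P"
  shows "mixed_int Q P (\<lambda>z. c * f z) = epow c Q * mixed_int Q P f"
  unfolding mixed_int_def using Q
  by (simp add: epow_mult nn_integral_cmult epow_epow)

lemma epow_tendsto_0:
  assumes s: "0 < s" and x: "(x \<longlongrightarrow> 0) F"
  shows "((\<lambda>n. epow (x n) s) \<longlongrightarrow> 0) F"
proof (rule order_tendstoI)
  fix a :: ennreal assume a: "0 < a"
  have "eventually (\<lambda>n. x n < epow a (1 / s)) F"
    using a s by (intro order_tendstoD(2)[OF x]) (simp add: less_le epow_eq_0_iff)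
  then show "eventually (\<lambda>n. epow (x n) s < a) F"
  proof eventually_elim
    case (elim n)
    then have "\<not> epow (epow a (1/s)) s \<le> epow (x n) s" using s by (simp only: epow_le_iff not_le)
    then show ?case using s by (simp add: epow_cancel)
  qed
qed simp

text \<open>Dominated convergence in the inner variable for almost every y, then in the outer one;
  the inner majorant is integrable only for almost every y.\<close>

lemma mixed_int_dominated_tendsto_0:
  fixes h :: "nat \<Rightarrow> 'a::euclidean_space \<times> 'b::euclidean_space \<Rightarrow> ennreal"
  assumes h[measurable]: "\<And>n. h n \<in> borel_measurable borel" and G[measurable]: "G \<in> borel_measurable borel"
    and Q: "0 < Q" "Q \<le> P" and fin: "mixed_int Q P G < top" and le: "\<And>n z. h n z \<le> G z"
    and ae: "AE z in lborel. (\<lambda>n. h n z) \<longlonglongrightarrow> 0"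
  shows "(\<lambda>n. mixed_int Q P (h n)) \<longlonglongrightarrow> 0"
proof -
  have P: "0 < P" "0 < Q / P" using Q by auto
  have "AE z in lborel \<Otimes>\<^sub>M lborel. (\<lambda>n. h n (z :: 'a \<times> 'b)) \<longlonglongrightarrow> 0"
    using ae by (subst lborel_prod)
  then have ae2: "AE y in lborel. AE w in lborel. (\<lambda>n. h n (y, w)) \<longlonglongrightarrow> 0"
    by (rule lborel_pair.AE_pair)
  have "AE y in lborel. epow (\<integral>\<^sup>+w. epow (G (y, w)) P \<partial>lborel) (Q / P) \<noteq> \<infinity>"
    using fin unfolding mixed_int_def by (intro nn_integral_noteq_infinite) auto
  then have fin2: "AE y in lborel. (\<integral>\<^sup>+w. epow (G (y, w)) P \<partial>lborel) < \<infinity>"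
    using P by (auto elim!: eventually_mono simp: less_top epow_eq_top_iff)
  have "(\<lambda>n. mixed_int Q P (h n)) \<longlonglongrightarrow> (\<integral>\<^sup>+(y::'a). 0 \<partial>lborel)"
    unfolding mixed_int_def
  proof (rule nn_integral_dominated_convergence[where w="\<lambda>y. epow (\<integral>\<^sup>+w. epow (G (y, w)) P \<partial>lborel) (Q / P)"])
    show "AE y in lborel. (\<lambda>n. epow (\<integral>\<^sup>+w. epow (h n (y, w)) P \<partial>lborel) (Q / P)) \<longlonglongrightarrow> 0"
      using ae2 fin2
    proof eventually_elim
      case (elim y)
      have "(\<lambda>n. \<integral>\<^sup>+w. epow (h n (y, w)) P \<partial>lborel) \<longlonglongrightarrow> (\<integral>\<^sup>+(w::'b). 0 \<partial>lborel)"
      proof (rule nn_integral_dominated_convergence[where w="\<lambda>w. epow (G (y, w)) P"])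
        show "AE w in lborel. (\<lambda>n. epow (h n (y, w)) P) \<longlonglongrightarrow> 0"
          using elim(1) by (rule eventually_mono) (intro epow_tendsto_0 P)
      qed (use elim(2) P le in \<open>auto intro!: epow_mono\<close>)
      then show ?case by (intro epow_tendsto_0 P) simp
    qed
  qed (use fin P le in \<open>auto intro!: epow_mono nn_integral_mono simp: mixed_int_def\<close>)
  then show ?thesis by simp
qed

lemma mixed_int_indicator_finite:
  assumes [measurable]: "C1 \<in> sets borel" "C2 \<in> sets borel" and fin: "emeasure lborel C1 < top" "emeasure lborel C2 < top"
    and Q: "0 < Q" "Q \<le> P" and K: "K < top"
  shows "mixed_int Q P (\<lambda>z. K * indicator (C1 \<times> C2) z) < top"
proof -
  have P: "0 < P" "0 < Q / P" using Q by auto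
  have e: "epow (indicator A x) s = (indicator A x :: ennreal)" if "0 < s" for A x s
    using that by (auto simp: indicator_def)
  have e2: "epow (indicator (C1 \<times> C2) (y, w)) P = (indicator C1 y * indicator C2 w :: ennreal)" for y w
    using P by (auto simp: indicator_def)
  have [measurable]: "(\<lambda>z. indicator (C1 \<times> C2) z :: ennreal) \<in> borel_measurable borel"
    by (intro borel_measurable_indicator borel_Times) auto
  have "mixed_int Q P (\<lambda>z. K * indicator (C1 \<times> C2) z)
    = epow K Q * (\<integral>\<^sup>+y. epow (\<integral>\<^sup>+w. indicator C1 y * indicator C2 w \<partial>lborel) (Q / P) \<partial>lborel)"
    by (subst mixed_int_cmult) (use Q P in \<open>auto simp: mixed_int_def e2\<close>)
  also have "\<dots> = epow K Q * (epow (emeasure lborel C2) (Q / P) * emeasure lborel C1)"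
    using P by (simp add: nn_integral_cmult epow_mult e nn_integral_multc mult.commute)
  also have "\<dots> < top"
    using fin K P Q by (simp add: ennreal_mult_less_top epow_less_top)
  finally show ?thesis .
qed

(* Truncating g at a large level makes the convolutions of its tail uniformly small, so that the family
   of all convolutions of g is equi-integrable in the mixed norm. *)
lemma mixed_int_nnconv_tendsto_0:
  fixes g :: "'a::euclidean_space \<times> 'b::euclidean_space \<Rightarrow> ennreal"
  assumes g[measurable]: "g \<in> borel_measurable borel" and gfin: "mixed_int Q P g < top" "\<And>z. g z < top"
    and Q: "1 \<le> Q" "Q \<le> P"
    and C[measurable]: "C1 \<in> sets borel" "C2 \<in> sets borel" and Cfin: "emeasure lborel C1 < top" "emeasure lborel C2 < top"
    and mu: "\<And>n. sets (\<mu> n) = sets borel" "\<And>n. emeasure (\<mu> n) UNIV = 1"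
    and f[measurable]: "\<And>n. f n \<in> borel_measurable borel"
    and fle: "\<And>n z. f n z \<le> nnconv (\<mu> n) g z" and f0: "\<And>n z. z \<notin> C1 \<times> C2 \<Longrightarrow> f n z = 0"
    and ae: "AE z in lborel. (\<lambda>n. f n z) \<longlonglongrightarrow> 0"
  shows "(\<lambda>n. mixed_int Q P (f n)) \<longlonglongrightarrow> 0"
proof -
  have Q0: "0 < Q" "0 < P" using Q by auto
  have spc: "space (\<mu> n) = UNIV" for n using sets_eq_imp_space_eq[OF mu(1)] by simp
  have sf: "sigma_finite_measure (\<mu> n)" for n
  proof -
    interpret finite_measure "\<mu> n" by (rule finite_measureI) (simp add: spc mu)
    show ?thesis by (rule sigma_finite_measure_axioms)
  qed
  define gK where "gK K z = (if of_nat K < g z then g z else 0)" for K :: nat and z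
  have [measurable]: "gK K \<in> borel_measurable borel" for K unfolding gK_def by measurable
  have [measurable]: "nnconv (\<mu> n) (gK K) \<in> borel_measurable borel" for n K
    by (intro measurable_nnconv mu sf) measurable
  have gK0: "(\<lambda>K. mixed_int Q P (gK K)) \<longlonglongrightarrow> 0"
  proof (rule mixed_int_dominated_tendsto_0[OF _ g Q0(1) Q(2) gfin(1)])
    show "AE z in lborel. (\<lambda>K. gK K z) \<longlonglongrightarrow> 0"
    proof (intro AE_I2 tendsto_eventually)
      fix z
      obtain K0 where "g z \<le> of_nat K0"
        using gfin(2)[of z] by (metis ennreal_Ex_less_of_nat infinity_ennreal_def less_imp_le)
      note K0 = this
      show "\<forall>\<^sub>F K in sequentially. gK K z = 0"
      proof (rule eventually_sequentiallyI[of K0])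
        fix K assume "K0 \<le> K"
        then have "g z \<le> of_nat K" using K0 by (meson of_nat_mono order_trans)
        then show "gK K z = 0" by (simp add: gK_def not_less)
      qed
    qed
  qed (auto simp: gK_def)
  \<comment> \<open>From f <= K + t, with t the convolved tail, it follows that f <= 2 K or f <= 2
    t. The maximum is the form that \<open>mixed_int_max_le\<close> accepts.\<close>
  have split: "f n z \<le> max (min (f n z) (2 * of_nat K)) (2 * nnconv (\<mu> n) (gK K) z)" for n K z
  proof -
    have "nnconv (\<mu> n) g z \<le> (\<integral>\<^sup>+s. of_nat K + gK K (z - s) \<partial>\<mu> n)"
      unfolding nnconv_def by (intro nn_integral_mono) (auto simp: gK_def not_less intro: add_increasing)
    also have "\<dots> = of_nat K + nnconv (\<mu> n) (gK K) z"
      using mu(1)[of n] unfolding nnconv_def by (subst nn_integral_add) (auto simp: mu spc cong: measurable_cong_sets)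
    finally have le: "f n z \<le> of_nat K + nnconv (\<mu> n) (gK K) z" using fle order_trans by blast
    show ?thesis
    proof (cases "f n z \<le> 2 * of_nat K \<or> nnconv (\<mu> n) (gK K) z = top")
      case False
      then obtain c where c: "nnconv (\<mu> n) (gK K) z = ennreal c" "0 \<le> c" by (cases "nnconv (\<mu> n) (gK K) z") auto
      have "f n z < top" using le c by (auto simp: of_nat_less_top less_top[symmetric] top_unique)
      then obtain a where a: "f n z = ennreal a" "0 \<le> a" by (cases "f n z") auto
      have "a \<le> real K + c"
        using le a c by (simp add: ennreal_of_nat_eq_real_of_nat ennreal_plus[symmetric] del: ennreal_plus)
      moreover have "2 * real K < a"
        using False a by (auto simp: ennreal_of_nat_eq_real_of_nat ennreal_mult[symmetric] ennreal_numeral[symmetric] simp del: ennreal_numeral)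
      ultimately have "a \<le> 2 * c" by simp
      then have "f n z \<le> 2 * nnconv (\<mu> n) (gK K) z"
        using a c by (simp add: ennreal_mult[symmetric] ennreal_numeral[symmetric] ennreal_leI del: ennreal_numeral)
      then show ?thesis by (simp add: le_max_iff_disj)
    qed (auto simp: le_max_iff_disj)
  qed
  show ?thesis
  proof (rule order_tendstoI)
    fix a :: ennreal assume "0 < a"
    then obtain b where "0 < b" "b < a" using dense by blast
    then obtain e where e: "0 < e" "ennreal e < a" by (cases b rule: ennreal_cases3) auto
    have "(\<lambda>K. epow 2 Q * mixed_int Q P (gK K)) \<longlonglongrightarrow> epow 2 Q * 0"
      by (intro ennreal_tendsto_cmult gK0) (use Q0 in \<open>auto intro!: epow_less_top\<close>)
    then have "\<forall>\<^sub>F K in sequentially. epow 2 Q * mixed_int Q P (gK K) < ennreal (e / 2)"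
      using e by (intro order_tendstoD) auto
    then obtain K where K: "epow 2 Q * mixed_int Q P (gK K) < ennreal (e / 2)"
      by (meson eventually_sequentially order_refl)
    have "(\<lambda>n. mixed_int Q P (\<lambda>z. min (f n z) (2 * of_nat K))) \<longlonglongrightarrow> 0"
    proof (rule mixed_int_dominated_tendsto_0[OF _ _ Q0(1) Q(2)])
      show "mixed_int Q P (\<lambda>z::'a\<times>'b. (2 * of_nat K) * indicator (C1 \<times> C2) z) < top"
        using C Cfin Q0(1) Q(2) by (rule mixed_int_indicator_finite) (simp add: ennreal_mult_less_top of_nat_less_top)
      show "(\<lambda>z::'a\<times>'b. (2 * of_nat K) * indicator (C1 \<times> C2) z :: ennreal) \<in> borel_measurable borel"
        by (intro borel_measurable_times_ennreal borel_measurable_const borel_measurable_indicator borel_Times C)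
      show "min (f n z) (2 * of_nat K) \<le> (2 * of_nat K) * indicator (C1 \<times> C2) z" for n z
        using f0[of z n] by (cases "z \<in> C1 \<times> C2") auto
      show "AE z in lborel. (\<lambda>n. min (f n z) (2 * of_nat K)) \<longlonglongrightarrow> 0"
        using ae by (rule eventually_mono) (rule tendsto_sandwich[OF _ _ tendsto_const], auto)
    qed measurable
    then have "\<forall>\<^sub>F n in sequentially. mixed_int Q P (\<lambda>z. min (f n z) (2 * of_nat K)) < ennreal (e / 2)"
      using e by (intro order_tendstoD) auto
    then show "\<forall>\<^sub>F n in sequentially. mixed_int Q P (f n) < a"
    proof eventually_elim
      case (elim n)
      have "mixed_int Q P (f n) \<le> mixed_int Q P (\<lambda>z. max (min (f n z) (2 * of_nat K)) (2 * nnconv (\<mu> n) (gK K) z))"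
        using Q0 by (intro mixed_int_mono split) auto
      also have "\<dots> \<le> mixed_int Q P (\<lambda>z. min (f n z) (2 * of_nat K)) + mixed_int Q P (\<lambda>z. 2 * nnconv (\<mu> n) (gK K) z)"
        using Q0 Q by (intro mixed_int_max_le) auto
      also have "mixed_int Q P (\<lambda>z. 2 * nnconv (\<mu> n) (gK K) z) = epow 2 Q * mixed_int Q P (nnconv (\<mu> n) (gK K))"
        using Q0 Q by (intro mixed_int_cmult) auto
      also have "\<dots> \<le> epow 2 Q * mixed_int Q P (gK K)"
        using Q mu by (intro mult_left_mono mixed_int_nnconv_le) auto
      finally have "mixed_int Q P (f n) \<le> mixed_int Q P (\<lambda>z. min (f n z) (2 * of_nat K)) + epow 2 Q * mixed_int Q P (gK K)"
        by (simp add: add_left_mono)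
      also have "\<dots> < ennreal (e / 2) + ennreal (e / 2)" using elim K by (rule add_strict_mono)
      also have "\<dots> = ennreal e" using e by (simp add: ennreal_plus[symmetric] del: ennreal_plus)
      finally show ?case using e by simp
    qed
  qed simp
qed

section \<open>Smooth functions and convolutions\<close>

text \<open>The one-sided bump exp(-1/x) together with the powers of 1/x that differentiation
  produces, so that the family is closed under derivatives up to linear combination.\<close>

definition gam :: "nat \<Rightarrow> real \<Rightarrow> real" where
  "gam k x = (if 0 < x then exp (- 1 / x) / x ^ k else 0)"

lemma gam_nonneg: "0 \<le> gam k x" by (simp add: gam_def)

lemma power_div_fact_le_exp:
  assumes "0 \<le> (y::real)"
  shows "y ^ n / fact n \<le> exp y"
proof -
  have "(\<Sum>k\<in>{n}. y ^ k /\<^sub>R fact k) \<le> (\<Sum>k. y ^ k /\<^sub>R fact k)"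
    using assms by (intro sum_le_suminf summable_exp_generic) auto
  then show ?thesis by (simp add: exp_def divide_inverse mult.commute)
qed

text \<open>A single term of the exponential series at 1 / x gives it. Quadratic decay is what makes
  \<open>gam\<close> differentiable at the origin, with derivative 0.\<close>

lemma gam_le_square: "gam k x \<le> fact (k + 2) * x\<^sup>2"
proof (cases "0 < x")
  case True
  obtain F :: real where F: "F = fact (k + 2)" "0 < F" by simp
  have "(1 / x) ^ (k + 2) / F \<le> exp (1 / x)"
    unfolding F using True by (intro power_div_fact_le_exp) auto
  then have "exp (- 1 / x) * ((1 / x) ^ (k + 2) / F) \<le> exp (- 1 / x) * exp (1 / x)"
    by (intro mult_left_mono) auto
  also have "\<dots> = 1" by (simp add: exp_add[symmetric])
  finally show ?thesis using True F(2) unfolding F(1)[symmetric]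
    by (simp add: gam_def divide_simps power_add power2_eq_square mult_ac)
qed (simp add: gam_def)

lemma gam_deriv: "(gam k has_real_derivative gam (k + 2) x - real k * gam (k + 1) x) (at x)"
proof -
  consider "0 < x" | "x < 0" | "x = 0" by linarith
  then show ?thesis
  proof cases
    case 1
    have "((\<lambda>x. exp (- 1 / x) / x ^ k) has_real_derivative gam (k + 2) x - real k * gam (k + 1) x) (at x)"
    proof -
      have q: "real k * x ^ (k - Suc 0) = real k * x ^ k / x" using 1 by (cases k) auto
      have "((\<lambda>x. exp (- 1 / x) / x ^ k) has_real_derivative
        (exp (- 1 / x) * (1 / x\<^sup>2) * x ^ k - exp (- 1 / x) * (real k * x ^ (k - Suc 0))) / (x ^ k * x ^ k)) (at x)"
        using 1 by (auto intro!: derivative_eq_intros simp: power2_eq_square)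
      moreover have "(exp (- 1 / x) * (1 / x\<^sup>2) * x ^ k - exp (- 1 / x) * (real k * x ^ (k - Suc 0))) / (x ^ k * x ^ k)
        = gam (k + 2) x - real k * gam (k + 1) x"
        unfolding q using 1 by (simp add: gam_def power2_eq_square divide_simps) (simp add: algebra_simps)
      ultimately show ?thesis by simp
    qed
    then show ?thesis
      by (rule DERIV_cong_ev[THEN iffD1, rotated 3, OF _ refl _ refl])
         (use 1 in \<open>auto simp: gam_def intro!: eventually_mono[OF eventually_nhds_in_open[of "{0<..}"]]\<close>)
  next
    case 2
    have "((\<lambda>x. 0) has_real_derivative 0) (at x)" by simp
    then have "(gam k has_real_derivative 0) (at x)"
      by (rule DERIV_cong_ev[THEN iffD1, rotated 3, OF _ refl _ refl])
         (use 2 in \<open>auto simp: gam_def intro!: eventually_mono[OF eventually_nhds_in_open[of "{..<0}"]]\<close>)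
    then show ?thesis using 2 by (simp add: gam_def)
  next
    case 3
    have "((\<lambda>h. gam k h / h) \<longlongrightarrow> 0) (at 0)"
    proof (rule Lim_null_comparison)
      show "\<forall>\<^sub>F h in at 0. norm (gam k h / h) \<le> fact (k + 2) * \<bar>h\<bar>"
      proof (rule always_eventually, rule allI)
        fix h
        show "norm (gam k h / h) \<le> fact (k + 2) * \<bar>h\<bar>"
        proof (cases "h = 0")
          case False
          have "\<bar>gam k h\<bar> / \<bar>h\<bar> \<le> fact (k + 2) * h\<^sup>2 / \<bar>h\<bar>"
            using gam_le_square[of k h] gam_nonneg[of k h] by (intro divide_right_mono) auto
          also have "\<dots> = fact (k + 2) * \<bar>h\<bar>"
            using False by (simp add: power2_eq_square abs_if)
          finally show ?thesis by simp
        qed simp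
      qed
      show "((\<lambda>h. fact (k + 2) * \<bar>h\<bar>) \<longlongrightarrow> (0::real)) (at 0)"
        by (auto intro!: tendsto_eq_intros)
    qed
    then show ?thesis using 3 by (simp add: DERIV_def gam_def)
  qed
qed

text \<open>An inductively generated algebra that contains the mollifiers. Closure under directional
  derivatives and symmetry of second derivatives can then be proved by induction over the
  rules.\<close>

inductive_set smoothC :: "('a::euclidean_space \<Rightarrow> real) set" where
  const: "(\<lambda>_. c) \<in> smoothC"
| gam: "(\<lambda>z. gam k (c + z \<bullet> v)) \<in> smoothC"
| add: "f \<in> smoothC \<Longrightarrow> g \<in> smoothC \<Longrightarrow> (\<lambda>z. f z + g z) \<in> smoothC"
| mult: "f \<in> smoothC \<Longrightarrow> g \<in> smoothC \<Longrightarrow> (\<lambda>z. f z * g z) \<in> smoothC"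

lemma smoothC_deriv_ex:
  assumes "f \<in> smoothC"
  shows "\<exists>D. (\<forall>z. (f has_derivative (\<lambda>v. D v z)) (at z)) \<and> (\<forall>v. D v \<in> smoothC)"
  using assms
proof induction
  case (const c)
  then show ?case by (intro exI[of _ "\<lambda>_ _. 0"]) (auto intro: smoothC.const)
next
  case (gam k c v)
  have "(\<lambda>z. (gam (k + 2) (c + z \<bullet> v) + (- real k) * gam (k + 1) (c + z \<bullet> v)) * (w \<bullet> v)) \<in> smoothC" for w
    by (intro smoothC.intros)
  moreover have "((\<lambda>z. gam k (c + z \<bullet> v)) has_derivative
     (\<lambda>w. (gam (k + 2) (c + z \<bullet> v) + (- real k) * gam (k + 1) (c + z \<bullet> v)) * (w \<bullet> v))) (at z)" for z
  proof -
    have 1: "((\<lambda>z. c + z \<bullet> v) has_derivative (\<lambda>w. w \<bullet> v)) (at z)"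
      by (auto intro!: derivative_eq_intros)
    have "(gam k has_derivative (*) (gam (k + 2) (c + z \<bullet> v) - real k * gam (k + 1) (c + z \<bullet> v))) (at (c + z \<bullet> v))"
      using gam_deriv[of k "c + z \<bullet> v"] by (simp add: has_field_derivative_def)
    from has_derivative_compose[OF 1 this] show ?thesis by simp
  qed
  ultimately show ?case
    by (intro exI[of _ "\<lambda>w z. (gam (k + 2) (c + z \<bullet> v) + (- real k) * gam (k + 1) (c + z \<bullet> v)) * (w \<bullet> v)"]) auto
next
  case (add f g)
  then obtain D E where DE: "\<forall>z. (f has_derivative (\<lambda>v. D v z)) (at z)" "\<forall>v. D v \<in> smoothC"
    "\<forall>z. (g has_derivative (\<lambda>v. E v z)) (at z)" "\<forall>v. E v \<in> smoothC" by blast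
  then show ?case
    by (intro exI[of _ "\<lambda>v z. D v z + E v z"] conjI allI smoothC.add has_derivative_add) blast+
next
  case (mult f g)
  then obtain D E where DE: "\<forall>z. (f has_derivative (\<lambda>v. D v z)) (at z)" "\<forall>v. D v \<in> smoothC"
    "\<forall>z. (g has_derivative (\<lambda>v. E v z)) (at z)" "\<forall>v. E v \<in> smoothC" by blast
  show ?case
  proof (intro exI[of _ "\<lambda>v z. f z * E v z + D v z * g z"] conjI allI)
    show "((\<lambda>z. f z * g z) has_derivative (\<lambda>v. f z * E v z + D v z * g z)) (at z)" for z
      using DE by (intro has_derivative_mult) blast+
    show "(\<lambda>z. f z * E v z + D v z * g z) \<in> smoothC" for v
      using DE mult.hyps by (intro smoothC.add smoothC.mult) blast+
  qed
qed

lemma dir_deriv_eq: "(f has_derivative f') (at z) \<Longrightarrow> dir_deriv v f z = f' v"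
  by (simp add: dir_deriv_def frechet_derivative_at[symmetric])

lemma
  assumes "f \<in> smoothC"
  shows smoothC_has_derivative: "(f has_derivative (\<lambda>v. dir_deriv v f z)) (at z)"
    and smoothC_dir_deriv: "dir_deriv v f \<in> smoothC"
proof -
  obtain D where D: "\<And>z. (f has_derivative (\<lambda>v. D v z)) (at z)" "\<And>v. D v \<in> smoothC"
    using smoothC_deriv_ex[OF assms] by blast
  have "dir_deriv v f = D v" for v
    using dir_deriv_eq[OF D(1)] by auto
  then show "(f has_derivative (\<lambda>v. dir_deriv v f z)) (at z)" "dir_deriv v f \<in> smoothC"
    using D by auto
qed

lemma smoothC_dir_derivs: "f \<in> smoothC \<Longrightarrow> dir_derivs vs f \<in> smoothC"
  by (induction vs) (auto intro: smoothC_dir_deriv)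

lemma smoothC_smooth: "f \<in> smoothC \<Longrightarrow> smooth f"
  unfolding smooth_def by (intro allI differentiableI[OF smoothC_has_derivative[OF smoothC_dir_derivs]])

lemma smoothC_continuous_on: "f \<in> smoothC \<Longrightarrow> continuous_on A f"
  by (rule has_derivative_continuous_on[OF has_derivative_at_withinI[OF smoothC_has_derivative]])

lemma smoothC_measurable [measurable]: "f \<in> smoothC \<Longrightarrow> f \<in> borel_measurable borel"
  by (intro borel_measurable_continuous_onI smoothC_continuous_on)

lemma dir_deriv_const: "dir_deriv v (\<lambda>_. c) = (\<lambda>_. 0)"
  by (auto intro!: ext dir_deriv_eq)

lemma dir_deriv_add: "f \<in> smoothC \<Longrightarrow> g \<in> smoothC \<Longrightarrow>
  dir_deriv v (\<lambda>z. f z + g z) = (\<lambda>z. dir_deriv v f z + dir_deriv v g z)"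
  by (intro ext dir_deriv_eq[where f' = "\<lambda>v. dir_deriv v f z + dir_deriv v g z" for z, THEN trans])
     (auto intro!: has_derivative_add smoothC_has_derivative)

lemma dir_deriv_mult: "f \<in> smoothC \<Longrightarrow> g \<in> smoothC \<Longrightarrow>
  dir_deriv v (\<lambda>z. f z * g z) = (\<lambda>z. f z * dir_deriv v g z + dir_deriv v f z * g z)"
  by (intro ext dir_deriv_eq[where f' = "\<lambda>v. f z * dir_deriv v g z + dir_deriv v f z * g z" for z, THEN trans])
     (auto intro!: has_derivative_mult smoothC_has_derivative)

lemma dir_deriv_gam: "dir_deriv w (\<lambda>z. gam k (c + z \<bullet> v)) =
  (\<lambda>z. (gam (k + 2) (c + z \<bullet> v) + (- real k) * gam (k + 1) (c + z \<bullet> v)) * (w \<bullet> v))"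
proof
  fix z
  have 1: "((\<lambda>z. c + z \<bullet> v) has_derivative (\<lambda>w. w \<bullet> v)) (at z)"
    by (auto intro!: derivative_eq_intros)
  have "(gam k has_derivative (*) (gam (k + 2) (c + z \<bullet> v) - real k * gam (k + 1) (c + z \<bullet> v))) (at (c + z \<bullet> v))"
    using gam_deriv[of k "c + z \<bullet> v"] by (simp add: has_field_derivative_def)
  from dir_deriv_eq[OF has_derivative_compose[OF 1 this]] show "dir_deriv w (\<lambda>z. gam k (c + z \<bullet> v)) z =
    (gam (k + 2) (c + z \<bullet> v) + (- real k) * gam (k + 1) (c + z \<bullet> v)) * (w \<bullet> v)" by simp
qed

text \<open>Sums and products inherit the symmetry. For a generator with direction u, both orders of
  differentiation produce the same function of c + z \<bullet> u with the symmetric factor (v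
  \<bullet> u) * (w \<bullet> u).\<close>

lemma smoothC_dir_deriv_commute:
  assumes "f \<in> smoothC"
  shows "dir_deriv v (dir_deriv w f) = dir_deriv w (dir_deriv v f)"
  using assms
proof induction
  case (const c)
  then show ?case by (simp add: dir_deriv_const)
next
  case (gam k c u)
  have *: "dir_deriv v (\<lambda>z. (gam (k + 2) (c + z \<bullet> u) + (- real k) * gam (k + 1) (c + z \<bullet> u)) * (w \<bullet> u))
    = (\<lambda>z. dir_deriv v (\<lambda>z. gam (k + 2) (c + z \<bullet> u) + (- real k) * gam (k + 1) (c + z \<bullet> u)) z * (w \<bullet> u))" for v w
    by (subst dir_deriv_mult[OF smoothC.add[OF smoothC.gam smoothC.mult[OF smoothC.const smoothC.gam]] smoothC.const])
      (simp add: dir_deriv_const)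
  have **: "dir_deriv v (\<lambda>z. gam (k + 2) (c + z \<bullet> u) + (- real k) * gam (k + 1) (c + z \<bullet> u))
    = (\<lambda>z. dir_deriv v (\<lambda>z. gam (k + 2) (c + z \<bullet> u)) z + (- real k) * dir_deriv v (\<lambda>z. gam (k + 1) (c + z \<bullet> u)) z)" for v
    by (subst dir_deriv_add[OF smoothC.gam smoothC.mult[OF smoothC.const smoothC.gam]],
        subst dir_deriv_mult[OF smoothC.const smoothC.gam]) (simp add: dir_deriv_const)
  show ?case
    by (simp only: dir_deriv_gam * **) (simp add: algebra_simps)
next
  case (add f g)
  then show ?case by (simp add: dir_deriv_add smoothC_dir_deriv)
next
  case (mult f g)
  then show ?case by (simp add: dir_deriv_mult dir_deriv_add smoothC_dir_deriv smoothC.mult algebra_simps)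
qed

lemma smoothC_reflect: "f \<in> smoothC \<Longrightarrow> (\<lambda>w. f (z - w)) \<in> smoothC"
proof (induction rule: smoothC.induct)
  case (gam k c v)
  have "(\<lambda>w. gam k (c + z \<bullet> v + w \<bullet> (- v))) \<in> smoothC" by (rule smoothC.gam)
  then show ?case by (simp add: inner_diff_left algebra_simps)
qed (auto intro: smoothC.intros)

lemma dir_deriv_reflect:
  assumes "f \<in> smoothC"
  shows "dir_deriv v (\<lambda>w. f (z - w)) = (\<lambda>w. - dir_deriv v f (z - w))"
proof
  fix w
  have "((\<lambda>w. z - w) has_derivative (\<lambda>k. - k)) (at w)" by (auto intro!: derivative_eq_intros)
  from dir_deriv_eq[OF has_derivative_compose[OF this smoothC_has_derivative[OF assms]]]
  have "dir_deriv v (\<lambda>w. f (z - w)) w = dir_deriv (- v) f (z - w)" by simp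
  also have "\<dots> = - dir_deriv v f (z - w)"
    using linear_neg[OF has_derivative_linear[OF smoothC_has_derivative[OF assms]]] by simp
  finally show "dir_deriv v (\<lambda>w. f (z - w)) w = - dir_deriv v f (z - w)" .
qed

lemma dir_derivs_reflect:
  assumes "f \<in> smoothC"
  shows "dir_derivs vs (\<lambda>w. f (z - w)) = (\<lambda>w. (- 1) ^ length vs * dir_derivs vs f (z - w))"
proof (induction vs)
  case (Cons v vs)
  have "dir_deriv v (\<lambda>w. (- 1) ^ length vs * dir_derivs vs f (z - w))
      = (\<lambda>w. (- 1) ^ length vs * dir_deriv v (\<lambda>w. dir_derivs vs f (z - w)) w)"
    by (subst dir_deriv_mult) (auto intro: smoothC.const smoothC_reflect smoothC_dir_derivs assms simp: dir_deriv_const)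
  then show ?case
    by (simp add: Cons dir_deriv_reflect smoothC_dir_derivs assms)
qed simp

section \<open>Uniform bounds for smooth functions of bounded support\<close>

lemma dir_deriv_zero_outside:
  assumes "f \<in> smoothC" and f0: "\<And>z. r < norm z \<Longrightarrow> f z = 0" and z: "r < norm z"
  shows "dir_deriv v f z = 0"
proof -
  have "(f has_derivative (\<lambda>_. 0)) (at z)"
  proof (rule has_derivative_transform_within_open[of "\<lambda>_. 0"])
    show "open {z::'a. r < norm z}" by (intro open_Collect_less continuous_intros)
  qed (use z f0 in auto)
  then show ?thesis by (rule dir_deriv_eq)
qed

lemma dir_derivs_zero_outside:
  assumes "f \<in> smoothC" "\<And>z. r < norm z \<Longrightarrow> f z = 0" "r < norm z"
  shows "dir_derivs vs f z = 0"
  using assms(3) by (induction vs arbitrary: z) (auto intro!: dir_deriv_zero_outside smoothC_dir_derivs assms)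

lemma smoothC_bounded:
  fixes f :: "'a::euclidean_space \<Rightarrow> real"
  assumes f: "f \<in> smoothC" and f0: "\<And>z. r < norm z \<Longrightarrow> f z = 0"
  obtains B where "0 \<le> B" "\<And>z. \<bar>f z\<bar> \<le> B"
proof -
  have "bounded (f ` cball 0 r)"
    by (intro compact_imp_bounded compact_continuous_image smoothC_continuous_on f compact_cball)
  then obtain B where "\<forall>y\<in>f ` cball 0 r. norm y \<le> B" unfolding bounded_iff by blast
  then have "\<bar>f z\<bar> \<le> max B 0" for z using f0[of z] by (cases "norm z \<le> r") (auto simp: le_max_iff_disj)
  then show thesis using that[of "max B 0"] by auto
qed

lemma dir_deriv_expand:
  assumes "f \<in> smoothC"
  shows "dir_deriv k f z = (\<Sum>b\<in>Basis. (k \<bullet> b) * dir_deriv b f z)"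
proof -
  have lin: "linear (\<lambda>v. dir_deriv v f z)"
    by (rule has_derivative_linear[OF smoothC_has_derivative[OF assms]])
  have "dir_deriv k f z = dir_deriv (\<Sum>b\<in>Basis. (k \<bullet> b) *\<^sub>R b) f z" by (simp add: euclidean_representation)
  also have "\<dots> = (\<Sum>b\<in>Basis. (k \<bullet> b) * dir_deriv b f z)"
    using linear_sum[OF lin, of "\<lambda>b. (k \<bullet> b) *\<^sub>R b" Basis] linear_scale[OF lin] by simp
  finally show ?thesis .
qed

lemma smoothC_dir_deriv_bound:
  fixes f :: "'a::euclidean_space \<Rightarrow> real"
  assumes f: "f \<in> smoothC" and f0: "\<And>z. r < norm z \<Longrightarrow> f z = 0"
  obtains L where "0 \<le> L" "\<And>z k. \<bar>dir_deriv k f z\<bar> \<le> L * norm k"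
proof -
  have "\<exists>B. 0 \<le> B \<and> (\<forall>z. \<bar>dir_deriv b f z\<bar> \<le> B)" for b
    by (rule smoothC_bounded[OF smoothC_dir_deriv[OF f], of r]) (auto intro: dir_deriv_zero_outside[of f r, OF f f0])
  then obtain B where B: "\<And>b. 0 \<le> B b" "\<And>b z. \<bar>dir_deriv b f z\<bar> \<le> B b" by metis
  have "\<bar>dir_deriv k f z\<bar> \<le> (\<Sum>b\<in>Basis. B b) * norm k" for k z
  proof -
    have "\<bar>dir_deriv k f z\<bar> \<le> (\<Sum>b\<in>Basis. \<bar>(k \<bullet> b) * dir_deriv b f z\<bar>)"
      unfolding dir_deriv_expand[OF f, of k] by (rule sum_abs)
    also have "\<dots> \<le> (\<Sum>b\<in>Basis. norm k * B b)"
      unfolding abs_mult by (intro sum_mono mult_mono B Basis_le_norm) auto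
    finally show ?thesis by (simp add: sum_distrib_left[symmetric] mult.commute[of _ "norm k"])
  qed
  then show thesis using that[of "\<Sum>b\<in>Basis. B b"] B by (auto intro: sum_nonneg)
qed

lemma smoothC_lipschitz:
  fixes f :: "'a::euclidean_space \<Rightarrow> real"
  assumes f: "f \<in> smoothC" and L: "0 \<le> L" "\<And>z k. \<bar>dir_deriv k f z\<bar> \<le> L * norm k"
  shows "\<bar>f x - f y\<bar> \<le> L * norm (x - y)"
proof -
  have "norm (f x - f y) \<le> L * norm (x - y)"
    by (rule differentiable_bound[OF convex_UNIV, where f' = "\<lambda>z v. dir_deriv v f z"])
       (auto intro!: smoothC_has_derivative f onorm_le L)
  then show ?thesis by simp
qed

text \<open>One constant serves all z and k, because the second derivatives are bounded on the whole
  space. This uniformity is what lets \<open>conv_has_derivative\<close> integrate the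
  remainder.\<close>

lemma smoothC_taylor:
  fixes f :: "'a::euclidean_space \<Rightarrow> real"
  assumes f: "f \<in> smoothC" and f0: "\<And>z. r < norm z \<Longrightarrow> f z = 0"
  obtains C where "0 \<le> C" "\<And>z k. \<bar>f (z + k) - f z - dir_deriv k f z\<bar> \<le> C * (norm k)\<^sup>2"
proof -
  have "\<exists>B. 0 \<le> B \<and> (\<forall>z k. \<bar>dir_deriv k (dir_deriv b f) z\<bar> \<le> B * norm k)" for b
    by (rule smoothC_dir_deriv_bound[OF smoothC_dir_deriv[OF f], of r]) (auto intro: dir_deriv_zero_outside[of f r, OF f f0])
  then obtain B where B: "\<And>b. 0 \<le> B b" "\<And>b z k. \<bar>dir_deriv k (dir_deriv b f) z\<bar> \<le> B b * norm k" by metis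
  define C where "C = (\<Sum>b\<in>Basis. B b)"
  have C0: "0 \<le> C" using B by (auto simp: C_def intro: sum_nonneg)
  have lip: "\<bar>dir_deriv k f x - dir_deriv k f y\<bar> \<le> C * norm (x - y) * norm k" for k x y
  proof -
    have "\<bar>dir_deriv k f x - dir_deriv k f y\<bar> = \<bar>\<Sum>b\<in>Basis. (k \<bullet> b) * (dir_deriv b f x - dir_deriv b f y)\<bar>"
      by (simp add: dir_deriv_expand[OF f, of k] sum_subtractf right_diff_distrib)
    also have "\<dots> \<le> (\<Sum>b\<in>Basis. \<bar>(k \<bullet> b) * (dir_deriv b f x - dir_deriv b f y)\<bar>)" by (rule sum_abs)
    also have "\<dots> \<le> (\<Sum>b\<in>Basis. norm k * (B b * norm (x - y)))"
      unfolding abs_mult by (intro sum_mono mult_mono Basis_le_norm smoothC_lipschitz smoothC_dir_deriv f B) auto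
    finally show ?thesis by (simp add: sum_distrib_left[symmetric] sum_distrib_right[symmetric] C_def mult_ac)
  qed
  have "\<bar>f (z + k) - f z - dir_deriv k f z\<bar> \<le> C * (norm k)\<^sup>2" for z k
  proof -
    have lin: "linear (\<lambda>v. dir_deriv v f z)"
      by (rule has_derivative_linear[OF smoothC_has_derivative[OF f]])
    \<comment> \<open>The mean value inequality for f minus its linear part at z: the derivative of
      that difference is at most C * norm k on the ball.\<close>
    have "norm ((f (z + k) - dir_deriv (z + k) f z) - (f z - dir_deriv z f z)) \<le> C * norm k * norm ((z + k) - z)"
    proof (rule differentiable_bound[of "cball z (norm k)"])
      fix x assume x: "x \<in> cball z (norm k)"
      show "((\<lambda>x. f x - dir_deriv x f z) has_derivative (\<lambda>v. dir_deriv v f x - dir_deriv v f z)) (at x within cball z (norm k))"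
        by (intro has_derivative_diff has_derivative_at_withinI[OF smoothC_has_derivative] f linear_imp_has_derivative lin)
      show "onorm (\<lambda>v. dir_deriv v f x - dir_deriv v f z) \<le> C * norm k"
      proof (rule onorm_le)
        fix v
        have "\<bar>dir_deriv v f x - dir_deriv v f z\<bar> \<le> C * norm (x - z) * norm v" by (rule lip)
        also have "\<dots> \<le> C * norm k * norm v"
          using x C0 by (intro mult_right_mono mult_left_mono) (auto simp: dist_norm norm_minus_commute)
        finally show "norm (dir_deriv v f x - dir_deriv v f z) \<le> C * norm k * norm v" by simp
      qed
    qed (auto simp: dist_norm)
    then show ?thesis
      using linear_add[OF lin, of z k] by (simp add: power2_eq_square algebra_simps)
  qed
  then show thesis using that C0 by blast
qed

lemma integrable_mult_smoothC:
  fixes g :: "'a::euclidean_space \<Rightarrow> real"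
  assumes g: "g \<in> smoothC" and g0: "\<And>z. r < norm z \<Longrightarrow> g z = 0" and u: "integrable lborel u"
  shows "integrable lborel (\<lambda>w. u w * g (z - w))"
proof -
  obtain B where B: "0 \<le> B" "\<And>z. \<bar>g z\<bar> \<le> B" using smoothC_bounded[OF g g0] by blast
  have [measurable]: "g \<in> borel_measurable borel" using g by measurable
  have [measurable]: "u \<in> borel_measurable borel" using u by auto
  have "\<bar>u w\<bar> * \<bar>g (z - w)\<bar> \<le> \<bar>u w\<bar> * B" for w
    using B by (intro mult_left_mono) auto
  note le = this
  show ?thesis
  proof (rule Bochner_Integration.integrable_bound)
    show "integrable lborel (\<lambda>w. u w * B)" using u by (rule integrable_mult_left)
    show "(\<lambda>w. u w * g (z - w)) \<in> borel_measurable lborel" by measurable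
    show "AE w in lborel. norm (u w * g (z - w)) \<le> norm (u w * B)"
      using le B(1) by (intro AE_I2) (simp add: abs_mult)
  qed
qed

text \<open>The uniform quadratic Taylor remainder, integrated against \<bar>u\<bar>, is again
  quadratic in the increment, so differentiation passes under the integral.\<close>

lemma conv_has_derivative:
  fixes f :: "'a::euclidean_space \<Rightarrow> real" and u :: "'a \<Rightarrow> real"
  assumes f: "f \<in> smoothC" and f0: "\<And>z. r < norm z \<Longrightarrow> f z = 0" and u: "integrable lborel u"
  shows "((\<lambda>z. \<integral>w. u w * f (z - w) \<partial>lborel) has_derivative (\<lambda>k. \<integral>w. u w * dir_deriv k f (z - w) \<partial>lborel)) (at z)"
proof -
  have [measurable]: "u \<in> borel_measurable borel" using u by auto
  have intf: "integrable lborel (\<lambda>w. u w * f (z - w))" for z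
    by (rule integrable_mult_smoothC[OF f f0 u])
  have intd: "integrable lborel (\<lambda>w. u w * dir_deriv k f (z - w))" for k z
    by (rule integrable_mult_smoothC[OF smoothC_dir_deriv[OF f] dir_deriv_zero_outside[of f r, OF f f0] u])
  obtain C where C: "0 \<le> C" "\<And>z k. \<bar>f (z + k) - f z - dir_deriv k f z\<bar> \<le> C * (norm k)\<^sup>2"
    using smoothC_taylor[OF f f0] by blast
  define U where "U = (\<integral>w. \<bar>u w\<bar> \<partial>lborel)"
  have U0: "0 \<le> U" by (simp add: U_def)
  have lin: "linear (\<lambda>v. dir_deriv v f z)" for z
    by (rule has_derivative_linear[OF smoothC_has_derivative[OF f]])
  show ?thesis
    unfolding has_derivative_at_alt
  proof (intro conjI allI impI)
    show "bounded_linear (\<lambda>k. \<integral>w. u w * dir_deriv k f (z - w) \<partial>lborel)"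
      unfolding linear_conv_bounded_linear[symmetric]
      by (rule linearI) (simp_all add: linear_add[OF lin] linear_scale[OF lin] distrib_left Bochner_Integration.integral_add[OF intd intd] mult.left_commute)
    fix e :: real assume e: "0 < e"
    define d where "d = e / (C * U + 1)"
    have CU: "0 \<le> C * U" using C U0 by simp
    have d: "0 < d" using e CU by (simp add: d_def)
    show "\<exists>d>0. \<forall>y. norm (y - z) < d \<longrightarrow>
       norm ((\<integral>w. u w * f (y - w) \<partial>lborel) - (\<integral>w. u w * f (z - w) \<partial>lborel) - (\<integral>w. u w * dir_deriv (y - z) f (z - w) \<partial>lborel)) \<le> e * norm (y - z)"
    proof (intro exI[of _ d] conjI allI impI d)
      fix y assume y: "norm (y - z) < d"
      have "(\<integral>w. u w * f (y - w) \<partial>lborel) - (\<integral>w. u w * f (z - w) \<partial>lborel) - (\<integral>w. u w * dir_deriv (y - z) f (z - w) \<partial>lborel)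
        = (\<integral>w. u w * (f (y - w) - f (z - w) - dir_deriv (y - z) f (z - w)) \<partial>lborel)"
        by (simp add: right_diff_distrib intf intd)
      also have "norm \<dots> \<le> (\<integral>w. \<bar>u w\<bar> * (C * (norm (y - z))\<^sup>2) \<partial>lborel)"
      proof (rule order_trans[OF integral_norm_bound integral_mono])
        show "integrable lborel (\<lambda>w. norm (u w * (f (y - w) - f (z - w) - dir_deriv (y - z) f (z - w))))"
          by (intro integrable_norm) (simp add: right_diff_distrib intf intd)
        show "integrable lborel (\<lambda>w. \<bar>u w\<bar> * (C * (norm (y - z))\<^sup>2))" using u by auto
        show "norm (u w * (f (y - w) - f (z - w) - dir_deriv (y - z) f (z - w))) \<le> \<bar>u w\<bar> * (C * (norm (y - z))\<^sup>2)" for w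
          using C(2)[of "z - w" "y - z"] by (auto simp: abs_mult intro!: mult_left_mono)
      qed
      also have "\<dots> = (C * U * norm (y - z)) * norm (y - z)"
        by (simp add: U_def power2_eq_square mult_ac)
      also have "\<dots> \<le> e * norm (y - z)"
      proof (rule mult_right_mono)
        have "C * U * norm (y - z) \<le> (C * U + 1) * d"
          using y CU by (intro mult_mono) auto
        then show "C * U * norm (y - z) \<le> e" using CU by (simp add: d_def)
      qed simp
      finally show "norm ((\<integral>w. u w * f (y - w) \<partial>lborel) - (\<integral>w. u w * f (z - w) \<partial>lborel) - (\<integral>w. u w * dir_deriv (y - z) f (z - w) \<partial>lborel)) \<le> e * norm (y - z)" .
    qed
  qed
qed

section \<open>Mollification\<close>

text \<open>A product of one-dimensional bumps living on the cube \<bar>z \<bullet> b\<bar> < e /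
  DIM. The sum of the coordinates is less than e there, so the cube lies in the ball of radius
  e.\<close>

definition bumpf :: "real \<Rightarrow> 'a::euclidean_space \<Rightarrow> real" where
  "bumpf e z = (\<Prod>b\<in>Basis. gam 0 (1 + z \<bullet> ((DIM('a) / e) *\<^sub>R b)) * gam 0 (1 + z \<bullet> (- (DIM('a) / e) *\<^sub>R b)))"

definition kern :: "real \<Rightarrow> 'a::euclidean_space \<Rightarrow> real" where
  "kern e z = bumpf e z / (\<integral>w. bumpf e (w :: 'a) \<partial>lborel)"

lemma smoothC_prod: "finite I \<Longrightarrow> (\<And>i. i \<in> I \<Longrightarrow> f i \<in> smoothC) \<Longrightarrow> (\<lambda>z. \<Prod>i\<in>I. f i z) \<in> smoothC"
  by (induction rule: finite_induct) (auto intro: smoothC.const smoothC.mult)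

lemma bumpf_smoothC: "bumpf e \<in> smoothC"
  unfolding bumpf_def[abs_def] by (intro smoothC_prod smoothC.mult smoothC.gam finite_Basis)

lemma bumpf_nonneg: "0 \<le> bumpf e z"
  unfolding bumpf_def by (intro prod_nonneg mult_nonneg_nonneg gam_nonneg ballI)

lemma bumpf_pos_iff:
  fixes z :: "'a::euclidean_space"
  assumes "0 < e"
  shows "0 < bumpf e z \<longleftrightarrow> (\<forall>b\<in>Basis. \<bar>z \<bullet> b\<bar> < e / DIM('a))"
proof -
  have "0 < bumpf e z \<longleftrightarrow> bumpf e z \<noteq> 0" using bumpf_nonneg[of e z] by auto
  also have "\<dots> \<longleftrightarrow> (\<forall>b\<in>Basis. 0 < 1 + DIM('a) / e * (z \<bullet> b) \<and> 0 < 1 - DIM('a) / e * (z \<bullet> b))"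
    by (auto simp: bumpf_def gam_def)
  also have "\<dots> \<longleftrightarrow> (\<forall>b\<in>Basis. \<bar>z \<bullet> b\<bar> < e / DIM('a))"
    using assms DIM_positive[where 'a='a] by (intro ball_cong refl) (auto simp: field_simps abs_less_iff)
  finally show ?thesis .
qed

lemma bumpf_zero:
  fixes z :: "'a::euclidean_space"
  assumes e: "0 < e" and z: "e < norm z"
  shows "bumpf e z = 0"
proof (rule ccontr)
  assume "bumpf e z \<noteq> 0"
  then have "0 < bumpf e z" using bumpf_nonneg[of e z] by auto
  then have "\<bar>z \<bullet> b\<bar> \<le> e / DIM('a)" if "b \<in> Basis" for b
    using that by (auto simp: bumpf_pos_iff[OF e] less_imp_le)
  then have "(\<Sum>b\<in>Basis. \<bar>z \<bullet> b\<bar>) \<le> (\<Sum>b\<in>(Basis::'a set). e / DIM('a))" by (intro sum_mono)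
  also have "\<dots> = e" by simp
  finally show False using norm_le_l1[of z] z by linarith
qed

lemma bumpf_integrable:
  fixes e :: real
  assumes "0 < e"
  shows "integrable lborel (bumpf e :: 'a::euclidean_space \<Rightarrow> real)"
proof -
  have "integrable lborel (\<lambda>w::'a. indicator (cball 0 e) w * bumpf e w)"
  proof -
    have "integrable lborel (\<lambda>w::'a. indicator (cball 0 e) w *\<^sub>R bumpf e w)"
      using borel_integrable_compact[OF compact_cball smoothC_continuous_on[OF bumpf_smoothC]] by blast
    then show ?thesis by simp
  qed
  moreover have "(\<lambda>w::'a. indicator (cball 0 e) w * bumpf e w) = bumpf e"
    using bumpf_zero[OF assms, where 'a='a] by (auto simp: indicator_def fun_eq_iff not_le)
  ultimately show ?thesis by (simp only:)
qed

lemma bumpf_integral_pos: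
  assumes e: "0 < e"
  shows "0 < (\<integral>z. bumpf e (z :: 'a::euclidean_space) \<partial>lborel)"
proof -
  have "(\<integral>z. bumpf e (z::'a) \<partial>lborel) \<noteq> 0"
  proof
    assume "(\<integral>z. bumpf e (z::'a) \<partial>lborel) = 0"
    then have "AE z in lborel. bumpf e (z::'a) = 0"
      using integral_nonneg_eq_0_iff_AE[OF bumpf_integrable[OF e, where 'a='a]] by (simp add: bumpf_nonneg)
    moreover have "(\<Sum>b\<in>(Basis::'a set). e / DIM('a) * (b \<bullet> b)) > 0"
      using e by (intro sum_pos) (auto simp: inner_Basis)
    have "bumpf e z \<noteq> 0" if "z \<in> box (- (e / DIM('a)) *\<^sub>R One) ((e / DIM('a)) *\<^sub>R (One::'a))" for z
      using that bumpf_pos_iff[OF e, of z] by (auto simp: mem_box abs_less_iff)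
    ultimately have "AE z in lborel. z \<notin> box (- (e / DIM('a)) *\<^sub>R One) ((e / DIM('a)) *\<^sub>R (One::'a))"
      by (auto elim!: eventually_mono)
    then have "emeasure lborel (box (- (e / DIM('a)) *\<^sub>R One) ((e / DIM('a)) *\<^sub>R (One::'a))) = 0"
      by (subst (asm) AE_iff_measurable[OF _ refl]) auto
    moreover have "emeasure lborel (box (- (e / DIM('a)) *\<^sub>R One) ((e / DIM('a)) *\<^sub>R (One::'a)))
      = ennreal (\<Prod>b\<in>(Basis::'a set). 2 * (e / DIM('a)))"
    proof -
      have "(\<Prod>b\<in>Basis. ((e / DIM('a)) *\<^sub>R (One::'a) - - (e / DIM('a)) *\<^sub>R One) \<bullet> b) = (\<Prod>b\<in>(Basis::'a set). 2 * (e / DIM('a)))"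
        by (intro prod.cong refl) (simp add: inner_diff_left inner_add_left)
      then show ?thesis using e by (subst emeasure_lborel_box) (simp_all only:, auto)
    qed
    moreover have "0 < (\<Prod>b\<in>(Basis::'a set). 2 * (e / DIM('a)))"
      using e by (intro prod_pos) auto
    ultimately show False by (simp only: ennreal_eq_0_iff not_le)
  qed
  moreover have "0 \<le> (\<integral>z. bumpf e (z::'a) \<partial>lborel)" by (simp add: bumpf_nonneg)
  ultimately show ?thesis by simp
qed

lemma kern_smoothC: "(kern e :: 'a::euclidean_space \<Rightarrow> real) \<in> smoothC"
proof -
  have "(\<lambda>z. (1 / (\<integral>w. bumpf e (w :: 'a) \<partial>lborel)) * bumpf e z) \<in> smoothC"
    by (intro smoothC.mult smoothC.const bumpf_smoothC)
  then show ?thesis by (simp add: kern_def[abs_def])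
qed

lemma kern_measurable [measurable]: "kern e \<in> borel_measurable borel"
  by (rule smoothC_measurable[OF kern_smoothC])

lemma kern_nonneg: "0 < e \<Longrightarrow> 0 \<le> kern e z"
  unfolding kern_def using bumpf_integral_pos by (intro divide_nonneg_nonneg bumpf_nonneg) (auto intro: less_imp_le)

lemma kern_zero: "0 < e \<Longrightarrow> e < norm z \<Longrightarrow> kern e z = 0"
  by (simp add: kern_def bumpf_zero)

lemma kern_nn_integral:
  assumes "0 < e"
  shows "(\<integral>\<^sup>+z. ennreal (kern e (z::'a::euclidean_space)) \<partial>lborel) = 1"
proof -
  have "integrable lborel (kern e :: 'a \<Rightarrow> real)"
    unfolding kern_def[abs_def] by (intro integrable_divide bumpf_integrable assms)
  then have "(\<integral>\<^sup>+z. ennreal (kern e (z::'a)) \<partial>lborel) = ennreal (\<integral>z. kern e (z::'a) \<partial>lborel)"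
    by (intro nn_integral_eq_integral) (auto simp: kern_nonneg[OF assms])
  also have "(\<integral>z. kern e (z::'a) \<partial>lborel) = 1"
    using bumpf_integral_pos[OF assms, where 'a='a] by (simp add: kern_def)
  finally show ?thesis by simp
qed

text \<open>The kernel as a probability measure, so that the mixed-norm bounds for
  \<open>nnconv\<close> apply to mollifications.\<close>

definition kmeas :: "real \<Rightarrow> 'a::euclidean_space measure" where
  "kmeas e = density lborel (\<lambda>s. ennreal (kern e s))"

lemma sets_kmeas: "sets (kmeas e) = sets borel" by (simp add: kmeas_def)

lemma emeasure_kmeas: "0 < e \<Longrightarrow> emeasure (kmeas e) UNIV = 1"
  by (simp add: kmeas_def emeasure_density kern_nn_integral)

lemma nn_integral_lborel_reflect:
  fixes f :: "'a::euclidean_space \<Rightarrow> ennreal"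
  assumes [measurable]: "f \<in> borel_measurable borel"
  shows "(\<integral>\<^sup>+w. f (z - w) \<partial>lborel) = (\<integral>\<^sup>+w. f w \<partial>lborel)"
proof -
  have "(\<integral>\<^sup>+w. f w \<partial>lborel) = (\<integral>\<^sup>+w. f w \<partial>density (distr lborel borel (\<lambda>x. z + (-1) *\<^sub>R x)) (\<lambda>_. ennreal (\<bar>-1\<bar> ^ DIM('a))))"
    by (subst lborel_affine[of "-1" z]) auto
  also have "\<dots> = (\<integral>\<^sup>+w. f (z - w) \<partial>lborel)"
    by (subst nn_integral_density) (auto simp: nn_integral_distr)
  finally show ?thesis by simp
qed

lemma nnconv_kmeas:
  fixes g :: "'a::euclidean_space \<Rightarrow> ennreal"
  assumes [measurable]: "g \<in> borel_measurable borel"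
  shows "nnconv (kmeas e) g z = (\<integral>\<^sup>+w. g w * ennreal (kern e (z - w)) \<partial>lborel)"
proof -
  have "nnconv (kmeas e) g z = (\<integral>\<^sup>+s. ennreal (kern e s) * g (z - s) \<partial>lborel)"
    unfolding nnconv_def kmeas_def by (subst nn_integral_density) auto
  also have "\<dots> = (\<integral>\<^sup>+s. (\<lambda>w. g w * ennreal (kern e (z - w))) (z - s) \<partial>lborel)"
    by (simp add: mult.commute)
  also have "\<dots> = (\<integral>\<^sup>+w. g w * ennreal (kern e (z - w)) \<partial>lborel)"
    by (rule nn_integral_lborel_reflect) measurable
  finally show ?thesis .
qed

definition moll :: "real \<Rightarrow> ('a::euclidean_space \<Rightarrow> real) \<Rightarrow> 'a \<Rightarrow> real" where
  "moll e f z = (\<integral>w. f w * kern e (z - w) \<partial>lborel)"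

lemma moll_integrand_integrable:
  "0 < e \<Longrightarrow> integrable lborel f \<Longrightarrow> integrable lborel (\<lambda>w. f w * kern e (z - w))"
  by (rule integrable_mult_smoothC[OF kern_smoothC kern_zero])

lemma moll_abs_le:
  assumes e: "0 < e" and f: "integrable lborel f"
  shows "ennreal \<bar>moll e f z\<bar> \<le> nnconv (kmeas e) (\<lambda>w. ennreal \<bar>f w\<bar>) z"
proof -
  have [measurable]: "f \<in> borel_measurable borel" using f by auto
  have "ennreal (norm (moll e f z)) \<le> (\<integral>\<^sup>+w. ennreal (norm (f w * kern e (z - w))) \<partial>lborel)"
    unfolding moll_def by (intro integral_norm_bound_ennreal moll_integrand_integrable e f)
  also have "\<dots> = (\<integral>\<^sup>+w. ennreal \<bar>f w\<bar> * ennreal (kern e (z - w)) \<partial>lborel)"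
    by (intro nn_integral_cong) (simp add: abs_mult ennreal_mult kern_nonneg[OF e])
  also have "\<dots> = nnconv (kmeas e) (\<lambda>w. ennreal \<bar>f w\<bar>) z"
    by (rule nnconv_kmeas[symmetric]) simp
  finally show ?thesis by simp
qed

text \<open>The kernel has mass one, so the constant c can be moved under the integral.\<close>

lemma moll_diff_le:
  assumes e: "0 < e" and f: "integrable lborel f"
  shows "ennreal \<bar>moll e f z - c\<bar> \<le> (\<integral>\<^sup>+w. ennreal \<bar>f w - c\<bar> * ennreal (kern e (z - w)) \<partial>lborel)"
proof -
  have [measurable]: "f \<in> borel_measurable borel" using f by auto
  have k1: "(\<integral>\<^sup>+w. ennreal (kern e (z - w)) \<partial>lborel) = 1"
    using nn_integral_lborel_reflect[of "\<lambda>w. ennreal (kern e w)" z] by (simp add: kern_nn_integral[OF e])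
  have ik: "integrable lborel (\<lambda>w. kern e (z - w))"
    by (rule integrableI_nonneg) (auto simp: kern_nonneg[OF e] k1)
  have "(\<integral>w. kern e (z - w) \<partial>lborel) = 1"
    by (rule integral_eq_nn_integral[THEN trans]) (auto simp: kern_nonneg[OF e] k1)
  then have "moll e f z - c = (\<integral>w. f w * kern e (z - w) - c * kern e (z - w) \<partial>lborel)"
    unfolding moll_def using moll_integrand_integrable[OF e f, of z] ik
    by (subst Bochner_Integration.integral_diff) auto
  also have "\<dots> = (\<integral>w. (f w - c) * kern e (z - w) \<partial>lborel)" by (simp add: left_diff_distrib)
  finally have eq: "moll e f z - c = (\<integral>w. (f w - c) * kern e (z - w) \<partial>lborel)" .
  have "integrable lborel (\<lambda>w. (f w - c) * kern e (z - w))"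
    unfolding left_diff_distrib using moll_integrand_integrable[OF e f, of z] ik by auto
  then have "ennreal (norm (moll e f z - c)) \<le> (\<integral>\<^sup>+w. ennreal (norm ((f w - c) * kern e (z - w))) \<partial>lborel)"
    unfolding eq by (rule integral_norm_bound_ennreal)
  also have "\<dots> = (\<integral>\<^sup>+w. ennreal \<bar>f w - c\<bar> * ennreal (kern e (z - w)) \<partial>lborel)"
    by (intro nn_integral_cong) (simp add: abs_mult ennreal_mult kern_nonneg[OF e])
  finally show ?thesis by simp
qed

lemma moll_near:
  fixes f :: "'a::euclidean_space \<Rightarrow> real"
  assumes e: "0 < e" and f: "integrable lborel f" and d: "0 \<le> d"
    and near: "\<And>w. norm (z - w) \<le> e \<Longrightarrow> \<bar>f w - c\<bar> \<le> d"
  shows "\<bar>moll e f z - c\<bar> \<le> d"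
proof -
  have "ennreal \<bar>moll e f z - c\<bar> \<le> (\<integral>\<^sup>+w. ennreal \<bar>f w - c\<bar> * ennreal (kern e (z - w)) \<partial>lborel)"
    by (rule moll_diff_le[OF e f])
  also have "\<dots> \<le> (\<integral>\<^sup>+w. ennreal d * ennreal (kern e (z - w)) \<partial>lborel)"
  proof (intro nn_integral_mono)
    fix w
    show "ennreal \<bar>f w - c\<bar> * ennreal (kern e (z - w)) \<le> ennreal d * ennreal (kern e (z - w))"
      using near[of w] kern_zero[OF e, of "z - w"]
      by (cases "norm (z - w) \<le> e") (auto intro!: mult_right_mono ennreal_leI)
  qed
  also have "\<dots> = ennreal d"
    using nn_integral_lborel_reflect[of "\<lambda>w. ennreal (kern e w)" z] kern_nn_integral[OF e, where 'a='a]
    by (subst nn_integral_cmult) auto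
  finally show ?thesis using d by simp
qed

lemma moll_has_derivative:
  assumes "0 < e" "integrable lborel u"
  shows "(moll e u has_derivative (\<lambda>k. \<integral>w. u w * dir_deriv k (kern e) (z - w) \<partial>lborel)) (at z)"
  unfolding moll_def[abs_def] by (rule conv_has_derivative[OF kern_smoothC kern_zero[OF assms(1)] assms(2)])

lemma moll_measurable:
  "0 < e \<Longrightarrow> integrable lborel u \<Longrightarrow> moll e u \<in> borel_measurable borel"
  by (intro borel_measurable_continuous_onI
      has_derivative_continuous_on[OF has_derivative_at_withinI[OF moll_has_derivative]])

section \<open>Continuity of translations and convergence of mollifications\<close>

lemma compact_open_approx:
  fixes A :: "'a::euclidean_space set"
  assumes A: "A \<in> sets borel" "emeasure lborel A < top" and e: "0 < e"
  obtains K U where "compact K" "open U" "K \<subseteq> A" "A \<subseteq> U" "emeasure lborel (U - K) < ennreal e"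
proof -
  have e2: "0 < e / 2" using e by simp
  obtain U where U: "open U" "A \<subseteq> U" "emeasure lborel (U - A) < ennreal (e / 2)"
    using outer_regular_lborel[OF A(1) e2] by blast
  \<comment> \<open>Restricting Lebesgue measure to A makes it a finite measure, for which inner
    regularity is available.\<close>
  define M where "M = density lborel (indicator A :: 'a \<Rightarrow> ennreal)"
  have M: "sets M = sets borel" by (simp add: M_def)
  have MA: "emeasure M X = emeasure lborel (A \<inter> X)" if "X \<in> sets borel" for X
    using A(1) that by (simp add: M_def emeasure_density indicator_inter_arith[symmetric])
  have Mfin: "emeasure M (space M) \<noteq> \<infinity>"
    using A MA[of UNIV] by (simp add: M_def less_top)
  have "emeasure M A = (SUP K\<in>{K. K \<subseteq> A \<and> compact K}. emeasure M K)"
    by (rule inner_regular[OF M Mfin A(1)])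
  then have sup: "emeasure lborel A = (SUP K\<in>{K. K \<subseteq> A \<and> compact K}. emeasure lborel K)"
  proof -
    have "(SUP K\<in>{K. K \<subseteq> A \<and> compact K}. emeasure M K) = (SUP K\<in>{K. K \<subseteq> A \<and> compact K}. emeasure lborel K)"
      by (intro SUP_cong refl) (auto simp: MA borel_compact Int_absorb1)
    with inner_regular[OF M Mfin A(1)] show ?thesis using MA[OF A(1)] by simp
  qed
  obtain K where K: "K \<subseteq> A" "compact K" "emeasure lborel A < emeasure lborel K + ennreal (e / 2)"
  proof (cases "emeasure lborel A = 0")
    case True
    then show thesis using that[of "{}"] e by simp
  next
    case False
    have "emeasure lborel A - ennreal (e / 2) < emeasure lborel A"
      using A(2) False e by (intro ennreal_between) (auto simp: less_top zero_less_iff_neq_zero)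
    then obtain K where K: "K \<subseteq> A" "compact K" "emeasure lborel A - ennreal (e / 2) < emeasure lborel K"
      unfolding sup less_SUP_iff by auto
    have "emeasure lborel A < emeasure lborel K + ennreal (e / 2)"
    proof (rule ccontr)
      assume "\<not> emeasure lborel A < emeasure lborel K + ennreal (e / 2)"
      then have "emeasure lborel K + ennreal (e / 2) - ennreal (e / 2) \<le> emeasure lborel A - ennreal (e / 2)"
        by (intro ennreal_minus_mono) (auto simp: not_less)
      then show False using K(3) by simp
    qed
    then show thesis using that K by blast
  qed
  have "emeasure lborel (A - K) < ennreal (e / 2)"
  proof -
    have "emeasure lborel (A - K) = emeasure lborel A - emeasure lborel K"
      using K A emeasure_mono[OF K(1), of lborel] by (intro emeasure_Diff) (auto simp: borel_compact top_unique)
    moreover have "emeasure lborel A - emeasure lborel K < ennreal (e / 2)"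
    proof (rule ccontr)
      assume "\<not> emeasure lborel A - emeasure lborel K < ennreal (e / 2)"
      then have "emeasure lborel K + ennreal (e / 2) \<le> emeasure lborel K + (emeasure lborel A - emeasure lborel K)"
        by (intro add_left_mono) (simp add: not_less)
      also have "\<dots> = emeasure lborel A"
        using emeasure_mono[OF K(1), of lborel] A(1) by (intro add_diff_inverse_ennreal) auto
      finally show False using K(3) by simp
    qed
    ultimately show ?thesis by simp
  qed
  moreover have "emeasure lborel (U - K) \<le> emeasure lborel ((U - A) \<union> (A - K))"
    using U K A by (intro emeasure_mono) (auto simp: borel_compact intro!: sets.Un sets.Diff)
  moreover have "\<dots> \<le> emeasure lborel (U - A) + emeasure lborel (A - K)"
    using U K A by (intro emeasure_subadditive) (auto simp: borel_compact)
  ultimately have "emeasure lborel (U - K) < ennreal (e / 2) + ennreal (e / 2)"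
    using U(3) by (meson add_strict_mono order.strict_trans1)
  also have "\<dots> = ennreal e" using e by (simp add: ennreal_plus[symmetric] del: ennreal_plus)
  finally show thesis using that U K by blast
qed

definition tdiff :: "('a::euclidean_space \<Rightarrow> real) \<Rightarrow> 'a \<Rightarrow> ennreal" where
  "tdiff f s = (\<integral>\<^sup>+z. ennreal \<bar>f (z - s) - f z\<bar> \<partial>lborel)"

lemma tdiff_le:
  assumes [measurable]: "f \<in> borel_measurable borel" "g \<in> borel_measurable borel"
  shows "tdiff f s \<le> tdiff g s + 2 * (\<integral>\<^sup>+z. ennreal \<bar>g z - f z\<bar> \<partial>lborel)"
proof -
  have "tdiff f s \<le> (\<integral>\<^sup>+z. ennreal \<bar>g (z - s) - g z\<bar> + (ennreal \<bar>g (z - s) - f (z - s)\<bar> + ennreal \<bar>g z - f z\<bar>) \<partial>lborel)"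
    unfolding tdiff_def by (intro nn_integral_mono) (simp add: ennreal_plus[symmetric] ennreal_leI del: ennreal_plus)
  also have "\<dots> = tdiff g s + ((\<integral>\<^sup>+z. ennreal \<bar>g (z - s) - f (z - s)\<bar> \<partial>lborel) + (\<integral>\<^sup>+z. ennreal \<bar>g z - f z\<bar> \<partial>lborel))"
    unfolding tdiff_def by (simp add: nn_integral_add)
  also have "(\<integral>\<^sup>+z. ennreal \<bar>g (z - s) - f (z - s)\<bar> \<partial>lborel) = (\<integral>\<^sup>+z. ennreal \<bar>g z - f z\<bar> \<partial>lborel)"
    by (rule nn_integral_lborel_translate) simp
  finally show ?thesis by (simp add: mult_2)
qed

lemma tdiff_add_le:
  assumes [measurable]: "f \<in> borel_measurable borel" "g \<in> borel_measurable borel"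
  shows "tdiff (\<lambda>x. f x + g x) s \<le> tdiff f s + tdiff g s"
proof -
  have "tdiff (\<lambda>x. f x + g x) s \<le> (\<integral>\<^sup>+z. ennreal \<bar>f (z - s) - f z\<bar> + ennreal \<bar>g (z - s) - g z\<bar> \<partial>lborel)"
    unfolding tdiff_def by (intro nn_integral_mono) (simp add: ennreal_plus[symmetric] ennreal_leI del: ennreal_plus)
  also have "\<dots> = tdiff f s + tdiff g s" unfolding tdiff_def by (intro nn_integral_add) auto
  finally show ?thesis .
qed

text \<open>Translations are continuous in L1: this holds for indicators by regularity, and survives
  sums and L1 limits.\<close>

lemma tdiff_small:
  fixes f :: "'a::euclidean_space \<Rightarrow> real"
  assumes "integrable lborel f"
  shows "\<forall>e>0. \<exists>d>0. \<forall>s. norm s \<le> d \<longrightarrow> tdiff f s < ennreal e"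
  using assms
proof (induction rule: integrable_induct)
  case (base A c)
  show ?case
  proof (intro allI impI)
    fix e :: real assume e: "0 < e"
    define e' where "e' = e / (2 * (\<bar>c\<bar> + 1))"
    have e': "0 < e'" using e by (simp add: e'_def)
    obtain K U where KU: "compact K" "open U" "K \<subseteq> A" "A \<subseteq> U" "emeasure lborel (U - K) < ennreal e'"
      using compact_open_approx[of A e'] base e' by auto
    have "K \<subseteq> U" using KU by auto
    then obtain d where d: "0 < d" "(\<Union>x\<in>K. cball x d) \<subseteq> U"
      using compact_subset_open_imp_cball_epsilon_subset[OF KU(1,2)] by blast
    have [measurable]: "U - K \<in> sets borel" using KU by (auto simp: borel_compact)
    show "\<exists>d>0. \<forall>s. norm s \<le> d \<longrightarrow> tdiff (\<lambda>x. indicator A x *\<^sub>R c) s < ennreal e"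
    proof (intro exI[of _ d] conjI allI impI d)
      fix s :: 'a assume s: "norm s \<le> d"
      \<comment> \<open>A shift by at most d moves K inside U. Hence the indicator of A changes only
        at points of U - K or of its translate.\<close>
      have pt: "ennreal \<bar>indicator A (z - s) *\<^sub>R c - indicator A z *\<^sub>R c\<bar>
        \<le> ennreal \<bar>c\<bar> * (indicator (U - K) z + indicator (U - K) (z - s))" for z
      proof -
        have 1: "z \<in> U" if "z - s \<in> K" using d(2) that s by (force simp: dist_norm)
        have 2: "z - s \<in> U" if "z \<in> K" using d(2) that s by (force simp: dist_norm)
        show ?thesis using 1 2 KU(3,4) mult_left_mono[of 1 2 "ennreal \<bar>c\<bar>"] by (auto simp: indicator_def)
      qed
      have "tdiff (\<lambda>x. indicator A x *\<^sub>R c) s \<le> (\<integral>\<^sup>+z. ennreal \<bar>c\<bar> * (indicator (U - K) z + indicator (U - K) (z - s)) \<partial>lborel)"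
        unfolding tdiff_def by (intro nn_integral_mono pt)
      also have "\<dots> = ennreal \<bar>c\<bar> * (emeasure lborel (U - K) + (\<integral>\<^sup>+z. indicator (U - K) (z - s) \<partial>lborel))"
        by (simp add: nn_integral_cmult nn_integral_add)
      also have "(\<integral>\<^sup>+z. indicator (U - K) (z - s) \<partial>lborel) = (\<integral>\<^sup>+z. indicator (U - K) z \<partial>lborel)"
        by (rule nn_integral_lborel_translate) simp
      also have "\<dots> = emeasure lborel (U - K)" by simp
      also have "ennreal \<bar>c\<bar> * (emeasure lborel (U - K) + emeasure lborel (U - K)) \<le> ennreal \<bar>c\<bar> * (ennreal e' + ennreal e')"
        using less_imp_le[OF KU(5)] by (intro mult_left_mono add_mono) auto
      also have "\<dots> = ennreal (\<bar>c\<bar> * (e' + e'))"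
        using e' by (simp add: ennreal_mult ennreal_plus[symmetric] del: ennreal_plus)
      also have "\<dots> < ennreal e"
      proof (rule ennreal_lessI[OF e])
        have "e' + e' = e / (\<bar>c\<bar> + 1)" 
          unfolding e'_def by (metis add_divide_distrib field_sum_of_halves divide_divide_eq_left' mult.commute)
        then have "\<bar>c\<bar> * (e' + e') = e * (\<bar>c\<bar> / (\<bar>c\<bar> + 1))" by simp
        also have "\<dots> < e * 1" using e by (intro mult_strict_left_mono) auto
        finally show "\<bar>c\<bar> * (e' + e') < e" by simp
      qed
      finally show "tdiff (\<lambda>x. indicator A x *\<^sub>R c) s < ennreal e" .
    qed
  qed
next
  case (add f g)
  have [measurable]: "f \<in> borel_measurable borel" "g \<in> borel_measurable borel" using add.hyps by auto
  show ?case
  proof (intro allI impI)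
    fix e :: real assume e: "0 < e"
    then have e2: "0 < e / 2" by simp
    obtain d1 where d1: "0 < d1" "\<And>s. norm s \<le> d1 \<Longrightarrow> tdiff f s < ennreal (e / 2)" using add.IH(1) e2 by blast
    obtain d2 where d2: "0 < d2" "\<And>s. norm s \<le> d2 \<Longrightarrow> tdiff g s < ennreal (e / 2)" using add.IH(2) e2 by blast
    show "\<exists>d>0. \<forall>s. norm s \<le> d \<longrightarrow> tdiff (\<lambda>x. f x + g x) s < ennreal e"
    proof (intro exI[of _ "min d1 d2"] conjI allI impI)
      fix s :: 'a assume "norm s \<le> min d1 d2"
      then have "tdiff f s + tdiff g s < ennreal (e / 2) + ennreal (e / 2)"
        by (intro add_strict_mono d1 d2) auto
      also have "\<dots> = ennreal e" using e by (simp add: ennreal_plus[symmetric] del: ennreal_plus)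
      finally show "tdiff (\<lambda>x. f x + g x) s < ennreal e"
        using tdiff_add_le[of f g s] by (rule le_less_trans[rotated]) auto
    qed (use d1 d2 in auto)
  qed
next
  case (lim f s)
  have [measurable]: "f \<in> borel_measurable borel" "s i \<in> borel_measurable borel" for i using lim.hyps by auto
  have L1: "(\<lambda>i. \<integral>\<^sup>+x. ennreal \<bar>s i x - f x\<bar> \<partial>lborel) \<longlonglongrightarrow> (\<integral>\<^sup>+(x::'a). 0 \<partial>lborel)"
  proof (rule nn_integral_dominated_convergence[where w = "\<lambda>x. ennreal (3 * \<bar>f x\<bar>)"])
    have "integrable lborel (\<lambda>x. 3 * \<bar>f x\<bar>)" using lim.hyps by auto
    then show "(\<integral>\<^sup>+x. ennreal (3 * \<bar>f x\<bar>) \<partial>lborel) < \<infinity>"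
      by (subst nn_integral_eq_integral) auto
    have "\<bar>s i x - f x\<bar> \<le> 3 * \<bar>f x\<bar>" for i x
      using lim.hyps(3)[of x i] by (auto simp: abs_if split: if_splits)
    then show "AE x in lborel. ennreal \<bar>s i x - f x\<bar> \<le> ennreal (3 * \<bar>f x\<bar>)" for i
      by (intro AE_I2 ennreal_leI)
    have "(\<lambda>i. \<bar>s i x - f x\<bar>) \<longlonglongrightarrow> 0" for x
      using lim.hyps(2)[of x] by (intro tendsto_rabs_zero) (simp add: LIM_zero)
    then have "(\<lambda>i. ennreal \<bar>s i x - f x\<bar>) \<longlonglongrightarrow> ennreal 0" for x by (intro tendsto_ennrealI)
    then show "AE x in lborel. (\<lambda>i. ennreal \<bar>s i x - f x\<bar>) \<longlonglongrightarrow> 0" by simp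
  qed auto
  show ?case
  proof (intro allI impI)
    fix e :: real assume e: "0 < e"
    have "\<forall>\<^sub>F i in sequentially. (\<integral>\<^sup>+x. ennreal \<bar>s i x - f x\<bar> \<partial>lborel) < ennreal (e / 4)"
      using L1 e by (intro order_tendstoD) auto
    then obtain i where i: "(\<integral>\<^sup>+x. ennreal \<bar>s i x - f x\<bar> \<partial>lborel) < ennreal (e / 4)"
      by (meson eventually_sequentially order_refl)
    have "0 < e / 2" using e by simp
    then obtain d where d: "0 < d" "\<And>t. norm t \<le> d \<Longrightarrow> tdiff (s i) t < ennreal (e / 2)" using lim.IH[of i] by blast
    show "\<exists>d>0. \<forall>t. norm t \<le> d \<longrightarrow> tdiff f t < ennreal e"
    proof (intro exI[of _ d] conjI allI impI d)
      fix t :: 'a assume t: "norm t \<le> d"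
      have "tdiff f t \<le> tdiff (s i) t + 2 * (\<integral>\<^sup>+z. ennreal \<bar>s i z - f z\<bar> \<partial>lborel)"
        by (rule tdiff_le) auto
      also have "\<dots> \<le> tdiff (s i) t + 2 * ennreal (e / 4)"
        using i by (intro add_left_mono mult_left_mono less_imp_le) auto
      also have "\<dots> < ennreal (e / 2) + ennreal (e / 2)"
      proof -
        have "2 * ennreal (e / 4) = ennreal (e / 2)"
          using e by (simp add: ennreal_mult[symmetric] ennreal_numeral[symmetric] del: ennreal_numeral)
        then have "tdiff (s i) t + 2 * ennreal (e / 4) = ennreal (e / 2) + tdiff (s i) t" by (simp add: add.commute)
        also have "\<dots> < ennreal (e / 2) + ennreal (e / 2)"
          using d(2)[OF t] by (subst ennreal_add_left_cancel_less) simp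
        finally show ?thesis .
      qed
      also have "\<dots> = ennreal e" using e by (simp add: ennreal_plus[symmetric] del: ennreal_plus)
      finally show "tdiff f t < ennreal e" .
    qed
  qed
qed

definition moll_err :: "real \<Rightarrow> ('a::euclidean_space \<Rightarrow> real) \<Rightarrow> ennreal" where
  "moll_err e f = (\<integral>\<^sup>+z. ennreal \<bar>moll e f z - f z\<bar> \<partial>lborel)"

text \<open>By Fubini the L1 error is at most the kernel average of the translation errors
  \<open>tdiff\<close>, and the kernel only sees small shifts.\<close>

lemma moll_err_small:
  fixes f :: "'a::euclidean_space \<Rightarrow> real"
  assumes f: "integrable lborel f" and d: "0 < d"
  shows "\<exists>e0>0. \<forall>e. 0 < e \<and> e \<le> e0 \<longrightarrow> moll_err e f \<le> ennreal d"
proof -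
  have [measurable]: "f \<in> borel_measurable borel" using f by auto
  obtain e0 where e0: "0 < e0" "\<And>s. norm s \<le> e0 \<Longrightarrow> tdiff f s < ennreal d"
    using tdiff_small[OF f] d by blast
  show ?thesis
  proof (intro exI[of _ e0] conjI allI impI e0)
    fix e assume e: "0 < e \<and> e \<le> e0"
    then have e1: "0 < e" by simp
    have "moll_err e f \<le> (\<integral>\<^sup>+z. \<integral>\<^sup>+s. ennreal \<bar>f (z - s) - f z\<bar> * ennreal (kern e s) \<partial>lborel \<partial>lborel)"
      unfolding moll_err_def
    proof (intro nn_integral_mono)
      fix z
      have "ennreal \<bar>moll e f z - f z\<bar> \<le> (\<integral>\<^sup>+w. ennreal \<bar>f w - f z\<bar> * ennreal (kern e (z - w)) \<partial>lborel)"
        by (rule moll_diff_le[OF e1 f])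
      also have "\<dots> = (\<integral>\<^sup>+s. ennreal \<bar>f (z - s) - f z\<bar> * ennreal (kern e s) \<partial>lborel)"
        using nn_integral_lborel_reflect[of "\<lambda>w. ennreal \<bar>f w - f z\<bar> * ennreal (kern e (z - w))" z] by simp
      finally show "ennreal \<bar>moll e f z - f z\<bar> \<le> (\<integral>\<^sup>+s. ennreal \<bar>f (z - s) - f z\<bar> * ennreal (kern e s) \<partial>lborel)" .
    qed
    also have "\<dots> = (\<integral>\<^sup>+s. \<integral>\<^sup>+z. ennreal \<bar>f (z - s) - f z\<bar> * ennreal (kern e s) \<partial>lborel \<partial>lborel)"
      by (rule lborel_pair.Fubini') measurable
    also have "\<dots> = (\<integral>\<^sup>+s. tdiff f s * ennreal (kern e s) \<partial>lborel)"
      unfolding tdiff_def by (intro nn_integral_cong nn_integral_multc) measurable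
    also have "\<dots> \<le> (\<integral>\<^sup>+s. ennreal d * ennreal (kern e (s :: 'a)) \<partial>lborel)"
    proof (intro nn_integral_mono)
      fix s :: 'a
      show "tdiff f s * ennreal (kern e s) \<le> ennreal d * ennreal (kern e s)"
        using kern_zero[OF e1, of s] e mult_right_mono[OF less_imp_le[OF e0(2)[of s]], of "ennreal (kern e s)"]
        by (cases "norm s \<le> e") auto
    qed
    also have "\<dots> = ennreal d"
      using kern_nn_integral[OF e1, where 'a='a] by (subst nn_integral_cmult) auto
    finally show "moll_err e f \<le> ennreal d" .
  qed
qed

lemma finite_uniform_threshold:
  assumes "finite F" "\<And>f. f \<in> F \<Longrightarrow> \<exists>e0>0. \<forall>e. 0 < e \<and> e \<le> (e0::real) \<longrightarrow> P f e"
  shows "\<exists>e0>0. \<forall>e. 0 < e \<and> e \<le> e0 \<longrightarrow> (\<forall>f\<in>F. P f e)"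
  using assms
proof (induction rule: finite_induct)
  case (insert f F)
  obtain e1 where e1: "0 < e1" "\<forall>e. 0 < e \<and> e \<le> e1 \<longrightarrow> (\<forall>f\<in>F. P f e)" using insert by auto
  obtain e2 where e2: "0 < e2" "\<forall>e. 0 < e \<and> e \<le> e2 \<longrightarrow> P f e" using insert.prems by auto
  show ?case using e1 e2 by (intro exI[of _ "min e1 e2"]) auto
qed (auto intro: exI[of _ 1])

(* Rapid L1-convergence, so that no subsequence has to be extracted simultaneously for all functions. *)
lemma moll_AE_sequence:
  fixes F :: "('a::euclidean_space \<Rightarrow> real) set"
  assumes F: "finite F" "\<And>f. f \<in> F \<Longrightarrow> integrable lborel f" and c: "0 < c"
  obtains \<epsilon> :: "nat \<Rightarrow> real" where "\<And>n. 0 < \<epsilon> n" "\<And>n. \<epsilon> n \<le> c" "\<epsilon> \<longlonglongrightarrow> 0"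
    "\<And>f. f \<in> F \<Longrightarrow> AE z in lborel. (\<lambda>n. moll (\<epsilon> n) f z) \<longlonglongrightarrow> f z"
proof -
  have "\<exists>e0>0. \<forall>e. 0 < e \<and> e \<le> e0 \<longrightarrow> (\<forall>f\<in>F. moll_err e f \<le> ennreal ((1/2)^n))" for n
    by (intro finite_uniform_threshold F(1) moll_err_small F(2)) auto
  then obtain e0 where e0: "\<And>n. 0 < e0 n" "\<And>n e f. 0 < e \<Longrightarrow> e \<le> e0 n \<Longrightarrow> f \<in> F \<Longrightarrow> moll_err e f \<le> ennreal ((1/2)^n)"
    by metis
  define \<epsilon> where "\<epsilon> n = min (e0 n) (min c (1 / Suc n))" for n
  have \<epsilon>: "0 < \<epsilon> n" "\<epsilon> n \<le> c" "\<epsilon> n \<le> 1 / Suc n" "\<epsilon> n \<le> e0 n" for n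
    using e0(1)[of n] c by (auto simp: \<epsilon>_def)
  have "\<epsilon> \<longlonglongrightarrow> 0"
    by (rule tendsto_sandwich[OF _ _ tendsto_const LIMSEQ_inverse_real_of_nat])
       (use \<epsilon>(1,3) in \<open>auto simp: less_imp_le inverse_eq_divide\<close>)
  moreover have "AE z in lborel. (\<lambda>n. moll (\<epsilon> n) f z) \<longlonglongrightarrow> f z" if f: "f \<in> F" for f
  proof -
    have [measurable]: "f \<in> borel_measurable borel" using F(2)[OF f] by auto
    have [measurable]: "moll (\<epsilon> n) f \<in> borel_measurable borel" for n
      by (intro moll_measurable \<epsilon> F(2) f)
    have "(\<integral>\<^sup>+z. (\<Sum>n. ennreal \<bar>moll (\<epsilon> n) f z - f z\<bar>) \<partial>lborel) = (\<Sum>n. moll_err (\<epsilon> n) f)"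
      unfolding moll_err_def by (intro nn_integral_suminf) measurable
    also have "\<dots> \<le> (\<Sum>n. ennreal ((1/2)^n))"
      by (intro suminf_le e0(2) \<epsilon> f) auto
    also have "\<dots> = ennreal (\<Sum>n. (1/2)^n)"
      by (intro suminf_ennreal2) (auto intro: summable_geometric)
    also have "\<dots> < \<infinity>" by simp
    finally have "AE z in lborel. (\<Sum>n. ennreal \<bar>moll (\<epsilon> n) f z - f z\<bar>) \<noteq> \<infinity>"
      by (intro nn_integral_noteq_infinite) auto
    then show ?thesis
    proof eventually_elim
      case (elim z)
      then have "summable (\<lambda>n. \<bar>moll (\<epsilon> n) f z - f z\<bar>)"
        by (intro summable_suminf_not_top) auto
      then have "(\<lambda>n. \<bar>moll (\<epsilon> n) f z - f z\<bar>) \<longlonglongrightarrow> 0" by (rule summable_LIMSEQ_zero)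
      then have "(\<lambda>n. moll (\<epsilon> n) f z - f z) \<longlonglongrightarrow> 0" by (simp add: tendsto_rabs_zero_iff)
      then show ?case by (simp add: LIM_zero_iff)
    qed
  qed
  ultimately show thesis using that[of \<epsilon>] \<epsilon> by blast
qed

lemma moll_uniform:
  fixes u :: "'a::euclidean_space \<Rightarrow> real"
  assumes O: "open \<Omega>" and K: "compact K" "K \<subseteq> \<Omega>" and u: "continuous_on \<Omega> u"
    and f: "integrable lborel f" "\<And>z. z \<in> \<Omega> \<Longrightarrow> f z = u z" and d: "0 < d"
  shows "\<exists>e0>0. \<forall>e. 0 < e \<and> e \<le> e0 \<longrightarrow> (\<forall>z\<in>K. \<bar>moll e f z - u z\<bar> \<le> d)"
proof -
  obtain r where r: "0 < r" "(\<Union>x\<in>K. cball x r) \<subseteq> \<Omega>"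
    using compact_subset_open_imp_cball_epsilon_subset[OF K(1) O K(2)] by blast
  define K' where "K' = (\<Union>x\<in>K. cball x r)"
  have K': "compact K'" unfolding K'_def by (rule compact_minkowski_sum_cball[OF K(1)])
  then have "uniformly_continuous_on K' u"
    using u r by (intro compact_uniformly_continuous continuous_on_subset[OF u]) (auto simp: K'_def)
  then obtain s where s: "0 < s" "\<And>x y. x \<in> K' \<Longrightarrow> y \<in> K' \<Longrightarrow> dist y x < s \<Longrightarrow> dist (u y) (u x) < d"
    using d unfolding uniformly_continuous_on_def by blast
  show ?thesis
  proof (intro exI[of _ "min r (s / 2)"] conjI allI impI ballI)
    fix e z assume e: "0 < e \<and> e \<le> min r (s / 2)" and z: "z \<in> K"
    show "\<bar>moll e f z - u z\<bar> \<le> d"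
    proof (rule moll_near)
      fix w assume w: "norm (z - w) \<le> e"
      then have wK: "w \<in> K'" "z \<in> K'" "dist w z < s"
        using e z r(1) s(1) by (auto simp: K'_def dist_norm norm_minus_commute intro!: bexI[of _ z])
      moreover have "K' \<subseteq> \<Omega>" using r(2) by (simp add: K'_def)
      ultimately have "w \<in> \<Omega>" by blast
      then show "\<bar>f w - u z\<bar> \<le> d"
        using s(2)[OF wK(2,1,3)] f(2)[of w] by (simp add: dist_real_def)
    qed (use e d f in auto)
  qed (use r s in auto)
qed

text \<open>The reflected kernel is a test function because its support lies in the ball around z.
  The sign from reflection cancels the sign from integration by parts.\<close>

lemma conv_weak_deriv:
  assumes O: "open \<Omega>" and w: "weak_deriv \<Omega> vs u v"
    and f: "f \<in> smoothC" "\<And>z. r < norm z \<Longrightarrow> f z = 0" and z: "cball z r \<subseteq> \<Omega>"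
  shows "(\<integral>w. indicator \<Omega> w * u w * dir_derivs vs f (z - w) \<partial>lborel) = (\<integral>w. indicator \<Omega> w * v w * f (z - w) \<partial>lborel)"
proof -
  let ?\<phi> = "\<lambda>w. f (z - w)"
  have sub: "{x. ?\<phi> x \<noteq> 0} \<subseteq> cball z r"
    using f(2) by (auto simp: dist_norm) (meson not_le)
  then have cl: "closure {x. ?\<phi> x \<noteq> 0} \<subseteq> cball z r" by (rule closure_minimal) simp
  moreover have "compact (closure {x. ?\<phi> x \<noteq> 0})"
    using bounded_subset[OF bounded_cball sub] by simp
  ultimately have "?\<phi> \<in> test_functions \<Omega>"
    unfolding test_functions_def using z smoothC_smooth[OF smoothC_reflect[OF f(1)]] by auto
  then have "set_lebesgue_integral lborel \<Omega> (\<lambda>w. u w * dir_derivs vs ?\<phi> w)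
    = (- 1) ^ length vs * set_lebesgue_integral lborel \<Omega> (\<lambda>w. v w * ?\<phi> w)"
    using w unfolding weak_deriv_def by blast
  moreover have "set_lebesgue_integral lborel \<Omega> (\<lambda>w. u w * dir_derivs vs ?\<phi> w)
    = (- 1) ^ length vs * (\<integral>w. indicator \<Omega> w * u w * dir_derivs vs f (z - w) \<partial>lborel)"
    unfolding dir_derivs_reflect[OF f(1)] set_lebesgue_integral_def
    by (subst integral_mult_right_zero[symmetric]) (simp add: mult_ac)
  ultimately show ?thesis
    by (simp add: set_lebesgue_integral_def mult.assoc)
qed

section \<open>Contact points of smooth functions\<close>

text \<open>Here vt is the time derivative, Dv the spatial gradient, H the spatial Hessian and g the
  time derivative of the gradient; g occurs in the derivative of \<open>contact_map\<close>, but not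
  in its Jacobian.\<close>

definition smooth_data ::
  "(real \<times> (real^'n) \<Rightarrow> real) \<Rightarrow> (real \<times> (real^'n) \<Rightarrow> real) \<Rightarrow> (real \<times> (real^'n) \<Rightarrow> real^'n) \<Rightarrow>
   (real \<times> (real^'n) \<Rightarrow> real^'n^'n) \<Rightarrow> (real \<times> (real^'n) \<Rightarrow> real^'n) \<Rightarrow> bool" where
  "smooth_data v vt Dv H g \<longleftrightarrow>
    (\<forall>z. (v has_derivative (\<lambda>k. vt z * fst k + Dv z \<bullet> snd k)) (at z)) \<and>
    (\<forall>z. (Dv has_derivative (\<lambda>k. H z *v snd k + fst k *\<^sub>R g z)) (at z)) \<and>
    (\<forall>z. transpose (H z) = H z) \<and>
    vt \<in> borel_measurable borel \<and> (\<forall>i j. (\<lambda>z. H z $ i $ j) \<in> borel_measurable borel)"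

text \<open>Only strictly later times are compared, as suits a backward parabolic operator. The
  comparison at the same time is recovered by continuity in
  \<open>contact_same_time\<close>.\<close>

definition contact :: "(real \<times> (real^'n) \<Rightarrow> real) \<Rightarrow> (real \<times> (real^'n) \<Rightarrow> real^'n) \<Rightarrow> (real \<times> (real^'n)) set \<Rightarrow> (real \<times> (real^'n)) set" where
  "contact v Dv U = {z \<in> U. \<forall>w\<in>U. fst z < fst w \<longrightarrow> v w \<le> v z + Dv z \<bullet> (snd w - snd z)}"

(* Height and slope of the tangent plane at z in the spatial variables. *)
definition contact_map :: "(real \<times> (real^'n) \<Rightarrow> real) \<Rightarrow> (real \<times> (real^'n) \<Rightarrow> real^'n) \<Rightarrow> real \<times> (real^'n) \<Rightarrow> real \<times> (real^'n)" where
  "contact_map v Dv z = (v z - snd z \<bullet> Dv z, Dv z)"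

lemma measurable_det [measurable (raw)]:
  fixes A :: "'a \<Rightarrow> real^'n^'n"
  assumes "\<And>i j. (\<lambda>x. A x $ i $ j) \<in> borel_measurable M"
  shows "(\<lambda>x. det (A x)) \<in> borel_measurable M"
  unfolding det_def using assms by measurable

lemma det_uminus_abs: "\<bar>det (- A)\<bar> = \<bar>det (A :: real^'n^'n)\<bar>"
proof -
  have "- A = diag (\<lambda>_. -1) ** A"
    by (simp add: vec_eq_iff matrix_matrix_mult_def diag_def mult_delta_left)
  then show ?thesis by (simp add: det_mul det_diag abs_mult power_abs)
qed

context
  fixes v vt :: "real \<times> (real^'n) \<Rightarrow> real" and Dv :: "real \<times> (real^'n) \<Rightarrow> real^'n" and H g and U :: "(real \<times> (real^'n)) set"
  assumes sd: "smooth_data v vt Dv H g" and U: "open U"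
begin

lemma v_deriv: "(v has_derivative (\<lambda>k. vt z * fst k + Dv z \<bullet> snd k)) (at z)"
  and Dv_deriv: "(Dv has_derivative (\<lambda>k. H z *v snd k + fst k *\<^sub>R g z)) (at z)"
  and H_sym: "transpose (H z) = H z"
  and meas [measurable]: "vt \<in> borel_measurable borel" "(\<lambda>z. H z $ i $ j) \<in> borel_measurable borel"
  using sd unfolding smooth_data_def by blast+

lemma contactD: "z \<in> contact v Dv U \<Longrightarrow> w \<in> U \<Longrightarrow> fst z < fst w \<Longrightarrow> v w \<le> v z + Dv z \<bullet> (snd w - snd z)"
  unfolding contact_def by blast

lemma contact_subset: "z \<in> contact v Dv U \<Longrightarrow> z \<in> U"
  unfolding contact_def by blast

lemma cont: "continuous_on A v" "continuous_on A Dv"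
  using v_deriv Dv_deriv
  by (auto intro!: has_derivative_continuous_on[OF has_derivative_at_withinI])

lemma v_t_deriv: "((\<lambda>s. v (s, x)) has_real_derivative vt (t, x)) (at t)"
proof -
  have "((\<lambda>s. (s, x)) has_derivative (\<lambda>h. (h, 0))) (at t)" by (auto intro!: derivative_eq_intros)
  from has_derivative_compose[OF this v_deriv] show ?thesis
    by (simp add: has_field_derivative_def)
qed

text \<open>Each later point w imposes a closed condition on z. The form U \<inter> C gives both the
  measurability of the contact set and the \<sigma>-compactness behind that of its image.\<close>

lemma contact_closed_part:
  obtains C where "closed C" "contact v Dv U = U \<inter> C"
proof -
  define C where "C = (\<Inter>w\<in>U. {z. fst w \<le> fst z} \<union> {z. v w \<le> v z + Dv z \<bullet> (snd w - snd z)})"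
  have "closed C" unfolding C_def
    by (intro closed_INT ballI closed_Un closed_Collect_le continuous_intros cont)
  moreover have "contact v Dv U = U \<inter> C" 
    by (intro set_eqI) (simp only: C_def contact_def Int_iff INT_iff Un_iff mem_Collect_eq not_less[symmetric], blast)
  ultimately show thesis using that by blast
qed

lemma continuous_contact_map: "continuous_on A (contact_map v Dv)"
  unfolding contact_map_def[abs_def] by (intro continuous_intros cont)

lemma contact_borel: "contact v Dv U \<in> sets borel"
  using contact_closed_part U by (metis borel_closed borel_open sets.Int)

text \<open>U is a countable union of compact boxes, so the contact set is a countable union of
  compact sets, and so is its continuous image.\<close>

lemma contact_map_image_borel: "contact_map v Dv ` contact v Dv U \<in> sets borel"
proof -
  obtain C where C: "closed C" "contact v Dv U = U \<inter> C" by (rule contact_closed_part)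
  obtain \<D> where D: "countable \<D>" "\<D> \<subseteq> Pow U" "\<And>X. X \<in> \<D> \<Longrightarrow> \<exists>a b. X = cbox a b" "\<Union>\<D> = U"
    using open_countable_Union_open_cbox[OF U] by blast
  have "contact_map v Dv ` contact v Dv U = (\<Union>X\<in>\<D>. contact_map v Dv ` (X \<inter> C))"
    using D C by auto
  moreover have "compact (contact_map v Dv ` (X \<inter> C))" if "X \<in> \<D>" for X
    using D(3)[OF that] C(1) by (intro compact_continuous_image continuous_contact_map) (auto intro: compact_Int_closed)
  then have "(\<Union>X\<in>\<D>. contact_map v Dv ` (X \<inter> C)) \<in> sets borel"
    by (intro sets.countable_UN'[OF D(1)] image_subsetI borel_compact)
  ultimately show ?thesis by (simp only:)
qed

text \<open>The point y is approached through slightly later times, which stay in the open set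
  U.\<close>

lemma contact_same_time:
  assumes z: "z \<in> contact v Dv U" and y: "(fst z, y) \<in> U"
  shows "v (fst z, y) \<le> v z + Dv z \<bullet> (y - snd z)"
proof -
  have lim: "((\<lambda>s. v (s, y)) \<longlongrightarrow> v (fst z, y)) (at_right (fst z))"
    using has_field_derivative_imp_has_derivative[OF v_t_deriv[of y "fst z"]]
    by (metis DERIV_isCont continuous_within filterlim_at_split v_t_deriv)
  have "continuous_on UNIV (\<lambda>s. (s, y))" by (intro continuous_intros)
  then have "open ((\<lambda>s. (s, y)) -` U)" using U open_vimage by blast
  then have "\<forall>\<^sub>F s in at_right (fst z). (s, y) \<in> U"
    using y eventually_at_filter eventually_nhds_in_open[of "(\<lambda>s. (s, y)) -` U" "fst z"]
    by (auto elim!: eventually_mono simp: eventually_at_filter)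
  moreover have "\<forall>\<^sub>F s in at_right (fst z). fst z < s" by (simp add: eventually_at_right_less)
  ultimately have "\<forall>\<^sub>F s in at_right (fst z). v (s, y) \<le> v z + Dv z \<bullet> (y - snd z)"
  proof eventually_elim
    case (elim s)
    then show ?case using contactD[OF z, of "(s, y)"] by simp
  qed
  then show ?thesis using tendsto_upperbound[OF lim] by simp
qed

lemma contact_vt_le_0:
  assumes z: "z \<in> contact v Dv U"
  shows "vt z \<le> 0"
proof (rule ccontr)
  assume "\<not> vt z \<le> 0"
  then have "0 < vt (fst z, snd z)" by simp
  from DERIV_pos_inc_right[OF v_t_deriv this] obtain d where d: "0 < d" "\<And>h. 0 < h \<Longrightarrow> h < d \<Longrightarrow> v (fst z, snd z) < v (fst z + h, snd z)"
    by blast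
  have "open U" "z \<in> U" using U z by (auto simp: contact_def)
  then obtain e where e: "0 < e" "ball z e \<subseteq> U" using openE by blast
  define h where "h = min d e / 2"
  have h: "0 < h" "h < d" "h < e" using d e by (auto simp: h_def)
  have "(fst z + h, snd z) \<in> U"
    using e(2) h by (cases z) (auto simp: dist_prod_def dist_real_def subset_iff mem_ball)
  then have "v (fst z + h, snd z) \<le> v z" using contactD[OF z, of "(fst z + h, snd z)"] h by simp
  then show False using d(2)[OF h(1,2)] by simp
qed

text \<open>On a line in the time slice, v minus its tangent has derivative 0 at the contact point.
  Positive curvature would make it increase to one side, above the tangent plane.\<close>

lemma contact_psd:
  assumes z: "z \<in> contact v Dv U"
  shows "psd (- H z)"
proof -
  have "y \<bullet> (H z *v y) \<le> 0" for y
  proof (rule ccontr)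
    assume "\<not> y \<bullet> (H z *v y) \<le> 0"
    then have pos: "0 < y \<bullet> (H z *v y)" by simp
    define c where "c h = (fst z, snd z + h *\<^sub>R y)" for h :: real
    have c: "(c has_derivative (\<lambda>k. (0, k *\<^sub>R y))) (at h)" for h
      unfolding c_def[abs_def] by (auto intro!: derivative_eq_intros)
    have c0: "c 0 = z" by (simp add: c_def)
    define \<phi> where "\<phi> h = v (c h) - h * (Dv z \<bullet> y)" for h
    define \<psi> where "\<psi> h = (Dv (c h) - Dv z) \<bullet> y" for h
    have \<phi>: "(\<phi> has_real_derivative \<psi> h) (at h)" for h
      unfolding \<phi>_def[abs_def] has_field_derivative_def
      by (rule has_derivative_eq_rhs[OF has_derivative_diff[OF has_derivative_compose[OF c v_deriv] has_derivative_mult_left[OF has_derivative_ident]]])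
         (auto simp: \<psi>_def inner_diff_left algebra_simps)
    have \<psi>: "(\<psi> has_real_derivative y \<bullet> (H z *v y)) (at 0)"
    proof -
      have "((\<lambda>h. Dv (c h)) has_derivative (\<lambda>k. H z *v (k *\<^sub>R y))) (at 0)"
        using has_derivative_compose[OF c Dv_deriv, of 0] by (simp add: c0)
      then have "(\<psi> has_derivative (\<lambda>k. (H z *v (k *\<^sub>R y)) \<bullet> y)) (at 0)"
        unfolding \<psi>_def[abs_def] by (auto intro!: derivative_eq_intros)
      then show ?thesis
        by (simp add: has_field_derivative_def matrix_vector_mult_scaleR inner_commute mult_commute_abs)
    qed
    obtain d where d: "0 < d" "\<And>h. 0 < h \<Longrightarrow> h < d \<Longrightarrow> 0 < \<psi> h"
      using DERIV_pos_inc_right[OF \<psi> pos] by (auto simp: \<psi>_def c0)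
    have "continuous_on UNIV c" unfolding c_def[abs_def] by (intro continuous_intros)
    then have "open (c -` U)" using U open_vimage by blast
    moreover have "0 \<in> c -` U" using z by (simp add: c0 contact_def)
    ultimately obtain e where e: "0 < e" "ball 0 e \<subseteq> c -` U" using openE by blast
    define h where "h = min d e / 2"
    have h: "0 < h" "h < d" "h < e" using d e by (auto simp: h_def)
    obtain s where s: "0 < s" "s < h" "\<phi> h - \<phi> 0 = (h - 0) * \<psi> s"
      using MVT2[of 0 h \<phi> \<psi>] \<phi> h by auto
    have "0 < (h - 0) * \<psi> s" using d(2)[of s] s h by simp
    then have "\<phi> 0 < \<phi> h" using s by simp
    moreover have "c h \<in> U"
    proof -
      have "h \<in> ball 0 e" using h by simp
      then show ?thesis using e(2) by blast
    qed
    then have "v (c h) \<le> v z + Dv z \<bullet> (h *\<^sub>R y)"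
      using contact_same_time[OF z, of "snd z + h *\<^sub>R y"] by (simp add: c_def)
    then have "\<phi> h \<le> \<phi> 0" by (simp add: \<phi>_def c0)
    ultimately show False by simp
  qed
  moreover have "(- H z) *v y = - (H z *v y)" for y
    by (simp add: matrix_vector_mult_def vec_eq_iff sum_negf)
  moreover have "transpose (- H z) = - H z"
    using H_sym[of z] by (simp add: transpose_def vec_eq_iff)
  ultimately show ?thesis by (simp add: psd_def)
qed

lemma ldet_real_mult: "ldet (\<lambda>k::real. c * k) = \<bar>c\<bar>"
proof -
  have lin: "linear (\<lambda>k::real. c * k)" by (rule linearI) (auto simp: algebra_simps)
  have "ennreal (ldet (\<lambda>k::real. c * k)) = emeasure lborel ((\<lambda>k. c * k) ` {0..1})"
    by (simp add: emeasure_linear_image_ldet[OF lin])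
  also have "(\<lambda>k. c * k) ` {0..1} = (if c \<ge> 0 then {0..c} else {c..0})"
    using image_mult_atLeastAtMost_if[of c 0 1] by auto
  finally show ?thesis by (auto simp: ldet_nonneg split: if_splits)
qed

text \<open>For fixed x the values of v do not increase from one contact point to a later one.
  Adding e * t to -v makes it injective on the slice, and the area formula on the line bounds the
  integral by the length of the range, whose excess 2 * e * B comes from the added term.\<close>

lemma contact_time_slice:
  assumes G: "G \<in> sets borel" "G \<subseteq> contact v Dv U" and c: "\<And>z. z \<in> G \<Longrightarrow> c1 \<le> v z \<and> v z \<le> c2"
    and B: "\<And>z. z \<in> U \<Longrightarrow> \<bar>fst z\<bar> \<le> B" and e: "0 < e" and cc: "c1 \<le> c2" "0 \<le> B"
  shows "(\<integral>\<^sup>+t. indicator G (t, x) * ennreal (- vt (t, x)) \<partial>lborel) \<le> ennreal (c2 - c1 + 2 * e * B)"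
proof -
  define E where "E = {t. (t, x) \<in> G}"
  have E: "E \<in> sets borel"
    using measurable_sets[of "\<lambda>t. (t, x)" borel borel G] G by (simp add: E_def vimage_def borel_prod[symmetric])
  define f where "f t = - v (t, x) + e * t" for t
  have "(\<integral>\<^sup>+t. indicator G (t, x) * ennreal (- vt (t, x)) \<partial>lborel) \<le> (\<integral>\<^sup>+t. indicator E t * ennreal (- vt (t, x) + e) \<partial>lborel)"
    using e by (intro nn_integral_mono) (auto simp: E_def indicator_def intro!: ennreal_leI)
  also have "\<dots> \<le> emeasure lborel {- c2 - e * B .. - c1 + e * B}"
  proof (rule nn_integral_ldet_le_emeasure[where f = f and f' = "\<lambda>t k. (- vt (t, x) + e) * k"])
    show "f ` E \<subseteq> {- c2 - e * B .. - c1 + e * B}"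
    proof
      fix r assume "r \<in> f ` E"
      then obtain t where t: "(t, x) \<in> G" "r = f t" by (auto simp: E_def)
      then have "\<bar>t\<bar> \<le> B" using B[of "(t, x)"] G by (auto simp: contact_def)
      then have "e * t \<le> e * B" "- (e * B) \<le> e * t" using e
        by (auto simp: abs_le_iff) (metis minus_le_iff mult_le_cancel_left_pos mult_minus_right)
      then show "r \<in> {- c2 - e * B .. - c1 + e * B}" using c[OF t(1)] t by (auto simp: f_def)
    qed
    show "(f has_derivative (\<lambda>k. (- vt (t, x) + e) * k)) (at t within E)" for t
    proof -
      have "(f has_real_derivative (- vt (t, x) + e)) (at t)"
        unfolding f_def[abs_def] using v_t_deriv[of x t] by (auto intro!: derivative_eq_intros)
      then show ?thesis by (simp add: has_field_derivative_def has_derivative_at_withinI)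
    qed
    show "inj_on f E"
    proof (rule linorder_inj_onI)
      fix s t assume st: "s < t" "s \<in> E" "t \<in> E"
      then have "(t, x) \<in> U" "(s, x) \<in> contact v Dv U" using G contact_subset by (auto simp: E_def)
      then have "v (t, x) \<le> v (s, x)" using st contactD[of "(s, x)" "(t, x)"] by simp
      then show "f s \<noteq> f t" using mult_strict_left_mono[OF st(1) e] unfolding f_def by linarith
    qed auto
    show "ldet (\<lambda>k. (- vt (t, x) + e) * k) = - vt (t, x) + e" if "t \<in> E" for t
      using contact_vt_le_0[of "(t, x)"] that G e by (auto simp: ldet_real_mult E_def)
    show "(\<lambda>t. indicat_real E t * (- vt (t, x) + e)) \<in> borel_measurable borel"
      using E by (simp add: borel_prod[symmetric])
  qed (use E in auto)
  also have "\<dots> = ennreal (c2 - c1 + 2 * e * B)"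
  proof -
    have "0 \<le> e * B" using e cc by simp
    then have "- c2 - e * B \<le> - c1 + e * B" using cc by linarith
    then show ?thesis by (simp add: algebra_simps)
  qed
  finally show ?thesis .
qed

text \<open>The tangent planes at two contact points of one slice lie above v at both points; adding
  the two inequalities shows that -Dv is monotone there. Then -Dv + e x is injective, and e = \<rho>
  / R keeps the added term at most \<rho>, so the range lies in the ball of radius 2 \<rho>.\<close>

lemma contact_space_slice:
  assumes G: "G \<in> sets borel" "G \<subseteq> contact v Dv U" and \<rho>: "\<And>z. z \<in> G \<Longrightarrow> norm (Dv z) \<le> \<rho>" "0 < \<rho>"
    and R: "\<And>z. z \<in> U \<Longrightarrow> norm (snd z) \<le> R" "0 < R"
  shows "(\<integral>\<^sup>+x. indicator G (t, x) * ennreal (det (- H (t, x))) \<partial>lborel) \<le> emeasure lborel (cball (0::real^'n) (2 * \<rho>))"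
proof -
  define E where "E = {x. (t, x) \<in> G}"
  define e where "e = \<rho> / R"
  have e: "0 < e" using \<rho> R by (simp add: e_def)
  have E: "E \<in> sets borel"
    using measurable_sets[of "\<lambda>x. (t, x)" borel borel G] G by (simp add: E_def vimage_def borel_prod[symmetric])
  define f where "f x = - Dv (t, x) + e *\<^sub>R x" for x
  define J where "J x = det (- H (t, x) + e *\<^sub>R mat 1)" for x
  have psdH: "psd (- H (t, x))" if "x \<in> E" for x using contact_psd that G by (auto simp: E_def)
  have "(\<integral>\<^sup>+x. indicator G (t, x) * ennreal (det (- H (t, x))) \<partial>lborel) \<le> (\<integral>\<^sup>+x. indicator E x * ennreal (J x) \<partial>lborel)"
  proof (intro nn_integral_mono)
    fix x
    show "indicator G (t, x) * ennreal (det (- H (t, x))) \<le> indicator E x * ennreal (J x)"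
      using psd_det_le_det_add[OF psdH, of x e] e by (cases "(t, x) \<in> G") (auto simp: E_def J_def intro!: ennreal_leI)
  qed
  also have "\<dots> \<le> emeasure lborel (cball (0::real^'n) (2 * \<rho>))"
  proof (rule nn_integral_ldet_le_emeasure[where f = f and f' = "\<lambda>x k. (- H (t, x) + e *\<^sub>R mat 1) *v k"])
    show "f ` E \<subseteq> cball 0 (2 * \<rho>)"
    proof
      fix r assume "r \<in> f ` E"
      then obtain x where x: "(t, x) \<in> G" "r = f x" by (auto simp: E_def)
      then have "norm x \<le> R" using R(1)[of "(t, x)"] G by (auto simp: contact_def)
      then have "norm (e *\<^sub>R x) \<le> \<rho>" using e R(2) \<rho>(2) by (simp add: e_def divide_simps mult_left_mono)
      moreover have "norm r \<le> norm (Dv (t, x)) + norm (e *\<^sub>R x)"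
        unfolding x f_def by (rule norm_triangle_le) simp
      ultimately show "r \<in> cball 0 (2 * \<rho>)" using \<rho>(1)[OF x(1)] by simp
    qed
    show "(f has_derivative (\<lambda>k. (- H (t, x) + e *\<^sub>R mat 1) *v k)) (at x within E)" for x
    proof -
      have "((\<lambda>x. (t, x)) has_derivative (\<lambda>k. (0, k))) (at x)" by (auto intro!: derivative_eq_intros)
      from has_derivative_compose[OF this Dv_deriv]
      have D: "((\<lambda>x. Dv (t, x)) has_derivative (\<lambda>k. H (t, x) *v k)) (at x)" by simp
      have "(f has_derivative (\<lambda>k. - (H (t, x) *v k) + e *\<^sub>R k)) (at x)"
        unfolding f_def[abs_def] by (intro has_derivative_add has_derivative_minus D has_derivative_scaleR_right has_derivative_ident)
      moreover have "- (H (t, x) *v k) + e *\<^sub>R k = (- H (t, x) + e *\<^sub>R mat 1) *v k" for k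
      proof -
        have "(- H (t, x)) *v k = - (H (t, x) *v k)"
          by (simp add: matrix_vector_mult_def vec_eq_iff sum_negf)
        moreover have "(e *\<^sub>R mat 1) *v k = e *\<^sub>R k"
          by (simp add: scaleR_matrix_vector_assoc[symmetric])
        ultimately show ?thesis by (simp only: matrix_vector_mult_add_rdistrib)
      qed
      ultimately show ?thesis by (simp add: has_derivative_at_withinI)
    qed
    show "inj_on f E"
    proof (rule inj_onI)
      fix x y assume xy: "x \<in> E" "y \<in> E" "f x = f y"
      then have G': "(t, x) \<in> contact v Dv U" "(t, y) \<in> contact v Dv U" using G by (auto simp: E_def)
      then have "v (t, y) \<le> v (t, x) + Dv (t, x) \<bullet> (y - x)" "v (t, x) \<le> v (t, y) + Dv (t, y) \<bullet> (x - y)"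
        using contact_same_time[OF G'(1), of y] contact_same_time[OF G'(2), of x] by (auto simp: contact_def)
      then have "0 \<le> (Dv (t, x) - Dv (t, y)) \<bullet> (y - x)" by (simp add: inner_diff_left inner_diff_right)
      moreover have "Dv (t, x) - Dv (t, y) = e *\<^sub>R (x - y)" using xy(3) by (simp add: f_def scaleR_diff_right algebra_simps)
      ultimately have "0 \<le> e * ((x - y) \<bullet> (y - x))" by simp
      then have "0 \<le> - ((x - y) \<bullet> (x - y))" using e
        by (simp add: zero_le_mult_iff inner_diff_left inner_diff_right)
      then have "(x - y) \<bullet> (x - y) = 0" using inner_ge_zero[of "x - y"] by linarith
      then show "x = y" by simp
    qed
    show "ldet (\<lambda>k. (- H (t, x) + e *\<^sub>R mat 1) *v k) = J x" if "x \<in> E" for x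
    proof -
      have "transpose (- H (t, x) + e *\<^sub>R mat 1) = - H (t, x) + e *\<^sub>R mat 1"
        using H_sym[of "(t, x)"] by (auto simp: transpose_def vec_eq_iff mat_def)
      moreover have "0 \<le> J x"
        using psd_det_nonneg[OF psdH[OF that]] psd_det_le_det_add[OF psdH[OF that], of e] e by (simp add: J_def)
      ultimately show ?thesis by (simp add: ldet_symmetric_matrix J_def)
    qed
    have [measurable]: "(\<lambda>x. H (t, x) $ i $ j) \<in> borel_measurable borel" for i j
      by (rule measurable_compose[OF _ meas(2)]) (simp add: borel_prod[symmetric])
    have "J \<in> borel_measurable borel" unfolding J_def[abs_def] by (rule measurable_det) simp
    then show "(\<lambda>x. indicat_real E x * J x) \<in> borel_measurable borel"
      using E by simp
  qed (use E in auto)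
  finally show ?thesis .
qed

text \<open>The derivative of \<open>contact_map\<close> has the form treated in
  \<open>ldet_space_time\<close>; at contact points the signs of vt and of -H remove the absolute
  values.\<close>

lemma contact_area:
  assumes S: "S \<in> sets borel"
  shows "emeasure lborel (contact_map v Dv ` contact v Dv U \<inter> S)
    \<le> (\<integral>\<^sup>+z. indicator (contact v Dv U \<inter> contact_map v Dv -` S) z * ennreal (- vt z * det (- H z)) \<partial>lborel)"
proof -
  let ?G = "contact v Dv U \<inter> contact_map v Dv -` S"
  have [measurable]: "contact_map v Dv \<in> borel_measurable borel"
    by (intro borel_measurable_continuous_onI continuous_contact_map)
  have G: "?G \<in> sets borel"
    using measurable_sets[of "contact_map v Dv" borel borel S] S contact_borel by auto
  have im: "contact_map v Dv ` contact v Dv U \<inter> S = contact_map v Dv ` ?G" by auto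
  have "emeasure lborel (contact_map v Dv ` ?G) \<le> (\<integral>\<^sup>+z. indicator ?G z * ennreal (- vt z * det (- H z)) \<partial>lborel)"
  proof (rule emeasure_image_le_nn_integral_ldet[where f' = "\<lambda>z (k, y). (vt z * k - snd z \<bullet> (H z *v y + k *\<^sub>R g z), H z *v y + k *\<^sub>R g z)"])
    show "contact_map v Dv ` ?G \<in> sets borel"
      using contact_map_image_borel S unfolding im[symmetric] by auto
    show "(contact_map v Dv has_derivative (\<lambda>(k, y). (vt z * k - snd z \<bullet> (H z *v y + k *\<^sub>R g z), H z *v y + k *\<^sub>R g z))) (at z within ?G)" for z
      unfolding contact_map_def[abs_def]
      by (rule has_derivative_at_withinI, rule has_derivative_eq_rhs,
          rule has_derivative_Pair[OF has_derivative_diff[OF v_deriv has_derivative_inner[OF has_derivative_snd[OF has_derivative_ident] Dv_deriv]] Dv_deriv])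
         (auto simp: fun_eq_iff inner_commute algebra_simps)
    show "ldet (\<lambda>(k, y). (vt z * k - snd z \<bullet> (H z *v y + k *\<^sub>R g z), H z *v y + k *\<^sub>R g z)) = - vt z * det (- H z)"
      if "z \<in> ?G" for z
    proof -
      have "\<bar>det (H z)\<bar> = det (- H z)"
      proof -
        have "0 \<le> det (- H z)" using psd_det_nonneg[OF contact_psd] that by blast
        then show ?thesis using det_uminus_abs[of "H z"] by linarith
      qed
      moreover have "vt z \<le> 0" using contact_vt_le_0 that by auto
      ultimately show ?thesis by (simp add: ldet_space_time[OF H_sym])
    qed
    have "(\<lambda>z. det (- H z)) \<in> borel_measurable borel" by (rule measurable_det) simp
    then show "(\<lambda>z. indicat_real ?G z * (- vt z * det (- H z))) \<in> borel_measurable borel"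
      using G by simp
  qed (rule G)
  then show ?thesis by (simp only: im)
qed

end

section \<open>Latest contact times\<close>

text \<open>The pair y encodes an affine function of space by its height at the origin and its
  slope, the coordinates in which \<open>contact_map\<close> takes its values.\<close>

definition above :: "(real \<times> 'b::euclidean_space \<Rightarrow> real) \<Rightarrow> (real \<times> 'b) set \<Rightarrow> real \<times> 'b \<Rightarrow> (real \<times> 'b) set" where
  "above v X y = {z \<in> X. fst y + snd y \<bullet> snd z \<le> v z}"

(* The bound -B only serves as a default value for an empty set. *)
definition toptime :: "real \<Rightarrow> (real \<times> 'b::euclidean_space \<Rightarrow> real) \<Rightarrow> (real \<times> 'b) set \<Rightarrow> real \<times> 'b \<Rightarrow> real" where
  "toptime B v X y = Sup (insert (- B) (fst ` above v X y))"

context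
  fixes B :: real and v :: "real \<times> 'b::euclidean_space \<Rightarrow> real" and K :: "(real \<times> 'b) set"
  assumes K: "compact K" and v: "continuous_on K v" and B: "\<And>z. z \<in> K \<Longrightarrow> \<bar>fst z\<bar> < B"
begin

lemma compact_above: "compact (above v K y)"
proof -
  have "closed {z \<in> K. fst y + snd y \<bullet> snd z \<le> v z}"
    using K by (intro continuous_on_closed_Collect_le continuous_intros v) (auto intro: compact_imp_closed)
  then have "compact (K \<inter> {z \<in> K. fst y + snd y \<bullet> snd z \<le> v z})" using K by (rule compact_Int_closed[rotated])
  moreover have "K \<inter> {z \<in> K. fst y + snd y \<bullet> snd z \<le> v z} = above v K y" by (auto simp: above_def)
  ultimately show ?thesis by simp
qed

lemma compact_times: "compact (insert (- B) (fst ` above v K y))"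
  by (intro compact_insert compact_continuous_image compact_above continuous_intros)

lemma bdd_times: "bdd_above (insert (- B) (fst ` above v K y))"
  by (intro bounded_imp_bdd_above compact_imp_bounded compact_times)

lemma toptime_upper: "z \<in> above v K y \<Longrightarrow> fst z \<le> toptime B v K y"
  unfolding toptime_def by (rule cSup_upper[OF _ bdd_times]) simp

lemma toptime_cases: "toptime B v K y = - B \<or> (\<exists>z\<in>above v K y. fst z = toptime B v K y)"
proof -
  have "toptime B v K y \<in> insert (- B) (fst ` above v K y)"
    unfolding toptime_def
    by (intro closed_contains_Sup compact_imp_closed compact_times bounded_imp_bdd_above compact_imp_bounded) auto
  then show ?thesis by (metis imageE insertE)
qed

text \<open>All times in K are strictly above -B, so for a nonempty set the default value cannot be
  the supremum.\<close>

lemma toptime_attained: "above v K y \<noteq> {} \<Longrightarrow> \<exists>z\<in>above v K y. fst z = toptime B v K y"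
proof -
  assume "above v K y \<noteq> {}"
  then obtain w where w: "w \<in> above v K y" by auto
  then have "- B < fst w" using B[of w] by (auto simp: above_def)
  then have "toptime B v K y \<noteq> - B" using toptime_upper[OF w] by linarith
  then show ?thesis using toptime_cases[of y] by blast
qed

lemma toptime_ge_iff:
  assumes "- B < c"
  shows "c \<le> toptime B v K y \<longleftrightarrow> (\<exists>z\<in>above v K y. c \<le> fst z)"
  using toptime_cases[of y] toptime_upper[of _ y] assms by force

lemma toptime_ge_lower: "- B \<le> toptime B v K y"
  unfolding toptime_def by (rule cSup_upper[OF _ bdd_times]) simp

text \<open>For c > -B the superlevel set is the projection of a closed set along the compact set of
  points with time at least c, hence closed.\<close>

lemma measurable_toptime: "toptime B v K \<in> borel_measurable borel"
  unfolding borel_measurable_iff_ge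
proof
  fix c
  show "{y \<in> space borel. c \<le> toptime B v K y} \<in> sets borel"
  proof (cases "c \<le> - B")
    case True
    then have "{y \<in> space borel. c \<le> toptime B v K y} = UNIV"
      by (auto intro: order_trans[OF True toptime_ge_lower])
    then show ?thesis by simp
  next
    case False
    define S where "S = {z \<in> K. c \<le> fst z}"
    have "closed S" unfolding S_def
      using K by (intro continuous_on_closed_Collect_le continuous_intros) (auto intro: compact_imp_closed)
    then have "compact (K \<inter> S)" using K by (rule compact_Int_closed[rotated])
    then have S: "compact S" by (simp add: S_def Int_def conj_ac cong: conj_cong)
    define T where "T = {p \<in> S \<times> (UNIV :: (real \<times> 'b) set). fst (snd p) + snd (snd p) \<bullet> snd (fst p) \<le> v (fst p)}"
    have "continuous_on (S \<times> (UNIV :: (real \<times> 'b) set)) (\<lambda>p. v (fst p))"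
      by (intro continuous_on_compose2[OF v] continuous_intros) (auto simp: S_def)
    then have "closed T" unfolding T_def
      using S by (intro continuous_on_closed_Collect_le continuous_intros closed_Times) (auto intro: compact_imp_closed)
    from closed_compact_projection[OF S this] have "closed {y. \<exists>z. z \<in> S \<and> (z, y) \<in> T}" .
    moreover have "{y. \<exists>z. z \<in> S \<and> (z, y) \<in> T} = {y. c \<le> toptime B v K y}"
      using False by (auto simp: toptime_ge_iff T_def S_def above_def)
    ultimately show ?thesis by auto
  qed
qed

lemma toptime_antimono:
  assumes "k \<le> l"
  shows "toptime B v K (l, x) \<le> toptime B v K (k, x)"
proof -
  have "above v K (l, x) \<subseteq> above v K (k, x)" using assms by (auto simp: above_def)
  then show ?thesis
    using toptime_cases[of "(l, x)"] toptime_ge_lower[of "(k, x)"] toptime_upper[of _ "(k, x)"] by fastforce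
qed

end

lemma toptime_mono_set:
  assumes K: "compact K" "continuous_on K v" "\<And>z. z \<in> K \<Longrightarrow> \<bar>fst z\<bar> < B" and L: "compact L" "L \<subseteq> K"
  shows "toptime B v L y \<le> toptime B v K y"
proof -
  have L': "compact L" "continuous_on L v" "\<And>z. z \<in> L \<Longrightarrow> \<bar>fst z\<bar> < B"
    using K L by (auto intro: continuous_on_subset)
  have "above v L y \<subseteq> above v K y" using L by (auto simp: above_def)
  then show ?thesis
    using toptime_cases[OF L', of y] toptime_ge_lower[OF K, of y] toptime_upper[OF K, of _ y] by force
qed

text \<open>The first exit point of the segment from w to z works: up to it the segment runs inside
  \<Omega> with increasing time, so, parametrised by time, it is itself an admissible curve.\<close>

lemma parabolic_exit:
  fixes \<Omega> :: "(real \<times> (real^'n)) set"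
  assumes O: "open \<Omega>" and w: "w \<in> \<Omega>" and z: "z \<notin> \<Omega>" "fst w < fst z"
  shows "\<exists>p\<in>parabolic_boundary \<Omega>. p \<in> closed_segment w z"
proof -
  define \<gamma> where "\<gamma> l = w + l *\<^sub>R (z - w)" for l :: real
  have \<gamma>c: "continuous_on A \<gamma>" for A unfolding \<gamma>_def[abs_def] by (intro continuous_intros)
  define S where "S = {l \<in> {0..1}. \<gamma> l \<notin> \<Omega>}"
  have "S = {0..1} \<inter> \<gamma> -` (- \<Omega>)" by (auto simp: S_def)
  moreover have "closed (\<gamma> -` (- \<Omega>))"
    using O \<gamma>c by (intro closed_vimage) auto
  ultimately have "closed S" by auto
  moreover have "1 \<in> S" using z by (simp add: S_def \<gamma>_def)
  moreover have bdd: "bdd_below S" by (rule bdd_belowI[of _ 0]) (simp add: S_def)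
  ultimately have lS: "Inf S \<in> S" by (intro closed_contains_Inf) auto
  define l where "l = Inf S"
  have l: "0 \<le> l" "l \<le> 1" "\<gamma> l \<notin> \<Omega>" using lS by (auto simp: S_def l_def)
  have below: "\<gamma> k \<in> \<Omega>" if "0 \<le> k" "k < l" for k
  proof (rule ccontr)
    assume "\<gamma> k \<notin> \<Omega>"
    then have "k \<in> S" using that l by (auto simp: S_def)
    then show False using cInf_lower[OF _ bdd] that by (force simp: l_def)
  qed
  have l0: "0 < l" using l w by (cases "l = 0") (auto simp: \<gamma>_def)
  define p where "p = \<gamma> l"
  have "p \<in> closure \<Omega>"
  proof -
    have "((\<lambda>k. \<gamma> k) \<longlongrightarrow> \<gamma> l) (at_left l)"
      using \<gamma>c[of UNIV] by (simp add: continuous_on_def filterlim_at_split)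
    moreover have "\<forall>\<^sub>F k in at_left l. \<gamma> k \<in> closure \<Omega>"
      using l0 below closure_subset unfolding eventually_at_left_field by (intro exI[of _ 0]) force
    ultimately show ?thesis unfolding p_def
      by (intro Lim_in_closed_set[of "closure \<Omega>" \<gamma> "at_left l"]) (auto simp: trivial_limit_at_left_real)
  qed
  then have fr: "p \<in> frontier \<Omega>" using O l by (simp add: frontier_def p_def interior_open)
  define s where "s = fst w"
  define h where "h = fst z - fst w"
  have h: "0 < h" using z by (simp add: h_def)
  define x where "x t = snd w + ((t - s) / h) *\<^sub>R (snd z - snd w)" for t
  have \<gamma>x: "\<gamma> k = (s + k * h, x (s + k * h))" for k
    using h by (intro prod_eqI) (auto simp: \<gamma>_def x_def s_def h_def)
  have "(fst p, snd p) \<in> frontier \<Omega> \<and> (\<exists>x \<epsilon>. \<epsilon> > 0 \<and> continuous_on UNIV x \<and> x (fst p) = snd p \<and>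
        (\<forall>t\<in>{fst p - \<epsilon>..<fst p}. (t, x t) \<in> \<Omega>))"
  proof (intro conjI exI[of _ x] exI[of _ "l * h"])
    show "(fst p, snd p) \<in> frontier \<Omega>" using fr by simp
    show "0 < l * h" using l0 h by simp
    show "continuous_on UNIV x" unfolding x_def[abs_def] using h by (intro continuous_intros) auto
    show "x (fst p) = snd p" unfolding p_def by (simp add: \<gamma>x)
    show "\<forall>t\<in>{fst p - l * h..<fst p}. (t, x t) \<in> \<Omega>"
    proof
      fix t assume t: "t \<in> {fst p - l * h..<fst p}"
      define k where "k = (t - s) / h"
      have tk: "t = s + k * h" using h by (simp add: k_def)
      have "fst p = s + l * h" unfolding p_def by (simp add: \<gamma>x)
      then have "0 \<le> k * h" "k * h < l * h" using t unfolding tk by auto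
      then have "0 \<le> k" "k < l" using h by (simp_all add: zero_le_mult_iff)
      from below[OF this] show "(t, x t) \<in> \<Omega>" by (simp add: \<gamma>x tk)
    qed
  qed
  then have "p \<in> parabolic_boundary \<Omega>" unfolding parabolic_boundary_def by (cases p) auto
  moreover have "p \<in> closed_segment w z"
    unfolding in_segment p_def \<gamma>_def using l by (intro exI[of _ l]) (auto simp: algebra_simps)
  ultimately show ?thesis by blast
qed

text \<open>Moving straight forward in time leaves the bounded set \<Omega>. The supremum in the
  estimate is thus not over the empty set.\<close>

lemma parabolic_boundary_nonempty:
  fixes \<Omega> :: "(real \<times> (real^'n)) set"
  assumes "open \<Omega>" "bounded \<Omega>" "\<Omega> \<noteq> {}"
  shows "parabolic_boundary \<Omega> \<noteq> {}"
proof -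
  obtain w where w: "w \<in> \<Omega>" using assms by auto
  obtain r where r: "\<And>z. z \<in> \<Omega> \<Longrightarrow> norm z \<le> r" using assms(2) by (auto simp: bounded_iff)
  define z where "z = (max (r + 1) (fst w + 1), snd w)"
  have "r < \<bar>fst z\<bar>" by (simp add: z_def)
  also have "\<dots> \<le> norm z" using norm_fst_le[of "fst z" "snd z"] by simp
  finally have "r < norm z" .
  then have "z \<notin> \<Omega>" by (meson leD r)
  moreover have "fst w < fst z" by (simp add: z_def)
  ultimately show ?thesis using parabolic_exit[OF assms(1) w] by blast
qed

text \<open>Otherwise points of \<Omega> earlier than z accumulate at z, and the segments from them
  to z leave \<Omega> at parabolic boundary points arbitrarily close to z.\<close>

lemma bottom_point:
  fixes \<Omega> :: "(real \<times> (real^'n)) set"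
  assumes O: "open \<Omega>" and z: "z \<notin> \<Omega>" "z \<notin> closure (parabolic_boundary \<Omega>)" and BB: "topological_basis BB"
  shows "\<exists>A\<in>BB. z \<in> A \<and> (\<forall>w\<in>\<Omega> \<inter> A. fst z \<le> fst w)"
proof (rule ccontr)
  assume neg: "\<not> ?thesis"
  have "z \<in> closure (parabolic_boundary \<Omega>)"
    unfolding closure_approachable
  proof (intro allI impI)
    fix e :: real assume "0 < e"
    then obtain A where A: "A \<in> BB" "z \<in> A" "A \<subseteq> ball z e"
      using topological_basisE[OF BB open_ball, of z z e] by auto
    then obtain w where w: "w \<in> \<Omega>" "w \<in> A" "fst w < fst z" using neg by (auto simp: not_le)
    then obtain p where p: "p \<in> parabolic_boundary \<Omega>" "p \<in> closed_segment w z"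
      using parabolic_exit[OF O w(1) z(1) w(3)] by blast
    have "dist p z \<le> dist w z" using dist_in_closed_segment[OF p(2)] by (simp add: dist_commute)
    also have "\<dots> < e" using w(2) A(3) by (auto simp: dist_commute)
    finally show "\<exists>y\<in>parabolic_boundary \<Omega>. dist y z < e" using p(1) by blast
  qed
  then show False using z by blast
qed

(* A frontier point off the closure of the parabolic boundary has one of countably many times, and for a
   fixed slope at most one height has a given latest contact time; so almost every plane touches in the interior. *)
lemma generic_contact_interior:
  fixes \<Omega> :: "(real \<times> (real^'n)) set" and v :: "real \<times> (real^'n) \<Rightarrow> real"
  assumes O: "open \<Omega>" "bounded \<Omega>" and v: "continuous_on (closure \<Omega>) v"
    and bd: "\<And>z. z \<in> parabolic_boundary \<Omega> \<Longrightarrow> v z \<le> 0"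
    and T: "T \<in> sets borel" "emeasure lborel T < top"
    and pos: "\<And>y z. y \<in> T \<Longrightarrow> z \<in> closure \<Omega> \<Longrightarrow> 0 < fst y + snd y \<bullet> snd z"
    and ne: "\<And>y. y \<in> T \<Longrightarrow> above v (closure \<Omega>) y \<noteq> {}"
    and e: "0 < (e::ennreal)"
  obtains U Bd where "open U" "compact (closure U)" "closure U \<subseteq> \<Omega>" "Bd \<in> sets borel" "emeasure lborel Bd < e"
    "\<And>y z. y \<in> T - Bd \<Longrightarrow> z \<in> above v (closure \<Omega>) y \<Longrightarrow> (\<And>w. w \<in> above v (closure \<Omega>) y \<Longrightarrow> fst w \<le> fst z) \<Longrightarrow> z \<in> U"
proof -
  define X where "X = closure \<Omega>"
  have X: "compact X" using O by (simp add: X_def)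
  have vX: "continuous_on X v" using v by (simp add: X_def)
  obtain r where r: "\<And>z. z \<in> X \<Longrightarrow> norm z \<le> r"
    using compact_imp_bounded[OF X] by (auto simp: bounded_iff)
  define B where "B = \<bar>r\<bar> + 1"
  have BX: "\<bar>fst z\<bar> < B" if "z \<in> X" for z
    using r[OF that] norm_fst_le[of "fst z" "snd z"] by (auto simp: B_def)
  note XX = X vX BX
  let ?\<tau> = "toptime B v X"
  obtain BB :: "(real \<times> (real^'n)) set set" where BB: "countable BB" "topological_basis BB"
    using ex_countable_basis by blast
  define TT where "TT = (\<lambda>A. Inf (fst ` (\<Omega> \<inter> A))) ` BB"
  have TT: "countable TT" using BB by (simp add: TT_def)
  \<comment> \<open>The second condition says that every lowering of the plane makes its latest time
    strictly larger. So the latest time is injective in the height for a fixed slope, and the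
    countable set \<open>TT\<close> leaves only countably many heights; Fubini then makes N
    null.\<close>
  define N where "N = {y. ?\<tau> y \<in> TT \<and> (\<forall>k::nat. ?\<tau> y < ?\<tau> (fst y - 1 / Suc k, snd y))}"
  have [measurable]: "?\<tau> \<in> borel_measurable borel" by (rule measurable_toptime[OF XX])
  have N: "N \<in> sets borel"
  proof -
    have [measurable]: "(\<lambda>y. ?\<tau> (fst y - 1 / Suc k, snd y)) \<in> borel_measurable borel" for k
      by (rule measurable_compose[OF _ measurable_toptime[OF XX]])
         (intro borel_measurable_continuous_onI continuous_intros)
    have [measurable]: "TT \<in> sets borel" using TT by (rule sets.countable[rotated]) auto
    have "{y \<in> space borel. ?\<tau> y \<in> TT \<and> (\<forall>k::nat. ?\<tau> y < ?\<tau> (fst y - 1 / Suc k, snd y))} \<in> sets borel"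
      by measurable
    then show ?thesis by (simp add: N_def)
  qed
  have slice: "countable {k. (k, x) \<in> N}" for x
  proof (rule countable_image_inj_on)
    have "(\<lambda>k. ?\<tau> (k, x)) ` {k. (k, x) \<in> N} \<subseteq> TT" by (auto simp: N_def)
    then show "countable ((\<lambda>k. ?\<tau> (k, x)) ` {k. (k, x) \<in> N})" using TT countable_subset by blast
    show "inj_on (\<lambda>k. ?\<tau> (k, x)) {k. (k, x) \<in> N}"
    proof (rule linorder_inj_onI)
      fix k l assume kl: "k < l" "k \<in> {k. (k, x) \<in> N}" "l \<in> {k. (k, x) \<in> N}"
      obtain m where m: "1 / Suc m < l - k" using nat_approx_posE[of "l - k"] kl by auto
      have "?\<tau> (l, x) < ?\<tau> (l - 1 / Suc m, x)" using kl(3) by (auto simp: N_def)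
      also have "\<dots> \<le> ?\<tau> (k, x)" using m by (intro toptime_antimono[OF XX]) auto
      finally show "?\<tau> (k, x) \<noteq> ?\<tau> (l, x)" by simp
    qed auto
  qed
  have N0: "emeasure lborel N = 0"
  proof -
    have "emeasure (lborel \<Otimes>\<^sub>M lborel) N = (\<integral>\<^sup>+x. emeasure lborel ((\<lambda>k. (k, x)) -` N) \<partial>lborel)"
      using N by (intro lborel_pair.emeasure_pair_measure_alt2) (simp only: lborel_prod sets_lborel)
    also have "\<dots> = (\<integral>\<^sup>+(x::real^'n). 0 \<partial>lborel)"
      using slice by (intro nn_integral_cong) (simp add: vimage_def emeasure_lborel_countable)
    finally show ?thesis by (simp add: lborel_prod)
  qed
  obtain C where C: "\<And>n. compact (C n)" "\<And>n. C n \<subseteq> \<Omega>" "\<And>n. C n \<subseteq> interior (C (Suc n))"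
    "\<And>K. compact K \<Longrightarrow> K \<subseteq> \<Omega> \<Longrightarrow> \<exists>N. \<forall>n\<ge>N. K \<subseteq> C n"
    using open_Union_compact_subsets[OF O(1)] by metis
  define V where "V n = interior (C n)" for n :: nat
  have V: "open (V n)" "closure (V n) \<subseteq> C n" for n
    unfolding V_def by (intro open_interior closure_minimal interior_subset compact_imp_closed C(1))+
  have Vmono: "V m \<subseteq> V n" if "m \<le> n" for m n
  proof -
    have "incseq V" unfolding V_def by (intro incseq_SucI subset_trans[OF interior_subset C(3)])
    then show ?thesis using that by (auto simp: incseq_def)
  qed
  have XV: "compact (X - V n)" "X - V n \<subseteq> X" for n using X V(1) by (auto intro: compact_diff)
  have XVX: "compact (X - V n)" "continuous_on (X - V n) v" "\<And>z. z \<in> X - V n \<Longrightarrow> \<bar>fst z\<bar> < B" for n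
    using XV vX BX by (auto intro: continuous_on_subset)
  have geV: "c \<le> toptime B v (X - V n) y \<longleftrightarrow> (\<exists>z\<in>above v (X - V n) y. c \<le> fst z)" if "- B < c" for c n y
    by (rule toptime_ge_iff[OF XVX(1,2) _ that]) (rule XVX(3))
  have measV: "toptime B v (X - V n) \<in> borel_measurable borel" for n
    by (rule measurable_toptime[OF XVX(1,2)]) (rule XVX(3))
  have upperV: "fst z \<le> toptime B v (X - V n) y" if "z \<in> above v (X - V n) y" for z n y
    by (rule toptime_upper[OF XVX(1,2) _ that]) (rule XVX(3))
  \<comment> \<open>Planes whose latest contact time is also reached outside V n. These sets
    decrease as V n exhausts \<Omega>.\<close>
  define bad where "bad n = {y \<in> T. ?\<tau> y \<le> toptime B v (X - V n) y}" for n
  have bad: "bad n \<in> sets borel" for n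
  proof -
    have [measurable]: "toptime B v (X - V n) \<in> borel_measurable borel" by (rule measV)
    have "bad n = T \<inter> {y \<in> space borel. ?\<tau> y \<le> toptime B v (X - V n) y}" by (auto simp: bad_def)
    moreover have "{y \<in> space borel. ?\<tau> y \<le> toptime B v (X - V n) y} \<in> sets borel" by measurable
    ultimately show "bad n \<in> sets borel" using T(1) by (simp only: sets.Int)
  qed
  have bdX: "v z \<le> 0" if "z \<in> closure (parabolic_boundary \<Omega>)" for z
  proof -
    have "closed {z \<in> X. v z \<le> 0}"
      using X by (intro continuous_on_closed_Collect_le vX continuous_intros) (auto intro: compact_imp_closed)
    moreover have "parabolic_boundary \<Omega> \<subseteq> {z \<in> X. v z \<le> 0}"
      using bd by (auto simp: parabolic_boundary_def X_def frontier_def)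
    ultimately show ?thesis using closure_minimal that by blast
  qed
  \<comment> \<open>A latest contact point outside \<Omega> has v > 0, so it is off the closure of
    the parabolic boundary and \<open>bottom_point\<close> puts its time into \<open>TT\<close>. A
    lowered plane lies strictly below v in a neighbourhood that contains later points of \<Omega>,
    so its latest time is larger.\<close>
  have inN: "y \<in> N" if y: "y \<in> T" and z: "z \<in> above v X y" "fst z = ?\<tau> y" "z \<notin> \<Omega>" for y z
  proof -
    have zX: "z \<in> X" and lz: "fst y + snd y \<bullet> snd z \<le> v z" using z by (auto simp: above_def)
    have "0 < v z" using pos[OF y, of z] zX lz by (simp add: X_def)
    then have "z \<notin> closure (parabolic_boundary \<Omega>)" by (meson bdX leD)
    from bottom_point[OF O(1) z(3) this BB(2)] obtain A
      where A: "A \<in> BB" "z \<in> A" "\<And>w. w \<in> \<Omega> \<Longrightarrow> w \<in> A \<Longrightarrow> fst z \<le> fst w" by auto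
    have oA: "open A" using A(1) BB(2) topological_basis_open by blast
    \<comment> \<open>Points of \<Omega> close to z are not earlier than z, by the choice of A; as
      \<Omega> \<inter> A \<inter> W is open, a small shift forward makes them strictly
      later.\<close>
    have later: "\<exists>w\<in>\<Omega> \<inter> W. fst z < fst w" "\<exists>w\<in>\<Omega> \<inter> W. fst w < fst z + d" if W: "open W" "z \<in> W" "0 < d" for W and d :: real
    proof -
      have oW: "open (\<Omega> \<inter> (A \<inter> W))" using O oA W by auto
      have "z \<in> (A \<inter> W) \<inter> ball z d" using A W by auto
      moreover have "open ((A \<inter> W) \<inter> ball z d)" using oA W by auto
      ultimately have "(A \<inter> W) \<inter> ball z d \<inter> \<Omega> \<noteq> {}"
        using zX open_Int_closure_eq_empty[of "(A \<inter> W) \<inter> ball z d" \<Omega>] by (auto simp: X_def)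
      then obtain w where w: "w \<in> \<Omega>" "w \<in> A" "w \<in> W" "dist z w < d" by auto
      have "\<bar>fst z - fst w\<bar> \<le> dist z w" using dist_fst_le[of z w] by (simp add: dist_real_def)
      then have "fst w < fst z + d" using w by linarith
      then show "\<exists>w\<in>\<Omega> \<inter> W. fst w < fst z + d" using w by blast
      obtain \<epsilon> where \<epsilon>: "0 < \<epsilon>" "ball w \<epsilon> \<subseteq> \<Omega> \<inter> (A \<inter> W)" using oW w openE by (metis IntI)
      have "(fst w + \<epsilon> / 2, snd w) \<in> ball w \<epsilon>"
        using \<epsilon> by (cases w) (auto simp: dist_prod_def dist_real_def)
      then have "(fst w + \<epsilon> / 2, snd w) \<in> \<Omega> \<inter> W" using \<epsilon> by blast
      moreover have "fst z < fst (fst w + \<epsilon> / 2, snd w)" using A(3)[OF w(1,2)] \<epsilon> by simp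
      ultimately show "\<exists>w\<in>\<Omega> \<inter> W. fst z < fst w" by blast
    qed
    have "fst z = Inf (fst ` (\<Omega> \<inter> A))"
    proof (rule antisym)
      show "fst z \<le> Inf (fst ` (\<Omega> \<inter> A))"
        using later(1)[OF oA A(2), of 1] A(3) by (intro cInf_greatest) auto
      show "Inf (fst ` (\<Omega> \<inter> A)) \<le> fst z"
      proof (rule field_le_epsilon)
        fix d :: real assume "0 < d"
        then obtain w where w: "w \<in> \<Omega> \<inter> A" "fst w < fst z + d" using later(2)[OF oA A(2)] by blast
        have "Inf (fst ` (\<Omega> \<inter> A)) \<le> fst w"
          using w A(3) by (intro cInf_lower) (auto intro!: bdd_belowI[of _ "fst z"])
        then show "Inf (fst ` (\<Omega> \<inter> A)) \<le> fst z + d" using w by simp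
      qed
    qed
    then have "?\<tau> y \<in> TT" using A(1) z(2) by (auto simp: TT_def)
    moreover have "?\<tau> y < ?\<tau> (fst y - 1 / Suc k, snd y)" for k
    proof -
      let ?g = "\<lambda>w. v w - (fst y - 1 / Suc k + snd y \<bullet> snd w)"
      have "continuous_on X ?g" by (intro continuous_intros vX)
      then have "openin (top_of_set X) (X \<inter> ?g -` {0<..})" by (intro continuous_openin_preimage_gen) auto
      then obtain W where W: "open W" "X \<inter> ?g -` {0<..} = X \<inter> W" by (auto simp: openin_open)
      have "z \<in> X \<inter> ?g -` {0<..}" 
      proof -
        have "0 < 1 / real (Suc k)" by simp
        then have "0 < ?g z" using lz by linarith
        then show ?thesis using zX by simp
      qed
      then have "z \<in> W" using W by auto
      from later(1)[OF W(1) this, of 1] obtain w where w: "w \<in> \<Omega>" "w \<in> W" "fst z < fst w" by auto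
      then have "w \<in> X" using closure_subset by (auto simp: X_def)
      then have "w \<in> X \<inter> ?g -` {0<..}" using W w by blast
      then have "w \<in> above v X (fst y - 1 / Suc k, snd y)" by (auto simp: above_def)
      from toptime_upper[OF XX this] show ?thesis using w z by simp
    qed
    ultimately show ?thesis by (simp add: N_def)
  qed
  \<comment> \<open>If all latest contact points lie in \<Omega>, they form a compact subset and fit
    into one V n, so the plane is not in every bad set. Otherwise \<open>inN\<close>
    applies.\<close>
  have "(\<Inter>n. bad n) \<subseteq> N"
  proof
    fix y assume y: "y \<in> (\<Inter>n. bad n)"
    then have yT: "y \<in> T" by (auto simp: bad_def)
    define c where "c = {z \<in> above v X y. fst z = ?\<tau> y}"
    have c: "compact c"
    proof -
      have "c = above v X y \<inter> {z. fst z = ?\<tau> y}" by (auto simp: c_def)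
      then show ?thesis
        by (simp only:) (intro compact_Int_closed compact_above[OF XX] closed_Collect_eq continuous_intros)
    qed
    show "y \<in> N"
    proof (cases "c \<subseteq> \<Omega>")
      case True
      then obtain n where "c \<subseteq> C n" using C(4)[OF c] by blast
      then have cV: "c \<subseteq> V (Suc n)" using C(3)[of n] by (auto simp: V_def)
      obtain z where z: "z \<in> above v X y" "fst z = ?\<tau> y"
        using toptime_attained[OF XX] ne[OF yT] by (metis X_def)
      have "- B < ?\<tau> y" using BX[of z] z by (auto simp: above_def)
      moreover have "?\<tau> y \<le> toptime B v (X - V (Suc n)) y" using y by (auto simp: bad_def)
      ultimately obtain w where w: "w \<in> above v (X - V (Suc n)) y" "?\<tau> y \<le> fst w"
        using geV[of "?\<tau> y" "Suc n" y] by blast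
      then have wX: "w \<in> above v X y" "w \<notin> V (Suc n)" by (auto simp: above_def)
      moreover have "fst w = ?\<tau> y" using toptime_upper[OF XX wX(1)] w by simp
      ultimately show ?thesis using cV by (auto simp: c_def)
    next
      case False
      then show ?thesis using inN[OF yT] by (auto simp: c_def)
    qed
  qed
  then have "emeasure lborel (\<Inter>n. bad n) = 0"
    using N N0 emeasure_mono[of "\<Inter>n. bad n" N lborel] by simp
  moreover have "(\<lambda>n. emeasure lborel (bad n)) \<longlonglongrightarrow> emeasure lborel (\<Inter>n. bad n)"
  proof (rule Lim_emeasure_decseq)
    show "decseq bad"
    proof (rule decseq_SucI)
      fix n
      have "toptime B v (X - V (Suc n)) y \<le> toptime B v (X - V n) y" for y
        using Vmono[of n "Suc n"] XV(1)
        by (intro toptime_mono_set[OF XVX(1,2)]) (auto intro: XVX(3))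
      then show "bad (Suc n) \<subseteq> bad n" unfolding bad_def using order_trans by blast
    qed
    show "emeasure lborel (bad n) \<noteq> \<infinity>" for n
      using emeasure_mono[of "bad n" T lborel] T by (auto simp: bad_def top_unique)
  qed (use bad in auto)
  ultimately have "(\<lambda>n. emeasure lborel (bad n)) \<longlonglongrightarrow> 0" by simp
  then have "\<forall>\<^sub>F n in sequentially. emeasure lborel (bad n) < e" using e by (rule order_tendstoD)
  then obtain n where n: "emeasure lborel (bad n) < e" by (meson eventually_sequentially order_refl)
  show thesis
  proof (rule that[of "V n" "bad n"])
    show "open (V n)" by (rule V)
    show "compact (closure (V n))" using V(2)[of n] C(1)[of n] by (meson closed_closure compact_imp_bounded bounded_subset compact_eq_bounded_closed)
    show "closure (V n) \<subseteq> \<Omega>" using V(2) C(2) by blast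
    show "bad n \<in> sets borel" "emeasure lborel (bad n) < e" using bad n by auto
    fix y z assume y: "y \<in> T - bad n" and z: "z \<in> above v (closure \<Omega>) y" "\<And>w. w \<in> above v (closure \<Omega>) y \<Longrightarrow> fst w \<le> fst z"
    show "z \<in> V n"
    proof (rule ccontr)
      assume "z \<notin> V n"
      then have "z \<in> above v (X - V n) y" using z(1) by (auto simp: above_def X_def)
      from upperV[OF this] have "fst z \<le> toptime B v (X - V n) y" .
      moreover have "above v X y \<noteq> {}" using z(1) by (auto simp: X_def)
      then obtain w where "w \<in> above v X y" "fst w = ?\<tau> y"
        using toptime_attained[OF XX, of y] by blast
      then have "?\<tau> y \<le> fst z" using z(2)[of w] by (simp add: X_def)
      ultimately show False using y by (auto simp: bad_def)
    qed
  qed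
qed

text \<open>As v <= vn, the latest meeting time of the plane with vn is not earlier than that with
  v. A limit of such meeting points outside U would, by uniform convergence, be a latest meeting
  point for v itself, and those lie in U.\<close>

lemma contact_stability:
  fixes v :: "real \<times> (real^'n) \<Rightarrow> real"
  assumes U: "open U" "compact (closure U)" and UX: "closure U \<subseteq> X"
    and v: "continuous_on X v" and X: "compact X"
    and ne: "above v X y \<noteq> {}"
    and top: "\<And>z. z \<in> above v X y \<Longrightarrow> (\<And>w. w \<in> above v X y \<Longrightarrow> fst w \<le> fst z) \<Longrightarrow> z \<in> U"
    and vn: "\<And>n. continuous_on (closure U) (vn n)" "\<And>n z. z \<in> closure U \<Longrightarrow> v z \<le> vn n z"
    and conv: "\<And>d. 0 < d \<Longrightarrow> \<forall>\<^sub>F n in sequentially. \<forall>z\<in>closure U. vn n z \<le> v z + d"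
  shows "\<forall>\<^sub>F n in sequentially. \<exists>z\<in>U. vn n z = fst y + snd y \<bullet> snd z \<and>
    (\<forall>w\<in>U. fst z < fst w \<longrightarrow> vn n w < fst y + snd y \<bullet> snd w)"
proof -
  let ?K = "closure U"
  obtain r where r: "\<And>z. z \<in> X \<Longrightarrow> norm z \<le> r"
    using compact_imp_bounded[OF X] by (auto simp: bounded_iff)
  define B where "B = \<bar>r\<bar> + 1"
  have BX: "\<bar>fst z\<bar> < B" if "z \<in> X" for z
    using r[OF that] norm_fst_le[of "fst z" "snd z"] by (auto simp: B_def)
  have BK: "\<bar>fst z\<bar> < B" if "z \<in> ?K" for z by (rule BX[OF subsetD[OF UX that]])
  obtain zs where zs: "zs \<in> above v X y" "fst zs = toptime B v X y"
    using toptime_attained[OF X v BX ne] by blast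
  have zs_top: "fst w \<le> fst zs" if "w \<in> above v X y" for w
    using toptime_upper[OF X v BX that] zs by simp
  have zsU: "zs \<in> U" using top[OF zs(1)] zs_top by blast
  have zsn: "zs \<in> above (vn n) ?K y" for n
    using zs(1) zsU closure_subset[of U] vn(2)[of zs n] by (auto simp: above_def)
  have "\<exists>z\<in>above (vn n) ?K y. \<forall>w\<in>above (vn n) ?K y. fst w \<le> fst z" for n
  proof -
    have "above (vn n) ?K y \<noteq> {}" using zsn by blast
    from toptime_attained[OF U(2) vn(1) BK this] show ?thesis
      using toptime_upper[OF U(2) vn(1) BK] by metis
  qed
  then obtain z where z: "\<And>n. z n \<in> above (vn n) ?K y" "\<And>n w. w \<in> above (vn n) ?K y \<Longrightarrow> fst w \<le> fst (z n)"
    by metis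
  have evU: "\<forall>\<^sub>F n in sequentially. z n \<in> U"
  proof (rule ccontr)
    assume "\<not> ?thesis"
    then have "\<exists>\<^sub>\<infinity>n. z n \<notin> U" by (simp add: frequently_def cofinite_eq_sequentially)
    then have inf: "infinite {n. z n \<notin> U}" by (simp add: INFM_iff_infinite)
    define s where "s = enumerate {n. z n \<notin> U}"
    have s: "strict_mono s" "\<And>n. z (s n) \<notin> U"
      using inf strict_mono_enumerate[OF inf] enumerate_in_set[OF inf] by (auto simp: s_def)
    have "compact (?K - U)" using U by (auto intro: compact_diff)
    moreover have "\<forall>n. z (s n) \<in> ?K - U" using z(1) s by (auto simp: above_def)
    ultimately obtain zl t where zl: "zl \<in> ?K - U" "strict_mono t" "((\<lambda>n. z (s n)) \<circ> t) \<longlonglongrightarrow> zl"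
      unfolding compact_def by (metis (lifting))
    then have lim: "(\<lambda>n. z (s (t n))) \<longlonglongrightarrow> zl" by (simp add: o_def)
    have zlK: "zl \<in> ?K" and zlX: "zl \<in> X" using zl UX by auto
    have vlim: "(\<lambda>n. v (z (s (t n)))) \<longlonglongrightarrow> v zl"
      using z(1) by (intro continuous_on_tendsto_compose[OF continuous_on_subset[OF v UX] lim zlK] always_eventually)
        (auto simp: above_def)
    have st: "filterlim (\<lambda>n. s (t n)) sequentially sequentially"
      by (rule filterlim_compose[OF filterlim_subseq[OF s(1)] filterlim_subseq[OF zl(2)]])
    have "fst y + snd y \<bullet> snd zl \<le> v zl"
    proof (rule field_le_epsilon)
      fix d :: real assume d: "0 < d"
      have "\<forall>\<^sub>F n in sequentially. \<forall>z\<in>?K. vn (s (t n)) z \<le> v z + d"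
        by (rule eventually_compose_filterlim[OF conv[OF d] st])
      then have ev: "\<forall>\<^sub>F n in sequentially. fst y + snd y \<bullet> snd (z (s (t n))) \<le> v (z (s (t n))) + d"
      proof eventually_elim
        case (elim n)
        then show ?case using z(1)[of "s (t n)"] by (force simp: above_def)
      qed
      show "fst y + snd y \<bullet> snd zl \<le> v zl + d"
        by (rule tendsto_le[OF _ _ _ ev]) (auto intro!: tendsto_intros vlim lim)
    qed
    then have zlab: "zl \<in> above v X y" using zlX by (simp add: above_def)
    have "fst zs \<le> fst zl"
      by (rule tendsto_lowerbound[OF tendsto_fst[OF lim]]) (auto intro!: always_eventually z(2) zsn)
    then have "zl \<in> U" using top[OF zlab] zs_top order_trans by blast
    then show False using zl by simp
  qed
  then show ?thesis
  proof eventually_elim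
    case (elim n)
    have later: "vn n w < fst y + snd y \<bullet> snd w" if "w \<in> U" "fst (z n) < fst w" for w
    proof (rule ccontr)
      assume "\<not> ?thesis"
      then have "w \<in> above (vn n) ?K y" using that closure_subset[of U] by (auto simp: above_def)
      then show False using z(2)[of w n] that by simp
    qed
    \<comment> \<open>At strictly later times vn lies below the plane; letting the time decrease to
      that of z n gives the inequality opposite to membership in \<open>above\<close>.\<close>
    have "vn n (z n) \<le> fst y + snd y \<bullet> snd (z n)"
    proof -
      obtain e where e: "0 < e" "ball (z n) e \<subseteq> U" using elim U(1) openE by blast
      define w where "w h = (fst (z n) + h, snd (z n))" for h :: real
      have wU: "w h \<in> U" if "0 < h" "h < e" for h
      proof -
        have "dist (z n) (w h) = h" using that by (cases "z n") (simp add: w_def dist_prod_def dist_real_def)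
        then show ?thesis using e that by auto
      qed
      have wc: "(w \<longlongrightarrow> z n) (at_right 0)"
      proof -
        have "continuous_on UNIV w" unfolding w_def[abs_def] by (intro continuous_intros)
        then have "(w \<longlongrightarrow> w 0) (at 0)" by (simp add: continuous_on_def)
        then show ?thesis by (simp add: w_def filterlim_at_split)
      qed
      have ev: "\<forall>\<^sub>F h in at_right 0. 0 < h \<and> h < e"
        using e(1) unfolding eventually_at_right_field by (intro exI[of _ e]) auto
      have "((\<lambda>h. vn n (w h)) \<longlongrightarrow> vn n (z n)) (at_right 0)"
        by (rule continuous_on_tendsto_compose[OF vn(1) wc])
           (use elim closure_subset[of U] wU in \<open>auto intro!: eventually_mono[OF ev]\<close>)
      moreover have "((\<lambda>h. fst y + snd y \<bullet> snd (w h)) \<longlongrightarrow> fst y + snd y \<bullet> snd (z n)) (at_right 0)"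
        by (intro tendsto_intros wc)
      moreover have "\<forall>\<^sub>F h in at_right 0. vn n (w h) \<le> fst y + snd y \<bullet> snd (w h)"
        using ev
      proof eventually_elim
        case (elim h)
        then show ?case using later[OF wU] by (simp add: w_def less_imp_le)
      qed
      ultimately show ?thesis using tendsto_le[OF trivial_limit_at_right_real] by blast
    qed
    then show ?case using elim later z(1)[of n] by (intro bexI[of _ "z n"]) (auto simp: above_def)
  qed
qed

text \<open>By continuity from later times the plane is also above v at the time of z, and it
  touches at z. The first-order condition in space then identifies the slope with Dv z.\<close>

lemma contact_map_eqI:
  assumes sd: "smooth_data v vt Dv H g" and U: "open U"
    and z: "z \<in> U" "v z = fst y + snd y \<bullet> snd z"
    and later: "\<And>w. w \<in> U \<Longrightarrow> fst z < fst w \<Longrightarrow> v w < fst y + snd y \<bullet> snd w"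
  shows "z \<in> contact v Dv U" "contact_map v Dv z = y"
proof -
  have same: "v (fst z, x) \<le> fst y + snd y \<bullet> x" if x: "(fst z, x) \<in> U" for x
  proof -
    have c: "continuous_on UNIV (\<lambda>s. v (s, x))"
      by (intro continuous_on_compose2[OF cont(1)[OF sd open_UNIV]] continuous_intros) auto
    then have lim: "((\<lambda>s. v (s, x)) \<longlongrightarrow> v (fst z, x)) (at_right (fst z))"
      by (simp add: continuous_on_def filterlim_at_split)
    have "continuous_on UNIV (\<lambda>s. (s, x))" by (intro continuous_intros)
    then have "open ((\<lambda>s. (s, x)) -` U)" using U open_vimage by blast
    then have "\<forall>\<^sub>F s in at_right (fst z). (s, x) \<in> U"
      using x eventually_nhds_in_open[of "(\<lambda>s. (s, x)) -` U" "fst z"]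
      by (auto elim!: eventually_mono simp: eventually_at_filter)
    moreover have "\<forall>\<^sub>F s in at_right (fst z). fst z < s" by (simp add: eventually_at_right_less)
    ultimately have "\<forall>\<^sub>F s in at_right (fst z). v (s, x) \<le> fst y + snd y \<bullet> x"
    proof eventually_elim
      case (elim s)
      then show ?case using later[of "(s, x)"] by simp
    qed
    then show ?thesis using tendsto_upperbound[OF lim] by simp
  qed
  have Dz: "Dv z = snd y"
  proof -
    define f where "f x = v (fst z, x) - (fst y + snd y \<bullet> x)" for x
    have "((\<lambda>x. (fst z, x)) has_derivative (\<lambda>k. (0, k))) (at (snd z))" by (auto intro!: derivative_eq_intros)
    from has_derivative_compose[OF this v_deriv[OF sd open_UNIV]]
    have "((\<lambda>x. v (fst z, x)) has_derivative (\<lambda>k. Dv z \<bullet> k)) (at (snd z))" by simp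
    then have "(f has_derivative (\<lambda>k. Dv z \<bullet> k - snd y \<bullet> k)) (at (snd z))"
      unfolding f_def[abs_def] by (auto intro!: derivative_eq_intros)
    moreover have "continuous_on UNIV (\<lambda>x. (fst z, x))" by (intro continuous_intros)
    then have "open ((\<lambda>x. (fst z, x)) -` U)" using U open_vimage by blast
    ultimately have "(\<lambda>k. Dv z \<bullet> k - snd y \<bullet> k) = (\<lambda>k. 0)"
      using z same by (intro differential_zero_maxmin[of "snd z" "(\<lambda>x. (fst z, x)) -` U" f]) (auto simp: f_def)
    then have "(Dv z - snd y) \<bullet> (Dv z - snd y) = 0" by (metis inner_diff_left)
    then show ?thesis by simp
  qed
  show "z \<in> contact v Dv U"
    unfolding contact_def using z(1)
  proof (simp, intro ballI impI)
    fix w assume w: "w \<in> U" "fst z < fst w"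
    then show "v w \<le> v z + Dv z \<bullet> (snd w - snd z)"
      using later[OF w] z(2) by (simp add: Dz inner_diff_right)
  qed
  show "contact_map v Dv z = y"
    by (simp add: contact_map_def Dz z(2) inner_commute)
qed

section \<open>Smooth approximation\<close>

lemma Basis_pair_expand:
  fixes y :: "real^'n"
  shows "(t, y) = t *\<^sub>R (1, 0) + (\<Sum>i\<in>UNIV. (y $ i) *\<^sub>R (0::real, axis i (1::real)))"
proof -
  have "(\<Sum>i\<in>UNIV. (y $ i) *\<^sub>R (0::real, axis i (1::real))) = (0, \<Sum>i\<in>UNIV. (y $ i) *\<^sub>R axis i 1)"
    by (simp add: sum_prod)
  also have "(\<Sum>i\<in>UNIV. (y $ i) *\<^sub>R axis i (1::real)) = y"
    using basis_expansion[of y] by (simp add: scalar_mult_eq_scaleR)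
  finally show ?thesis by simp
qed

lemma mixed_int_add_finite:
  assumes [measurable]: "f \<in> borel_measurable borel" "g \<in> borel_measurable borel" and Q: "0 < Q" "Q \<le> P"
    and fin: "mixed_int Q P f < top" "mixed_int Q P g < top"
  shows "mixed_int Q P (\<lambda>z. f z + g z) < top"
proof -
  have "mixed_int Q P (\<lambda>z. f z + g z) \<le> mixed_int Q P (\<lambda>z. 2 * max (f z) (g z))"
    using Q by (intro mixed_int_mono) (auto simp: mult_2 intro: add_mono)
  also have "\<dots> = epow 2 Q * mixed_int Q P (\<lambda>z. max (f z) (g z))"
    by (rule mixed_int_cmult) (use Q in auto)
  also have "\<dots> \<le> epow 2 Q * (mixed_int Q P f + mixed_int Q P g)"
    by (intro mult_left_mono mixed_int_max_le) (use Q in auto)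
  also have "\<dots> < top"
    using fin Q by (auto simp: ennreal_mult_less_top intro!: epow_less_top)
  finally show ?thesis .
qed

lemma mixed_int_sum_finite:
  assumes "finite I" "\<And>i. i \<in> I \<Longrightarrow> f i \<in> borel_measurable borel" and Q: "0 < Q" "Q \<le> P"
    and "\<And>i. i \<in> I \<Longrightarrow> mixed_int Q P (f i) < top"
  shows "mixed_int Q P (\<lambda>z. \<Sum>i\<in>I. f i z) < top"
  using assms(1,2,5)
proof (induction rule: finite_induct)
  case empty
  have "epow 0 P = 0" "epow 0 (Q / P) = 0" using Q by auto
  then show ?case by (simp add: mixed_int_def)
next
  case (insert i I)
  then show ?case using Q by (simp del: sum.insert_remove add: mixed_int_add_finite)
qed

(* The larger exponent belongs to the inner variable, so the roles of time and space depend on the exponents. *)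
definition smixed :: "real \<Rightarrow> real \<Rightarrow> (real \<times> (real^'n) \<Rightarrow> ennreal) \<Rightarrow> ennreal" where
  "smixed q p F = (if q < p then mixed_int q p F else mixed_int p q (\<lambda>z. F (snd z, fst z)))"

lemma mixed_norm_smixed:
  assumes "1 < q" "1 < p"
  shows "mixed_norm (ennreal q) (ennreal p) F = epow (smixed q p F) (1 / min q p)"
proof -
  have 1: "recip (ennreal s) = 1 / s" "enn2real (ennreal s) = s" "ennreal s \<noteq> top" if "1 < s" for s
    using that by (simp_all add: recip_def inverse_ennreal inverse_eq_divide)
  show ?thesis
  proof (cases "q < p")
    case True
    then have "ennreal q < ennreal p" using assms by (intro ennreal_lessI) auto
    then show ?thesis using True assms 1
      by (simp add: mixed_norm_def Lp_norm_def smixed_def mixed_int_def epow_epow min_def)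
  next
    case False
    then have "\<not> ennreal q < ennreal p" using assms by (simp add: not_less ennreal_leI)
    then show ?thesis using False assms 1
      by (simp add: mixed_norm_def Lp_norm_def smixed_def mixed_int_def epow_epow min_def)
  qed
qed

lemma measurable_swap_borel:
  assumes "F \<in> borel_measurable borel"
  shows "(\<lambda>z. F (snd z, fst z)) \<in> borel_measurable (borel :: ('a::euclidean_space \<times> 'b::euclidean_space) measure)"
  by (rule measurable_compose[OF _ assms]) (intro borel_measurable_continuous_onI continuous_intros)

lemma smixed_add_finite:
  assumes m: "f \<in> borel_measurable borel" "g \<in> borel_measurable borel" and q: "1 < q" "1 < p"
    and fin: "smixed q p f < top" "smixed q p g < top"
  shows "smixed q p (\<lambda>z. f z + g z) < top"
proof (cases "q < p")
  case True
  then show ?thesis using mixed_int_add_finite[OF m, of q p] q fin by (simp add: smixed_def)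
next
  case False
  then show ?thesis
    using mixed_int_add_finite[OF measurable_swap_borel[OF m(1)] measurable_swap_borel[OF m(2)], of p q] q fin
    by (simp add: smixed_def)
qed

lemma smixed_sum_finite:
  assumes "finite I" "\<And>i. i \<in> I \<Longrightarrow> f i \<in> borel_measurable borel" and q: "1 < q" "1 < p"
    and "\<And>i. i \<in> I \<Longrightarrow> smixed q p (f i) < top"
  shows "smixed q p (\<lambda>z. \<Sum>i\<in>I. f i z) < top"
proof (cases "q < p")
  case True
  then show ?thesis using mixed_int_sum_finite[of I f q p] assms by (simp add: smixed_def)
next
  case False
  have "(\<lambda>z. f i (snd z, fst z)) \<in> borel_measurable borel" if "i \<in> I" for i
    by (rule measurable_swap_borel[OF assms(2)[OF that]])
  then show ?thesis
    using mixed_int_sum_finite[of I "\<lambda>i z. f i (snd z, fst z)" p q] assms False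
    by (simp add: smixed_def)
qed

lemma borel_measurable_indicator_times:
  assumes "\<Omega> \<in> sets borel" "f \<in> borel_measurable (restrict_space borel \<Omega>)"
  shows "(\<lambda>z. indicator \<Omega> z * (f z :: real)) \<in> borel_measurable borel"
  using assms by (subst (asm) borel_measurable_restrict_space_iff) auto

lemma mixed_L_D:
  assumes f: "f \<in> mixed_L (ennreal q) (ennreal p) \<Omega>" and O: "open \<Omega>" and q: "1 < q" "1 < p"
  shows "(\<lambda>z. indicator \<Omega> z * f z) \<in> borel_measurable borel" "smixed q p (\<lambda>z. ennreal \<bar>indicator \<Omega> z * f z\<bar>) < top"
proof -
  show "(\<lambda>z. indicator \<Omega> z * f z) \<in> borel_measurable borel"
    using f O by (intro borel_measurable_indicator_times) (auto simp: mixed_L_def)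
  have "mixed_norm (ennreal q) (ennreal p) (\<lambda>z. indicator \<Omega> z * ennreal \<bar>f z\<bar>) < top"
    using f by (simp add: mixed_L_def mixed_norm_on_def)
  also have "(\<lambda>z. indicator \<Omega> z * ennreal \<bar>f z\<bar>) = (\<lambda>z. ennreal \<bar>indicator \<Omega> z * f z\<bar>)"
    by (auto simp: fun_eq_iff indicator_def)
  finally have "epow (smixed q p (\<lambda>z. ennreal \<bar>indicator \<Omega> z * f z\<bar>)) (1 / min q p) < top"
    by (simp only: mixed_norm_smixed[OF q])
  then show "smixed q p (\<lambda>z. ennreal \<bar>indicator \<Omega> z * f z\<bar>) < top"
    using q epow_eq_top_iff[of "1 / min q p"] by (auto simp: less_top[symmetric])
qed

lemma nnconv_mono:
  "(\<And>w. f w \<le> g w) \<Longrightarrow> nnconv \<mu> f z \<le> nnconv \<mu> g z"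
  unfolding nnconv_def by (intro nn_integral_mono)

lemma nnconv_add:
  assumes "sets \<mu> = sets borel" and m: "f \<in> borel_measurable borel" "g \<in> borel_measurable borel"
  shows "nnconv \<mu> (\<lambda>z. f z + g z) z = nnconv \<mu> f z + nnconv \<mu> g z"
proof -
  have "(\<lambda>s. z - s) \<in> borel \<rightarrow>\<^sub>M borel" by simp
  from measurable_compose[OF this m(1)] measurable_compose[OF this m(2)]
  have "(\<lambda>s. f (z - s)) \<in> borel_measurable \<mu>" "(\<lambda>s. g (z - s)) \<in> borel_measurable \<mu>"
    by (simp_all add: measurable_cong_sets[OF assms(1) refl])
  then show ?thesis unfolding nnconv_def by (rule nn_integral_add)
qed

lemma nnconv_sum:
  assumes "sets \<mu> = sets borel" "finite I" "\<And>i. i \<in> I \<Longrightarrow> f i \<in> borel_measurable borel"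
  shows "nnconv \<mu> (\<lambda>z. \<Sum>i\<in>I. f i z) z = (\<Sum>i\<in>I. nnconv \<mu> (f i) z)"
  using assms(2,3)
proof (induction rule: finite_induct)
  case (insert i I)
  have "(\<lambda>z. \<Sum>i\<in>I. f i z) \<in> borel_measurable borel" using insert by (intro borel_measurable_sum) auto
  then show ?case using insert nnconv_add[OF assms(1), of "f i" "\<lambda>z. \<Sum>i\<in>I. f i z" z] by simp
qed (simp add: nnconv_def)

text \<open>Only points within e of z contribute, and these lie in K. The cut-offs by \<Omega>,
  \<Omega>0 and K are therefore interchangeable inside the integral.\<close>

lemma conv_kern_weak_deriv:
  assumes O: "open \<Omega>0" and w: "weak_deriv \<Omega>0 vs u v" and K: "K \<subseteq> \<Omega>0" and e: "0 < e" and z: "cball z e \<subseteq> K"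
    and sub: "\<Omega>0 \<subseteq> \<Omega>"
  shows "(\<integral>w. indicator \<Omega> w * u w * dir_derivs vs (kern e) (z - w) \<partial>lborel) = moll e (\<lambda>w. indicator K w * v w) z"
proof -
  have out: "kern e (z - w) = 0" "dir_derivs vs (kern e) (z - w) = 0" if "w \<notin> K" for w
  proof -
    have "e < norm (z - w)" using z that by (force simp: dist_norm subset_iff mem_cball not_le[symmetric])
    then show "kern e (z - w) = 0" "dir_derivs vs (kern e) (z - w) = 0"
      using kern_zero[OF e] dir_derivs_zero_outside[OF kern_smoothC kern_zero[OF e]] by auto
  qed
  have "(\<integral>w. indicator \<Omega> w * u w * dir_derivs vs (kern e) (z - w) \<partial>lborel)
    = (\<integral>w. indicator \<Omega>0 w * u w * dir_derivs vs (kern e) (z - w) \<partial>lborel)"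
  proof (intro Bochner_Integration.integral_cong refl)
    fix w show "indicator \<Omega> w * u w * dir_derivs vs (kern e) (z - w) = indicator \<Omega>0 w * u w * dir_derivs vs (kern e) (z - w)"
      using out(2)[of w] K sub by (cases "w \<in> K") (auto simp: indicator_def subset_iff)
  qed
  also have "\<dots> = (\<integral>w. indicator \<Omega>0 w * v w * kern e (z - w) \<partial>lborel)"
    by (rule conv_weak_deriv[OF O w kern_smoothC kern_zero[OF e]]) (use z K in auto)
  also have "\<dots> = moll e (\<lambda>w. indicator K w * v w) z"
    unfolding moll_def
  proof (intro Bochner_Integration.integral_cong refl)
    fix w show "indicator \<Omega>0 w * v w * kern e (z - w) = indicator K w * v w * kern e (z - w)"
      using out(1)[of w] K by (cases "w \<in> K") (auto simp: indicator_def subset_iff)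
  qed
  finally show ?thesis .
qed

lemma locally_integrable_onD:
  "locally_integrable_on \<Omega> f \<Longrightarrow> compact K \<Longrightarrow> K \<subseteq> \<Omega> \<Longrightarrow> integrable lborel (\<lambda>w. indicator K w * f w)"
  by (auto simp: locally_integrable_on_def set_integrable_def)

text \<open>u, set to 0 outside \<Omega>, is mollified and then raised by its uniform error on the
  closure of U, so that the approximations lie above u, as \<open>contact_stability\<close>
  requires. \<open>gg\<close> is a mixed-norm majorant whose convolutions dominate the time
  derivatives and the diagonal second derivatives.\<close>

lemma smooth_approximation:
  fixes \<Omega> U :: "(real \<times> (real^'n)) set"
  assumes O: "open \<Omega>" "bounded \<Omega>" and u: "continuous_on (closure \<Omega>) u" and sob: "sobolev_derivs \<Omega> u ut Du D2u"
    and W: "u \<in> W12_loc (ennreal q) (ennreal p) \<Omega>" and q: "1 < q" "1 < p"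
    and U: "open U" "compact (closure U)" "closure U \<subseteq> \<Omega>"
  obtains vn vtn :: "nat \<Rightarrow> real \<times> (real^'n) \<Rightarrow> real" and Dvn Hn gn \<epsilon> gg where
    "\<And>n. smooth_data (vn n) (vtn n) (Dvn n) (Hn n) (gn n)"
    "\<And>n z. z \<in> closure U \<Longrightarrow> u z \<le> vn n z"
    "\<And>d. 0 < d \<Longrightarrow> \<forall>\<^sub>F n in sequentially. \<forall>z\<in>closure U. vn n z \<le> u z + d"
    "AE z in lborel. z \<in> U \<longrightarrow> (\<lambda>n. vtn n z) \<longlonglongrightarrow> ut z"
    "AE z in lborel. z \<in> U \<longrightarrow> (\<forall>i. (\<lambda>n. Dvn n z $ i) \<longlonglongrightarrow> Du z $ i)"
    "AE z in lborel. z \<in> U \<longrightarrow> (\<forall>i j. (\<lambda>n. Hn n z $ i $ j) \<longlonglongrightarrow> D2u z $ i $ j)"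
    "gg \<in> borel_measurable borel" "\<And>z. gg z < top" "smixed q p gg < top" "\<And>n. 0 < \<epsilon> n"
    "\<And>n z. z \<in> U \<Longrightarrow> ennreal (1 + \<bar>vtn n z\<bar> + (\<Sum>i\<in>UNIV. \<bar>Hn n z $ i $ i\<bar>)) \<le> nnconv (kmeas (\<epsilon> n)) gg z"
proof -
  obtain r where r: "0 < r" "(\<Union>x\<in>closure U. cball x r) \<subseteq> \<Omega>"
    using compact_subset_open_imp_cball_epsilon_subset[OF U(2) O(1) U(3)] by blast
  \<comment> \<open>The radius r / 2 leaves room for kernels of that size. The larger open set
    \<Omega>' still has compact closure in \<Omega>, so the local Sobolev hypothesis supplies global
    norms on it.\<close>
  define K where "K = (\<Union>x\<in>closure U. cball x (r / 2))"
  define \<Omega>' where "\<Omega>' = (\<Union>x\<in>closure U. ball x r)"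
  have K: "compact K" unfolding K_def by (rule compact_minkowski_sum_cball[OF U(2)])
  have O': "open \<Omega>'" by (auto simp: \<Omega>'_def)
  have sub: "K \<subseteq> \<Omega>'" "\<Omega>' \<subseteq> (\<Union>x\<in>closure U. cball x r)"
    unfolding K_def \<Omega>'_def using r(1) by (intro UN_mono order_refl; auto)+
  have K2: "compact (\<Union>x\<in>closure U. cball x r)" by (rule compact_minkowski_sum_cball[OF U(2)])
  have O'c: "compact (closure \<Omega>')" "closure \<Omega>' \<subseteq> \<Omega>"
  proof -
    have cl: "closure \<Omega>' \<subseteq> (\<Union>x\<in>closure U. cball x r)"
      using K2 sub(2) by (intro closure_minimal) (auto intro: compact_imp_closed)
    then show "closure \<Omega>' \<subseteq> \<Omega>" using r(2) by blast
    show "compact (closure \<Omega>')"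
      using bounded_subset[OF compact_imp_bounded[OF K2] sub(2)] by simp
  qed
  have KO: "K \<subseteq> \<Omega>" "\<Omega>' \<subseteq> \<Omega>" using sub r(2) by blast+
  have cb: "cball z e \<subseteq> K" if "z \<in> closure U" "e \<le> r / 2" for z e
    using that by (auto simp: K_def)
  define f0 where "f0 w = indicator \<Omega> w * u w" for w
  have f0: "integrable lborel f0"
  proof -
    have "compact (closure \<Omega>)" using O by simp
    from borel_integrable_compact[OF this u] have "set_integrable lborel (closure \<Omega>) u"
      by (simp add: set_integrable_def)
    then have "set_integrable lborel \<Omega> u"
      by (rule set_integrable_subset) (use O closure_subset in auto)
    then show ?thesis by (simp add: set_integrable_def f0_def[abs_def])
  qed
  have wt: "weak_deriv \<Omega> [(1, 0)] u ut" and wD: "weak_deriv \<Omega> [(0, axis i 1)] u (\<lambda>z. Du z $ i)"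
    and wH: "weak_deriv \<Omega> [(0, axis i 1), (0, axis j 1)] u (\<lambda>z. D2u z $ i $ j)" for i j
    using sob by (auto simp: sobolev_derivs_def)
  define F where "F = {\<lambda>w. indicator K w * ut w} \<union> range (\<lambda>i w. indicator K w * Du w $ i) \<union>
    range (\<lambda>(i, j) w. indicator K w * D2u w $ i $ j)"
  have F: "finite F" by (simp add: F_def)
  have Fint: "integrable lborel f" if "f \<in> F" for f
    using that wt wD wH locally_integrable_onD[OF _ K KO(1)]
    by (auto simp: F_def weak_deriv_def)
  obtain \<epsilon> :: "nat \<Rightarrow> real" where \<epsilon>: "\<And>n. 0 < \<epsilon> n" "\<And>n. \<epsilon> n \<le> r / 2" "\<epsilon> \<longlonglongrightarrow> 0"
    "\<And>f. f \<in> F \<Longrightarrow> AE z in lborel. (\<lambda>n. moll (\<epsilon> n) f z) \<longlonglongrightarrow> f z"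
    using moll_AE_sequence[OF F Fint, of "r / 2"] r(1) by auto
  define cv where "cv n vs z = (\<integral>w. f0 w * dir_derivs vs (kern (\<epsilon> n)) (z - w) \<partial>lborel)" for n vs z
  have cv_deriv: "(cv n vs has_derivative (\<lambda>k. \<integral>w. f0 w * dir_deriv k (dir_derivs vs (kern (\<epsilon> n))) (z - w) \<partial>lborel)) (at z)" for n vs z
    unfolding cv_def[abs_def]
    by (rule conv_has_derivative[OF smoothC_dir_derivs[OF kern_smoothC] _ f0])
       (rule dir_derivs_zero_outside[OF kern_smoothC kern_zero[OF \<epsilon>(1)]])
  have cv_deriv': "(cv n vs has_derivative (\<lambda>k. fst k * cv n ((1, 0) # vs) z + (\<Sum>i\<in>UNIV. snd k $ i * cv n ((0, axis i 1) # vs) z))) (at z)" for n vs z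
  proof -
    define L where "L k = (\<integral>w. f0 w * dir_deriv k (dir_derivs vs (kern (\<epsilon> n))) (z - w) \<partial>lborel)" for k
    have d: "(cv n vs has_derivative L) (at z)" using cv_deriv[of n vs z] by (simp add: L_def[abs_def])
    have lin: "linear L" by (rule has_derivative_linear[OF d])
    have "L k = fst k * cv n ((1, 0) # vs) z + (\<Sum>i\<in>UNIV. snd k $ i * cv n ((0, axis i 1) # vs) z)" for k
    proof -
      have "L k = L (fst k *\<^sub>R (1, 0) + (\<Sum>i\<in>UNIV. (snd k $ i) *\<^sub>R (0, axis i 1)))"
        using Basis_pair_expand[of "fst k" "snd k"] by simp
      also have "\<dots> = fst k * L (1, 0) + (\<Sum>i\<in>UNIV. snd k $ i * L (0, axis i 1))"
        by (simp add: linear_add[OF lin] linear_sum[OF lin] linear_scale[OF lin] del: scaleR_Pair)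
      finally show ?thesis by (simp add: L_def cv_def)
    qed
    then have "L = (\<lambda>k. fst k * cv n ((1, 0) # vs) z + (\<Sum>i\<in>UNIV. snd k $ i * cv n ((0, axis i 1) # vs) z))"
      by (rule ext)
    then show ?thesis using d by simp
  qed
  have cv_cont: "continuous_on A (cv n vs)" for A n vs
    by (rule has_derivative_continuous_on[OF has_derivative_at_withinI[OF cv_deriv']])
  have cv_meas: "cv n vs \<in> borel_measurable borel" for n vs
    by (intro borel_measurable_continuous_onI cv_cont)
  have moll_cv: "moll (\<epsilon> n) f0 = cv n []" for n
    by (simp add: moll_def[abs_def] cv_def[abs_def])
  have cv_eq: "cv n vs z = moll (\<epsilon> n) (\<lambda>w. indicator K w * v w) z"
    if "z \<in> closure U" "weak_deriv \<Omega>0 vs u v" "open \<Omega>0" "K \<subseteq> \<Omega>0" "\<Omega>0 \<subseteq> \<Omega>" for n vs v z \<Omega>0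
    unfolding cv_def f0_def
    by (rule conv_kern_weak_deriv[OF that(3,2,4) \<epsilon>(1) cb[OF that(1) \<epsilon>(2)] that(5)])
  \<comment> \<open>The uniform error on the closure of U; the inserted 0 keeps the set nonempty if
    U is empty.\<close>
  define err where "err n = Sup (insert 0 ((\<lambda>z. \<bar>moll (\<epsilon> n) f0 z - u z\<bar>) ` closure U))" for n
  have uU: "continuous_on (closure U) u" "continuous_on \<Omega> u"
    using U(3) closure_subset[of \<Omega>] by (auto intro!: continuous_on_subset[OF u])
  have bdd: "bdd_above (insert 0 ((\<lambda>z. \<bar>moll (\<epsilon> n) f0 z - u z\<bar>) ` closure U))" for n
  proof -
    have "compact ((\<lambda>z. \<bar>moll (\<epsilon> n) f0 z - u z\<bar>) ` closure U)"
      unfolding moll_cv by (intro compact_continuous_image continuous_intros cv_cont uU U)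
    then show ?thesis by (intro bounded_imp_bdd_above) (simp add: compact_imp_bounded)
  qed
  have err: "\<bar>moll (\<epsilon> n) f0 z - u z\<bar> \<le> err n" if "z \<in> closure U" for n z
    unfolding err_def using that by (intro cSup_upper bdd) auto
  define vn where "vn n z = moll (\<epsilon> n) f0 z + err n" for n z
  define vtn where "vtn n = cv n [(1, 0)]" for n
  define Dvn where "Dvn n z = (\<chi> i. cv n [(0, axis i 1)] z)" for n z
  define Hn where "Hn n z = (\<chi> i j. cv n [(0, axis i 1), (0, axis j 1)] z)" for n z
  define gn where "gn n z = (\<chi> i. cv n [(1, 0), (0, axis i 1)] z)" for n z
  have sym: "cv n [a, b] z = cv n [b, a] z" for n a b z
    by (simp add: cv_def smoothC_dir_deriv_commute[OF kern_smoothC, of a b])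
  have "smooth_data (vn n) (vtn n) (Dvn n) (Hn n) (gn n)" for n
    unfolding smooth_data_def
  proof (intro conjI allI)
    fix z
    show "(vn n has_derivative (\<lambda>k. vtn n z * fst k + Dvn n z \<bullet> snd k)) (at z)"
    proof -
      have "(cv n [] has_derivative (\<lambda>k. vtn n z * fst k + Dvn n z \<bullet> snd k)) (at z)"
        using cv_deriv'[of n "[]" z] by (simp add: vtn_def Dvn_def inner_vec_def mult.commute)
      then show ?thesis unfolding vn_def[abs_def] moll_cv by (auto intro!: derivative_eq_intros)
    qed
    show "(Dvn n has_derivative (\<lambda>k. Hn n z *v snd k + fst k *\<^sub>R gn n z)) (at z)"
    proof -
      have "((\<lambda>z. Dvn n z $ i) has_derivative (\<lambda>k. (Hn n z *v snd k + fst k *\<^sub>R gn n z) $ i)) (at z)" for i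
        using cv_deriv'[of n "[(0, axis i 1)]" z] sym[of n "(0, axis i 1)"]
        by (simp add: Dvn_def Hn_def gn_def matrix_vector_mult_def add.commute mult.commute)
      then show ?thesis
        by (subst has_derivative_componentwise_within) (auto simp: Basis_vec_def inner_axis)
    qed
    show "transpose (Hn n z) = Hn n z"
      by (simp add: transpose_def Hn_def vec_eq_iff sym)
    show "vtn n \<in> borel_measurable borel" by (simp add: vtn_def cv_meas)
    show "(\<lambda>z. Hn n z $ i $ j) \<in> borel_measurable borel" for i j
      using cv_meas[of n "[(0, axis i 1), (0, axis j 1)]"] by (simp add: Hn_def)
  qed
  moreover have "u z \<le> vn n z" if "z \<in> closure U" for n z
    using err[OF that, of n] by (simp add: vn_def abs_le_iff)
  moreover have "\<forall>\<^sub>F n in sequentially. \<forall>z\<in>closure U. vn n z \<le> u z + d" if d: "0 < d" for d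
  proof -
    obtain e0 where e0: "0 < e0" "\<And>e. 0 < e \<Longrightarrow> e \<le> e0 \<Longrightarrow> \<forall>z\<in>closure U. \<bar>moll e f0 z - u z\<bar> \<le> d / 2"
      using moll_uniform[OF O(1) U(2,3) uU(2) f0, of "d / 2"] d by (auto simp: f0_def)
    have "\<forall>\<^sub>F n in sequentially. \<epsilon> n < e0" using \<epsilon>(3) e0(1) by (rule order_tendstoD)
    then show ?thesis
    proof eventually_elim
      case (elim n)
      have le: "\<forall>z\<in>closure U. \<bar>moll (\<epsilon> n) f0 z - u z\<bar> \<le> d / 2" using e0(2)[OF \<epsilon>(1)] elim by simp
      then have "err n \<le> d / 2" unfolding err_def using d by (intro cSup_least) auto
      show ?case
      proof
        fix z assume "z \<in> closure U"
        then have "\<bar>moll (\<epsilon> n) f0 z - u z\<bar> \<le> d / 2" using le by blast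
        then show "vn n z \<le> u z + d" using \<open>err n \<le> d / 2\<close> unfolding vn_def by linarith
      qed
    qed
  qed
  moreover have UK: "z \<in> closure U" "indicator K z = (1::real)" if "z \<in> U" for z
  proof -
    show "z \<in> closure U" using that closure_subset by blast
    then show "indicator K z = (1::real)" using r(1) by (auto simp: K_def indicator_def intro!: bexI[of _ z])
  qed
  moreover have "AE z in lborel. z \<in> U \<longrightarrow> (\<lambda>n. vtn n z) \<longlonglongrightarrow> ut z"
  proof -
    have "AE z in lborel. (\<lambda>n. moll (\<epsilon> n) (\<lambda>w. indicator K w * ut w) z) \<longlonglongrightarrow> indicator K z * ut z"
      by (rule \<epsilon>(4)) (simp add: F_def)
    then show ?thesis
    proof eventually_elim
      case (elim z)
      show ?case using elim UK[of z] cv_eq[OF _ wt O(1) KO(1) order_refl, of z] by (auto simp: vtn_def)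
    qed
  qed
  moreover have "AE z in lborel. z \<in> U \<longrightarrow> (\<forall>i. (\<lambda>n. Dvn n z $ i) \<longlonglongrightarrow> Du z $ i)"
  proof -
    have "AE z in lborel. (\<lambda>n. moll (\<epsilon> n) (\<lambda>w. indicator K w * Du w $ i) z) \<longlonglongrightarrow> indicator K z * Du z $ i" for i
      by (rule \<epsilon>(4)) (auto simp: F_def)
    then have "AE z in lborel. \<forall>i. (\<lambda>n. moll (\<epsilon> n) (\<lambda>w. indicator K w * Du w $ i) z) \<longlonglongrightarrow> indicator K z * Du z $ i"
      by (simp add: AE_all_countable)
    then show ?thesis
    proof eventually_elim
      case (elim z)
      show ?case using elim UK[of z] cv_eq[OF _ wD O(1) KO(1) order_refl, of z] by (auto simp: Dvn_def)
    qed
  qed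
  moreover have "AE z in lborel. z \<in> U \<longrightarrow> (\<forall>i j. (\<lambda>n. Hn n z $ i $ j) \<longlonglongrightarrow> D2u z $ i $ j)"
  proof -
    have "AE z in lborel. (\<lambda>n. moll (\<epsilon> n) (\<lambda>w. indicator K w * D2u w $ i $ j) z) \<longlonglongrightarrow> indicator K z * D2u z $ i $ j" for i j
      by (rule \<epsilon>(4)) (force simp: F_def)
    then have "AE z in lborel. \<forall>i j. (\<lambda>n. moll (\<epsilon> n) (\<lambda>w. indicator K w * D2u w $ i $ j) z) \<longlonglongrightarrow> indicator K z * D2u z $ i $ j"
      by (simp add: AE_all_countable)
    then show ?thesis
    proof eventually_elim
      case (elim z)
      show ?case using elim UK[of z] cv_eq[OF _ wH O(1) KO(1) order_refl, of z] by (auto simp: Hn_def)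
    qed
  qed
  moreover obtain gg where "gg \<in> borel_measurable borel" "\<And>z. gg z < top" "smixed q p gg < top"
    "\<And>n z. z \<in> U \<Longrightarrow> ennreal (1 + \<bar>vtn n z\<bar> + (\<Sum>i\<in>UNIV. \<bar>Hn n z $ i $ i\<bar>)) \<le> nnconv (kmeas (\<epsilon> n)) gg z"
  proof -
    have "u \<in> W12 (ennreal q) (ennreal p) \<Omega>'" using W O' O'c by (auto simp: W12_loc_def)
    \<comment> \<open>These derivatives may be other versions than ut and D2u. By
      \<open>cv_eq\<close> either version represents the same convolutions \<open>cv\<close> at
      points of U, so the bounds transfer without comparing them.\<close>
    then obtain ut' Du' D2u' where s': "sobolev_derivs \<Omega>' u ut' Du' D2u'"
      "ut' \<in> mixed_L (ennreal q) (ennreal p) \<Omega>'" "\<And>i j. (\<lambda>z. D2u' z $ i $ j) \<in> mixed_L (ennreal q) (ennreal p) \<Omega>'"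
      unfolding W12_def by blast
    have wt': "weak_deriv \<Omega>' [(1, 0)] u ut'"
      and wH': "weak_deriv \<Omega>' [(0, axis i 1), (0, axis j 1)] u (\<lambda>z. D2u' z $ i $ j)" for i j
      using s'(1) by (auto simp: sobolev_derivs_def)
    define g1 where "g1 z = ennreal \<bar>indicator \<Omega>' z * ut' z\<bar>" for z
    define g2 where "g2 i z = ennreal \<bar>indicator \<Omega>' z * D2u' z $ i $ i\<bar>" for i z
    \<comment> \<open>Accounts for the summand 1 of the majorant: at points of U the convolution of
      this indicator is at least 1.\<close>
    define g0 where "g0 z = (indicator \<Omega>' z :: ennreal)" for z
    define gg where "gg z = (g0 z + g1 z) + (\<Sum>i\<in>UNIV. g2 i z)" for z
    have g0m: "g0 \<in> borel_measurable borel" using O' by (simp add: g0_def[abs_def])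
    have g1m: "g1 \<in> borel_measurable borel" using mixed_L_D(1)[OF s'(2) O' q] by (simp add: g1_def[abs_def])
    have g2m: "g2 i \<in> borel_measurable borel" for i
      using mixed_L_D(1)[OF s'(3)[of i i] O' q] by (simp add: g2_def[abs_def])
    have fin0: "smixed q p g0 < top"
    proof -
      obtain C :: real where C: "\<And>z. z \<in> closure \<Omega>' \<Longrightarrow> norm z \<le> C"
        using compact_imp_bounded[OF O'c(1)] by (auto simp: bounded_iff)
      define C1 where "C1 = {- C..C}"
      define C2 where "C2 = (cball 0 C :: (real^'n) set)"
      have m12: "C1 \<in> sets borel" "C2 \<in> sets borel" "emeasure lborel C1 < top" "emeasure lborel C2 < top"
        using emeasure_lborel_cball_finite[of "0::real^'n" C] by (simp_all add: C1_def C2_def emeasure_lborel_Icc_eq)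
      have sub': "\<Omega>' \<subseteq> C1 \<times> C2"
      proof
        fix z assume "z \<in> \<Omega>'"
        then have "norm z \<le> C" using C closure_subset by blast
        then show "z \<in> C1 \<times> C2" using norm_fst_le[of "fst z" "snd z"] norm_snd_le[of "snd z" "fst z"]
          by (cases z) (auto simp: C1_def C2_def abs_le_iff)
      qed
      show ?thesis
      proof (cases "q < p")
        case True
        have "mixed_int q p g0 \<le> mixed_int q p (\<lambda>z. 1 * indicator (C1 \<times> C2) z)"
          using q sub' by (intro mixed_int_mono) (auto simp: g0_def indicator_def)
        also have "\<dots> < top" by (rule mixed_int_indicator_finite[OF m12]) (use q True in auto)
        finally show ?thesis using True by (simp add: smixed_def)
      next
        case False
        have "mixed_int p q (\<lambda>z. g0 (snd z, fst z)) \<le> mixed_int p q (\<lambda>z. 1 * indicator (C2 \<times> C1) z)"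
          using q sub' by (intro mixed_int_mono) (auto simp: g0_def indicator_def)
        also have "\<dots> < top" by (rule mixed_int_indicator_finite[OF m12(2,1,4,3)]) (use q False in auto)
        finally show ?thesis using False by (simp add: smixed_def)
      qed
    qed
    have "gg \<in> borel_measurable borel" unfolding gg_def[abs_def]
      by (intro borel_measurable_add borel_measurable_sum g0m g1m g2m)
    moreover have "gg z < top" for z
      by (auto simp: gg_def g0_def g1_def g2_def indicator_def less_top[symmetric] ennreal_sum_less_top)
    moreover have "smixed q p gg < top" unfolding gg_def[abs_def]
      using mixed_L_D(2)[OF s'(2) O' q] mixed_L_D(2)[OF s'(3) O' q]
      by (intro smixed_add_finite smixed_sum_finite borel_measurable_add borel_measurable_sum g0m g1m g2m q fin0)
         (auto simp: g1_def[abs_def] g2_def[abs_def])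
    moreover have "ennreal (1 + \<bar>vtn n z\<bar> + (\<Sum>i\<in>UNIV. \<bar>Hn n z $ i $ i\<bar>)) \<le> nnconv (kmeas (\<epsilon> n)) gg z" if z: "z \<in> U" for n z
    proof -
      have zc: "z \<in> closure U" using UK z by blast
      have g0': "1 \<le> nnconv (kmeas (\<epsilon> n)) g0 z"
      proof -
        have "(1::ennreal) = (\<integral>\<^sup>+w. ennreal (kern (\<epsilon> n) (z - w)) \<partial>lborel)"
          using nn_integral_lborel_reflect[of "\<lambda>w. ennreal (kern (\<epsilon> n) w)" z] by (simp add: kern_nn_integral[OF \<epsilon>(1)])
        also have "\<dots> \<le> (\<integral>\<^sup>+w. g0 w * ennreal (kern (\<epsilon> n) (z - w)) \<partial>lborel)"
        proof (intro nn_integral_mono)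
          fix w
          show "ennreal (kern (\<epsilon> n) (z - w)) \<le> g0 w * ennreal (kern (\<epsilon> n) (z - w))"
          proof (cases "w \<in> \<Omega>'")
            case False
            then have "w \<notin> cball z (\<epsilon> n)" using cb[OF zc \<epsilon>(2)] sub(1) by blast
            then have "\<epsilon> n < norm (z - w)" by (simp add: dist_norm)
            then show ?thesis by (simp add: kern_zero[OF \<epsilon>(1)])
          qed (simp add: g0_def)
        qed
        also have "\<dots> = nnconv (kmeas (\<epsilon> n)) g0 z" by (rule nnconv_kmeas[OF g0m, symmetric])
        finally show ?thesis .
      qed
      have bnd: "ennreal \<bar>cv n vs z\<bar> \<le> nnconv (kmeas (\<epsilon> n)) (\<lambda>w. ennreal \<bar>indicator \<Omega>' w * v w\<bar>) z"
        if w: "weak_deriv \<Omega>' vs u v" for vs v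
      proof -
        have int: "integrable lborel (\<lambda>w. indicator K w * v w)"
          using w K sub(1) by (intro locally_integrable_onD[of \<Omega>']) (auto simp: weak_deriv_def)
        have "ennreal \<bar>cv n vs z\<bar> \<le> nnconv (kmeas (\<epsilon> n)) (\<lambda>w. ennreal \<bar>indicator K w * v w\<bar>) z"
          unfolding cv_eq[OF zc w O' sub(1) KO(2)] by (rule moll_abs_le[OF \<epsilon>(1) int])
        also have "\<dots> \<le> nnconv (kmeas (\<epsilon> n)) (\<lambda>w. ennreal \<bar>indicator \<Omega>' w * v w\<bar>) z"
          using sub(1) by (intro nnconv_mono) (auto simp: indicator_def)
        finally show ?thesis .
      qed
      have "ennreal (1 + \<bar>vtn n z\<bar> + (\<Sum>i\<in>UNIV. \<bar>Hn n z $ i $ i\<bar>)) = 1 + ennreal \<bar>vtn n z\<bar> + (\<Sum>i\<in>UNIV. ennreal \<bar>Hn n z $ i $ i\<bar>)"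
        by (simp add: sum_nonneg sum_ennreal)
      also have "\<dots> \<le> nnconv (kmeas (\<epsilon> n)) g0 z + nnconv (kmeas (\<epsilon> n)) g1 z + (\<Sum>i\<in>UNIV. nnconv (kmeas (\<epsilon> n)) (g2 i) z)"
        using bnd[OF wt'] bnd[OF wH'] by (intro add_mono sum_mono g0') (auto simp: vtn_def Hn_def g1_def[abs_def] g2_def[abs_def])
      also have "\<dots> = nnconv (kmeas (\<epsilon> n)) gg z"
        unfolding gg_def[abs_def]
        by (simp add: nnconv_add nnconv_sum sets_kmeas g0m g1m g2m borel_measurable_add borel_measurable_sum)
      finally show ?thesis .
    qed
    ultimately show thesis using that by blast
  qed
  ultimately show thesis using that[of vn vtn Dvn Hn gn gg \<epsilon>] \<epsilon>(1) by blast
qed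

section \<open>Contact sets of the mollified functions\<close>

text \<open>A plane in T is at least M/4 on the cylinder, while v <= 0 on the parabolic boundary,
  and at most 7M/8 at z0, where v is M. So it meets the graph, and by
  \<open>generic_contact_interior\<close> its latest contact lies in U outside a set of measure
  \<delta>/2. The other half of \<delta> is spent on passing from v to vn.\<close>

lemma contact_sequence:
  fixes \<Omega> :: "(real \<times> (real^'n)) set"
  assumes O: "open \<Omega>" "bounded \<Omega>" and R: "0 < R" "\<Omega> \<subseteq> UNIV \<times> ball 0 R"
    and u: "continuous_on (closure \<Omega>) u" and sob: "sobolev_derivs \<Omega> u ut Du D2u"
    and W: "u \<in> W12_loc (ennreal q) (ennreal p) \<Omega>" and q: "1 < q" "1 < p"
    and bd: "\<And>z. z \<in> parabolic_boundary \<Omega> \<Longrightarrow> u z \<le> m0"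
    and z0: "z0 \<in> \<Omega>" and M: "0 < M" "M = u z0 - m0" and \<delta>: "0 < (\<delta>::real)"
    and T: "T = {M / 2..5 * M / 8} \<times> cball (0 :: real^'n) (M / (4 * R))"
  obtains U and vn vtn :: "nat \<Rightarrow> real \<times> (real^'n) \<Rightarrow> real" and Dvn Hn gn \<epsilon> gg where
    "open U" "closure U \<subseteq> \<Omega>"
    "\<And>n. smooth_data (vn n) (vtn n) (Dvn n) (Hn n) (gn n)"
    "\<And>z. z \<in> U \<Longrightarrow> (\<lambda>n. vn n z) \<longlonglongrightarrow> u z - m0"
    "AE z in lborel. z \<in> U \<longrightarrow> (\<lambda>n. vtn n z) \<longlonglongrightarrow> ut z"
    "AE z in lborel. z \<in> U \<longrightarrow> (\<forall>i. (\<lambda>n. Dvn n z $ i) \<longlonglongrightarrow> Du z $ i)"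
    "AE z in lborel. z \<in> U \<longrightarrow> (\<forall>i j. (\<lambda>n. Hn n z $ i $ j) \<longlonglongrightarrow> D2u z $ i $ j)"
    "gg \<in> borel_measurable borel" "\<And>z. gg z < top" "smixed q p gg < top" "\<And>n. 0 < \<epsilon> n"
    "\<And>n z. z \<in> U \<Longrightarrow> ennreal (1 + \<bar>vtn n z\<bar> + (\<Sum>i\<in>UNIV. \<bar>Hn n z $ i $ i\<bar>)) \<le> nnconv (kmeas (\<epsilon> n)) gg z"
    "\<forall>\<^sub>F n in sequentially. emeasure lborel (T - contact_map (vn n) (Dvn n) ` contact (vn n) (Dvn n) U) \<le> ennreal \<delta>"
proof -
  define v where "v z = u z - m0" for z
  have v: "continuous_on (closure \<Omega>) v" unfolding v_def[abs_def] by (intro continuous_intros u)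
  have Rc: "norm (snd z) \<le> R" if "z \<in> closure \<Omega>" for z
  proof -
    have "closure \<Omega> \<subseteq> UNIV \<times> cball 0 R"
      using R(2) by (intro closure_minimal closed_Times) (auto simp: subset_iff mem_ball less_imp_le)
    then have "z \<in> UNIV \<times> cball 0 R" using that by blast
    then show ?thesis by (simp add: mem_Times_iff)
  qed
  have inner: "\<bar>snd y \<bullet> snd z\<bar> \<le> M / 4" if "y \<in> T" "z \<in> closure \<Omega>" for y z
  proof -
    have "norm (snd y) \<le> M / (4 * R)" using that(1) by (auto simp: T)
    then have "norm (snd y) * norm (snd z) \<le> M / (4 * R) * R"
      by (intro mult_mono Rc that(2)) (use M R in auto)
    then show ?thesis using R(1) Cauchy_Schwarz_ineq2[of "snd y" "snd z"] by simp
  qed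
  have Tc: "compact T" unfolding T by (intro compact_Times) auto
  have Tm: "T \<in> sets borel" "emeasure lborel T < top"
    using Tc emeasure_bounded_finite[OF compact_imp_bounded[OF Tc]] by (auto intro: borel_compact)
  have fstT: "M / 2 \<le> fst y" "fst y \<le> 5 * M / 8" if "y \<in> T" for y using that by (auto simp: T)
  have pos: "0 < fst y + snd y \<bullet> snd z" if "y \<in> T" "z \<in> closure \<Omega>" for y z
    using inner[OF that] fstT[OF that(1)] M(1) by linarith
  have ne: "above v (closure \<Omega>) y \<noteq> {}" if "y \<in> T" for y
  proof -
    have z0c: "z0 \<in> closure \<Omega>" using z0 closure_subset by blast
    then have "fst y + snd y \<bullet> snd z0 \<le> v z0"
      using inner[OF that z0c] fstT[OF that] M unfolding v_def by linarith
    then have "z0 \<in> above v (closure \<Omega>) y" using z0c by (simp add: above_def)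
    then show ?thesis by blast
  qed
  have "0 < ennreal (\<delta> / 2)" using \<delta> by simp
  have bdv: "v z \<le> 0" if "z \<in> parabolic_boundary \<Omega>" for z using bd[OF that] by (simp add: v_def)
  obtain U Bd where U: "open U" "compact (closure U)" "closure U \<subseteq> \<Omega>" and Bd: "Bd \<in> sets borel" "emeasure lborel Bd < ennreal (\<delta> / 2)"
    and UBd: "\<And>y z. y \<in> T - Bd \<Longrightarrow> z \<in> above v (closure \<Omega>) y \<Longrightarrow> (\<And>w. w \<in> above v (closure \<Omega>) y \<Longrightarrow> fst w \<le> fst z) \<Longrightarrow> z \<in> U"
  proof (rule generic_contact_interior[OF O v bdv Tm pos ne \<open>0 < ennreal (\<delta> / 2)\<close>], assumption+, goal_cases)
    case (1 U Bd)
    show ?case by (rule 1(1)[OF 1(2-)])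
  qed
  obtain wn vtn :: "nat \<Rightarrow> real \<times> (real^'n) \<Rightarrow> real" and Dvn Hn gn \<epsilon> gg where
    wn: "\<And>n. smooth_data (wn n) (vtn n) (Dvn n) (Hn n) (gn n)"
    "\<And>n z. z \<in> closure U \<Longrightarrow> u z \<le> wn n z"
    "\<And>d. 0 < d \<Longrightarrow> \<forall>\<^sub>F n in sequentially. \<forall>z\<in>closure U. wn n z \<le> u z + d"
    and ap: "AE z in lborel. z \<in> U \<longrightarrow> (\<lambda>n. vtn n z) \<longlonglongrightarrow> ut z"
    "AE z in lborel. z \<in> U \<longrightarrow> (\<forall>i. (\<lambda>n. Dvn n z $ i) \<longlonglongrightarrow> Du z $ i)"
    "AE z in lborel. z \<in> U \<longrightarrow> (\<forall>i j. (\<lambda>n. Hn n z $ i $ j) \<longlonglongrightarrow> D2u z $ i $ j)"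
    "gg \<in> borel_measurable borel" "\<And>z. gg z < top" "smixed q p gg < top" "\<And>n. 0 < \<epsilon> n"
    "\<And>n z. z \<in> U \<Longrightarrow> ennreal (1 + \<bar>vtn n z\<bar> + (\<Sum>i\<in>UNIV. \<bar>Hn n z $ i $ i\<bar>)) \<le> nnconv (kmeas (\<epsilon> n)) gg z"
  proof (rule smooth_approximation[OF O u sob W q U], goal_cases)
    case (1 wn vtn Dvn Hn gn gg \<epsilon>)
    show ?case by (rule 1(1)[OF 1(2-)])
  qed
  define vn where "vn n z = wn n z - m0" for n z
  have sd: "smooth_data (vn n) (vtn n) (Dvn n) (Hn n) (gn n)" for n
    using wn(1)[of n] unfolding smooth_data_def vn_def[abs_def]
    by (auto intro!: derivative_eq_intros)
  have up: "v z \<le> vn n z" if "z \<in> closure U" for n z using wn(2)[OF that, of n] by (simp add: v_def vn_def)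
  have cv: "\<forall>\<^sub>F n in sequentially. \<forall>z\<in>closure U. vn n z \<le> v z + d" if "0 < d" for d
    using wn(3)[OF that] by (simp add: v_def vn_def algebra_simps)
  have lim: "(\<lambda>n. vn n z) \<longlonglongrightarrow> u z - m0" if "z \<in> U" for z
  proof (rule order_tendstoI)
    have zc: "z \<in> closure U" using that closure_subset by blast
    fix a
    show "\<forall>\<^sub>F n in sequentially. a < vn n z" if "a < u z - m0"
      using that up[OF zc] unfolding v_def by (intro always_eventually allI) (meson less_le_trans)
    show "\<forall>\<^sub>F n in sequentially. vn n z < a" if "u z - m0 < a"
    proof -
      define d where "d = (a - (u z - m0)) / 2"
      have d: "0 < d" "v z + d < a" using that by (auto simp: d_def v_def field_simps)
      show ?thesis using cv[OF d(1)] by eventually_elim (use zc d(2) in fastforce)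
    qed
  qed
  define Im where "Im n = contact_map (vn n) (Dvn n) ` contact (vn n) (Dvn n) U" for n
  have Im: "Im n \<in> sets borel" for n unfolding Im_def by (rule contact_map_image_borel[OF sd U(1)])
  have Xc: "compact (closure \<Omega>)" using O(2) by simp
  have UX: "closure U \<subseteq> closure \<Omega>" using U(3) closure_subset by blast
  have ev: "\<forall>\<^sub>F n in sequentially. y \<in> Im n" if y: "y \<in> T - Bd" for y
  proof -
    have yT: "y \<in> T" using y by blast
    have "\<forall>\<^sub>F n in sequentially. \<exists>z\<in>U. vn n z = fst y + snd y \<bullet> snd z \<and>
      (\<forall>w\<in>U. fst z < fst w \<longrightarrow> vn n w < fst y + snd y \<bullet> snd w)"
      by (rule contact_stability[OF U(1,2) UX v Xc ne[OF yT] UBd[OF y] cont(1)[OF sd open_UNIV] up cv])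
    then show ?thesis
    proof eventually_elim
      case (elim n)
      then obtain z where z: "z \<in> U" "vn n z = fst y + snd y \<bullet> snd z" "\<And>w. w \<in> U \<Longrightarrow> fst z < fst w \<Longrightarrow> vn n w < fst y + snd y \<bullet> snd w"
        by blast
      from contact_map_eqI[OF sd[of n] U(1) z] show ?case unfolding Im_def by (metis image_eqI)
    qed
  qed
  have "(\<lambda>n. \<integral>\<^sup>+y. indicator ((T - Bd) - Im n) y \<partial>lborel) \<longlonglongrightarrow> (\<integral>\<^sup>+y. 0 \<partial>(lborel :: (real \<times> (real^'n)) measure))"
  proof (rule nn_integral_dominated_convergence[where w = "indicator T"])
    show "(\<integral>\<^sup>+y. indicator T y \<partial>lborel) < \<infinity>" using Tm by simp
    show "AE y in lborel. (\<lambda>n. indicator (T - Bd - Im n) y :: ennreal) \<longlonglongrightarrow> 0"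
    proof (rule AE_I2)
      fix y
      have "\<forall>\<^sub>F n in sequentially. indicator (T - Bd - Im n) y = (0::ennreal)"
      proof (cases "y \<in> T - Bd")
        case True
        show ?thesis using ev[OF True] by eventually_elim simp
      qed simp
      then show "(\<lambda>n. indicator (T - Bd - Im n) y :: ennreal) \<longlonglongrightarrow> 0" by (rule tendsto_eventually)
    qed
  qed (use Tm Bd Im in \<open>auto simp: indicator_def\<close>)
  then have "(\<lambda>n. emeasure lborel ((T - Bd) - Im n)) \<longlonglongrightarrow> 0"
    using Tm Bd Im by simp
  then have "\<forall>\<^sub>F n in sequentially. emeasure lborel ((T - Bd) - Im n) < ennreal (\<delta> / 2)"
    by (rule order_tendstoD) (use \<delta> in simp)
  then have "\<forall>\<^sub>F n in sequentially. emeasure lborel (T - Im n) \<le> ennreal \<delta>"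
  proof eventually_elim
    case (elim n)
    have "emeasure lborel (T - Im n) \<le> emeasure lborel (((T - Bd) - Im n) \<union> Bd)"
      using Tm Bd Im by (intro emeasure_mono) auto
    also have "\<dots> \<le> emeasure lborel ((T - Bd) - Im n) + emeasure lborel Bd"
      using Tm Bd Im by (intro emeasure_subadditive) auto
    also have "\<dots> \<le> ennreal (\<delta> / 2) + ennreal (\<delta> / 2)"
      using elim Bd by (intro add_mono) auto
    also have "\<dots> = ennreal \<delta>" using \<delta> by (simp flip: ennreal_plus)
    finally show ?case .
  qed
  then show thesis using that[OF U(1,3) sd lim ap] by (simp only: Im_def)
qed

section \<open>Mixed-norm estimates on contact sets\<close>

lemma nn_integral_lborel_fst:
  fixes f :: "'a::euclidean_space \<times> 'b::euclidean_space \<Rightarrow> ennreal"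
  assumes "f \<in> borel_measurable borel"
  shows "(\<integral>\<^sup>+z. f z \<partial>lborel) = (\<integral>\<^sup>+x. \<integral>\<^sup>+y. f (x, y) \<partial>lborel \<partial>lborel)"
  using lborel.nn_integral_fst[of f "lborel :: 'a measure"] measurable_lborel_pairD[OF assms] by (simp add: lborel_prod)

lemma nn_integral_lborel_snd:
  fixes f :: "'a::euclidean_space \<times> 'b::euclidean_space \<Rightarrow> ennreal"
  assumes "f \<in> borel_measurable borel"
  shows "(\<integral>\<^sup>+z. f z \<partial>lborel) = (\<integral>\<^sup>+y. \<integral>\<^sup>+x. f (x, y) \<partial>lborel \<partial>lborel)"
  using lborel_pair.nn_integral_snd[of f] measurable_lborel_pairD[OF assms] by (simp add: lborel_prod)

lemma AE_lborel_swap: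
  fixes P :: "'a::euclidean_space \<times> 'b::euclidean_space \<Rightarrow> bool"
  assumes "AE z in lborel. P z"
  shows "AE z in lborel. P (snd z, fst z)"
proof -
  have "AE z in distr (lborel \<Otimes>\<^sub>M lborel) (lborel \<Otimes>\<^sub>M lborel) (\<lambda>(x, y). (y, x)). P z"
    by (subst lborel_pair.distr_pair_swap[symmetric], subst lborel_prod) (rule assms)
  from AE_distrD[OF measurable_pair_swap' this] show ?thesis
    unfolding case_prod_beta lborel_prod .
qed

text \<open>For q >= p the components are exchanged and the measures pushed forward accordingly; the
  exchange commutes with convolution.\<close>

lemma smixed_nnconv_tendsto_0:
  fixes g :: "real \<times> (real^'n) \<Rightarrow> ennreal"
  assumes g: "g \<in> borel_measurable borel" and gfin: "smixed q p g < top" "\<And>z. g z < top" and q: "1 < q" "1 < p"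
    and C: "C1 \<in> sets borel" "C2 \<in> sets borel" and Cfin: "emeasure lborel C1 < top" "emeasure lborel C2 < top"
    and mu: "\<And>n. sets (\<mu> n) = sets borel" "\<And>n. emeasure (\<mu> n) UNIV = 1"
    and f: "\<And>n. f n \<in> borel_measurable borel"
    and fle: "\<And>n z. f n z \<le> nnconv (\<mu> n) g z" and f0: "\<And>n z. z \<notin> C1 \<times> C2 \<Longrightarrow> f n z = 0"
    and ae: "AE z in lborel. (\<lambda>n. f n z) \<longlonglongrightarrow> 0"
  shows "(\<lambda>n. smixed q p (f n)) \<longlonglongrightarrow> 0"
proof (cases "q < p")
  case True
  then show ?thesis
    using mixed_int_nnconv_tendsto_0[OF g _ gfin(2) _ _ C Cfin mu f fle f0 ae, of q p] gfin(1) q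
    by (simp add: smixed_def)
next
  case False
  let ?s = "\<lambda>z :: (real^'n) \<times> real. (snd z, fst z)" and ?s' = "\<lambda>z :: real \<times> (real^'n). (snd z, fst z)"
  define \<mu>' where "\<mu>' n = distr (\<mu> n) borel ?s'" for n
  have sm: "?s' \<in> \<mu> n \<rightarrow>\<^sub>M borel" for n
    by (subst measurable_cong_sets[OF mu(1) refl]) (intro borel_measurable_continuous_onI continuous_intros)
  have g': "(\<lambda>z. g (?s z)) \<in> borel_measurable borel" by (rule measurable_swap_borel[OF g])
  have conv: "nnconv (\<mu>' n) (\<lambda>z. g (?s z)) z = nnconv (\<mu> n) g (?s z)" for n z
  proof -
    have "(\<lambda>s. g (?s (z - s))) \<in> borel_measurable borel"
      by (rule measurable_compose[OF _ g']) simp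
    then show ?thesis
      unfolding nnconv_def \<mu>'_def by (subst nn_integral_distr[OF sm]) (simp_all add: minus_prod_def)
  qed
  have sp: "space (\<mu> n) = UNIV" for n using sets_eq_imp_space_eq[OF mu(1)] by simp
  have "(\<lambda>n. mixed_int p q (\<lambda>z. f n (?s z))) \<longlonglongrightarrow> 0"
  proof (rule mixed_int_nnconv_tendsto_0[where g = "\<lambda>z. g (?s z)" and \<mu> = \<mu>' and ?C1.0 = C2 and ?C2.0 = C1])
    show "mixed_int p q (\<lambda>z. g (?s z)) < top" using gfin(1) False by (simp add: smixed_def)
    show "sets (\<mu>' n) = sets borel" for n by (simp add: \<mu>'_def)
    show "emeasure (\<mu>' n) UNIV = 1" for n
      unfolding \<mu>'_def by (subst emeasure_distr[OF sm]) (simp_all add: sp mu)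
    show "f n (?s z) \<le> nnconv (\<mu>' n) (\<lambda>z. g (?s z)) z" for n z unfolding conv by (rule fle)
    show "f n (?s z) = 0" if "z \<notin> C2 \<times> C1" for n z using that by (intro f0) (auto simp: mem_Times_iff)
    show "AE z in lborel. (\<lambda>n. f n (?s z)) \<longlonglongrightarrow> 0" by (rule AE_lborel_swap[OF ae])
    show "(\<lambda>z. f n (?s z)) \<in> borel_measurable borel" for n by (rule measurable_swap_borel[OF f])
  qed (use q False g' gfin C Cfin in auto)
  then show ?thesis using False by (simp add: smixed_def)
qed

text \<open>The variable with the smaller exponent is integrated last. The slice bound that enters
  is then that of the inner variable: B for space if q < p, otherwise A for time.\<close>

lemma mixed_area_holder:
  fixes \<alpha> \<beta> G :: "real \<times> (real^'n) \<Rightarrow> ennreal"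
  assumes q: "0 < q" "0 < p" and m: "\<alpha> \<in> borel_measurable borel" "\<beta> \<in> borel_measurable borel" "G \<in> borel_measurable borel"
    and A: "\<And>x. (\<integral>\<^sup>+t. \<alpha> (t, x) \<partial>lborel) \<le> A" and B: "\<And>t. (\<integral>\<^sup>+x. \<beta> (t, x) \<partial>lborel) \<le> B"
    and G: "\<And>z. epow (\<alpha> z) (1 / q) * epow (\<beta> z) (1 / p) \<le> G z"
  shows "(\<integral>\<^sup>+z. \<alpha> z * \<beta> z \<partial>lborel) \<le> (if q < p then epow B (1 - q / p) else epow A (1 - p / q)) * smixed q p G"
proof -
  have ab: "(\<lambda>z. \<alpha> z * \<beta> z) \<in> borel_measurable borel" using m by simp
  note m' = m[THEN measurable_lborel_pairD]
  have sf: "sigma_finite_measure (lborel :: 'c::euclidean_space measure)" by (rule lborel.sigma_finite_measure_axioms)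
  show ?thesis
  proof (cases "q < p")
    case True
    have "(\<integral>\<^sup>+z. \<alpha> z * \<beta> z \<partial>lborel) = (\<integral>\<^sup>+t. \<integral>\<^sup>+x. \<alpha> (t, x) * \<beta> (t, x) \<partial>lborel \<partial>lborel)"
      by (rule nn_integral_lborel_fst[OF ab])
    also have "\<dots> \<le> epow B (1 - q / p) * mixed_int q p G" unfolding mixed_int_def
      by (rule mixed_holder[OF sf sf q(1) _ m'(2,1,3)]) (use True B G in auto)
    finally show ?thesis using True by (simp add: smixed_def)
  next
    case False
    note ms = m[THEN measurable_swap_borel, THEN measurable_lborel_pairD]
    have "(\<integral>\<^sup>+z. \<alpha> z * \<beta> z \<partial>lborel) = (\<integral>\<^sup>+x. \<integral>\<^sup>+t. \<alpha> (t, x) * \<beta> (t, x) \<partial>lborel \<partial>lborel)"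
      by (rule nn_integral_lborel_snd[OF ab])
    also have "\<dots> = (\<integral>\<^sup>+x. \<integral>\<^sup>+t. \<beta> (snd (x, t), fst (x, t)) * \<alpha> (snd (x, t), fst (x, t)) \<partial>lborel \<partial>lborel)"
      by (simp add: mult.commute)
    also have "\<dots> \<le> epow A (1 - p / q) * mixed_int p q (\<lambda>z. G (snd z, fst z))" unfolding mixed_int_def
      by (rule mixed_holder[OF sf sf q(2) _ ms(1,2,3)]) (use False A G in \<open>auto simp: mult.commute\<close>)
    finally show ?thesis using False by (simp add: smixed_def)
  qed
qed

text \<open>The power product with the convention x^0 = 1. It is used both for the coefficients r,
  det a, c and for the derivatives -u_t, det(-D^2 u), u - m0, with the exponents of the right-hand
  side or of the drift.\<close>

definition gexp :: "real \<Rightarrow> real \<Rightarrow> real \<Rightarrow> real \<Rightarrow> real \<Rightarrow> real \<Rightarrow> real" where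
  "gexp s \<sigma> \<nu> a b c = rpow a s * rpow b \<sigma> * rpow c \<nu>"

lemma rpow_nonneg: "0 \<le> rpow x s"
  by (simp add: rpow_def)

lemma gexp_nonneg: "0 \<le> gexp s \<sigma> \<nu> a b c"
  by (simp add: gexp_def rpow_nonneg)

lemma tendsto_rpow:
  assumes "(f \<longlongrightarrow> x) F" "\<And>n. 0 \<le> f n" "0 \<le> s"
  shows "((\<lambda>n. rpow (f n) s) \<longlongrightarrow> rpow x s) F"
  using assms by (cases "s = 0") (auto simp: rpow_def intro!: tendsto_powr')

lemma tendsto_gexp:
  assumes "(f \<longlongrightarrow> a) F" "(g \<longlongrightarrow> b) F" "(k \<longlongrightarrow> c) F" "\<And>n. 0 \<le> f n" "\<And>n. 0 \<le> g n" "\<And>n. 0 \<le> k n"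
    and "0 \<le> s" "0 \<le> \<sigma>" "0 \<le> \<nu>"
  shows "((\<lambda>n. gexp s \<sigma> \<nu> (f n) (g n) (k n)) \<longlongrightarrow> gexp s \<sigma> \<nu> a b c) F"
  unfolding gexp_def by (intro tendsto_mult tendsto_rpow assms)

lemma measurable_rpow [measurable]:
  assumes [measurable]: "f \<in> borel_measurable M"
  shows "(\<lambda>x. rpow (f x) s) \<in> borel_measurable M"
  unfolding rpow_def by measurable

lemma measurable_gexp [measurable]:
  assumes [measurable]: "f \<in> borel_measurable M" "g \<in> borel_measurable M" "k \<in> borel_measurable M"
  shows "(\<lambda>x. gexp s \<sigma> \<nu> (f x) (g x) (k x)) \<in> borel_measurable M"
  unfolding gexp_def by measurable

text \<open>Since b <= t^d and the exponents add up to at most 1, the product is at most the largest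
  of 1, x and t. Linear quantities are what mollification controls.\<close>

lemma powr_prod_le_sum:
  assumes "0 \<le> x" "0 \<le> t" "0 \<le> b" "b \<le> t ^ d" "0 < q" "0 < p" "real d / p + 1 / q \<le> 1" "0 < d"
  shows "x powr (1 / q) * b powr (1 / p) \<le> 1 + x + (t::real)"
proof -
  define m where "m = max 1 (max x t)"
  have m: "1 \<le> m" "x \<le> m" "t \<le> m" by (auto simp: m_def)
  have "b \<le> m ^ d" using assms m power_mono[of t m d] by linarith
  then have "x powr (1 / q) * b powr (1 / p) \<le> m powr (1 / q) * (m ^ d) powr (1 / p)"
    using assms m by (intro mult_mono powr_mono2) auto
  also have "\<dots> = m powr (1 / q + real d / p)"
    using m by (simp add: powr_realpow[symmetric] powr_powr powr_add)
  also have "\<dots> \<le> m powr 1" using m assms by (intro powr_mono) auto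
  also have "\<dots> = m" using m by simp
  also have "\<dots> \<le> 1 + x + t" using assms by (auto simp: m_def)
  finally show ?thesis .
qed

lemma ennreal_max_0: "ennreal (max 0 x) = ennreal x"
  by (cases "0 \<le> x") (auto simp: max_def ennreal_neg)

lemma det_uminus_tendsto:
  fixes A :: "nat \<Rightarrow> real^'n^'n"
  assumes "\<And>i j. (\<lambda>n. A n $ i $ j) \<longlonglongrightarrow> B $ i $ j"
  shows "(\<lambda>n. det (- A n)) \<longlonglongrightarrow> det (- B)"
  unfolding det_def by (intro tendsto_sum tendsto_mult tendsto_const tendsto_prod) (simp add: tendsto_minus assms)

text \<open>Both conditions in \<open>psd\<close> are closed, so infinitely many indices suffice; a
  point may belong to the contact sets along a subsequence only.\<close>

lemma psd_uminus_limit: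
  fixes A :: "nat \<Rightarrow> real^'n^'n"
  assumes lim: "\<And>i j. (\<lambda>n. A n $ i $ j) \<longlonglongrightarrow> B $ i $ j" and fr: "\<exists>\<^sub>F n in sequentially. psd (- A n)"
  shows "psd (- B)"
proof -
  have cl: "f B = g B" if f: "(\<lambda>n. f (A n)) \<longlonglongrightarrow> f B" "(\<lambda>n. g (A n)) \<longlonglongrightarrow> g B"
      and eq: "\<And>n. psd (- A n) \<Longrightarrow> f (A n) = g (A n)" for f g :: "real^'n^'n \<Rightarrow> real"
  proof (rule ccontr)
    assume "f B \<noteq> g B"
    then have "(\<lambda>n. f (A n) - g (A n)) \<longlonglongrightarrow> f B - g B" "f B - g B \<noteq> 0" using f by (auto intro: tendsto_diff)
    then have "\<forall>\<^sub>F n in sequentially. f (A n) - g (A n) \<noteq> 0" by (rule tendsto_imp_eventually_ne)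
    then have "\<forall>\<^sub>F n in sequentially. \<not> psd (- A n)" by (rule eventually_mono) (use eq in force)
    then show False using fr by (simp add: frequently_def)
  qed
  have "B $ i $ j = B $ j $ i" for i j
  proof (rule cl[where f = "\<lambda>A. A $ i $ j" and g = "\<lambda>A. A $ j $ i"])
    show "A n $ i $ j = A n $ j $ i" if "psd (- A n)" for n
    proof -
      have "transpose (- A n) $ i $ j = (- A n) $ i $ j" using that by (simp add: psd_def)
      then show ?thesis by (simp add: transpose_def)
    qed
  qed (rule lim)+
  then have sym: "transpose (- B) = - B" by (simp add: transpose_def vec_eq_iff)
  have "0 \<le> \<xi> \<bullet> ((- B) *v \<xi>)" for \<xi>
  proof (rule ccontr)
    assume neg: "\<not> 0 \<le> \<xi> \<bullet> ((- B) *v \<xi>)"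
    have "(\<lambda>n. \<xi> \<bullet> ((- A n) *v \<xi>)) \<longlonglongrightarrow> \<xi> \<bullet> ((- B) *v \<xi>)"
      unfolding inner_vec_def matrix_vector_mult_def inner_real_def vec_lambda_beta
      by (intro tendsto_sum tendsto_mult tendsto_const) (simp add: tendsto_minus lim)
    then have "\<forall>\<^sub>F n in sequentially. \<xi> \<bullet> ((- A n) *v \<xi>) < 0"
      using neg by (intro order_tendstoD(2)) auto
    then have "\<forall>\<^sub>F n in sequentially. \<not> psd (- A n)"
      by (rule eventually_mono) (simp only: psd_def not_le[symmetric], blast)
    then show False using fr by (simp add: frequently_def)
  qed
  then show ?thesis using sym by (simp add: psd_def)
qed

(* On \<Gamma>A the operator term controls the curvature, on \<Gamma>B the drift does, and \<Gamma>Z is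
   the error of the mollification. *)
lemma contact_structure:
  fixes \<Omega> :: "(real \<times> (real^'n)) set" and F :: "real \<times> (real^'n) \<Rightarrow> ennreal"
  assumes O: "open \<Omega>" "bounded \<Omega>" and R: "0 < R" "\<Omega> \<subseteq> UNIV \<times> ball 0 R"
    and u: "continuous_on (closure \<Omega>) u" and sob: "sobolev_derivs \<Omega> u ut Du D2u"
    and W: "u \<in> W12_loc (ennreal q) (ennreal p) \<Omega>" and q: "1 < q" "1 < p"
    and bd: "\<And>z. z \<in> parabolic_boundary \<Omega> \<Longrightarrow> u z \<le> m0"
    and z0: "z0 \<in> \<Omega>" and M: "0 < M" "M = u z0 - m0" and \<delta>: "0 < (\<delta>::real)"
    and T: "T = {M / 2..5 * M / 8} \<times> cball (0 :: real^'n) (M / (4 * R))"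
    and \<nu>: "0 \<le> \<nu>" "real CARD('n) / p + 1 / q \<le> 1" and ex0: "0 \<le> s0" "0 \<le> \<sigma>0" "0 \<le> \<nu>0"
    and F: "F \<in> borel_measurable borel" and h: "h' \<in> borel_measurable borel"
    and alt: "AE z in lborel. z \<in> \<Omega> \<longrightarrow> m0 < u z \<longrightarrow> ut z \<le> 0 \<longrightarrow> psd (- D2u z) \<longrightarrow>
      gexp (1 / q) (1 / p) \<nu> (- ut z) (det (- D2u z)) (u z - m0) = 0 \<or>
      0 < F z \<and> ennreal (gexp (1 / q) (1 / p) \<nu> (- ut z) (det (- D2u z)) (u z - m0)) \<le> F z \<or>
      0 < h' z * norm (Du z) \<and> gexp s0 \<sigma>0 \<nu>0 (- ut z) (det (- D2u z)) (u z - m0) \<le> h' z * norm (Du z)"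
  obtains \<Gamma> \<Gamma>A \<Gamma>B \<Gamma>Z and \<alpha> \<beta> val :: "real \<times> (real^'n) \<Rightarrow> real" and w :: "real \<times> (real^'n) \<Rightarrow> real^'n" where
    "\<Gamma> \<in> sets borel" "\<Gamma>A \<in> sets borel" "\<Gamma>B \<in> sets borel" "\<Gamma>Z \<in> sets borel" "\<Gamma> \<subseteq> \<Gamma>A \<union> \<Gamma>B \<union> \<Gamma>Z" "\<Gamma>A \<union> \<Gamma>B \<union> \<Gamma>Z \<subseteq> \<Gamma>"
    "\<alpha> \<in> borel_measurable borel" "\<beta> \<in> borel_measurable borel" "val \<in> borel_measurable borel" "w \<in> borel_measurable borel"
    "\<And>z. 0 \<le> \<alpha> z" "\<And>z. 0 \<le> \<beta> z" "\<And>z. z \<in> \<Gamma> \<Longrightarrow> M / 4 \<le> val z"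
    "\<And>S. S \<in> sets borel \<Longrightarrow> S \<subseteq> T \<Longrightarrow> emeasure lborel S
      \<le> (\<integral>\<^sup>+z. indicator (\<Gamma> \<inter> {z. (val z - snd z \<bullet> w z, w z) \<in> S}) z * ennreal (\<alpha> z * \<beta> z) \<partial>lborel) + ennreal \<delta>"
    "\<And>x. (\<integral>\<^sup>+t. indicator \<Gamma> (t, x) * ennreal (\<alpha> (t, x)) \<partial>lborel) \<le> ennreal M"
    "\<And>\<rho> t. 0 < \<rho> \<Longrightarrow> (\<integral>\<^sup>+x. indicator (\<Gamma> \<inter> {z. norm (w z) \<le> \<rho>}) (t, x) * ennreal (\<beta> (t, x)) \<partial>lborel)
      \<le> emeasure lborel (cball (0 :: real^'n) (2 * \<rho>))"
    "\<And>z. z \<in> \<Gamma>A \<Longrightarrow> ennreal (gexp (1 / q) (1 / p) \<nu> (\<alpha> z) (\<beta> z) (val z)) \<le> 2 * F z"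
    "\<And>z. z \<in> \<Gamma>B \<Longrightarrow> gexp s0 \<sigma>0 \<nu>0 (\<alpha> z) (\<beta> z) (val z) \<le> 2 * (h' z * norm (w z))"
    "(\<integral>\<^sup>+z. indicator \<Gamma>Z z * ennreal (\<alpha> z * \<beta> z) \<partial>lborel) \<le> ennreal \<delta>"
proof -
  obtain U and vn vtn :: "nat \<Rightarrow> real \<times> (real^'n) \<Rightarrow> real" and Dvn Hn gn \<epsilon> gg where
    U: "open U" "closure U \<subseteq> \<Omega>"
    and sd: "\<And>n. smooth_data (vn n) (vtn n) (Dvn n) (Hn n) (gn n)"
    and lim_v: "\<And>z. z \<in> U \<Longrightarrow> (\<lambda>n. vn n z) \<longlonglongrightarrow> u z - m0"
    and ae_t: "AE z in lborel. z \<in> U \<longrightarrow> (\<lambda>n. vtn n z) \<longlonglongrightarrow> ut z"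
    and ae_D: "AE z in lborel. z \<in> U \<longrightarrow> (\<forall>i. (\<lambda>n. Dvn n z $ i) \<longlonglongrightarrow> Du z $ i)"
    and ae_H: "AE z in lborel. z \<in> U \<longrightarrow> (\<forall>i j. (\<lambda>n. Hn n z $ i $ j) \<longlonglongrightarrow> D2u z $ i $ j)"
    and gg: "gg \<in> borel_measurable borel" "\<And>z. gg z < top" "smixed q p gg < top" and \<epsilon>: "\<And>n. 0 < \<epsilon> n"
    and gb: "\<And>n z. z \<in> U \<Longrightarrow> ennreal (1 + \<bar>vtn n z\<bar> + (\<Sum>i\<in>UNIV. \<bar>Hn n z $ i $ i\<bar>)) \<le> nnconv (kmeas (\<epsilon> n)) gg z"
    and ev: "\<forall>\<^sub>F n in sequentially. emeasure lborel (T - contact_map (vn n) (Dvn n) ` contact (vn n) (Dvn n) U) \<le> ennreal \<delta>"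
  proof (rule contact_sequence[OF O R u sob W q _ z0 M \<delta> T], goal_cases)
    case (1 z)
    show ?case by (rule bd[OF 1(2)])
  next
    case (2 U vn vtn Dvn Hn gn gg \<epsilon>)
    show ?case by (rule 2(1)[OF 2(2-)])
  qed
  have UO: "U \<subseteq> \<Omega>" using U(2) closure_subset by blast
  define \<Gamma> where "\<Gamma> n = contact (vn n) (Dvn n) U \<inter> contact_map (vn n) (Dvn n) -` T" for n
  define \<alpha> where "\<alpha> n z = max 0 (- vtn n z)" for n z
  define \<beta> where "\<beta> n z = max 0 (det (- Hn n z))" for n z
  define val where "val n z = max 0 (vn n z)" for n z
  have T': "T \<in> sets borel" unfolding T by (intro borel_compact compact_Times) auto
  have mv [measurable]: "vn n \<in> borel_measurable borel" "Dvn n \<in> borel_measurable borel" for n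
    using cont[OF sd open_UNIV] by (auto intro: borel_measurable_continuous_onI)
  have mm [measurable]: "vtn n \<in> borel_measurable borel" "(\<lambda>z. Hn n z $ i $ j) \<in> borel_measurable borel" for n i j
    using meas[OF sd open_UNIV] by auto
  have [measurable]: "(\<lambda>z. det (- Hn n z)) \<in> borel_measurable borel" for n
    by (rule measurable_det) simp
  have [measurable]: "\<alpha> n \<in> borel_measurable borel" "\<beta> n \<in> borel_measurable borel" "val n \<in> borel_measurable borel" for n
    unfolding \<alpha>_def[abs_def] \<beta>_def[abs_def] val_def[abs_def] by measurable
  have [measurable]: "\<Gamma> n \<in> sets borel" for n
  proof -
    have "contact_map (vn n) (Dvn n) \<in> borel_measurable borel"
      by (intro borel_measurable_continuous_onI continuous_contact_map[OF sd open_UNIV])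
    from measurable_sets[OF this T'] show ?thesis
      unfolding \<Gamma>_def using contact_borel[OF sd U(1)] by (intro sets.Int) auto
  qed
  have \<Gamma>U: "z \<in> U" "z \<in> contact (vn n) (Dvn n) U" if "z \<in> \<Gamma> n" for n z
    using that contact_subset[OF sd[of n] U(1), of z] by (simp_all add: \<Gamma>_def)
  have Rz: "norm (snd z) \<le> R" if "z \<in> U" for z
  proof -
    have "z \<in> UNIV \<times> ball 0 R" using that UO R(2) by blast
    then show ?thesis by (simp add: mem_Times_iff)
  qed
  have vrange: "M / 4 \<le> vn n z" "vn n z \<le> 7 * M / 8" if "z \<in> \<Gamma> n" for n z
  proof -
    have y: "contact_map (vn n) (Dvn n) z \<in> T" using that by (simp add: \<Gamma>_def)
    then have D: "norm (Dvn n z) \<le> M / (4 * R)" and k: "M / 2 \<le> vn n z - snd z \<bullet> Dvn n z" "vn n z - snd z \<bullet> Dvn n z \<le> 5 * M / 8"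
      by (auto simp: T contact_map_def)
    have "norm (snd z) * norm (Dvn n z) \<le> R * (M / (4 * R))"
      by (intro mult_mono Rz \<Gamma>U(1)[OF that] D) (use R in auto)
    then have "\<bar>snd z \<bullet> Dvn n z\<bar> \<le> M / 4"
      using Cauchy_Schwarz_ineq2[of "snd z" "Dvn n z"] R(1) by simp
    then show "M / 4 \<le> vn n z" "vn n z \<le> 7 * M / 8" using k by linarith+
  qed
  have vval: "val n z = vn n z" if "z \<in> \<Gamma> n" for n z using vrange[OF that] M(1) by (simp add: val_def)
  obtain B where B: "0 < B" "\<And>z. z \<in> \<Omega> \<Longrightarrow> norm z \<le> B" using O(2) unfolding bounded_pos by blast
  have BU: "\<bar>fst z\<bar> \<le> B" if "z \<in> U" for z
    using norm_fst_le[of "fst z" "snd z"] B(2)[OF subsetD[OF UO that]] by simp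
  \<comment> \<open>On the contact set the values lie in [M/4, 7M/8]; the slack e = M / (8 B) adds
    M/4 to their range, and the total 7M/8 is below M.\<close>
  have time: "(\<integral>\<^sup>+t. indicator (\<Gamma> n) (t, x) * ennreal (\<alpha> n (t, x)) \<partial>lborel) \<le> ennreal M" for n x
  proof -
    have "(\<integral>\<^sup>+t. indicator (\<Gamma> n) (t, x) * ennreal (- vtn n (t, x)) \<partial>lborel) \<le> ennreal (7 * M / 8 - M / 4 + 2 * (M / (8 * B)) * B)"
    proof (rule contact_time_slice[OF sd U(1) _ _ _ BU])
      show "\<Gamma> n \<subseteq> contact (vn n) (Dvn n) U" by (auto simp: \<Gamma>_def)
      show "M / 4 \<le> vn n z \<and> vn n z \<le> 7 * M / 8" if "z \<in> \<Gamma> n" for z using vrange[OF that] by simp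
    qed (use B M(1) in auto)
    also have "\<dots> \<le> ennreal M" using B(1) M(1) by (intro ennreal_leI) (simp add: field_simps)
    finally show ?thesis by (simp add: \<alpha>_def ennreal_max_0)
  qed
  have space: "(\<integral>\<^sup>+x. indicator (\<Gamma> n \<inter> {z. norm (Dvn n z) \<le> \<rho>}) (t, x) * ennreal (\<beta> n (t, x)) \<partial>lborel)
      \<le> emeasure lborel (cball (0 :: real^'n) (2 * \<rho>))" if "0 < \<rho>" for n \<rho> t
    unfolding \<beta>_def ennreal_max_0
  proof (rule contact_space_slice[OF sd U(1) _ _ _ that Rz R(1)])
    show "\<Gamma> n \<inter> {z. norm (Dvn n z) \<le> \<rho>} \<subseteq> contact (vn n) (Dvn n) U" by (auto simp: \<Gamma>_def)
  qed auto
  have area: "emeasure lborel S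
      \<le> (\<integral>\<^sup>+z. indicator (\<Gamma> n \<inter> {z. (val n z - snd z \<bullet> Dvn n z, Dvn n z) \<in> S}) z * ennreal (\<alpha> n z * \<beta> n z) \<partial>lborel) + ennreal \<delta>"
    if S: "S \<in> sets borel" "S \<subseteq> T"
      and n: "emeasure lborel (T - contact_map (vn n) (Dvn n) ` contact (vn n) (Dvn n) U) \<le> ennreal \<delta>" for S n
  proof -
    let ?I = "contact_map (vn n) (Dvn n) ` contact (vn n) (Dvn n) U"
    have I: "?I \<in> sets borel" by (rule contact_map_image_borel[OF sd U(1)])
    have "emeasure lborel S \<le> emeasure lborel ((?I \<inter> S) \<union> (T - ?I))"
      using S I T' by (intro emeasure_mono) auto
    also have "\<dots> \<le> emeasure lborel (?I \<inter> S) + emeasure lborel (T - ?I)"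
      using S I T' by (intro emeasure_subadditive) auto
    finally have 1: "emeasure lborel S \<le> emeasure lborel (?I \<inter> S) + emeasure lborel (T - ?I)" .
    have "emeasure lborel (?I \<inter> S) \<le> (\<integral>\<^sup>+z. indicator (contact (vn n) (Dvn n) U \<inter> contact_map (vn n) (Dvn n) -` S) z * ennreal (- vtn n z * det (- Hn n z)) \<partial>lborel)"
      by (rule contact_area[OF sd U(1) S(1)])
    also have "\<dots> = (\<integral>\<^sup>+z. indicator (\<Gamma> n \<inter> {z. (val n z - snd z \<bullet> Dvn n z, Dvn n z) \<in> S}) z * ennreal (\<alpha> n z * \<beta> n z) \<partial>lborel)"
    proof (intro nn_integral_cong)
      fix z
      show "indicator (contact (vn n) (Dvn n) U \<inter> contact_map (vn n) (Dvn n) -` S) z * ennreal (- vtn n z * det (- Hn n z))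
        = indicator (\<Gamma> n \<inter> {z. (val n z - snd z \<bullet> Dvn n z, Dvn n z) \<in> S}) z * ennreal (\<alpha> n z * \<beta> n z)"
      proof (cases "z \<in> \<Gamma> n")
        case True
        have "0 \<le> det (- Hn n z)" using psd_det_nonneg[OF contact_psd[OF sd U(1) \<Gamma>U(2)[OF True]]] .
        moreover have "vtn n z \<le> 0" by (rule contact_vt_le_0[OF sd U(1) \<Gamma>U(2)[OF True]])
        ultimately have "\<alpha> n z * \<beta> n z = - vtn n z * det (- Hn n z)" by (simp add: \<alpha>_def \<beta>_def)
        then show ?thesis using True \<Gamma>U(2)[OF True] vval[OF True] by (simp add: indicator_def contact_map_def)
      next
        case False
        then have "z \<notin> contact (vn n) (Dvn n) U \<inter> contact_map (vn n) (Dvn n) -` S" using S(2) by (auto simp: \<Gamma>_def)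
        then show ?thesis using False by simp
      qed
    qed
    finally show ?thesis by (rule order_trans[OF 1 add_mono[OF _ n]])
  qed
  \<comment> \<open>The factor 2 turns a limiting inequality with positive right-hand side into one
    that holds for all large n.\<close>
  define \<Gamma>A where "\<Gamma>A n = \<Gamma> n \<inter> {z. ennreal (gexp (1 / q) (1 / p) \<nu> (\<alpha> n z) (\<beta> n z) (val n z)) \<le> 2 * F z}" for n
  define \<Gamma>B where "\<Gamma>B n = \<Gamma> n \<inter> {z. gexp s0 \<sigma>0 \<nu>0 (\<alpha> n z) (\<beta> n z) (val n z) \<le> 2 * (h' z * norm (Dvn n z))}" for n
  define \<Gamma>Z where "\<Gamma>Z n = \<Gamma> n - \<Gamma>A n - \<Gamma>B n" for n
  note [measurable] = F h
  have [measurable]: "\<Gamma>A n \<in> sets borel" "\<Gamma>B n \<in> sets borel" for n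
    unfolding \<Gamma>A_def \<Gamma>B_def by measurable
  have \<Gamma>Zm [measurable]: "\<Gamma>Z n \<in> sets borel" for n unfolding \<Gamma>Z_def by measurable
  define f where "f n z = indicator (\<Gamma>Z n) z * ennreal (\<alpha> n z powr (1 / q) * \<beta> n z powr (1 / p))" for n z
  have fm: "f n \<in> borel_measurable borel" for n unfolding f_def[abs_def] by measurable
  \<comment> \<open>At contact points the determinant is at most a power of the trace, so
    \<open>powr_prod_le_sum\<close> gives the linear majorant that the convolutions of
    \<open>gg\<close> dominate.\<close>
  have fle: "f n z \<le> nnconv (kmeas (\<epsilon> n)) gg z" for n z
  proof (cases "z \<in> \<Gamma>Z n")
    case True
    then have z: "z \<in> \<Gamma> n" by (simp add: \<Gamma>Z_def)
    have ps: "psd (- Hn n z)" by (rule contact_psd[OF sd U(1) \<Gamma>U(2)[OF z]])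
    have "\<alpha> n z powr (1 / q) * \<beta> n z powr (1 / p) \<le> 1 + \<alpha> n z + trace (- Hn n z)"
    proof (rule powr_prod_le_sum[where d = "CARD('n)"])
      show "\<beta> n z \<le> trace (- Hn n z) ^ CARD('n)"
        using psd_det_le_trace_power[OF ps] psd_trace_nonneg[OF ps] by (simp add: \<beta>_def)
    qed (use \<nu> q psd_trace_nonneg[OF ps] in \<open>auto simp: \<alpha>_def \<beta>_def\<close>)
    also have "trace (- Hn n z) \<le> (\<Sum>i\<in>UNIV. \<bar>Hn n z $ i $ i\<bar>)"
      unfolding trace_def by (intro sum_mono) simp
    also have "1 + \<alpha> n z + (\<Sum>i\<in>UNIV. \<bar>Hn n z $ i $ i\<bar>) \<le> 1 + \<bar>vtn n z\<bar> + (\<Sum>i\<in>UNIV. \<bar>Hn n z $ i $ i\<bar>)"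
      by (simp add: \<alpha>_def)
    finally have "f n z \<le> ennreal (1 + \<bar>vtn n z\<bar> + (\<Sum>i\<in>UNIV. \<bar>Hn n z $ i $ i\<bar>))"
      using True ennreal_leI[of "\<alpha> n z powr (1 / q) * \<beta> n z powr (1 / p)" "1 + \<bar>vtn n z\<bar> + (\<Sum>i\<in>UNIV. \<bar>Hn n z $ i $ i\<bar>)"]
      by (simp add: f_def del: ennreal_plus)
    then show ?thesis using gb[OF \<Gamma>U(1)[OF z]] by (rule order_trans)
  qed (simp add: f_def)
  have ae: "AE z in lborel. (\<lambda>n. f n z) \<longlonglongrightarrow> 0"
    using ae_t ae_D ae_H alt
  proof eventually_elim
    case (elim z)
    show ?case
    proof (cases "\<exists>\<^sub>F n in sequentially. z \<in> \<Gamma> n")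
      case False
      then have "\<forall>\<^sub>F n in sequentially. z \<notin> \<Gamma> n" by (simp add: frequently_def)
      then have "\<forall>\<^sub>F n in sequentially. f n z = 0" by eventually_elim (simp add: f_def \<Gamma>Z_def)
      then show ?thesis by (rule tendsto_eventually)
    next
      \<comment> \<open>A point that is in contact infinitely often hands the signs of its
        derivatives and the lower bound M/4 over to the limit; these are the premises of
        \<open>alt\<close>.\<close>
      case fr: True
      then obtain k where "z \<in> \<Gamma> k" by (auto dest: frequently_ex)
      then have zU: "z \<in> U" by (rule \<Gamma>U)
      note lt = elim(1)[rule_format, OF zU] and lD = elim(2)[rule_format, OF zU] and lH = elim(3)[rule_format, OF zU]
      have lDn: "(\<lambda>n. norm (Dvn n z)) \<longlonglongrightarrow> norm (Du z)"
        by (intro tendsto_norm vec_tendstoI lD)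
      have ut: "ut z \<le> 0"
      proof (rule ccontr)
        assume "\<not> ut z \<le> 0"
        then have "\<forall>\<^sub>F n in sequentially. 0 < vtn n z" using lt by (intro order_tendstoD(1)) auto
        then have "\<forall>\<^sub>F n in sequentially. z \<notin> \<Gamma> n"
        proof eventually_elim
          case (elim n)
          show ?case using elim contact_vt_le_0[OF sd U(1) \<Gamma>U(2), of z n] by linarith
        qed
        then show False using fr by (simp add: frequently_def)
      qed
      have ps: "psd (- D2u z)"
        by (rule psd_uminus_limit[OF lH], rule frequently_elim1[OF fr], rule contact_psd[OF sd U(1) \<Gamma>U(2)])
      have uM: "M / 4 \<le> u z - m0"
      proof (rule ccontr)
        assume "\<not> M / 4 \<le> u z - m0"
        then have "\<forall>\<^sub>F n in sequentially. vn n z < M / 4" using lim_v[OF zU] by (intro order_tendstoD(2)) auto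
        then have "\<forall>\<^sub>F n in sequentially. z \<notin> \<Gamma> n"
        proof eventually_elim
          case (elim n)
          show ?case using elim vrange(1)[of z n] by linarith
        qed
        then show False using fr by (simp add: frequently_def)
      qed
      have la: "(\<lambda>n. \<alpha> n z) \<longlonglongrightarrow> - ut z"
      proof -
        have "(\<lambda>n. max 0 (- vtn n z)) \<longlonglongrightarrow> max 0 (- ut z)" by (intro tendsto_intros lt)
        then show ?thesis using ut by (simp add: \<alpha>_def max_absorb2)
      qed
      have lb: "(\<lambda>n. \<beta> n z) \<longlonglongrightarrow> det (- D2u z)"
      proof -
        have "(\<lambda>n. max 0 (det (- Hn n z))) \<longlonglongrightarrow> max 0 (det (- D2u z))" by (intro tendsto_max tendsto_const det_uminus_tendsto lH)
        then show ?thesis using psd_det_nonneg[OF ps] by (simp add: \<beta>_def max_absorb2)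
      qed
      have lv: "(\<lambda>n. val n z) \<longlonglongrightarrow> u z - m0"
      proof -
        have "(\<lambda>n. max 0 (vn n z)) \<longlonglongrightarrow> max 0 (u z - m0)" by (intro tendsto_max tendsto_const lim_v zU)
        then show ?thesis using uM M(1) by (simp add: val_def max_absorb2)
      qed
      have nn: "0 \<le> \<alpha> n z" "0 \<le> \<beta> n z" "0 \<le> val n z" for n by (auto simp: \<alpha>_def \<beta>_def val_def)
      let ?Ga = "gexp (1 / q) (1 / p) \<nu> (- ut z) (det (- D2u z)) (u z - m0)"
      let ?Gb = "gexp s0 \<sigma>0 \<nu>0 (- ut z) (det (- D2u z)) (u z - m0)"
      have lG: "(\<lambda>n. gexp (1 / q) (1 / p) \<nu> (\<alpha> n z) (\<beta> n z) (val n z)) \<longlonglongrightarrow> ?Ga"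
        by (intro tendsto_gexp la lb lv nn) (use q \<nu> in auto)
      have lG0: "(\<lambda>n. gexp s0 \<sigma>0 \<nu>0 (\<alpha> n z) (\<beta> n z) (val n z)) \<longlonglongrightarrow> ?Gb"
        by (intro tendsto_gexp la lb lv nn ex0)
      have ev0: ?thesis if "\<forall>\<^sub>F n in sequentially. z \<notin> \<Gamma>Z n"
      proof -
        have "\<forall>\<^sub>F n in sequentially. f n z = 0" using that by eventually_elim (simp add: f_def)
        then show ?thesis by (rule tendsto_eventually)
      qed
      consider "?Ga = 0" | "0 < F z" "ennreal ?Ga \<le> F z" | "0 < h' z * norm (Du z)" "?Gb \<le> h' z * norm (Du z)"
      proof -
        have "m0 < u z" using uM M(1) by linarith
        from elim(4)[rule_format, OF subsetD[OF UO zU] this ut ps] show ?thesis using that by blast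
      qed
      then show ?thesis
      proof cases
        \<comment> \<open>Here z may stay in the error set, but the power product itself tends to 0,
          because the remaining factor (u - m0)^\<nu> is positive.\<close>
        case 1
        have "rpow (u z - m0) \<nu> \<noteq> 0" using uM M(1) by (simp add: rpow_def)
        then have 0: "(- ut z) powr (1 / q) * det (- D2u z) powr (1 / p) = 0"
          using 1 q by (simp add: gexp_def rpow_def)
        have "(\<lambda>n. \<alpha> n z powr (1 / q) * \<beta> n z powr (1 / p)) \<longlonglongrightarrow> (- ut z) powr (1 / q) * det (- D2u z) powr (1 / p)"
          by (intro tendsto_mult tendsto_powr' la lb tendsto_const) (use q nn in auto)
        then have l0: "(\<lambda>n. ennreal (\<alpha> n z powr (1 / q) * \<beta> n z powr (1 / p))) \<longlonglongrightarrow> 0"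
          unfolding 0 by (metis ennreal_0 tendsto_ennrealI)
        show ?thesis
          by (rule tendsto_sandwich[OF _ _ tendsto_const l0])
             (auto simp: f_def indicator_def intro!: always_eventually)
      next
        case 2
        have "\<forall>\<^sub>F n in sequentially. ennreal (gexp (1 / q) (1 / p) \<nu> (\<alpha> n z) (\<beta> n z) (val n z)) \<le> 2 * F z"
        proof (cases "F z")
          case (real r)
          then have r: "0 < r" "?Ga \<le> r" using 2 by auto
          then have "\<forall>\<^sub>F n in sequentially. gexp (1 / q) (1 / p) \<nu> (\<alpha> n z) (\<beta> n z) (val n z) < 2 * r"
            by (intro order_tendstoD(2)[OF lG]) auto
          then show ?thesis
          proof eventually_elim
            case (elim n)
            then have "ennreal (gexp (1 / q) (1 / p) \<nu> (\<alpha> n z) (\<beta> n z) (val n z)) \<le> ennreal (2 * r)" by (intro ennreal_leI) simp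
            also have "\<dots> = 2 * F z" using real by (simp add: ennreal_mult)
            finally show ?case .
          qed
        qed (simp add: ennreal_mult_top)
        then have "\<forall>\<^sub>F n in sequentially. z \<notin> \<Gamma>Z n" by eventually_elim (simp add: \<Gamma>Z_def \<Gamma>A_def)
        then show ?thesis by (rule ev0)
      next
        case 3
        have l3: "(\<lambda>n. 2 * (h' z * norm (Dvn n z)) - gexp s0 \<sigma>0 \<nu>0 (\<alpha> n z) (\<beta> n z) (val n z)) \<longlonglongrightarrow> 2 * (h' z * norm (Du z)) - ?Gb"
          by (intro tendsto_intros lDn lG0)
        have "\<forall>\<^sub>F n in sequentially. 0 < 2 * (h' z * norm (Dvn n z)) - gexp s0 \<sigma>0 \<nu>0 (\<alpha> n z) (\<beta> n z) (val n z)"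
          by (rule order_tendstoD(1)[OF l3]) (use 3 in linarith)
        then have "\<forall>\<^sub>F n in sequentially. z \<notin> \<Gamma>Z n" by eventually_elim (simp add: \<Gamma>Z_def \<Gamma>B_def)
        then show ?thesis by (rule ev0)
      qed
    qed
  qed
  have f0: "f n z = 0" if "z \<notin> {- B..B} \<times> cball 0 R" for n z
  proof -
    have "z \<notin> U" using that BU[of z] Rz[of z] by (auto simp: mem_Times_iff abs_le_iff)
    then show ?thesis using \<Gamma>U(1)[of z n] by (auto simp: f_def \<Gamma>Z_def indicator_def)
  qed
  have C: "emeasure lborel {- B..B} < top" "emeasure lborel (cball (0::real^'n) R) < top"
    using emeasure_lborel_cball_finite[of "0::real^'n" R] by (simp_all add: emeasure_lborel_Icc_eq)
  have sm0: "(\<lambda>n. smixed q p (f n)) \<longlonglongrightarrow> 0"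
    by (rule smixed_nnconv_tendsto_0[OF gg(1,3,2) q _ _ C sets_kmeas emeasure_kmeas[OF \<epsilon>] fm fle f0 ae]) auto
  define \<rho> where "\<rho> = M / (4 * R)"
  have \<rho>: "0 < \<rho>" using M R by (simp add: \<rho>_def)
  define V where "V = emeasure lborel (cball (0 :: real^'n) (2 * \<rho>))"
  define c where "c = (if q < p then epow V (1 - q / p) else epow (ennreal M) (1 - p / q))"
  have ctop: "c < top"
    using emeasure_lborel_cball_finite[of "0::real^'n" "2 * \<rho>"] q
    by (auto simp: c_def V_def intro!: epow_less_top)
  \<comment> \<open>The slice bounds of the whole contact set convert smallness of f in the mixed
    norm into smallness of the measure covered from the error set.\<close>
  have Zle: "(\<integral>\<^sup>+z. indicator (\<Gamma>Z n) z * ennreal (\<alpha> n z * \<beta> n z) \<partial>lborel) \<le> c * smixed q p (f n)" for n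
  proof -
    let ?a = "\<lambda>z. indicator (\<Gamma>Z n) z * ennreal (\<alpha> n z)" and ?b = "\<lambda>z. indicator (\<Gamma>Z n) z * ennreal (\<beta> n z)"
    have "(\<integral>\<^sup>+z. indicator (\<Gamma>Z n) z * ennreal (\<alpha> n z * \<beta> n z) \<partial>lborel) = (\<integral>\<^sup>+z. ?a z * ?b z \<partial>lborel)"
      by (intro nn_integral_cong) (simp add: indicator_def \<alpha>_def \<beta>_def ennreal_mult)
    also have "\<dots> \<le> c * smixed q p (f n)" unfolding c_def
    proof (rule mixed_area_holder)
      show "(\<integral>\<^sup>+t. ?a (t, x) \<partial>lborel) \<le> ennreal M" for x
        by (rule order_trans[OF nn_integral_mono time[of n x]]) (auto simp: \<Gamma>Z_def indicator_def)
      show "(\<integral>\<^sup>+x. ?b (t, x) \<partial>lborel) \<le> V" for t unfolding V_def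
      proof (rule order_trans[OF nn_integral_mono space[OF \<rho>, of n t]])
        fix x
        have "norm (Dvn n (t, x)) \<le> \<rho>" if "(t, x) \<in> \<Gamma> n"
          using that by (auto simp: \<Gamma>_def T contact_map_def \<rho>_def)
        then show "?b (t, x) \<le> indicator (\<Gamma> n \<inter> {z. norm (Dvn n z) \<le> \<rho>}) (t, x) * ennreal (\<beta> n (t, x))"
          by (auto simp: \<Gamma>Z_def indicator_def)
      qed
      show "epow (?a z) (1 / q) * epow (?b z) (1 / p) \<le> f n z" for z
        using q by (cases "z \<in> \<Gamma>Z n") (auto simp: f_def epow_ennreal \<alpha>_def \<beta>_def ennreal_mult)
    qed (use q fm in auto)
    finally show ?thesis .
  qed
  have "(\<lambda>n. c * smixed q p (f n)) \<longlonglongrightarrow> c * 0"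
    by (rule tendsto_mult_ennreal[OF tendsto_const sm0]) (use ctop in auto)
  then have "\<forall>\<^sub>F n in sequentially. c * smixed q p (f n) < ennreal \<delta>"
    using \<delta> by (intro order_tendstoD(2)[of _ "c * 0"]) auto
  then have "\<forall>\<^sub>F n in sequentially. c * smixed q p (f n) < ennreal \<delta> \<and>
      emeasure lborel (T - contact_map (vn n) (Dvn n) ` contact (vn n) (Dvn n) U) \<le> ennreal \<delta>"
    using ev by (rule eventually_conj)
  \<comment> \<open>From here on a single, sufficiently late approximation is used; the remaining
    argument needs no further limit.\<close>
  then obtain n where n: "c * smixed q p (f n) < ennreal \<delta>"
      "emeasure lborel (T - contact_map (vn n) (Dvn n) ` contact (vn n) (Dvn n) U) \<le> ennreal \<delta>"
    using eventually_happens'[OF sequentially_bot] by blast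
  show thesis
  proof (rule that[of "\<Gamma> n" "\<Gamma>A n" "\<Gamma>B n" "\<Gamma>Z n" "\<alpha> n" "\<beta> n" "val n" "Dvn n"])
    show "emeasure lborel S \<le> (\<integral>\<^sup>+z. indicator (\<Gamma> n \<inter> {z. (val n z - snd z \<bullet> Dvn n z, Dvn n z) \<in> S}) z * ennreal (\<alpha> n z * \<beta> n z) \<partial>lborel) + ennreal \<delta>"
      if "S \<in> sets borel" "S \<subseteq> T" for S using area[OF that n(2)] .
    show "(\<integral>\<^sup>+z. indicator (\<Gamma>Z n) z * ennreal (\<alpha> n z * \<beta> n z) \<partial>lborel) \<le> ennreal \<delta>"
      using Zle[of n] n(1) by simp
    show "M / 4 \<le> val n z" if "z \<in> \<Gamma> n" for z using vrange(1)[OF that] vval[OF that] by simp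
  qed (use time space in \<open>auto simp: \<Gamma>Z_def \<Gamma>A_def \<Gamma>B_def \<alpha>_def \<beta>_def\<close>)
qed

section \<open>The pointwise alternative\<close>

lemma rpow_mult: "0 \<le> x \<Longrightarrow> 0 \<le> y \<Longrightarrow> rpow (x * y) s = rpow x s * rpow y s"
  by (simp add: rpow_def powr_mult)

lemma rpow_mono: "0 \<le> x \<Longrightarrow> x \<le> y \<Longrightarrow> 0 \<le> s \<Longrightarrow> rpow x s \<le> rpow y s"
  by (auto simp: rpow_def intro: powr_mono2)

text \<open>Each coefficient is paired with its derivative, and each pair is bounded by a power of
  X. The exponents add up to 1, so the product is X up to the factor 2^(d \<sigma>) <= 2 that the
  determinants cost; for X = 0 some exponent is positive and its factor vanishes.\<close>

lemma gexp_prod_le: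
  fixes A B :: "real^'n^'n"
  assumes A: "psd A" and B: "psd B" and nn: "0 \<le> r" "0 \<le> x" "0 \<le> c" "0 \<le> v"
    and ex: "0 \<le> s" "0 \<le> \<sigma>" "0 \<le> \<nu>" "s + real CARD('n) * \<sigma> + \<nu> = 1"
    and X: "r * x \<le> X" "trace (A ** B) \<le> 2 * X" "c * v \<le> X"
  shows "gexp s \<sigma> \<nu> r (det A) c * gexp s \<sigma> \<nu> x (det B) v \<le> 2 * X"
proof -
  have X0: "0 \<le> X" using X(1) nn by (meson mult_nonneg_nonneg order_trans)
  have dd: "0 \<le> det A * det B" "det A * det B \<le> (2 * X) ^ CARD('n)"
    using psd_det_nonneg[OF A] psd_det_nonneg[OF B] psd_det_mult_le[OF A B] power_mono[OF X(2), of "CARD('n)"]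
    by (auto intro: order_trans)
  have "gexp s \<sigma> \<nu> r (det A) c * gexp s \<sigma> \<nu> x (det B) v
      = rpow (r * x) s * rpow (det A * det B) \<sigma> * rpow (c * v) \<nu>"
    using nn psd_det_nonneg[OF A] psd_det_nonneg[OF B] by (simp add: gexp_def rpow_mult mult_ac)
  also have "\<dots> \<le> rpow X s * rpow ((2 * X) ^ CARD('n)) \<sigma> * rpow X \<nu>"
    using nn X X0 dd ex psd_det_nonneg[OF A] psd_det_nonneg[OF B] by (intro mult_mono rpow_mono mult_nonneg_nonneg rpow_nonneg) auto
  also have "\<dots> \<le> 2 * X"
  proof (cases "X = 0")
    case True
    have "s \<noteq> 0 \<or> \<sigma> \<noteq> 0 \<or> \<nu> \<noteq> 0" using ex(4) by auto
    then show ?thesis using True by (auto simp: rpow_def)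
  next
    case False
    then have "0 < X" using X0 by simp
    have r: "rpow y t = y powr t" if "0 < y" for y t using that by (simp add: rpow_def)
    have "rpow X s * rpow ((2 * X) ^ CARD('n)) \<sigma> * rpow X \<nu> = X powr (s + real CARD('n) * \<sigma> + \<nu>) * 2 powr (real CARD('n) * \<sigma>)"
      using \<open>0 < X\<close> by (simp add: r powr_add powr_mult powr_realpow[symmetric] powr_powr)
    also have "\<dots> = X * 2 powr (real CARD('n) * \<sigma>)" using \<open>0 < X\<close> by (simp add: ex(4))
    also have "\<dots> \<le> X * 2 powr 1" using \<open>0 < X\<close> ex by (intro mult_left_mono powr_mono) auto
    finally show ?thesis by simp
  qed
  finally show ?thesis .
qed

lemma trace_mult_symmetric:
  fixes A B :: "real^'n^'n"
  assumes "transpose B = B"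
  shows "trace (A ** B) = (\<Sum>i\<in>UNIV. \<Sum>j\<in>UNIV. A $ i $ j * B $ i $ j)"
proof -
  have "B $ j $ i = B $ i $ j" for i j
    using arg_cong[OF assms, of "\<lambda>C. C $ i $ j"] by (simp add: transpose_def)
  then show ?thesis by (simp add: trace_def matrix_matrix_mult_def)
qed

text \<open>X is the sum of three nonnegative terms, and X <= neg_part L + norm b * norm D because c
  * m0 >= 0. Hence X is at most twice the larger summand, and \<open>gexp_prod_le\<close> with the
  exponents belonging to it gives the second or the third alternative; the 4 is 2 * 2.\<close>

lemma pde_alternative:
  fixes a D2 :: "real^'n^'n" and b D :: "real^'n"
  assumes a: "psd a" and nn: "0 \<le> r" "0 \<le> c" and pos: "0 < r + trace a + c"
    and b: "norm b \<le> gexp s0 \<sigma>0 \<nu>0 r (det a) c * h"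
    and ex0: "0 \<le> s0" "0 \<le> \<sigma>0" "0 \<le> \<nu>0" "s0 + real CARD('n) * \<sigma>0 + \<nu>0 = 1"
    and q: "0 < p" "0 < q" and \<nu>: "0 \<le> \<nu>" "\<nu> = 1 - real CARD('n) / p - 1 / q"
    and ut: "ut \<le> 0" and D2: "psd (- D2)" and u: "0 \<le> m0" "m0 < u"
    and L: "L = r * ut + (1/2) * (\<Sum>i\<in>UNIV. \<Sum>j\<in>UNIV. a $ i $ j * D2 $ i $ j) + (\<Sum>i\<in>UNIV. b $ i * D $ i) - c * u"
    and W: "W = epow (ennreal c) (- \<nu>) * epow (ennreal r) (- 1 / q) * epow (ennreal (det a)) (- 1 / p) * ennreal (neg_part L)"
  shows "gexp (1 / q) (1 / p) \<nu> (- ut) (det (- D2)) (u - m0) = 0 \<or>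
      L < 0 \<and> 0 < 4 * W \<and> ennreal (gexp (1 / q) (1 / p) \<nu> (- ut) (det (- D2)) (u - m0)) \<le> 4 * W \<or>
      0 < 4 * h * norm D \<and> gexp s0 \<sigma>0 \<nu>0 (- ut) (det (- D2)) (u - m0) \<le> 4 * h * norm D"
proof -
  define X where "X = r * (- ut) + (1/2) * trace (a ** (- D2)) + c * (u - m0)"
  define f where "f = neg_part L"
  define Ga where "Ga = gexp (1 / q) (1 / p) \<nu> (- ut) (det (- D2)) (u - m0)"
  define Gb where "Gb = gexp s0 \<sigma>0 \<nu>0 (- ut) (det (- D2)) (u - m0)"
  define wt where "wt = gexp (1 / q) (1 / p) \<nu> r (det a) c"
  define wt0 where "wt0 = gexp s0 \<sigma>0 \<nu>0 r (det a) c"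
  have f: "0 \<le> f" "- L \<le> f" "0 < f \<Longrightarrow> L < 0" by (auto simp: f_def neg_part_def split: if_splits)
  have dn: "0 \<le> det a" "0 \<le> det (- D2)" using psd_det_nonneg a D2 by auto
  have tr0: "0 \<le> trace (a ** (- D2))" by (rule psd_det_mult_le(2)[OF a D2])
  have nn': "0 \<le> r * (- ut)" "0 \<le> c * (u - m0)" using nn ut u by (auto intro: mult_nonneg_nonneg mult_nonneg_nonpos)
  have "trace (a ** (- D2)) = - (\<Sum>i\<in>UNIV. \<Sum>j\<in>UNIV. a $ i $ j * D2 $ i $ j)"
    using D2 by (subst trace_mult_symmetric) (auto simp: psd_def sum_negf)
  then have "X = - L + b \<bullet> D - c * m0" by (simp add: X_def L inner_vec_def algebra_simps)
  moreover have "b \<bullet> D \<le> norm b * norm D" by (rule norm_cauchy_schwarz)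
  moreover have "0 \<le> c * m0" using nn u by simp
  ultimately have Xf: "X \<le> f + norm b * norm D" using f by linarith
  have X: "r * (- ut) \<le> X" "trace (a ** (- D2)) \<le> 2 * X" "c * (u - m0) \<le> X" "0 \<le> X"
    using nn' tr0 by (auto simp: X_def)
  have g: "wt * Ga \<le> 2 * X" unfolding wt_def Ga_def
    by (rule gexp_prod_le[OF a D2]) (use nn ut u q \<nu> X in auto)
  have g0: "wt0 * Gb \<le> 2 * X" unfolding wt0_def Gb_def
    by (rule gexp_prod_le[OF a D2]) (use nn ut u ex0 X in auto)
  have "Ga = 0 \<or> L < 0 \<and> 0 < 4 * W \<and> ennreal Ga \<le> 4 * W \<or> 0 < 4 * h * norm D \<and> Gb \<le> 4 * h * norm D"
  proof (cases "norm b * norm D \<le> f")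
    case True
    then have Xf2: "X \<le> 2 * f" using Xf by simp
    show ?thesis
    \<comment> \<open>If f = 0, all three terms of X vanish, so c = 0. By nondegeneracy either r > 0
      and ut = 0, or trace a > 0 and det (- D2) = 0; the first alternative holds in both
      cases.\<close>
    proof (cases "f = 0")
      case True
      then have "X = 0" using Xf2 X(4) by simp
      then have z: "r * (- ut) = 0" "trace (a ** (- D2)) = 0" "c * (u - m0) = 0" using X nn' tr0 by auto
      then have c0: "c = 0" using u by simp
      have "ut = 0 \<or> det (- D2) = 0"
      proof (cases "r = 0")
        case True
        then show ?thesis using psd_trace_mult_eq_0[OF a D2 z(2)] pos c0 by simp
      qed (use z in simp)
      then have "Ga = 0" using q by (auto simp: Ga_def gexp_def rpow_def)
      then show ?thesis by simp
    next
      case False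
      then have f0: "0 < f" using f by simp
      have e: "epow (ennreal c) (- \<nu>) = (if rpow c \<nu> = 0 then top else ennreal (1 / rpow c \<nu>))"
        "epow (ennreal r) (- 1 / q) = (if rpow r (1 / q) = 0 then top else ennreal (1 / rpow r (1 / q)))"
        "epow (ennreal (det a)) (- 1 / p) = (if rpow (det a) (1 / p) = 0 then top else ennreal (1 / rpow (det a) (1 / p)))"
        using nn dn \<nu>(1) q by (auto simp: rpow_def epow_ennreal_pos powr_minus_divide[symmetric] epow_def)
      have "0 < W \<and> ennreal Ga \<le> 4 * W"
      \<comment> \<open>A vanishing weight means that some coefficient has an infinite inverse
        power, so W is infinite and the bound is trivial.\<close>
      proof (cases "wt = 0")
        case True
        then have "W = top" using f0 rpow_nonneg[of c \<nu>] rpow_nonneg[of r "1 / q"] rpow_nonneg[of "det a" "1 / p"]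
          unfolding W e wt_def gexp_def f_def[symmetric]
          by (auto simp: ennreal_mult_top ennreal_top_mult mult_eq_0_iff less_le)
        then show ?thesis by (simp add: ennreal_mult_top)
      next
        case False
        then have wt0: "0 < wt" using gexp_nonneg[of "1 / q" "1 / p" \<nu> r "det a" c] by (simp add: wt_def)
        have "W = ennreal (f / wt)"
          using False rpow_nonneg[of c \<nu>] rpow_nonneg[of r "1 / q"] rpow_nonneg[of "det a" "1 / p"] f0
          unfolding W e wt_def gexp_def f_def[symmetric]
          by (simp add: ennreal_mult[symmetric] field_simps)
        moreover from this have "4 * W = ennreal (4 * (f / wt))" using f0 wt0 by (subst ennreal_mult) auto
        moreover have "Ga \<le> 4 * (f / wt)" using g Xf2 wt0 by (simp add: field_simps)
        ultimately show ?thesis using f0 wt0 by (metis divide_pos_pos ennreal_leI ennreal_less_zero_iff)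
      qed
      then have "0 < 4 * W" "ennreal Ga \<le> 4 * W" by (auto simp: zero_less_iff_neq_zero)
      then show ?thesis using f(3)[OF f0] by blast
    qed
  next
    case False
    then have bD: "0 < norm b * norm D" using f(1) by linarith
    then have bD': "0 < norm b" "0 < norm D" by (auto simp: zero_less_mult_iff)
    have w0: "0 \<le> wt0" unfolding wt0_def by (rule gexp_nonneg)
    have "0 < wt0 * h" using b bD'(1) unfolding wt0_def by linarith
    then have h: "0 < wt0" "0 < h" using w0 by (auto simp: zero_less_mult_iff)
    have "wt0 * Gb \<le> 2 * (2 * (norm b * norm D))" using g0 Xf False by linarith
    also have "\<dots> \<le> 2 * (2 * (wt0 * h * norm D))" using b bD' by (simp add: wt0_def)
    finally have "wt0 * Gb \<le> wt0 * (4 * h * norm D)" by (simp add: mult_ac)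
    then have "Gb \<le> 4 * h * norm D" using h by simp
    then show ?thesis using h bD' by simp
  qed
  then show ?thesis unfolding Ga_def Gb_def .
qed

section \<open>The constants\<close>

text \<open>By homogeneity the powers of M and \<open>\<rho>\<close> combine into M * \<rho>^d times
  Y^P with Y = (\<rho>/M)^(1 - d/P) * 32 * H, where 32 bounds 8 * 4^\<nu>. As Y <=
  \<open>\<theta>\<close> <= 1, Y^P <= Y. Logarithms verify the identity of exponents; s = 0 covers
  an infinite time exponent.\<close>

lemma drift_numeric_time:
  fixes M \<rho> H \<omega> P s d \<theta> \<nu> :: real
  assumes pos: "0 < M" "0 < \<rho>" "0 \<le> H" "0 < \<omega>" and P: "1 \<le> P" and \<nu>: "\<nu> = 1 - d / P - s" "0 \<le> \<nu>" and sd: "0 \<le> s" "0 \<le> d"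
    and X: "(\<rho> / M) powr (1 - d / P) * 32 * H \<le> \<theta>" and \<theta>: "\<theta> \<le> 1" "\<theta> \<le> \<omega> / 64"
  shows "M powr (1 - P * s) * ((8 * \<rho> * (M / 4) powr (- \<nu>)) powr P * H powr P) \<le> M * \<omega> * \<rho> powr d / 64"
proof -
  define Y where "Y = (\<rho> / M) powr (1 - d / P) * 32 * H"
  have Y: "0 \<le> Y" "Y \<le> \<theta>" using X pos by (auto simp: Y_def)
  have "\<nu> \<le> 1" using \<nu> sd P divide_nonneg_nonneg[of d P] by linarith
  have id: "M powr (1 - P * s) * (8 * \<rho> * (M / 4) powr (- \<nu>)) powr P = M * \<rho> powr d * ((\<rho> / M) powr (1 - d / P) * (8 * 4 powr \<nu>)) powr P"
  proof -
    have "ln (M powr (1 - P * s) * (8 * \<rho> * (M / 4) powr (- \<nu>)) powr P) = ln (M * \<rho> powr d * ((\<rho> / M) powr (1 - d / P) * (8 * 4 powr \<nu>)) powr P)"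
      using pos P by (simp add: ln_mult ln_div ln_powr \<nu>(1) field_simps)
    then show ?thesis using pos by (subst (asm) ln_inj_iff) auto
  qed
  have "M powr (1 - P * s) * ((8 * \<rho> * (M / 4) powr (- \<nu>)) powr P * H powr P)
    = M * \<rho> powr d * (((\<rho> / M) powr (1 - d / P) * (8 * 4 powr \<nu>)) powr P * H powr P)"
    using id by (simp add: mult.assoc)
  also have "\<dots> = M * \<rho> powr d * ((\<rho> / M) powr (1 - d / P) * (8 * 4 powr \<nu>) * H) powr P"
    using pos by (simp add: powr_mult)
  also have "\<dots> \<le> M * \<rho> powr d * Y powr P"
  proof -
    have "(4::real) powr \<nu> \<le> 4 powr 1" using \<open>\<nu> \<le> 1\<close> by (intro powr_mono) auto
    then have "(\<rho> / M) powr (1 - d / P) * (8 * 4 powr \<nu>) * H \<le> Y"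
      unfolding Y_def using pos by (intro mult_right_mono mult_left_mono) auto
    then show ?thesis using pos P by (intro mult_left_mono powr_mono2) auto
  qed
  also have "Y powr P \<le> Y powr 1" using Y \<theta> P by (intro powr_mono') auto
  also have "Y powr 1 \<le> \<omega> / 64" using Y \<theta> by simp
  finally show ?thesis using pos by (simp add: mult_ac)
qed

text \<open>The counterpart in which the slice bound of the determinant enters. The divisor 2^d and
  the minimum with \<open>\<omega>\<close> in \<open>\<theta>\<close> pay for the powers of 2 and
  \<open>\<omega>\<close> that it brings; \<sigma> = 0 covers an infinite space exponent.\<close>

lemma drift_numeric_space:
  fixes M \<rho> H \<omega> Q \<sigma> d \<theta> \<nu> :: real
  assumes pos: "0 < M" "0 < \<rho>" "0 \<le> H" "0 < \<omega>" and Q: "1 \<le> Q" and \<nu>: "\<nu> = 1 - d * \<sigma> - 1 / Q" "0 \<le> \<nu>"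
    and \<sigma>: "0 \<le> \<sigma>" "Q * \<sigma> \<le> 1" "0 \<le> d"
    and X: "(\<rho> / M) powr (1 - d * \<sigma>) * 32 * H \<le> \<theta>" and \<theta>: "\<theta> \<le> 1" "\<theta> = min 1 \<omega> / (64 * 2 powr d)"
  shows "(\<omega> * (2 * \<rho>) powr d) powr (1 - Q * \<sigma>) * ((8 * \<rho> * (M / 4) powr (- \<nu>)) powr Q * H powr Q) \<le> M * \<omega> * \<rho> powr d / 64"
proof -
  define Y where "Y = (\<rho> / M) powr (1 - d * \<sigma>) * 32 * H"
  have Y: "0 \<le> Y" "Y \<le> \<theta>" using X pos by (auto simp: Y_def)
  have "\<nu> \<le> 1" using \<nu> \<sigma> Q divide_nonneg_nonneg[of 1 Q] mult_nonneg_nonneg[of d \<sigma>] by linarith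
  have id: "(\<omega> * (2 * \<rho>) powr d) powr (1 - Q * \<sigma>) * (8 * \<rho> * (M / 4) powr (- \<nu>)) powr Q
      = (M * \<omega> * \<rho> powr d) * (2 powr (d * (1 - Q * \<sigma>)) * \<omega> powr (- (Q * \<sigma>)) * ((\<rho> / M) powr (1 - d * \<sigma>) * (8 * 4 powr \<nu>)) powr Q)"
  proof -
    have "ln ((\<omega> * (2 * \<rho>) powr d) powr (1 - Q * \<sigma>) * (8 * \<rho> * (M / 4) powr (- \<nu>)) powr Q)
      = ln ((M * \<omega> * \<rho> powr d) * (2 powr (d * (1 - Q * \<sigma>)) * \<omega> powr (- (Q * \<sigma>)) * ((\<rho> / M) powr (1 - d * \<sigma>) * (8 * 4 powr \<nu>)) powr Q))"
      using pos Q by (simp add: ln_mult ln_div ln_powr \<nu>(1) field_simps)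
    then show ?thesis using pos by (subst (asm) ln_inj_iff) auto
  qed
  have "(\<omega> * (2 * \<rho>) powr d) powr (1 - Q * \<sigma>) * ((8 * \<rho> * (M / 4) powr (- \<nu>)) powr Q * H powr Q)
    = (M * \<omega> * \<rho> powr d) * (2 powr (d * (1 - Q * \<sigma>)) * \<omega> powr (- (Q * \<sigma>)) * (((\<rho> / M) powr (1 - d * \<sigma>) * (8 * 4 powr \<nu>)) powr Q * H powr Q))"
    using id by (simp add: mult.assoc)
  also have "((\<rho> / M) powr (1 - d * \<sigma>) * (8 * 4 powr \<nu>)) powr Q * H powr Q = ((\<rho> / M) powr (1 - d * \<sigma>) * (8 * 4 powr \<nu>) * H) powr Q"
    using pos by (simp add: powr_mult)
  finally have eq: "(\<omega> * (2 * \<rho>) powr d) powr (1 - Q * \<sigma>) * ((8 * \<rho> * (M / 4) powr (- \<nu>)) powr Q * H powr Q)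
    = (M * \<omega> * \<rho> powr d) * (2 powr (d * (1 - Q * \<sigma>)) * \<omega> powr (- (Q * \<sigma>)) * ((\<rho> / M) powr (1 - d * \<sigma>) * (8 * 4 powr \<nu>) * H) powr Q)" .
  have "2 powr (d * (1 - Q * \<sigma>)) * \<omega> powr (- (Q * \<sigma>)) * ((\<rho> / M) powr (1 - d * \<sigma>) * (8 * 4 powr \<nu>) * H) powr Q
    \<le> 2 powr d * (1 / min 1 \<omega>) * \<theta>"
  proof (intro mult_mono)
    show "(2::real) powr (d * (1 - Q * \<sigma>)) \<le> 2 powr d" using \<sigma> Q by (intro powr_mono) (auto intro: mult_left_le)
    have "min 1 \<omega> \<le> \<omega> powr (Q * \<sigma>)"
    proof (cases "\<omega> \<le> 1")
      case True
      then have "\<omega> powr 1 \<le> \<omega> powr (Q * \<sigma>)" using pos \<sigma> by (intro powr_mono') auto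
      then show ?thesis using pos True by simp
    next
      case False
      then have "1 \<le> \<omega> powr (Q * \<sigma>)" using \<sigma> Q by (intro ge_one_powr_ge_zero) auto
      then show ?thesis by simp
    qed
    then show "\<omega> powr (- (Q * \<sigma>)) \<le> 1 / min 1 \<omega>" using pos by (simp add: powr_minus_divide frac_le)
    have "(4::real) powr \<nu> \<le> 4 powr 1" using \<open>\<nu> \<le> 1\<close> by (intro powr_mono) auto
    then have "(\<rho> / M) powr (1 - d * \<sigma>) * (8 * 4 powr \<nu>) * H \<le> Y"
      unfolding Y_def using pos by (intro mult_right_mono mult_left_mono) auto
    then have "((\<rho> / M) powr (1 - d * \<sigma>) * (8 * 4 powr \<nu>) * H) powr Q \<le> Y powr Q" using pos Q by (intro powr_mono2) auto
    also have "\<dots> \<le> Y powr 1" using Y \<theta>(1) Q by (intro powr_mono') auto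
    finally show "((\<rho> / M) powr (1 - d * \<sigma>) * (8 * 4 powr \<nu>) * H) powr Q \<le> \<theta>" using Y by simp
  qed (use pos in auto)
  also have "\<dots> = 1 / 64" using pos by (simp add: \<theta>(2))
  finally show ?thesis unfolding eq using pos by (simp add: mult_left_mono[where c = "M * \<omega> * \<rho> powr d", of _ "1 / 64", simplified])
qed

lemma powr_le_powr_iff:
  fixes x y s :: real
  assumes "0 \<le> x" "0 \<le> y" "0 < s"
  shows "x powr s \<le> y powr s \<longleftrightarrow> x \<le> y"
  using assms powr_less_mono2[of s y x] powr_mono2[of s x y] by (auto simp: not_less[symmetric])

text \<open>After cancelling a common power of M both sides are p-th powers up to constants. Since
  \<open>\<theta>\<close>^p <= \<open>\<theta>\<close> <= \<omega>/32, the constant can be taken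
  inside before the root is extracted.\<close>

lemma final_numeric_time:
  fixes M \<rho> K \<omega> p q d \<theta> \<nu> :: real
  assumes pos: "0 < M" "0 < \<rho>" "0 \<le> K" "0 < \<omega>" and p: "1 \<le> p" and \<nu>: "\<nu> = 1 - d / p - 1 / q" "0 \<le> \<nu>" and sd: "0 < q" "0 \<le> d"
    and \<theta>: "0 < \<theta>" "\<theta> \<le> 1" "\<theta> \<le> \<omega> / 64"
    and X: "M * \<omega> * \<rho> powr d / 32 \<le> M powr (1 - p / q) * ((8 * (M / 4) powr (- \<nu>)) powr p * K powr p)"
  shows "\<theta> * ((\<rho> / M) powr (d / p) * M) \<le> 32 * K"
proof -
  define y where "y = (\<rho> / M) powr (d / p) * M"
  have y: "0 < y" using pos by (simp add: y_def)
  have "\<nu> \<le> 1" using \<nu> sd p divide_nonneg_nonneg[of d p] divide_nonneg_nonneg[of 1 q] by linarith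
  have id1: "M * \<rho> powr d = M powr (1 + d - p) * y powr p"
  proof -
    have "ln (M * \<rho> powr d) = ln (M powr (1 + d - p) * y powr p)" unfolding y_def
      using pos p by (simp add: ln_mult ln_div ln_powr field_simps)
    then show ?thesis using pos y by (subst (asm) ln_inj_iff) auto
  qed
  have id2: "M powr (1 - p / q) * (8 * (M / 4) powr (- \<nu>)) powr p = M powr (1 + d - p) * (8 * 4 powr \<nu>) powr p"
  proof -
    have "ln (M powr (1 - p / q) * (8 * (M / 4) powr (- \<nu>)) powr p) = ln (M powr (1 + d - p) * (8 * 4 powr \<nu>) powr p)"
      using pos p sd by (simp add: ln_mult ln_div ln_powr \<nu>(1) field_simps)
    then show ?thesis using pos by (subst (asm) ln_inj_iff) auto
  qed
  have "M powr (1 + d - p) * (\<omega> / 32 * y powr p) = M * \<omega> * \<rho> powr d / 32" using id1 by (simp add: mult_ac)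
  also have "\<dots> \<le> M powr (1 + d - p) * ((8 * 4 powr \<nu>) powr p * K powr p)" using X unfolding mult.assoc[symmetric] id2[unfolded mult.assoc[symmetric]] .
  finally have "\<omega> / 32 * y powr p \<le> (8 * 4 powr \<nu>) powr p * K powr p" using pos by (subst (asm) mult_le_cancel_left_pos) auto
  also have "\<dots> = (8 * 4 powr \<nu> * K) powr p" using pos by (simp add: powr_mult)
  also have "\<dots> \<le> (32 * K) powr p"
  proof -
    have "(4::real) powr \<nu> \<le> 4 powr 1" using \<open>\<nu> \<le> 1\<close> by (intro powr_mono) auto
    then show ?thesis using pos p by (intro powr_mono2 mult_right_mono) auto
  qed
  finally have 1: "\<omega> / 32 * y powr p \<le> (32 * K) powr p" .
  have "\<theta> powr p \<le> \<theta> powr 1" using \<theta> p by (intro powr_mono') auto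
  then have "\<theta> powr p \<le> \<omega> / 32" using \<theta> pos by simp
  then have "(\<theta> * y) powr p \<le> (32 * K) powr p"
    unfolding powr_mult[of \<theta> y] using order_trans[OF mult_right_mono 1, of "\<theta> powr p"] by simp
  then show ?thesis using \<theta> y pos p unfolding y_def[symmetric] by (subst (asm) powr_le_powr_iff) auto
qed

text \<open>The same scaling argument with the slice bound of the determinant: C collects the common
  powers, and 64 * 2^d * \<open>\<theta>\<close> = min 1 \<open>\<omega>\<close> <=
  \<open>\<omega>\<close>^(q/p) pays for the constants before the q-th root is taken.\<close>

lemma final_numeric_space:
  fixes M \<rho> K \<omega> p q d \<theta> \<nu> :: real
  assumes pos: "0 < M" "0 < \<rho>" "0 \<le> K" "0 < \<omega>" and q: "1 \<le> q" "q \<le> p" and \<nu>: "\<nu> = 1 - d / p - 1 / q" "0 \<le> \<nu>" and sd: "0 \<le> d"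
    and \<theta>: "0 < \<theta>" "\<theta> \<le> 1" "\<theta> = min 1 \<omega> / (64 * 2 powr d)"
    and X: "M * \<omega> * \<rho> powr d / 32 \<le> (\<omega> * (2 * \<rho>) powr d) powr (1 - q / p) * ((8 * (M / 4) powr (- \<nu>)) powr q * K powr q)"
  shows "\<theta> * ((\<rho> / M) powr (d / p) * M) \<le> 32 * K"
proof -
  define y where "y = (\<rho> / M) powr (d / p) * M"
  have y: "0 < y" using pos by (simp add: y_def)
  have p: "0 < p" using q by simp
  have "\<nu> \<le> 1" using \<nu> sd q p divide_nonneg_nonneg[of d p] divide_nonneg_nonneg[of 1 q] by linarith
  define C where "C = \<omega> powr (1 - q / p) * \<rho> powr (d * (1 - q / p)) * M powr (1 + d * q / p - q)"
  have C: "0 < C" using pos by (simp add: C_def)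
  have id1: "M * \<omega> * \<rho> powr d = C * (\<omega> powr (q / p) * y powr q)"
  proof -
    have "ln (M * \<omega> * \<rho> powr d) = ln (C * (\<omega> powr (q / p) * y powr q))" unfolding y_def C_def
      using pos p q by (simp add: ln_mult ln_div ln_powr field_simps)
    then show ?thesis using pos y C by (subst (asm) ln_inj_iff) auto
  qed
  have id2: "(\<omega> * (2 * \<rho>) powr d) powr (1 - q / p) * (8 * (M / 4) powr (- \<nu>)) powr q = C * (2 powr (d * (1 - q / p)) * (8 * 4 powr \<nu>) powr q)"
  proof -
    have "ln ((\<omega> * (2 * \<rho>) powr d) powr (1 - q / p) * (8 * (M / 4) powr (- \<nu>)) powr q) = ln (C * (2 powr (d * (1 - q / p)) * (8 * 4 powr \<nu>) powr q))"
      unfolding C_def using pos p q sd by (simp add: ln_mult ln_div ln_powr \<nu>(1) field_simps)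
    then show ?thesis using pos C by (subst (asm) ln_inj_iff) auto
  qed
  have "C * (\<omega> powr (q / p) * y powr q / 32) = M * \<omega> * \<rho> powr d / 32" using id1 by simp
  also have "\<dots> \<le> C * (2 powr (d * (1 - q / p)) * ((8 * 4 powr \<nu>) powr q * K powr q))" using X unfolding mult.assoc[symmetric] id2[unfolded mult.assoc[symmetric]] .
  finally have "\<omega> powr (q / p) * y powr q / 32 \<le> 2 powr (d * (1 - q / p)) * ((8 * 4 powr \<nu>) powr q * K powr q)"
    using C by (subst (asm) mult_le_cancel_left_pos) auto
  also have "(8 * 4 powr \<nu>) powr q * K powr q = (8 * 4 powr \<nu> * K) powr q" using pos by (simp add: powr_mult)
  also have "2 powr (d * (1 - q / p)) * (8 * 4 powr \<nu> * K) powr q \<le> 2 powr d * (32 * K) powr q"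
  proof (intro mult_mono)
    have "(4::real) powr \<nu> \<le> 4 powr 1" using \<open>\<nu> \<le> 1\<close> by (intro powr_mono) auto
    then show "(8 * 4 powr \<nu> * K) powr q \<le> (32 * K) powr q" using pos q by (intro powr_mono2 mult_right_mono) auto
    show "(2::real) powr (d * (1 - q / p)) \<le> 2 powr d" using sd q p by (intro powr_mono) (auto intro: mult_left_le)
  qed auto
  finally have 1: "\<omega> powr (q / p) * y powr q / 32 \<le> 2 powr d * (32 * K) powr q" .
  have "min 1 \<omega> \<le> \<omega> powr (q / p)"
  proof (cases "\<omega> \<le> 1")
    case True
    then have "\<omega> powr 1 \<le> \<omega> powr (q / p)" using pos q p by (intro powr_mono') auto
    then show ?thesis using pos True by simp
  next
    case False
    then have "1 \<le> \<omega> powr (q / p)" using q p by (intro ge_one_powr_ge_zero) auto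
    then show ?thesis by simp
  qed
  then have "\<theta> * 64 * 2 powr d \<le> \<omega> powr (q / p)" by (simp add: \<theta>(3))
  moreover have "\<theta> powr q \<le> \<theta> powr 1" using \<theta> q by (intro powr_mono') auto
  ultimately have "\<theta> powr q * (64 * 2 powr d) \<le> \<omega> powr (q / p)"
    using order_trans[OF mult_right_mono[of "\<theta> powr q" \<theta> "64 * 2 powr d"], of "\<omega> powr (q / p)"] \<theta>(1) by (simp add: mult.assoc)
  then have "\<theta> powr q * (64 * 2 powr d) * y powr q \<le> \<omega> powr (q / p) * y powr q" using y by (intro mult_right_mono) auto
  moreover have "0 \<le> 2 powr d * (\<theta> powr q * y powr q)" by simp
  ultimately have "2 powr d * (\<theta> powr q * y powr q) \<le> 2 powr d * (32 * K) powr q" using 1 by argo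
  then have "(\<theta> * y) powr q \<le> (32 * K) powr q" unfolding powr_mult[of \<theta> y] by simp
  then show ?thesis using \<theta>(1) y pos q unfolding y_def[symmetric] by (subst (asm) powr_le_powr_iff) auto
qed

section \<open>Measure taken by the drift and measure left for the operator\<close>

lemma smixed_cmult:
  assumes F: "F \<in> borel_measurable borel" and q: "1 < q" "1 < p"
  shows "smixed q p (\<lambda>z. c * F z) = epow c (min q p) * smixed q p F"
proof (cases "q < p")
  case True
  then show ?thesis using mixed_int_cmult[OF F, of q p c] q by (simp add: smixed_def min_def)
next
  case False
  then show ?thesis
    using mixed_int_cmult[OF measurable_swap_borel[OF F], of p q c] q
    by (simp add: smixed_def min_def)
qed

lemma emeasure_Icc_times_cball:
  assumes "a \<le> b" "0 \<le> \<rho>"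
  shows "emeasure lborel ({a..b} \<times> cball (0 :: real^'n) \<rho>) = ennreal ((b - a) * (unit_ball_vol (real CARD('n)) * \<rho> ^ CARD('n)))"
proof -
  have "emeasure lborel ({a..b} \<times> cball (0 :: real^'n) \<rho>) = emeasure lborel {a..b} * emeasure lborel (cball (0 :: real^'n) \<rho>)"
    unfolding lborel_prod[symmetric] by (rule lborel.emeasure_pair_measure_Times) auto
  then show ?thesis using assms by (simp add: emeasure_cball ennreal_mult)
qed

lemma epow_root_eqD: "epow x (1 / s) = y \<Longrightarrow> 0 < s \<Longrightarrow> x = epow y s"
  using epow_cancel(2)[of s x] by simp

lemma recip_cases:
  assumes "1 \<le> p"
  obtains "p = top" "recip p = 0" | P where "1 \<le> P" "p = ennreal P" "recip p = 1 / P"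
proof (cases p)
  case (real P)
  then have "1 \<le> P" using assms by (simp flip: ennreal_1)
  then show thesis using that(2)[of P] real by (simp add: recip_def inverse_ennreal inverse_eq_divide)
next
  case top
  then show thesis using that(1) by (simp add: recip_def)
qed

text \<open>On E the drift bounds a power product of \<open>\<alpha>\<close> and
  \<open>\<beta>\<close> by a multiple of \<bar>h\<bar>, so mixed Hoelder with the slice bounds
  applies. The four cases are the finite and infinite values of p0 and q0; \<theta> is small enough
  for all of them.\<close>

lemma drift_bound:
  fixes \<alpha> \<beta> h :: "real \<times> (real^'n) \<Rightarrow> real" and p0 q0 :: ennreal
  defines "d \<equiv> real CARD('n)"
  defines "\<omega> \<equiv> unit_ball_vol d"
  assumes pos: "0 < M" "0 < \<rho>" and pq: "1 \<le> p0" "1 \<le> q0" and \<nu>: "\<nu> = 1 - d * recip p0 - recip q0" "0 \<le> \<nu>"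
    and \<theta>: "\<theta> = min 1 \<omega> / (64 * 2 powr d)"
    and E: "E \<in> sets borel" and m: "\<alpha> \<in> borel_measurable borel" "\<beta> \<in> borel_measurable borel" "h \<in> borel_measurable borel"
    and nn: "\<And>z. 0 \<le> \<alpha> z" "\<And>z. 0 \<le> \<beta> z"
    and A: "\<And>x. (\<integral>\<^sup>+t. indicator E (t, x) * ennreal (\<alpha> (t, x)) \<partial>lborel) \<le> ennreal M"
    and B: "\<And>t. (\<integral>\<^sup>+x. indicator E (t, x) * ennreal (\<beta> (t, x)) \<partial>lborel) \<le> ennreal (\<omega> * (2 * \<rho>) powr d)"
    and G: "\<And>z. z \<in> E \<Longrightarrow> rpow (\<alpha> z) (recip q0) * rpow (\<beta> z) (recip p0) \<le> 8 * \<rho> * (M / 4) powr (- \<nu>) * \<bar>h z\<bar>"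
    and H: "mixed_norm q0 p0 (\<lambda>z. ennreal \<bar>h z\<bar>) = ennreal H" "0 \<le> H"
    and X: "(\<rho> / M) powr (1 - d * recip p0) * 32 * H \<le> \<theta>"
  shows "(\<integral>\<^sup>+z. indicator E z * ennreal (\<alpha> z * \<beta> z) \<partial>lborel) \<le> ennreal (M * \<omega> * \<rho> powr d / 64)"
proof -
  have d1: "1 \<le> d" unfolding d_def by simp
  have \<omega>: "0 < \<omega>" using d1 by (simp add: \<omega>_def)
  have th: "\<theta> \<le> 1" "\<theta> \<le> \<omega> / 64" "\<theta> \<le> 1 / 64"
  proof -
    have "1 \<le> (2::real) powr d" using d1 by (intro ge_one_powr_ge_zero) auto
    then have "\<theta> \<le> min 1 \<omega> / 64" using \<omega> unfolding \<theta> by (intro divide_left_mono) auto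
    then show "\<theta> \<le> 1" "\<theta> \<le> \<omega> / 64" "\<theta> \<le> 1 / 64" by auto
  qed
  define \<kappa> where "\<kappa> = 8 * \<rho> * (M / 4) powr (- \<nu>)"
  have \<kappa>: "0 < \<kappa>" using pos by (simp add: \<kappa>_def)
  define a where "a z = indicator E z * ennreal (\<alpha> z)" for z
  define b where "b z = indicator E z * ennreal (\<beta> z)" for z
  note [measurable] = E m
  have am [measurable]: "a \<in> borel_measurable borel" and bm [measurable]: "b \<in> borel_measurable borel"
    unfolding a_def[abs_def] b_def[abs_def] by measurable
  have hm [measurable]: "(\<lambda>z. ennreal \<bar>h z\<bar>) \<in> borel_measurable borel" by measurable
  have sf: "sigma_finite_measure (lborel :: 'c::euclidean_space measure)" by (rule lborel.sigma_finite_measure_axioms)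
  have ab: "(\<integral>\<^sup>+z. indicator E z * ennreal (\<alpha> z * \<beta> z) \<partial>lborel) = (\<integral>\<^sup>+z. a z * b z \<partial>lborel)"
    by (intro nn_integral_cong) (simp add: a_def b_def indicator_def nn ennreal_mult)
  show ?thesis
    using pq(1)
  proof (cases rule: recip_cases)
    case 1
    note p0 = 1
    show ?thesis
      using pq(2)
    proof (cases rule: recip_cases)
      case 1
      note q0 = 1
      \<comment> \<open>With both exponents infinite \<nu> = 1, and the drift inequality on E reads
        1 <= \<kappa> * \<bar>h\<bar>. Almost everywhere this contradicts \<bar>h\<bar> <= H, so E
        is null.\<close>
      have "\<kappa> * H < 1"
      proof -
        have "\<kappa> = 8 * \<rho> * (4 / M)" using pos \<nu> p0 q0 by (simp add: \<kappa>_def powr_minus_divide)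
        also have "\<dots> = (\<rho> / M) powr (1 - d * recip p0) * 32" using pos p0 by simp
        finally show ?thesis using X th(3) by simp
      qed
      then have "\<kappa> * H < 1" .
      have es: "esssup lborel (\<lambda>x. esssup lborel (\<lambda>t. ennreal \<bar>h (t, x)\<bar>)) = ennreal H"
        using H(1) p0 q0 by (simp add: mixed_norm_def Lp_norm_def)
      have hle: "AE z in lborel. ennreal \<bar>h (snd z, fst z)\<bar> \<le> ennreal H"
      proof -
        have [measurable]: "(\<lambda>z. ennreal \<bar>h (snd z, fst z)\<bar>) \<in> borel_measurable (lborel \<Otimes>\<^sub>M lborel)"
          by (rule measurable_lborel_pairD[OF measurable_swap_borel[OF hm]])
        have "AE x in lborel. AE t in lborel. ennreal \<bar>h (snd (x, t), fst (x, t))\<bar> \<le> ennreal H"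
          using esssup_AE[of "\<lambda>x. esssup lborel (\<lambda>t. ennreal \<bar>h (t, x)\<bar>)" lborel]
        proof eventually_elim
          case (elim x)
          show ?case
            using esssup_AE[of "\<lambda>t. ennreal \<bar>h (t, x)\<bar>" lborel]
          proof eventually_elim
            case (elim t)
            then show ?case using \<open>esssup lborel (\<lambda>t. ennreal \<bar>h (t, x)\<bar>) \<le> _\<close> es by (simp add: order_trans)
          qed
        qed
        then have "AE z in lborel \<Otimes>\<^sub>M lborel. ennreal \<bar>h (snd z, fst z)\<bar> \<le> ennreal H"
          by (intro lborel_pair.AE_pair_measure) measurable
        then show ?thesis unfolding lborel_prod .
      qed
      have "AE z in lborel. ennreal \<bar>h z\<bar> \<le> ennreal H" using AE_lborel_swap[OF hle] by simp
      then have "AE z in lborel. indicator E z * ennreal (\<alpha> z * \<beta> z) = 0"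
      proof eventually_elim
        case (elim z)
        have "z \<notin> E"
        proof
          assume "z \<in> E"
          from G[OF this] have "1 \<le> \<kappa> * \<bar>h z\<bar>" using p0 q0 by (simp add: rpow_def \<kappa>_def)
          also have "\<kappa> * \<bar>h z\<bar> \<le> \<kappa> * H" using elim H(2) \<kappa> by simp
          finally show False using \<open>\<kappa> * H < 1\<close> by simp
        qed
        then show ?case by simp
      qed
      then have "(\<integral>\<^sup>+z. indicator E z * ennreal (\<alpha> z * \<beta> z) \<partial>lborel) = (\<integral>\<^sup>+(z::real \<times> (real^'n)). 0 \<partial>lborel)"
        by (rule nn_integral_cong_AE)
      then show ?thesis by simp
    next
      case (2 Q)
      note q0 = 2
      \<comment> \<open>Rescaled by \<kappa>^(-Q), so that its Q-th root is bounded by \<bar>h\<bar>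
        itself.\<close>
      define a' where "a' z = a z * epow (ennreal (1 / \<kappa>)) Q" for z
      have a'm [measurable]: "a' \<in> borel_measurable borel" unfolding a'_def[abs_def] by measurable
      have "(\<integral>\<^sup>+z. a' z * b z \<partial>lborel) = (\<integral>\<^sup>+t. \<integral>\<^sup>+x. a' (t, x) * b (t, x) \<partial>lborel \<partial>lborel)"
        by (rule nn_integral_lborel_fst) measurable
      also have "\<dots> \<le> ennreal (\<omega> * (2 * \<rho>) powr d) * (\<integral>\<^sup>+t. epow (esssup lborel (\<lambda>x. ennreal \<bar>h (t, x)\<bar>)) Q \<partial>lborel)"
      proof (rule mixed_holder_esssup[OF sf sf, of Q b a' "\<lambda>z. ennreal \<bar>h z\<bar>"])
        show "epow (a' z) (1 / Q) \<le> ennreal \<bar>h z\<bar>" if "b z \<noteq> 0" for z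
        proof -
          have zE: "z \<in> E" using that by (auto simp: b_def indicator_def split: if_splits)
          have "\<alpha> z powr (1 / Q) \<le> \<kappa> * \<bar>h z\<bar>"
            using G[OF zE] q0 p0 by (simp add: rpow_def \<kappa>_def)
          moreover have "epow (a' z) (1 / Q) = ennreal (\<alpha> z powr (1 / Q)) * ennreal (1 / \<kappa>)"
            using zE q0 nn by (simp add: a'_def a_def epow_mult epow_cancel epow_ennreal)
          ultimately show ?thesis using \<kappa> by (simp add: ennreal_mult[symmetric] field_simps)
        qed
        show "b \<in> borel_measurable (lborel \<Otimes>\<^sub>M lborel)" "a' \<in> borel_measurable (lborel \<Otimes>\<^sub>M lborel)"
          "(\<lambda>z. ennreal \<bar>h z\<bar>) \<in> borel_measurable (lborel \<Otimes>\<^sub>M lborel)"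
          by (rule measurable_lborel_pairD, fact)+
        show "(\<integral>\<^sup>+x. b (t, x) \<partial>lborel) \<le> ennreal (\<omega> * (2 * \<rho>) powr d)" for t unfolding b_def by (rule B)
      qed (use q0 in auto)
      finally have le: "(\<integral>\<^sup>+z. a' z * b z \<partial>lborel) \<le> ennreal (\<omega> * (2 * \<rho>) powr d) * (\<integral>\<^sup>+t. epow (esssup lborel (\<lambda>x. ennreal \<bar>h (t, x)\<bar>)) Q \<partial>lborel)" .
      have "epow (\<integral>\<^sup>+t. epow (esssup lborel (\<lambda>x. ennreal \<bar>h (t, x)\<bar>)) Q \<partial>lborel) (1 / Q) = ennreal H"
        using H(1) p0 q0 by (simp add: mixed_norm_def Lp_norm_def)
      then have HQ: "(\<integral>\<^sup>+t. epow (esssup lborel (\<lambda>x. ennreal \<bar>h (t, x)\<bar>)) Q \<partial>lborel) = epow (ennreal H) Q"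
        by (rule epow_root_eqD) (use q0 in simp)
      have "(\<integral>\<^sup>+z. a z * b z \<partial>lborel) = (\<integral>\<^sup>+z. epow (ennreal \<kappa>) Q * (a' z * b z) \<partial>lborel)"
      proof (intro nn_integral_cong)
        fix z
        have "epow (ennreal \<kappa>) Q * epow (ennreal (1 / \<kappa>)) Q = 1"
          using \<kappa> q0 by (subst epow_mult[symmetric]) (simp_all flip: ennreal_mult)
        then show "a z * b z = epow (ennreal \<kappa>) Q * (a' z * b z)" unfolding a'_def by (simp add: mult_ac)
      qed
      also have "\<dots> = epow (ennreal \<kappa>) Q * (\<integral>\<^sup>+z. a' z * b z \<partial>lborel)" by (rule nn_integral_cmult) measurable
      also have "\<dots> \<le> epow (ennreal \<kappa>) Q * (ennreal (\<omega> * (2 * \<rho>) powr d) * epow (ennreal H) Q)"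
        using le unfolding HQ by (rule mult_left_mono) simp
      also have "\<dots> = ennreal ((\<omega> * (2 * \<rho>) powr d) powr (1 - Q * 0) * (\<kappa> powr Q * H powr Q))"
        using \<kappa> H q0 pos \<omega> by (simp add: epow_ennreal ennreal_mult mult_ac)
      also have "\<dots> \<le> ennreal (M * \<omega> * \<rho> powr d / 64)" unfolding \<kappa>_def
        by (intro ennreal_leI drift_numeric_space[where \<theta> = \<theta>]) (use pos H \<omega> q0 p0 \<nu> X th \<theta> d1 in auto)
      finally show ?thesis unfolding ab .
    qed
  next
    case (2 P)
    note p0 = 2
    show ?thesis
      using pq(2)
    proof (cases rule: recip_cases)
      case 1
      note q0 = 1
      define b' where "b' z = b z * epow (ennreal (1 / \<kappa>)) P" for z
      have b'm [measurable]: "b' \<in> borel_measurable borel" unfolding b'_def[abs_def] by measurable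
      have "(\<integral>\<^sup>+z. b' z * a z \<partial>lborel) = (\<integral>\<^sup>+x. \<integral>\<^sup>+t. b' (t, x) * a (t, x) \<partial>lborel \<partial>lborel)"
        by (rule nn_integral_lborel_snd) measurable
      also have "\<dots> \<le> ennreal M * (\<integral>\<^sup>+x. epow (esssup lborel (\<lambda>t. ennreal \<bar>h (t, x)\<bar>)) P \<partial>lborel)"
      proof (rule mixed_holder_esssup[OF sf sf, of P "\<lambda>z. a (snd z, fst z)" "\<lambda>z. b' (snd z, fst z)" "\<lambda>z. ennreal \<bar>h (snd z, fst z)\<bar>", unfolded fst_conv snd_conv])
        show "epow (b' (snd z, fst z)) (1 / P) \<le> ennreal \<bar>h (snd z, fst z)\<bar>" if "a (snd z, fst z) \<noteq> 0" for z
        proof -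
          have zE: "(snd z, fst z) \<in> E" using that by (auto simp: a_def indicator_def split: if_splits)
          have "\<beta> (snd z, fst z) powr (1 / P) \<le> \<kappa> * \<bar>h (snd z, fst z)\<bar>"
            using G[OF zE] q0 p0 by (simp add: rpow_def \<kappa>_def)
          moreover have "epow (b' (snd z, fst z)) (1 / P) = ennreal (\<beta> (snd z, fst z) powr (1 / P)) * ennreal (1 / \<kappa>)"
            using zE p0 nn by (simp add: b'_def b_def epow_mult epow_cancel epow_ennreal)
          ultimately show ?thesis using \<kappa> by (simp add: ennreal_mult[symmetric] field_simps)
        qed
        show "(\<lambda>z. a (snd z, fst z)) \<in> borel_measurable (lborel \<Otimes>\<^sub>M lborel)" "(\<lambda>z. b' (snd z, fst z)) \<in> borel_measurable (lborel \<Otimes>\<^sub>M lborel)"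
          "(\<lambda>z. ennreal \<bar>h (snd z, fst z)\<bar>) \<in> borel_measurable (lborel \<Otimes>\<^sub>M lborel)"
          by (rule measurable_lborel_pairD[OF measurable_swap_borel[OF am]] measurable_lborel_pairD[OF measurable_swap_borel[OF b'm]]
              measurable_lborel_pairD[OF measurable_swap_borel[OF hm]])+
        show "(\<integral>\<^sup>+t. a (t, x) \<partial>lborel) \<le> ennreal M" for x unfolding a_def by (rule A)
      qed (use p0 in auto)
      finally have le: "(\<integral>\<^sup>+z. b' z * a z \<partial>lborel) \<le> ennreal M * (\<integral>\<^sup>+x. epow (esssup lborel (\<lambda>t. ennreal \<bar>h (t, x)\<bar>)) P \<partial>lborel)" .
      have "epow (\<integral>\<^sup>+x. epow (esssup lborel (\<lambda>t. ennreal \<bar>h (t, x)\<bar>)) P \<partial>lborel) (1 / P) = ennreal H"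
        using H(1) p0 q0 by (simp add: mixed_norm_def Lp_norm_def)
      then have HP: "(\<integral>\<^sup>+x. epow (esssup lborel (\<lambda>t. ennreal \<bar>h (t, x)\<bar>)) P \<partial>lborel) = epow (ennreal H) P"
        by (rule epow_root_eqD) (use p0 in simp)
      have "(\<integral>\<^sup>+z. a z * b z \<partial>lborel) = (\<integral>\<^sup>+z. epow (ennreal \<kappa>) P * (b' z * a z) \<partial>lborel)"
      proof (intro nn_integral_cong)
        fix z
        have "epow (ennreal \<kappa>) P * epow (ennreal (1 / \<kappa>)) P = 1"
          using \<kappa> p0 by (subst epow_mult[symmetric]) (simp_all flip: ennreal_mult)
        then show "a z * b z = epow (ennreal \<kappa>) P * (b' z * a z)" unfolding b'_def by (simp add: mult_ac)
      qed
      also have "\<dots> = epow (ennreal \<kappa>) P * (\<integral>\<^sup>+z. b' z * a z \<partial>lborel)" by (rule nn_integral_cmult) measurable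
      also have "\<dots> \<le> epow (ennreal \<kappa>) P * (ennreal M * epow (ennreal H) P)"
        using le unfolding HP by (rule mult_left_mono) simp
      also have "\<dots> = ennreal (M powr (1 - P * 0) * (\<kappa> powr P * H powr P))"
        using \<kappa> H p0 pos by (simp add: epow_ennreal ennreal_mult mult_ac)
      also have "\<dots> \<le> ennreal (M * \<omega> * \<rho> powr d / 64)" unfolding \<kappa>_def
        by (intro ennreal_leI drift_numeric_time[where \<theta> = \<theta>]) (use pos H \<omega> q0 p0 \<nu> X th \<theta> d1 in auto)
      finally show ?thesis unfolding ab .
    next
      case (2 Q)
      note q0 = 2
      \<comment> \<open>Strict, because d / P and 1 / Q are positive with sum at most 1 and 1 / P <=
        d / P.\<close>
      have PQ: "1 < P" "1 < Q"
      proof -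
        have "1 / P \<le> d / P" "0 < 1 / P" "0 < 1 / Q" using d1 p0 q0 by (auto intro: divide_right_mono)
        moreover have "0 \<le> 1 - d / P - 1 / Q" using \<nu> p0 q0 by simp
        ultimately have "1 / P < 1" "1 / Q < 1" by linarith+
        then show "1 < P" "1 < Q" using p0(1) q0(1) by (auto simp: less_le)
      qed
      let ?w = "if Q < P then epow (ennreal (\<omega> * (2 * \<rho>) powr d)) (1 - Q / P) else epow (ennreal M) (1 - P / Q)"
      have "(\<integral>\<^sup>+z. a z * b z \<partial>lborel) \<le> ?w * smixed Q P (\<lambda>z. ennreal \<kappa> * ennreal \<bar>h z\<bar>)"
      proof (rule mixed_area_holder)
        show "(\<integral>\<^sup>+t. a (t, x) \<partial>lborel) \<le> ennreal M" for x unfolding a_def by (rule A)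
        show "(\<integral>\<^sup>+x. b (t, x) \<partial>lborel) \<le> ennreal (\<omega> * (2 * \<rho>) powr d)" for t unfolding b_def by (rule B)
        show "epow (a z) (1 / Q) * epow (b z) (1 / P) \<le> ennreal \<kappa> * ennreal \<bar>h z\<bar>" for z
        proof (cases "z \<in> E")
          case True
          have "\<alpha> z powr (1 / Q) * \<beta> z powr (1 / P) \<le> \<kappa> * \<bar>h z\<bar>"
            using G[OF True] q0 p0 by (simp add: rpow_def \<kappa>_def)
          then show ?thesis using True PQ nn \<kappa>
            by (simp add: a_def b_def epow_ennreal ennreal_mult[symmetric])
        qed (use PQ in \<open>simp add: a_def\<close>)
      qed (use PQ in auto)
      also have "smixed Q P (\<lambda>z. ennreal \<kappa> * ennreal \<bar>h z\<bar>) = epow (ennreal \<kappa>) (min Q P) * epow (ennreal H) (min Q P)"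
      proof -
        have "epow (smixed Q P (\<lambda>z. ennreal \<bar>h z\<bar>)) (1 / min Q P) = ennreal H"
          using H(1) unfolding p0 q0 by (simp only: mixed_norm_smixed[OF PQ(2,1)])
        then have "smixed Q P (\<lambda>z. ennreal \<bar>h z\<bar>) = epow (ennreal H) (min Q P)"
          by (rule epow_root_eqD) (use PQ in simp)
        then show ?thesis using PQ by (simp add: smixed_cmult)
      qed
      also have "?w * (epow (ennreal \<kappa>) (min Q P) * epow (ennreal H) (min Q P)) \<le> ennreal (M * \<omega> * \<rho> powr d / 64)"
      proof (cases "Q < P")
        case True
        have "?w * (epow (ennreal \<kappa>) (min Q P) * epow (ennreal H) (min Q P))
          = ennreal ((\<omega> * (2 * \<rho>) powr d) powr (1 - Q * (1 / P)) * (\<kappa> powr Q * H powr Q))"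
          using True PQ \<kappa> H pos \<omega> by (simp add: epow_ennreal epow_ennreal_pos min_def flip: ennreal_mult)
        also have "\<dots> \<le> ennreal (M * \<omega> * \<rho> powr d / 64)" unfolding \<kappa>_def
          by (intro ennreal_leI drift_numeric_space[where \<theta> = \<theta>]) (use pos H \<omega> q0 p0 \<nu> X th \<theta> d1 True PQ in auto)
        finally show ?thesis .
      next
        case False
        have "?w * (epow (ennreal \<kappa>) (min Q P) * epow (ennreal H) (min Q P))
          = ennreal (M powr (1 - P * (1 / Q)) * (\<kappa> powr P * H powr P))"
          using False PQ \<kappa> H pos \<omega> by (simp add: epow_ennreal epow_ennreal_pos min_def flip: ennreal_mult)
        also have "\<dots> \<le> ennreal (M * \<omega> * \<rho> powr d / 64)" unfolding \<kappa>_def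
          by (intro ennreal_leI drift_numeric_time[where \<theta> = \<theta>]) (use pos H \<omega> q0 p0 \<nu> X th \<theta> d1 False PQ in auto)
        finally show ?thesis .
      qed
      finally show ?thesis unfolding ab .
    qed
  qed
qed

text \<open>Dividing \<alpha> * \<beta> by (8 * norm w)^d gives an integral of at most M * H^d,
  whatever the range of slopes. If the drift took too much on each of K disjoint dyadic annuli, each
  would contribute at least c = M * \<omega> / (64 * 8^d), and K * c would exceed this
  total.\<close>

lemma annulus_selection:
  fixes \<alpha> \<beta> h :: "real \<times> (real^'n) \<Rightarrow> real" and w :: "real \<times> (real^'n) \<Rightarrow> real^'n"
  defines "d \<equiv> real CARD('n)"
  defines "\<omega> \<equiv> unit_ball_vol d"
  assumes pos: "0 < M" "0 < \<rho>"
    and E: "E \<in> sets borel" and m: "\<alpha> \<in> borel_measurable borel" "\<beta> \<in> borel_measurable borel" "h \<in> borel_measurable borel" "w \<in> borel_measurable borel"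
    and nn: "\<And>z. 0 \<le> \<alpha> z" "\<And>z. 0 \<le> \<beta> z"
    and A: "\<And>x. (\<integral>\<^sup>+t. indicator E (t, x) * ennreal (\<alpha> (t, x)) \<partial>lborel) \<le> ennreal M"
    and G: "\<And>z. z \<in> E \<Longrightarrow> \<beta> z powr (1 / d) \<le> 8 * \<bar>h z\<bar> * norm (w z)"
    and H: "mixed_norm top (ennreal d) (\<lambda>z. ennreal \<bar>h z\<bar>) = ennreal H" "0 \<le> H"
    and K: "64 * 8 powr d * H powr d / \<omega> < real K"
  shows "\<exists>k<K. (\<integral>\<^sup>+z. indicator (E \<inter> {z. \<rho> / 2 ^ Suc k < norm (w z) \<and> norm (w z) \<le> \<rho> / 2 ^ k}) z * ennreal (\<alpha> z * \<beta> z) \<partial>lborel)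
    \<le> ennreal (M * \<omega> * (\<rho> / 2 ^ k) powr d / 64)"
proof (rule ccontr)
  assume neg: "\<not> ?thesis"
  have d1: "1 \<le> d" unfolding d_def by simp
  have \<omega>: "0 < \<omega>" using d1 by (simp add: \<omega>_def)
  note [measurable] = E m
  define a where "a z = indicator E z * ennreal (\<alpha> z)" for z
  define b where "b z = indicator (E \<inter> {z. w z \<noteq> 0}) z * ennreal (\<beta> z / (8 * norm (w z)) powr d)" for z
  have am [measurable]: "a \<in> borel_measurable borel" unfolding a_def[abs_def] by measurable
  have bm [measurable]: "b \<in> borel_measurable borel" unfolding b_def[abs_def] by measurable
  have hm [measurable]: "(\<lambda>z. ennreal \<bar>h z\<bar>) \<in> borel_measurable borel" by measurable
  have sf: "sigma_finite_measure (lborel :: 'c::euclidean_space measure)" by (rule lborel.sigma_finite_measure_axioms)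
  have "(\<integral>\<^sup>+z. b z * a z \<partial>lborel) = (\<integral>\<^sup>+x. \<integral>\<^sup>+t. b (t, x) * a (t, x) \<partial>lborel \<partial>lborel)"
    by (rule nn_integral_lborel_snd) measurable
  also have "\<dots> \<le> ennreal M * (\<integral>\<^sup>+x. epow (esssup lborel (\<lambda>t. ennreal \<bar>h (t, x)\<bar>)) d \<partial>lborel)"
  proof (rule mixed_holder_esssup[OF sf sf, of d "\<lambda>z. a (snd z, fst z)" "\<lambda>z. b (snd z, fst z)" "\<lambda>z. ennreal \<bar>h (snd z, fst z)\<bar>", unfolded fst_conv snd_conv])
    show "epow (b (snd z, fst z)) (1 / d) \<le> ennreal \<bar>h (snd z, fst z)\<bar>" if "a (snd z, fst z) \<noteq> 0" for z
    proof (cases "w (snd z, fst z) = 0")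
      case False
      define y where "y = (snd z, fst z)"
      have zE: "y \<in> E" using that by (auto simp: y_def a_def indicator_def split: if_splits)
      have w: "0 < norm (w y)" using False by (simp add: y_def)
      have "epow (b y) (1 / d) = ennreal ((\<beta> y / (8 * norm (w y)) powr d) powr (1 / d))"
        using zE w d1 nn by (simp add: b_def epow_ennreal)
      also have "(\<beta> y / (8 * norm (w y)) powr d) powr (1 / d) = \<beta> y powr (1 / d) / (8 * norm (w y))"
        using w d1 nn by (simp add: powr_divide powr_powr)
      also have "ennreal \<dots> \<le> ennreal \<bar>h y\<bar>"
        using G[OF zE] w by (intro ennreal_leI) (simp add: field_simps)
      finally show ?thesis by (simp only: y_def)
    qed (use d1 in \<open>simp add: b_def\<close>)
    show "(\<lambda>z. a (snd z, fst z)) \<in> borel_measurable (lborel \<Otimes>\<^sub>M lborel)" "(\<lambda>z. b (snd z, fst z)) \<in> borel_measurable (lborel \<Otimes>\<^sub>M lborel)"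
      "(\<lambda>z. ennreal \<bar>h (snd z, fst z)\<bar>) \<in> borel_measurable (lborel \<Otimes>\<^sub>M lborel)"
      by (rule measurable_lborel_pairD[OF measurable_swap_borel[OF am]] measurable_lborel_pairD[OF measurable_swap_borel[OF bm]]
          measurable_lborel_pairD[OF measurable_swap_borel[OF hm]])+
    show "(\<integral>\<^sup>+t. a (t, x) \<partial>lborel) \<le> ennreal M" for x unfolding a_def by (rule A)
  qed (use d1 in auto)
  also have "(\<integral>\<^sup>+x. epow (esssup lborel (\<lambda>t. ennreal \<bar>h (t, x)\<bar>)) d \<partial>lborel) = epow (ennreal H) d"
  proof (rule epow_root_eqD)
    show "epow (\<integral>\<^sup>+x. epow (esssup lborel (\<lambda>t. ennreal \<bar>h (t, x)\<bar>)) d \<partial>lborel) (1 / d) = ennreal H"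
      using H(1) d1 by (simp add: mixed_norm_def Lp_norm_def recip_def inverse_ennreal inverse_eq_divide)
  qed (use d1 in simp)
  finally have I: "(\<integral>\<^sup>+z. b z * a z \<partial>lborel) \<le> ennreal (M * H powr d)"
    using pos H d1 by (simp add: epow_ennreal ennreal_mult)
  define Ek where "Ek k = E \<inter> {z. \<rho> / 2 ^ Suc k < norm (w z) \<and> norm (w z) \<le> \<rho> / 2 ^ k}" for k
  have [measurable]: "Ek k \<in> sets borel" for k unfolding Ek_def by measurable
  have disj: "disjoint_family_on Ek {..<K}"
  proof -
    have "Ek i \<inter> Ek j = {}" if "i < j" for i j
    proof -
      have "\<rho> / 2 ^ j \<le> \<rho> / 2 ^ Suc i"
        using that pos by (intro divide_left_mono power_increasing) auto
      then show ?thesis by (auto simp: Ek_def simp del: power_Suc)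
    qed
    then show ?thesis unfolding disjoint_family_on_def by (metis Int_commute linorder_neqE_nat)
  qed
  define c where "c = M * \<omega> / (64 * 8 powr d)"
  have c: "0 < c" using pos \<omega> by (simp add: c_def)
  have W: "ennreal c \<le> (\<integral>\<^sup>+z. indicator (Ek k) z * (b z * a z) \<partial>lborel)" if k: "k < K" for k
  proof -
    define r where "r = \<rho> / 2 ^ k"
    have r: "0 < r" using pos by (simp add: r_def)
    have "ennreal ((8 * r) powr d) * ennreal c = ennreal (M * \<omega> * r powr d / 64)"
      using r c by (simp add: c_def powr_mult mult_ac flip: ennreal_mult)
    also have "\<dots> \<le> (\<integral>\<^sup>+z. indicator (Ek k) z * ennreal (\<alpha> z * \<beta> z) \<partial>lborel)"
      using neg k unfolding Ek_def r_def by (auto simp: not_le intro: less_imp_le)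
    also have "\<dots> \<le> (\<integral>\<^sup>+z. ennreal ((8 * r) powr d) * (indicator (Ek k) z * (b z * a z)) \<partial>lborel)"
    proof (intro nn_integral_mono)
      fix z
      show "indicator (Ek k) z * ennreal (\<alpha> z * \<beta> z) \<le> ennreal ((8 * r) powr d) * (indicator (Ek k) z * (b z * a z))"
      proof (cases "z \<in> Ek k")
        case True
        have "0 < \<rho> / 2 ^ Suc k" using pos by simp
        then have w: "0 < norm (w z)" "norm (w z) \<le> r" "z \<in> E" using True by (auto simp: Ek_def r_def simp del: power_Suc)
        have "(8 * norm (w z)) powr d \<le> (8 * r) powr d" using w d1 by (intro powr_mono2) auto
        then have "\<beta> z * (8 * norm (w z)) powr d \<le> \<beta> z * (8 * r) powr d" using nn(2) by (rule mult_left_mono)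
        then have bl: "\<beta> z \<le> (8 * r) powr d * (\<beta> z / (8 * norm (w z)) powr d)" using w by (simp add: field_simps)
        have "\<alpha> z * \<beta> z \<le> (8 * r) powr d * (\<beta> z / (8 * norm (w z)) powr d * \<alpha> z)"
          using mult_left_mono[OF bl nn(1)[of z]] by (simp add: mult_ac)
        then show ?thesis using True w nn by (simp add: a_def b_def ennreal_leI flip: ennreal_mult)
      qed simp
    qed
    also have "\<dots> = ennreal ((8 * r) powr d) * (\<integral>\<^sup>+z. indicator (Ek k) z * (b z * a z) \<partial>lborel)"
      by (rule nn_integral_cmult) measurable
    finally show ?thesis using r by (subst (asm) ennreal_mult_le_mult_iff) auto
  qed
  have "ennreal (real K * c) = (\<Sum>k<K. ennreal c)" using c by (simp add: ennreal_mult ennreal_of_nat_eq_real_of_nat)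
  also have "\<dots> \<le> (\<Sum>k<K. \<integral>\<^sup>+z. indicator (Ek k) z * (b z * a z) \<partial>lborel)" by (intro sum_mono W) simp
  also have "\<dots> = (\<integral>\<^sup>+z. (\<Sum>k<K. indicator (Ek k) z * (b z * a z)) \<partial>lborel)" by (rule nn_integral_sum[symmetric]) measurable
  also have "\<dots> \<le> (\<integral>\<^sup>+z. b z * a z \<partial>lborel)"
  proof (intro nn_integral_mono)
    fix z
    have "(\<Sum>k<K. indicator (Ek k) z * (b z * a z)) = indicator (\<Union> (Ek ` {..<K})) z * (b z * a z)"
      by (simp add: indicator_UN_disjoint[OF _ disj] sum_distrib_right)
    also have "\<dots> \<le> b z * a z" by (simp add: indicator_def)
    finally show "(\<Sum>k<K. indicator (Ek k) z * (b z * a z)) \<le> b z * a z" .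
  qed
  also note I
  finally have "real K * c \<le> M * H powr d" using pos c by (subst (asm) ennreal_le_iff) auto
  then show False using K pos \<omega> by (simp add: c_def field_simps)
qed

text \<open>With c = M * \<omega> * \<rho>^d, at least c/16 is covered; the drift takes at most c/64
  and the two losses \<delta> together at most c/64. The remaining c/32 comes from
  \<open>\<Gamma>A\<close>, where mixed Hoelder bounds it by the norm of W.\<close>

lemma final_step:
  fixes \<alpha> \<beta> val :: "real \<times> (real^'n) \<Rightarrow> real" and w :: "real \<times> (real^'n) \<Rightarrow> real^'n"
  defines "d \<equiv> real CARD('n)"
  defines "\<omega> \<equiv> unit_ball_vol d"
  assumes pos: "0 < M" "0 < \<rho>" and q: "1 < q" "1 < p" and \<nu>: "\<nu> = 1 - d / p - 1 / q" "0 \<le> \<nu>"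
    and \<theta>: "\<theta> = min 1 \<omega> / (64 * 2 powr d)"
    and G: "\<Gamma> \<in> sets borel" "\<Gamma>A \<in> sets borel" "\<Gamma>B \<in> sets borel" "\<Gamma>Z \<in> sets borel" "\<Gamma> \<subseteq> \<Gamma>A \<union> \<Gamma>B \<union> \<Gamma>Z" "\<Gamma>A \<subseteq> \<Gamma>"
    and m: "\<alpha> \<in> borel_measurable borel" "\<beta> \<in> borel_measurable borel" "val \<in> borel_measurable borel" "w \<in> borel_measurable borel"
    and nn: "\<And>z. 0 \<le> \<alpha> z" "\<And>z. 0 \<le> \<beta> z" and val: "\<And>z. z \<in> \<Gamma> \<Longrightarrow> M / 4 \<le> val z"
    and S: "S \<in> sets borel" "\<And>y. y \<in> S \<Longrightarrow> norm (snd y) \<le> \<rho>" "ennreal (M * \<omega> * \<rho> powr d / 16) \<le> emeasure lborel S"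
    and area: "emeasure lborel S
      \<le> (\<integral>\<^sup>+z. indicator (\<Gamma> \<inter> {z. (val z - snd z \<bullet> w z, w z) \<in> S}) z * ennreal (\<alpha> z * \<beta> z) \<partial>lborel) + ennreal \<delta>"
    and time: "\<And>x. (\<integral>\<^sup>+t. indicator \<Gamma> (t, x) * ennreal (\<alpha> (t, x)) \<partial>lborel) \<le> ennreal M"
    and space: "\<And>t. (\<integral>\<^sup>+x. indicator (\<Gamma> \<inter> {z. norm (w z) \<le> \<rho>}) (t, x) * ennreal (\<beta> (t, x)) \<partial>lborel) \<le> ennreal (\<omega> * (2 * \<rho>) powr d)"
    and A: "\<And>z. z \<in> \<Gamma>A \<Longrightarrow> ennreal (gexp (1 / q) (1 / p) \<nu> (\<alpha> z) (\<beta> z) (val z)) \<le> 8 * W z"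
    and B: "(\<integral>\<^sup>+z. indicator (\<Gamma>B \<inter> {z. (val z - snd z \<bullet> w z, w z) \<in> S}) z * ennreal (\<alpha> z * \<beta> z) \<partial>lborel) \<le> ennreal (M * \<omega> * \<rho> powr d / 64)"
    and Z: "(\<integral>\<^sup>+z. indicator \<Gamma>Z z * ennreal (\<alpha> z * \<beta> z) \<partial>lborel) \<le> ennreal \<delta>" and \<delta>: "0 < \<delta>" "\<delta> \<le> M * \<omega> * \<rho> powr d / 128"
    and W: "W \<in> borel_measurable borel" "mixed_norm (ennreal q) (ennreal p) W = ennreal K" "0 \<le> K"
  shows "\<theta> * ((\<rho> / M) powr (d / p) * M) \<le> 32 * K"
proof -
  have d1: "1 \<le> d" unfolding d_def by simp
  have \<omega>: "0 < \<omega>" using d1 by (simp add: \<omega>_def)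
  have th: "0 < \<theta>" "\<theta> \<le> 1" "\<theta> \<le> \<omega> / 64"
  proof -
    have "1 \<le> (2::real) powr d" using d1 by (intro ge_one_powr_ge_zero) auto
    then have "\<theta> \<le> min 1 \<omega> / 64" using \<omega> unfolding \<theta> by (intro divide_left_mono) auto
    then show "\<theta> \<le> 1" "\<theta> \<le> \<omega> / 64" by auto
    show "0 < \<theta>" using \<omega> by (simp add: \<theta>)
  qed
  note [measurable] = G(1-4) m S(1) W(1)
  define P where "P = {z. (val z - snd z \<bullet> w z, w z) \<in> S}"
  have "(\<lambda>z. (val z - snd z \<bullet> w z, w z)) \<in> borel_measurable borel"
    by (intro borel_measurable_Pair borel_measurable_diff borel_measurable_inner m)
       (intro borel_measurable_continuous_onI continuous_intros)
  from measurable_sets[OF this S(1)] have [measurable]: "P \<in> sets borel" by (simp add: P_def vimage_def)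
  have Pw: "norm (w z) \<le> \<rho>" if "z \<in> P" for z using S(2) that by (fastforce simp: P_def)
  define E where "E = \<Gamma>A \<inter> P"
  have [measurable]: "E \<in> sets borel" by (simp add: E_def)
  define V where "V X = (\<integral>\<^sup>+z. indicator X z * ennreal (\<alpha> z * \<beta> z) \<partial>lborel)" for X
  define c where "c = M * \<omega> * \<rho> powr d"
  have c: "0 < c" using pos \<omega> by (simp add: c_def)
  have Vsplit: "V (\<Gamma> \<inter> P) \<le> V E + (V (\<Gamma>B \<inter> P) + V \<Gamma>Z)"
  proof -
    have "V (\<Gamma> \<inter> P) \<le> (\<integral>\<^sup>+z. indicator E z * ennreal (\<alpha> z * \<beta> z) + (indicator (\<Gamma>B \<inter> P) z * ennreal (\<alpha> z * \<beta> z) + indicator \<Gamma>Z z * ennreal (\<alpha> z * \<beta> z)) \<partial>lborel)"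
      unfolding V_def
    proof (intro nn_integral_mono)
      fix z
      show "indicator (\<Gamma> \<inter> P) z * ennreal (\<alpha> z * \<beta> z) \<le> indicator E z * ennreal (\<alpha> z * \<beta> z) + (indicator (\<Gamma>B \<inter> P) z * ennreal (\<alpha> z * \<beta> z) + indicator \<Gamma>Z z * ennreal (\<alpha> z * \<beta> z))"
      proof (cases "z \<in> \<Gamma> \<inter> P")
        case True
        then consider "z \<in> E" | "z \<in> \<Gamma>B \<inter> P" | "z \<in> \<Gamma>Z" using G(5) by (auto simp: E_def)
        then show ?thesis by cases (auto simp: True indicator_def intro: add_increasing add_increasing2)
      qed simp
    qed
    also have "\<dots> = V E + (V (\<Gamma>B \<inter> P) + V \<Gamma>Z)" unfolding V_def
      by (subst nn_integral_add; (subst nn_integral_add)?) measurable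
    finally show ?thesis .
  qed
  have VE: "ennreal (c / 32) \<le> V E"
  proof (cases "V E")
    case (real v)
    have "ennreal (c / 16) \<le> V (\<Gamma> \<inter> P) + ennreal \<delta>"
      using S(3) area unfolding V_def P_def c_def by (rule order_trans)
    also have "\<dots> \<le> (ennreal v + (ennreal (c / 64) + ennreal \<delta>)) + ennreal \<delta>"
      using Vsplit B Z unfolding V_def[symmetric] P_def[symmetric] c_def[symmetric] real(2)
      by (intro add_mono order_refl) (auto intro: order_trans add_mono)
    also have "\<dots> = ennreal (v + (c / 64 + \<delta>) + \<delta>)" using real \<delta> c by (simp add: ennreal_plus[symmetric] del: ennreal_plus)
    finally have "c / 16 \<le> v + (c / 64 + \<delta>) + \<delta>" using real \<delta> c by (subst (asm) ennreal_le_iff) auto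
    then have "c / 32 \<le> v" using \<delta>(2) by (simp add: c_def[symmetric])
    then show ?thesis using real by (simp add: ennreal_leI)
  qed simp
  \<comment> \<open>The 8 is the factor in hypothesis \<open>A\<close>; val >= M/4 replaces the
    factor val^\<nu> by a constant.\<close>
  define \<kappa> where "\<kappa> = 8 * (M / 4) powr (- \<nu>)"
  have \<kappa>: "0 < \<kappa>" using pos by (simp add: \<kappa>_def)
  define a where "a z = indicator E z * ennreal (\<alpha> z)" for z
  define b where "b z = indicator E z * ennreal (\<beta> z)" for z
  have [measurable]: "a \<in> borel_measurable borel" "b \<in> borel_measurable borel"
    unfolding a_def[abs_def] b_def[abs_def] by measurable
  let ?w = "if q < p then epow (ennreal (\<omega> * (2 * \<rho>) powr d)) (1 - q / p) else epow (ennreal M) (1 - p / q)"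
  have "V E = (\<integral>\<^sup>+z. a z * b z \<partial>lborel)" unfolding V_def
    by (intro nn_integral_cong) (simp add: a_def b_def indicator_def nn ennreal_mult)
  also have "\<dots> \<le> ?w * smixed q p (\<lambda>z. ennreal \<kappa> * W z)"
  proof (rule mixed_area_holder)
    have E\<Gamma>: "z \<in> \<Gamma>" if "z \<in> E" for z using that G(6) by (auto simp: E_def)
    show "(\<integral>\<^sup>+t. a (t, x) \<partial>lborel) \<le> ennreal M" for x unfolding a_def
      by (rule order_trans[OF nn_integral_mono time[of x]]) (use E\<Gamma> in \<open>auto simp: indicator_def\<close>)
    show "(\<integral>\<^sup>+x. b (t, x) \<partial>lborel) \<le> ennreal (\<omega> * (2 * \<rho>) powr d)" for t unfolding b_def
      by (rule order_trans[OF nn_integral_mono space[of t]]) (use E\<Gamma> Pw in \<open>auto simp: indicator_def E_def\<close>)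
    show "epow (a z) (1 / q) * epow (b z) (1 / p) \<le> ennreal \<kappa> * W z" for z
    proof (cases "z \<in> E")
      case True
      have zA: "z \<in> \<Gamma>A" using True by (simp add: E_def)
      define g where "g = \<alpha> z powr (1 / q) * \<beta> z powr (1 / p)"
      have g0: "0 \<le> g" by (simp add: g_def)
      have v: "rpow (M / 4) \<nu> \<le> rpow (val z) \<nu>"
        using val[OF E\<Gamma>[OF True]] pos \<nu> by (intro rpow_mono) auto
      have v0: "rpow (M / 4) \<nu> * (M / 4) powr (- \<nu>) = 1" using pos by (simp add: rpow_def powr_minus)
      have "g * rpow (M / 4) \<nu> \<le> gexp (1 / q) (1 / p) \<nu> (\<alpha> z) (\<beta> z) (val z)"
        using q mult_left_mono[OF v g0] by (simp add: gexp_def rpow_def[of _ "1 / q"] rpow_def[of _ "1 / p"] g_def)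
      then have "ennreal (g * rpow (M / 4) \<nu>) \<le> 8 * W z"
        using A[OF zA] by (meson ennreal_leI order_trans)
      then have "ennreal ((M / 4) powr (- \<nu>)) * ennreal (g * rpow (M / 4) \<nu>) \<le> ennreal ((M / 4) powr (- \<nu>)) * (8 * W z)"
        by (rule mult_left_mono) simp
      moreover have "ennreal ((M / 4) powr (- \<nu>)) * ennreal (g * rpow (M / 4) \<nu>) = ennreal g"
        using v0 g0 rpow_nonneg[of "M / 4" \<nu>] by (simp add: mult_ac flip: ennreal_mult)
      moreover have "ennreal ((M / 4) powr (- \<nu>)) * (8 * W z) = ennreal \<kappa> * W z"
        using pos by (simp add: \<kappa>_def ennreal_mult mult_ac)
      ultimately have "ennreal g \<le> ennreal \<kappa> * W z" by simp
      then show ?thesis using True q nn by (simp add: a_def b_def g_def epow_ennreal ennreal_mult)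
    qed (use q in \<open>simp add: a_def\<close>)
  qed (use q in auto)
  also have "smixed q p (\<lambda>z. ennreal \<kappa> * W z) = epow (ennreal \<kappa>) (min q p) * epow (ennreal K) (min q p)"
  proof -
    have "epow (smixed q p W) (1 / min q p) = ennreal K" using W(2) by (simp only: mixed_norm_smixed[OF q])
    then have "smixed q p W = epow (ennreal K) (min q p)" by (rule epow_root_eqD) (use q in simp)
    then show ?thesis using q W(1) by (simp add: smixed_cmult)
  qed
  finally have main: "ennreal (c / 32) \<le> ?w * (epow (ennreal \<kappa>) (min q p) * epow (ennreal K) (min q p))"
    using VE by (rule order_trans[rotated])
  show ?thesis
  proof (cases "q < p")
    case True
    have "?w * (epow (ennreal \<kappa>) (min q p) * epow (ennreal K) (min q p))
      = ennreal ((\<omega> * (2 * \<rho>) powr d) powr (1 - q / p) * (\<kappa> powr q * K powr q))"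
      using True q \<kappa> W(3) pos \<omega> by (simp add: epow_ennreal epow_ennreal_pos min_def flip: ennreal_mult)
    with main have "c / 32 \<le> (\<omega> * (2 * \<rho>) powr d) powr (1 - q / p) * (\<kappa> powr q * K powr q)"
      by (simp add: ennreal_le_iff)
    then show ?thesis unfolding c_def \<kappa>_def
      by (intro final_numeric_space[where \<omega> = \<omega> and \<nu> = \<nu> and q = q and p = p])
         (use True q pos W(3) \<omega> \<nu> d1 th \<theta> in auto)
  next
    case False
    have "?w * (epow (ennreal \<kappa>) (min q p) * epow (ennreal K) (min q p))
      = ennreal (M powr (1 - p / q) * (\<kappa> powr p * K powr p))"
      using False q \<kappa> W(3) pos by (simp add: epow_ennreal epow_ennreal_pos min_def flip: ennreal_mult)
    with main have "c / 32 \<le> M powr (1 - p / q) * (\<kappa> powr p * K powr p)"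
      by (simp add: ennreal_le_iff)
    then show ?thesis unfolding c_def \<kappa>_def
      by (intro final_numeric_time[where \<omega> = \<omega> and \<nu> = \<nu> and q = q and p = p])
         (use False q pos W(3) \<omega> \<nu> d1 th in auto)
  qed
qed

section \<open>The estimate\<close>

text \<open>An open set is a countable union of compact boxes, and integrability on each box
  includes measurability there.\<close>

lemma locally_integrable_measurable:
  fixes f :: "'a::euclidean_space \<Rightarrow> real"
  assumes O: "open \<Omega>" and f: "locally_integrable_on \<Omega> f"
  shows "f \<in> borel_measurable (restrict_space borel \<Omega>)"
proof -
  obtain \<D> where D: "countable \<D>" "\<D> \<subseteq> Pow \<Omega>" "\<And>X. X \<in> \<D> \<Longrightarrow> \<exists>a b. X = cbox a b" "\<Union>\<D> = \<Omega>"
    using open_countable_Union_open_cbox[OF O] by blast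
  show ?thesis
  proof (rule measurable_piecewise_restrict[OF D(1)])
    show "space (restrict_space borel \<Omega>) \<subseteq> \<Union>\<D>" using D(4) by (simp add: space_restrict_space)
    fix X assume X: "X \<in> \<D>"
    then obtain a b where ab: "X = cbox a b" using D(3) by blast
    have XO: "X \<subseteq> \<Omega>" using D(2) X by blast
    show "X \<inter> space (restrict_space borel \<Omega>) \<in> sets (restrict_space borel \<Omega>)"
      using O ab XO by (auto simp: sets_restrict_space_iff space_restrict_space)
    have "(\<lambda>w. indicator X w * f w) \<in> borel_measurable borel"
      using locally_integrable_onD[OF f, of X] ab XO by (auto dest: borel_measurable_integrable)
    then have "f \<in> borel_measurable (restrict_space borel X)"
      using ab by (subst borel_measurable_restrict_space_iff) auto
    moreover have "restrict_space (restrict_space borel \<Omega>) X = restrict_space borel X"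
      using O ab XO by (subst restrict_restrict_space) (auto simp: inf_absorb2)
    ultimately show "f \<in> borel_measurable (restrict_space (restrict_space borel \<Omega>) X)" by simp
  qed
qed

lemma measurable_vec_nth_restrict:
  fixes f :: "'a \<Rightarrow> real^'n"
  assumes "f \<in> borel_measurable M"
  shows "(\<lambda>z. f z $ i) \<in> borel_measurable M"
  by (rule measurable_compose[OF assms]) (intro borel_measurable_continuous_onI continuous_intros)

lemma measurable_vec_vec_nth_restrict:
  fixes f :: "'a \<Rightarrow> real^'n^'m"
  assumes "f \<in> borel_measurable M"
  shows "(\<lambda>z. f z $ i $ j) \<in> borel_measurable M"
  by (rule measurable_compose[OF assms]) (intro borel_measurable_continuous_onI continuous_intros)

lemma measurable_weighted_neg_part:
  fixes \<Omega> :: "(real \<times> (real^'n)) set"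
  assumes O: "open \<Omega>" and u: "continuous_on (closure \<Omega>) u" and sob: "sobolev_derivs \<Omega> u ut Du D2u"
    and m: "a \<in> borel_measurable (restrict_space borel \<Omega>)" "b \<in> borel_measurable (restrict_space borel \<Omega>)"
      "c \<in> borel_measurable (restrict_space borel \<Omega>)" "r \<in> borel_measurable (restrict_space borel \<Omega>)"
  defines "L \<equiv> parabolic_op a b c r u ut Du D2u"
  shows "(\<lambda>y. indicator (\<Omega> \<inter> {y. L y < 0}) y * (epow (ennreal (c y)) s1 * epow (ennreal (r y)) s2 *
                 epow (ennreal (det (a y))) s3 * ennreal (neg_part (L y)))) \<in> borel_measurable borel"
proof -
  let ?M = "restrict_space borel \<Omega>"
  have [measurable]: "ut \<in> borel_measurable ?M" "(\<lambda>z. Du z $ i) \<in> borel_measurable ?M" "(\<lambda>z. D2u z $ i $ j) \<in> borel_measurable ?M" for i j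
    using sob by (auto simp: sobolev_derivs_def weak_deriv_def intro!: locally_integrable_measurable[OF O])
  have "continuous_on \<Omega> u" using continuous_on_subset[OF u closure_subset] .
  then have [measurable]: "u \<in> borel_measurable ?M" by (rule borel_measurable_continuous_on_restrict)
  note [measurable] = m(3,4) measurable_vec_nth_restrict[OF m(2)] measurable_vec_vec_nth_restrict[OF m(1)]
  have [measurable]: "L \<in> borel_measurable ?M" unfolding L_def parabolic_op_def[abs_def] by measurable
  have [measurable]: "(\<lambda>z. det (a z)) \<in> borel_measurable ?M" by (rule measurable_det) measurable
  have "(\<lambda>y. (if L y < 0 then 1 else 0) * (epow (ennreal (c y)) s1 * epow (ennreal (r y)) s2 *
                 epow (ennreal (det (a y))) s3 * ennreal (neg_part (L y)))) \<in> borel_measurable ?M"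
    unfolding neg_part_def by measurable
  then have "(\<lambda>y. (if L y < 0 then 1 else 0) * (epow (ennreal (c y)) s1 * epow (ennreal (r y)) s2 *
                 epow (ennreal (det (a y))) s3 * ennreal (neg_part (L y))) * indicator \<Omega> y) \<in> borel_measurable borel"
    using O by (subst (asm) borel_measurable_restrict_space_iff_ennreal) auto
  moreover have "(\<lambda>y. (if L y < 0 then 1 else 0) * (epow (ennreal (c y)) s1 * epow (ennreal (r y)) s2 *
                 epow (ennreal (det (a y))) s3 * ennreal (neg_part (L y))) * indicator \<Omega> y)
    = (\<lambda>y. indicator (\<Omega> \<inter> {y. L y < 0}) y * (epow (ennreal (c y)) s1 * epow (ennreal (r y)) s2 *
                 epow (ennreal (det (a y))) s3 * ennreal (neg_part (L y))))"
    by (auto simp: fun_eq_iff indicator_def)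
  ultimately show ?thesis by simp
qed

text \<open>Small enough for every exponent at once: it gives \<theta> <= 1, \<theta> <= \<omega>/64
  and 64 * 2^d * \<theta> <= \<omega>^s for all s in [0, 1]. This keeps the constant independent of
  p, q and q0.\<close>

definition theta_const :: "real \<Rightarrow> real" where
  "theta_const d = min 1 (unit_ball_vol d) / (64 * 2 powr d)"

(* Among that many dyadic annuli of slopes there is one on which the drift accounts for only a quarter of the measure. *)
definition annuli_number :: "real \<Rightarrow> real \<Rightarrow> nat" where
  "annuli_number d H = nat \<lceil>64 * 8 powr d * H powr d / unit_ball_vol d\<rceil> + 1"

text \<open>128 = 32 * 4: the 32 comes from \<open>final_step\<close>, the 4 from slopes of size M /
  (4 R2) and 4^(d/p) <= 4. The maximum is the factor by which R + H^(1/e), with e = 1 - d/p0, is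
  enlarged to make the drift small if p0 > d; for p0 = d its exponent is 1 / 0 = 0, so it equals
  1.\<close>

definition N_const :: "real \<Rightarrow> ennreal \<Rightarrow> real" where
  "N_const d p0 = 128 / theta_const d * max 1 ((32 / theta_const d) powr (1 / (1 - d * recip p0)))"

lemma estimate_at_point:
  fixes \<Omega> :: "(real \<times> (real^'n)) set"
  defines "d \<equiv> real CARD('n)"
  assumes R: "0 < R" "\<Omega> \<subseteq> UNIV \<times> ball 0 R" and O: "open \<Omega>" "bounded \<Omega>"
    and m: "a \<in> borel_measurable (restrict_space borel \<Omega>)" "b \<in> borel_measurable (restrict_space borel \<Omega>)"
      "c \<in> borel_measurable (restrict_space borel \<Omega>)" "r \<in> borel_measurable (restrict_space borel \<Omega>)"
    and coef: "\<And>z. z \<in> \<Omega> \<Longrightarrow> psd (a z) \<and> 0 \<le> c z \<and> 0 \<le> r z"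
    and pq: "1 \<le> p0" "1 \<le> q0" and \<nu>0: "\<nu>0 = 1 - d * recip p0 - recip q0" "0 \<le> \<nu>0"
    and h: "h \<in> borel_measurable borel" "mixed_norm q0 p0 (\<lambda>z. ennreal \<bar>h z\<bar>) = ennreal H" "0 \<le> H"
    and b: "\<And>z. z \<in> \<Omega> \<Longrightarrow> norm (b z) \<le> gexp (recip q0) (recip p0) \<nu>0 (r z) (det (a z)) (c z) * h z"
    and nd: "AE z in lborel. z \<in> \<Omega> \<longrightarrow> 0 < r z + trace (a z) + c z"
    and q: "1 < q" "1 < p" and \<nu>: "\<nu> = 1 - d / p - 1 / q" "0 \<le> \<nu>"
    and W12: "u \<in> W12_loc (ennreal q) (ennreal p) \<Omega>" and u: "continuous_on (closure \<Omega>) u" and sob: "sobolev_derivs \<Omega> u ut Du D2u"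
    and L: "L = parabolic_op a b c r u ut Du D2u"
    and W: "W = (\<lambda>y. indicator (\<Omega> \<inter> {y. L y < 0}) y * (epow (ennreal (c y)) (- \<nu>) * epow (ennreal (r y)) (- 1 / q) *
                 epow (ennreal (det (a y))) (- 1 / p) * ennreal (neg_part (L y))))"
    and K: "mixed_norm (ennreal q) (ennreal p) W = ennreal K" "0 \<le> K"
    and z0: "z0 \<in> \<Omega>" and m0: "0 \<le> m0" "\<And>z. z \<in> parabolic_boundary \<Omega> \<Longrightarrow> u z \<le> m0"
    and C: "C = (if p0 > ennreal d then (R + H powr (1 / (1 - d * recip p0))) powr (d / p)
      else 2 ^ annuli_number d H * R powr (d / p))"
  shows "u z0 - m0 \<le> N_const d p0 * C * K"
proof -
  define \<omega> where "\<omega> = unit_ball_vol d"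
  define \<theta> where "\<theta> = theta_const d"
  define M where "M = u z0 - m0"
  define e where "e = 1 - d * recip p0"
  define N1 where "N1 = max 1 ((32 / \<theta>) powr (1 / e))"
  define Kn where "Kn = annuli_number d H"
  have d1: "1 \<le> d" unfolding d_def by simp
  have \<omega>: "0 < \<omega>" using d1 by (simp add: \<omega>_def)
  have \<theta>: "0 < \<theta>" "\<theta> = min 1 \<omega> / (64 * 2 powr d)" using \<omega> by (simp_all add: \<theta>_def theta_const_def \<omega>_def)
  have N1: "1 \<le> N1" by (simp add: N1_def)
  have Nc: "N_const d p0 = 128 / \<theta> * N1" by (simp add: N_const_def \<theta>_def N1_def e_def)
  have C0: "0 \<le> C" using C by simp
  have rn: "0 \<le> recip q0" "0 \<le> recip p0" by (simp_all add: recip_def)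
  have dp: "d / p \<le> 1" using \<nu> q divide_nonneg_nonneg[of 1 q] by linarith
  show ?thesis
  proof (cases "0 < M")
    case False
    have "0 \<le> N_const d p0 * C * K" unfolding Nc using C0 K(2) \<theta>(1) N1 by (intro mult_nonneg_nonneg divide_nonneg_nonneg) auto
    then show ?thesis using False by (simp add: M_def)
  next
    case M: True
    define \<rho>0 where "\<rho>0 = M / (4 * R)"
    \<comment> \<open>The radius for p0 > d: slopes up to M / (4 * R1) satisfy the smallness
      hypothesis of \<open>drift_bound\<close>.\<close>
    define R1 where "R1 = N1 * (R + H powr (1 / e))"
    \<comment> \<open>\<open>\<delta>\<close> must be fixed before the approximation, but the
      annulus is selected only afterwards. So \<open>\<rho>1\<close> is a lower bound for every
      radius that may be selected.\<close>
    define \<rho>1 where "\<rho>1 = (if p0 > ennreal d then M / (4 * R1) else \<rho>0 / 2 ^ Kn)"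
    define \<delta> where "\<delta> = M * \<omega> * \<rho>1 powr d / 128"
    define T where "T = {M / 2..5 * M / 8} \<times> cball (0 :: real^'n) (M / (4 * R))"
    have R1: "R \<le> R1" "0 < R1"
    proof -
      have "1 * R \<le> R1" unfolding R1_def using N1 R by (intro mult_mono) auto
      then show "R \<le> R1" "0 < R1" using R by auto
    qed
    have \<rho>1: "0 < \<rho>1" using M R R1 by (simp add: \<rho>1_def \<rho>0_def)
    have \<delta>: "0 < \<delta>" using M \<omega> \<rho>1 by (simp add: \<delta>_def)
    have Wm: "W \<in> borel_measurable borel" unfolding W L by (rule measurable_weighted_neg_part[OF O(1) u sob m])
    have alt: "AE z in lborel. z \<in> \<Omega> \<longrightarrow> m0 < u z \<longrightarrow> ut z \<le> 0 \<longrightarrow> psd (- D2u z) \<longrightarrow>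
      gexp (1 / q) (1 / p) \<nu> (- ut z) (det (- D2u z)) (u z - m0) = 0 \<or>
      0 < 4 * W z \<and> ennreal (gexp (1 / q) (1 / p) \<nu> (- ut z) (det (- D2u z)) (u z - m0)) \<le> 4 * W z \<or>
      0 < 4 * h z * norm (Du z) \<and> gexp (recip q0) (recip p0) \<nu>0 (- ut z) (det (- D2u z)) (u z - m0) \<le> 4 * h z * norm (Du z)"
      using nd
    proof eventually_elim
      case (elim z)
      show ?case
      proof (intro impI)
        assume z: "z \<in> \<Omega>" and um: "m0 < u z" and ut: "ut z \<le> 0" and D2: "psd (- D2u z)"
        define W' where "W' = epow (ennreal (c z)) (- \<nu>) * epow (ennreal (r z)) (- 1 / q) *
                 epow (ennreal (det (a z))) (- 1 / p) * ennreal (neg_part (L z))"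
        have WW: "W z = W'" if "L z < 0" using that z by (simp add: W W'_def)
        have "gexp (1 / q) (1 / p) \<nu> (- ut z) (det (- D2u z)) (u z - m0) = 0 \<or>
          L z < 0 \<and> 0 < 4 * W' \<and> ennreal (gexp (1 / q) (1 / p) \<nu> (- ut z) (det (- D2u z)) (u z - m0)) \<le> 4 * W' \<or>
          0 < 4 * h z * norm (Du z) \<and> gexp (recip q0) (recip p0) \<nu>0 (- ut z) (det (- D2u z)) (u z - m0) \<le> 4 * h z * norm (Du z)"
        proof (rule pde_alternative[where a = "a z" and b = "b z" and c = "c z" and r = "r z"])
          show "psd (a z)" "0 \<le> r z" "0 \<le> c z" using coef[OF z] by auto
          show "0 < r z + trace (a z) + c z" using elim z by blast
          show "norm (b z) \<le> gexp (recip q0) (recip p0) \<nu>0 (r z) (det (a z)) (c z) * h z" by (rule b[OF z])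
          show "recip q0 + real CARD('n) * recip p0 + \<nu>0 = 1" using \<nu>0 by (simp add: d_def)
          show "L z = r z * ut z + 1 / 2 * (\<Sum>i\<in>UNIV. \<Sum>j\<in>UNIV. a z $ i $ j * D2u z $ i $ j) + (\<Sum>i\<in>UNIV. b z $ i * Du z $ i) - c z * u z"
            by (simp add: L parabolic_op_def)
        qed (use rn \<nu>0 q \<nu> ut D2 m0(1) um in \<open>auto simp: d_def W'_def\<close>)
        then show "gexp (1 / q) (1 / p) \<nu> (- ut z) (det (- D2u z)) (u z - m0) = 0 \<or>
          0 < 4 * W z \<and> ennreal (gexp (1 / q) (1 / p) \<nu> (- ut z) (det (- D2u z)) (u z - m0)) \<le> 4 * W z \<or>
          0 < 4 * h z * norm (Du z) \<and> gexp (recip q0) (recip p0) \<nu>0 (- ut z) (det (- D2u z)) (u z - m0) \<le> 4 * h z * norm (Du z)"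
          using WW by metis
      qed
    qed
    have nu1: "real CARD('n) / p + 1 / q \<le> 1" using \<nu> by (simp add: d_def)
    have m4: "(\<lambda>z. 4 * W z) \<in> borel_measurable borel" "(\<lambda>z. 4 * h z) \<in> borel_measurable borel" using Wm h(1) by measurable
    obtain \<Gamma> \<Gamma>A \<Gamma>B \<Gamma>Z and \<alpha> \<beta> val :: "real \<times> (real^'n) \<Rightarrow> real" and w :: "real \<times> (real^'n) \<Rightarrow> real^'n" where
      \<Gamma>: "\<Gamma> \<in> sets borel" "\<Gamma>A \<in> sets borel" "\<Gamma>B \<in> sets borel" "\<Gamma>Z \<in> sets borel" "\<Gamma> \<subseteq> \<Gamma>A \<union> \<Gamma>B \<union> \<Gamma>Z" "\<Gamma>A \<union> \<Gamma>B \<union> \<Gamma>Z \<subseteq> \<Gamma>"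
      and mm: "\<alpha> \<in> borel_measurable borel" "\<beta> \<in> borel_measurable borel" "val \<in> borel_measurable borel" "w \<in> borel_measurable borel"
      and nn: "\<And>z. 0 \<le> \<alpha> z" "\<And>z. 0 \<le> \<beta> z" and val: "\<And>z. z \<in> \<Gamma> \<Longrightarrow> M / 4 \<le> val z"
      and area: "\<And>S. S \<in> sets borel \<Longrightarrow> S \<subseteq> T \<Longrightarrow> emeasure lborel S
        \<le> (\<integral>\<^sup>+z. indicator (\<Gamma> \<inter> {z. (val z - snd z \<bullet> w z, w z) \<in> S}) z * ennreal (\<alpha> z * \<beta> z) \<partial>lborel) + ennreal \<delta>"
      and time: "\<And>x. (\<integral>\<^sup>+t. indicator \<Gamma> (t, x) * ennreal (\<alpha> (t, x)) \<partial>lborel) \<le> ennreal M"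
      and space: "\<And>\<rho> t. 0 < \<rho> \<Longrightarrow> (\<integral>\<^sup>+x. indicator (\<Gamma> \<inter> {z. norm (w z) \<le> \<rho>}) (t, x) * ennreal (\<beta> (t, x)) \<partial>lborel)
        \<le> emeasure lborel (cball (0 :: real^'n) (2 * \<rho>))"
      and A: "\<And>z. z \<in> \<Gamma>A \<Longrightarrow> ennreal (gexp (1 / q) (1 / p) \<nu> (\<alpha> z) (\<beta> z) (val z)) \<le> 2 * (4 * W z)"
      and B: "\<And>z. z \<in> \<Gamma>B \<Longrightarrow> gexp (recip q0) (recip p0) \<nu>0 (\<alpha> z) (\<beta> z) (val z) \<le> 2 * (4 * h z * norm (w z))"
      and Z: "(\<integral>\<^sup>+z. indicator \<Gamma>Z z * ennreal (\<alpha> z * \<beta> z) \<partial>lborel) \<le> ennreal \<delta>"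
    proof (rule contact_structure[OF O R u sob W12 q _ z0 M M_def \<delta> T_def \<nu>(2) nu1 rn \<nu>0(2) m4 alt], goal_cases)
      case (1 z)
      show ?case by (rule m0(2)[OF 1(2)])
    next
      case (2 \<Gamma> \<Gamma>A \<Gamma>B \<Gamma>Z \<alpha> \<beta> val w)
      show ?case by (rule 2(1)[OF 2(2-)])
    qed
    define P where "P S = {z. (val z - snd z \<bullet> w z, w z) \<in> S}" for S
    have PB: "P S \<in> sets borel" if "S \<in> sets borel" for S
    proof -
      have "(\<lambda>z. (val z - snd z \<bullet> w z, w z)) \<in> borel_measurable borel"
        by (intro borel_measurable_Pair borel_measurable_diff borel_measurable_inner mm)
           (intro borel_measurable_continuous_onI continuous_intros)
      from measurable_sets[OF this that] show ?thesis by (simp add: P_def vimage_def)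
    qed
    have space': "(\<integral>\<^sup>+x. indicator (\<Gamma> \<inter> {z. norm (w z) \<le> \<rho>}) (t, x) * ennreal (\<beta> (t, x)) \<partial>lborel)
        \<le> ennreal (\<omega> * (2 * \<rho>) powr d)" if "0 < \<rho>" for \<rho> t
      using space[OF that, of t] that by (simp add: emeasure_cball \<omega>_def d_def powr_realpow)
    have B\<Gamma>: "z \<in> \<Gamma>" if "z \<in> \<Gamma>B" for z using \<Gamma>(6) that by blast
    \<comment> \<open>The common end of both cases, for any set S of planes that is large enough and
      on which the drift share is acceptable.\<close>
    have step: "M \<le> 128 / \<theta> * R2 powr (d / p) * K"
      if R2: "R \<le> R2" "\<rho> = M / (4 * R2)" and \<rho>1\<rho>: "\<rho>1 \<le> \<rho>" and S: "S \<in> sets borel" "\<And>y. y \<in> S \<Longrightarrow> norm (snd y) \<le> \<rho>"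
        "S \<subseteq> {M / 2..5 * M / 8} \<times> UNIV" "ennreal (M * \<omega> * \<rho> powr d / 16) \<le> emeasure lborel S"
        and VB: "(\<integral>\<^sup>+z. indicator (\<Gamma>B \<inter> P S) z * ennreal (\<alpha> z * \<beta> z) \<partial>lborel) \<le> ennreal (M * \<omega> * \<rho> powr d / 64)"
      for R2 \<rho> S
    proof -
      have R20: "0 < R2" using R R2 by simp
      have \<rho>: "0 < \<rho>" using R20 M R2 by simp
      have \<rho>T: "\<rho> \<le> M / (4 * R)" unfolding R2(2) using R R2 M by (intro divide_left_mono) auto
      have ST: "S \<subseteq> T"
      proof
        fix y assume y: "y \<in> S"
        then have "y \<in> {M / 2..5 * M / 8} \<times> UNIV" using S(3) by blast
        then have "fst y \<in> {M / 2..5 * M / 8}" by (simp only: mem_Times_iff)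
        moreover have "norm (snd y) \<le> M / (4 * R)" using S(2)[OF y] \<rho>T by (rule order_trans)
        ultimately show "y \<in> T" by (simp add: T_def mem_Times_iff)
      qed
      have "\<delta> \<le> M * \<omega> * \<rho> powr d / 128"
        unfolding \<delta>_def using \<rho>1 \<rho>1\<rho> M \<omega> d1 by (intro divide_right_mono mult_left_mono powr_mono2) auto
      then have "\<theta> * ((\<rho> / M) powr (d / p) * M) \<le> 32 * K"
        using final_step[of M \<rho> q p \<nu> \<theta> \<Gamma> \<Gamma>A \<Gamma>B \<Gamma>Z \<alpha> \<beta> val w S \<delta> W K, folded d_def, folded \<omega>_def,
            OF M \<rho> q \<nu> \<theta>(2) \<Gamma>(1-5) _ mm nn val S(1,2,4) area[OF S(1) ST] time space'[OF \<rho>] _ VB[unfolded P_def] Z \<delta> _ Wm K]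
          \<Gamma>(6) A by (simp add: mult.assoc[symmetric])
      also have "\<rho> / M = 1 / (4 * R2)" using M by (simp add: R2)
      finally have "\<theta> * M \<le> 32 * K * (4 * R2) powr (d / p)"
        using R20 by (simp add: powr_divide field_simps)
      also have "(4 * R2) powr (d / p) = 4 powr (d / p) * R2 powr (d / p)" by (rule powr_mult)
      also have "32 * K * (4 powr (d / p) * R2 powr (d / p)) \<le> 32 * K * (4 powr 1 * R2 powr (d / p))"
        using K dp by (intro mult_left_mono mult_right_mono powr_mono) auto
      finally show ?thesis using \<theta>(1) by (simp add: field_simps)
    qed
    show ?thesis
    proof (cases "p0 > ennreal d")
      case p0: True
      have e: "0 < e"
      proof (cases rule: recip_cases[OF pq(1)])
        case 1
        then show ?thesis by (simp add: e_def)
      next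
        case (2 P)
        then have "d < P" using p0 d1 by (simp add: ennreal_less_iff)
        then show ?thesis using 2 by (simp add: e_def)
      qed
      define \<rho> where "\<rho> = M / (4 * R1)"
      define S where "S = {M / 2..5 * M / 8} \<times> cball (0 :: real^'n) \<rho>"
      have \<rho>: "0 < \<rho>" "\<rho>1 = \<rho>" using M R1 p0 by (simp_all add: \<rho>_def \<rho>1_def)
      have Sb: "S \<in> sets borel" unfolding S_def by (intro borel_compact compact_Times) auto
      have Sm: "emeasure lborel S = ennreal (M * \<omega> * \<rho> powr d / 8)"
        unfolding S_def using M \<rho> by (subst emeasure_Icc_times_cball) (auto simp: \<omega>_def d_def powr_realpow field_simps)
      \<comment> \<open>R1 was chosen so that R1^e >= 32 * H / \<theta>, and \<rho> / M = 1 / (4 *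
        R1).\<close>
      have X: "(\<rho> / M) powr (1 - d * recip p0) * 32 * H \<le> \<theta>"
      proof (cases "H = 0")
        case False
        then have H0: "0 < H" using h(3) by simp
        have "(32 / \<theta>) powr (1 / e) * H powr (1 / e) \<le> N1 * (R + H powr (1 / e))"
          using R by (intro mult_mono) (auto simp: N1_def)
        then have "(32 / \<theta> * H) powr (1 / e) \<le> R1" unfolding powr_mult[of "32 / \<theta>" H] R1_def .
        then have "((32 / \<theta> * H) powr (1 / e)) powr e \<le> (4 * R1) powr e"
          using e R1 by (intro powr_mono2) auto
        then have l: "32 / \<theta> * H \<le> (4 * R1) powr e" using e \<theta>(1) H0 by (simp add: powr_powr)
        have x: "(\<rho> / M) powr e = 1 / (4 * R1) powr e"
          using M R1 by (simp add: \<rho>_def powr_divide)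
        have y: "0 < (4 * R1) powr e" using R1 by simp
        have "32 * H \<le> \<theta> * (4 * R1) powr e" using l \<theta>(1) by (simp add: divide_le_eq mult.commute)
        then show ?thesis unfolding e_def[symmetric] x using y by (simp add: divide_le_eq)
      qed (use \<theta>(1) in simp)
      have EB: "(\<integral>\<^sup>+z. indicator (\<Gamma>B \<inter> P S) z * ennreal (\<alpha> z * \<beta> z) \<partial>lborel) \<le> ennreal (M * \<omega> * \<rho> powr d / 64)"
      proof (rule drift_bound[where \<nu> = \<nu>0 and h = h and H = H and \<theta> = \<theta>, folded d_def, folded \<omega>_def, OF M \<rho>(1) pq \<nu>0 \<theta>(2) _ mm(1,2) h(1) nn _ _ _ h(2,3) X])
        have EG: "z \<in> \<Gamma>" "norm (w z) \<le> \<rho>" if "z \<in> \<Gamma>B \<inter> P S" for z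
          using that B\<Gamma> by (auto simp: P_def S_def)
        show "\<Gamma>B \<inter> P S \<in> sets borel" using \<Gamma>(3) PB[OF Sb] by (rule sets.Int)
        show "(\<integral>\<^sup>+t. indicator (\<Gamma>B \<inter> P S) (t, x) * ennreal (\<alpha> (t, x)) \<partial>lborel) \<le> ennreal M" for x
          by (rule order_trans[OF nn_integral_mono time[of x]]) (use EG in \<open>auto simp: indicator_def\<close>)
        show "(\<integral>\<^sup>+x. indicator (\<Gamma>B \<inter> P S) (t, x) * ennreal (\<beta> (t, x)) \<partial>lborel) \<le> ennreal (\<omega> * (2 * \<rho>) powr d)" for t
          by (rule order_trans[OF nn_integral_mono space'[OF \<rho>(1), of t]]) (use EG in \<open>auto simp: indicator_def\<close>)
        show "rpow (\<alpha> z) (recip q0) * rpow (\<beta> z) (recip p0) \<le> 8 * \<rho> * (M / 4) powr (- \<nu>0) * \<bar>h z\<bar>" if z: "z \<in> \<Gamma>B \<inter> P S" for z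
        proof -
          define g where "g = rpow (\<alpha> z) (recip q0) * rpow (\<beta> z) (recip p0)"
          have g0: "0 \<le> g" by (simp add: g_def rpow_nonneg)
          have "rpow (M / 4) \<nu>0 \<le> rpow (val z) \<nu>0" using val[OF EG(1)[OF z]] M \<nu>0 by (intro rpow_mono) auto
          then have "g * rpow (M / 4) \<nu>0 \<le> gexp (recip q0) (recip p0) \<nu>0 (\<alpha> z) (\<beta> z) (val z)"
            using g0 by (simp add: gexp_def g_def mult_left_mono)
          also have "\<dots> \<le> 8 * (h z * norm (w z))" using B[of z] z by simp
          also have "\<dots> \<le> 8 * (\<bar>h z\<bar> * \<rho>)" using EG(2)[OF z] by (intro mult_left_mono mult_mono) auto
          finally have "g * rpow (M / 4) \<nu>0 * (M / 4) powr (- \<nu>0) \<le> 8 * (\<bar>h z\<bar> * \<rho>) * (M / 4) powr (- \<nu>0)"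
            by (rule mult_right_mono) simp
          moreover have "rpow (M / 4) \<nu>0 * (M / 4) powr (- \<nu>0) = 1" using M by (simp add: rpow_def powr_minus)
          ultimately show ?thesis unfolding g_def[symmetric] by (simp add: mult.assoc mult_ac)
        qed
      qed
      have "M \<le> 128 / \<theta> * R1 powr (d / p) * K"
      proof (rule step[OF R1(1) \<rho>_def _ Sb _ _ _ EB])
        show "ennreal (M * \<omega> * \<rho> powr d / 16) \<le> emeasure lborel S"
          unfolding Sm using M \<omega> by (intro ennreal_leI) auto
      qed (auto simp: \<rho> S_def)
      also have "R1 powr (d / p) \<le> N1 * C"
      proof -
        have "N1 powr (d / p) \<le> N1 powr 1" using N1 dp by (intro powr_mono) auto
        then have "N1 powr (d / p) * C \<le> N1 * C" using N1 C0 by (intro mult_right_mono) auto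
        then show ?thesis using p0 by (simp add: R1_def powr_mult C e_def)
      qed
      then have "128 / \<theta> * R1 powr (d / p) * K \<le> 128 / \<theta> * (N1 * C) * K"
        using \<theta>(1) K(2) by (intro mult_right_mono mult_left_mono) auto
      finally show ?thesis by (simp add: Nc M_def mult.assoc)
    next
      case False
      \<comment> \<open>If p0 does not exceed d, then \<nu>0 >= 0 forces p0 = d, q0 = \<infinity>
        and \<nu>0 = 0. No power of \<rho>/M is left that could be made small.\<close>
      have dr: "d * recip p0 \<le> 1" using \<nu>0 rn by linarith
      obtain P0 where P0: "1 \<le> P0" "p0 = ennreal P0" "recip p0 = 1 / P0"
        using recip_cases[OF pq(1)] False by (metis ennreal_less_top top.not_eq_extremum)
      have "d \<le> P0" using dr P0(1) unfolding P0(3) by (simp add: divide_le_eq)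
      moreover have "P0 \<le> d" using False P0 d1 by (simp add: not_less)
      ultimately have P0d: "P0 = d" by simp
      then have p0: "p0 = ennreal d" "recip p0 = 1 / d" using P0 by auto
      have q00: "recip q0 = 0" "\<nu>0 = 0" using \<nu>0 rn p0 d1 by auto
      have q0: "q0 = top" using recip_cases[OF pq(2)] q00 by (metis divide_eq_0_iff not_one_le_zero one_neq_zero)
      have Kn: "64 * 8 powr d * H powr d / \<omega> < real Kn"
        unfolding Kn_def annuli_number_def \<omega>_def by linarith
      have \<rho>0: "0 < \<rho>0" using M R by (simp add: \<rho>0_def)
      have "\<exists>k<Kn. (\<integral>\<^sup>+z. indicator (\<Gamma>B \<inter> P ({M / 2..5 * M / 8} \<times> UNIV) \<inter> {z. \<rho>0 / 2 ^ Suc k < norm (w z) \<and> norm (w z) \<le> \<rho>0 / 2 ^ k}) z * ennreal (\<alpha> z * \<beta> z) \<partial>lborel)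
          \<le> ennreal (M * \<omega> * (\<rho>0 / 2 ^ k) powr d / 64)"
      proof (rule annulus_selection[where h = h and H = H, folded d_def, folded \<omega>_def, OF M \<rho>0 _ mm(1,2) h(1) mm(4) nn _ _ _ h(3) Kn])
        show "\<Gamma>B \<inter> P ({M / 2..5 * M / 8} \<times> UNIV) \<in> sets borel" 
          by (intro sets.Int \<Gamma>(3) PB borel_closed closed_Times closed_UNIV closed_atLeastAtMost)
        show "(\<integral>\<^sup>+t. indicator (\<Gamma>B \<inter> P ({M / 2..5 * M / 8} \<times> UNIV)) (t, x) * ennreal (\<alpha> (t, x)) \<partial>lborel) \<le> ennreal M" for x
          by (rule order_trans[OF nn_integral_mono time[of x]]) (use B\<Gamma> in \<open>auto simp: indicator_def\<close>)
        show "\<beta> z powr (1 / d) \<le> 8 * \<bar>h z\<bar> * norm (w z)" if "z \<in> \<Gamma>B \<inter> P ({M / 2..5 * M / 8} \<times> UNIV)" for z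
        proof -
          have "\<beta> z powr (1 / d) = gexp (recip q0) (recip p0) \<nu>0 (\<alpha> z) (\<beta> z) (val z)"
            using d1 unfolding q00 p0(2) by (simp add: gexp_def rpow_def)
          also have "\<dots> \<le> 8 * (h z * norm (w z))" using B[of z] that by simp
          also have "\<dots> \<le> 8 * (\<bar>h z\<bar> * norm (w z))" by (intro mult_left_mono mult_right_mono) auto
          finally show ?thesis by simp
        qed
        show "mixed_norm top (ennreal d) (\<lambda>z. ennreal \<bar>h z\<bar>) = ennreal H" using h(2) by (simp add: q0 p0)
      qed
      then obtain k where k: "k < Kn" and Vk: "(\<integral>\<^sup>+z. indicator (\<Gamma>B \<inter> P ({M / 2..5 * M / 8} \<times> UNIV) \<inter> {z. \<rho>0 / 2 ^ Suc k < norm (w z) \<and> norm (w z) \<le> \<rho>0 / 2 ^ k}) z * ennreal (\<alpha> z * \<beta> z) \<partial>lborel)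
          \<le> ennreal (M * \<omega> * (\<rho>0 / 2 ^ k) powr d / 64)" by blast
      define \<rho> where "\<rho> = \<rho>0 / 2 ^ k"
      have \<rho>: "0 < \<rho>" using \<rho>0 by (simp add: \<rho>_def)
      \<comment> \<open>Only slopes in the selected annulus. Removing the half ball takes away at
        most half of the measure, because 2^d >= 2; this is why c/16 rather than c/8 is asked
        for.\<close>
      define S where "S = {M / 2..5 * M / 8} \<times> cball (0 :: real^'n) \<rho> - {M / 2..5 * M / 8} \<times> cball 0 (\<rho> / 2)"
      have cb: "{M / 2..5 * M / 8} \<times> cball (0 :: real^'n) x \<in> sets borel" for x
        by (intro borel_compact compact_Times) auto
      have Sb: "S \<in> sets borel" unfolding S_def by (intro sets.Diff cb)
      have Sm: "ennreal (M * \<omega> * \<rho> powr d / 16) \<le> emeasure lborel S"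
      proof -
        have pw: "(2::real) powr d \<ge> 2" using powr_mono[OF d1, of 2] by simp
        have "emeasure lborel S = emeasure lborel ({M / 2..5 * M / 8} \<times> cball (0 :: real^'n) \<rho>) - emeasure lborel ({M / 2..5 * M / 8} \<times> cball (0 :: real^'n) (\<rho> / 2))"
          unfolding S_def
        proof (rule emeasure_Diff)
          show "emeasure lborel ({M / 2..5 * M / 8} \<times> cball (0 :: real^'n) (\<rho> / 2)) \<noteq> \<infinity>"
            using M \<rho> by (subst emeasure_Icc_times_cball) auto
        qed (use cb \<rho> in \<open>auto intro!: cb\<close>)
        also have "\<dots> = ennreal (M / 8 * (\<omega> * \<rho> powr d)) - ennreal (M / 8 * (\<omega> * (\<rho> / 2) powr d))"
          using M \<rho> by (simp add: emeasure_Icc_times_cball \<omega>_def d_def powr_realpow)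
        also have "\<dots> = ennreal (M / 8 * (\<omega> * \<rho> powr d) - M / 8 * (\<omega> * (\<rho> / 2) powr d))"
          using M \<omega> by (intro ennreal_minus) auto
        finally have eq: "emeasure lborel S = ennreal (M / 8 * (\<omega> * \<rho> powr d) - M / 8 * (\<omega> * (\<rho> / 2) powr d))" .
        have "(\<rho> / 2) powr d = \<rho> powr d / 2 powr d" using \<rho> by (simp add: powr_divide)
        also have "\<dots> \<le> \<rho> powr d / 2" using pw by (intro divide_left_mono) auto
        finally have "M / 8 * (\<omega> * (\<rho> / 2) powr d) \<le> M / 8 * (\<omega> * (\<rho> powr d / 2))"
          using M \<omega> by (intro mult_left_mono) auto
        then show ?thesis unfolding eq by (intro ennreal_leI) (simp add: field_simps)
      qed
      have PS: "P ({M / 2..5 * M / 8} \<times> UNIV) \<inter> {z. \<rho>0 / 2 ^ Suc k < norm (w z) \<and> norm (w z) \<le> \<rho>0 / 2 ^ k} = P S"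
        by (auto simp: P_def S_def \<rho>_def mult.commute)
      have "M \<le> 128 / \<theta> * (2 ^ k * R) powr (d / p) * K"
      proof (rule step[where \<rho> = \<rho> and S = S])
        have "1 * R \<le> 2 ^ k * R" using R by (intro mult_right_mono) auto
        then show "R \<le> 2 ^ k * R" by simp
        show "\<rho> = M / (4 * (2 ^ k * R))" by (simp add: \<rho>_def \<rho>0_def mult_ac)
        show "\<rho>1 \<le> \<rho>" using False k \<rho>0 by (auto simp: \<rho>1_def \<rho>_def intro!: divide_left_mono power_increasing)
        show "(\<integral>\<^sup>+z. indicator (\<Gamma>B \<inter> P S) z * ennreal (\<alpha> z * \<beta> z) \<partial>lborel) \<le> ennreal (M * \<omega> * \<rho> powr d / 64)"
          using Vk unfolding Int_assoc PS \<rho>_def .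
      qed (use Sb Sm in \<open>auto simp: S_def\<close>)
      also have "(2 ^ k * R) powr (d / p) \<le> C"
      proof -
        have "(2 ^ k) powr (d / p) \<le> (2 ^ k) powr (1::real)" using dp by (intro powr_mono) auto
        also have "\<dots> \<le> 2 ^ Kn" using k by simp
        finally have "(2 ^ k) powr (d / p) * R powr (d / p) \<le> 2 ^ Kn * R powr (d / p)" by (rule mult_right_mono) simp
        then show ?thesis using False by (simp add: C Kn_def powr_mult)
      qed
      then have "128 / \<theta> * (2 ^ k * R) powr (d / p) * K \<le> 128 / \<theta> * (1 * C) * K"
        using \<theta>(1) K(2) by (intro mult_right_mono mult_left_mono) auto
      also have "\<dots> \<le> 128 / \<theta> * (N1 * C) * K"
        using \<theta>(1) K(2) N1 C0 by (intro mult_right_mono mult_left_mono) auto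
      finally show ?thesis by (simp add: Nc M_def mult.assoc)
    qed
  qed
qed

text \<open>What remains after \<open>estimate_at_point\<close> is arithmetic in the extended reals.
  The supremum is finite because u is bounded on the compact closure and the parabolic boundary is
  nonempty; if the norm is infinite, so is the right-hand side, since the constants are positive.
  The constant for p0 = d is a power of 2 because up to \<open>annuli_number\<close> halvings of the
  slope may occur.\<close>

theorem theorem1p3p11:
  assumes "CARD('n::finite) \<ge> 2"
  shows "\<exists>(N :: ennreal \<Rightarrow> real) (M :: real \<Rightarrow> real).
    (\<forall>p0. N p0 > 0) \<and> (\<forall>s. M s > 0) \<and>
    (\<forall>(R::real) (\<Omega> :: (real \<times> (real^'n)) set)
       (a :: real \<times> (real^'n) \<Rightarrow> real^'n^'n) (b :: real \<times> (real^'n) \<Rightarrow> real^'n)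
       (c :: real \<times> (real^'n) \<Rightarrow> real) (r :: real \<times> (real^'n) \<Rightarrow> real)
       (p0::ennreal) (q0::ennreal) (h :: real \<times> (real^'n) \<Rightarrow> real)
       (p::real) (q::real) (u :: real \<times> (real^'n) \<Rightarrow> real)
       (ut :: real \<times> (real^'n) \<Rightarrow> real) (Du :: real \<times> (real^'n) \<Rightarrow> real^'n)
       (D2u :: real \<times> (real^'n) \<Rightarrow> real^'n^'n).
      let d = real CARD('n);
          \<nu>0 = 1 - d * recip p0 - recip q0;
          \<nu> = 1 - d / p - 1 / q;
          H = enn2real (mixed_norm q0 p0 (\<lambda>z. ennreal \<bar>h z\<bar>));
          L = parabolic_op a b c r u ut Du D2u;
          C = (if p0 > ennreal d
               then (R + H powr (if p0 = top then 1 else enn2real p0 / (enn2real p0 - d))) powr (d / p)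
               else M H * R powr (d / p))
      in
        0 < R \<and> \<Omega> \<subseteq> UNIV \<times> ball 0 R \<and> open \<Omega> \<and> connected \<Omega> \<and> \<Omega> \<noteq> {} \<and> bounded \<Omega> \<and>
        a \<in> borel_measurable (restrict_space borel \<Omega>) \<and>
        b \<in> borel_measurable (restrict_space borel \<Omega>) \<and>
        c \<in> borel_measurable (restrict_space borel \<Omega>) \<and>
        r \<in> borel_measurable (restrict_space borel \<Omega>) \<and>
        (\<forall>z\<in>\<Omega>. transpose (a z) = a z \<and> (\<forall>\<xi>. 0 \<le> \<xi> \<bullet> (a z *v \<xi>)) \<and> 0 \<le> c z \<and> 0 \<le> r z) \<and>
        1 \<le> p0 \<and> 1 \<le> q0 \<and> 0 \<le> \<nu>0 \<and>
        h \<in> mixed_L q0 p0 UNIV \<and>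
        (\<forall>z\<in>\<Omega>. norm (b z) \<le>
          rpow (r z) (recip q0) * rpow (det (a z)) (recip p0) * rpow (c z) \<nu>0 * h z) \<and>
        (AE z in lborel. z \<in> \<Omega> \<longrightarrow> 0 < r z + trace (a z) + c z) \<and>
        1 < p \<and> 1 < q \<and> 0 \<le> \<nu> \<and>
        u \<in> W12_loc (ennreal q) (ennreal p) \<Omega> \<and> continuous_on (closure \<Omega>) u \<and>
        sobolev_derivs \<Omega> u ut Du D2u
        \<longrightarrow>
        (\<forall>z\<in>\<Omega>. ereal (u z) \<le>
          (SUP y\<in>parabolic_boundary \<Omega>. ereal (pos_part (u y))) +
          ereal (N p0 * C) *
          enn2ereal (mixed_norm_on (ennreal q) (ennreal p) (\<Omega> \<inter> {y. L y < 0})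
            (\<lambda>y. epow (ennreal (c y)) (- \<nu>) * epow (ennreal (r y)) (- 1 / q) *
                 epow (ennreal (det (a y))) (- 1 / p) * ennreal (neg_part (L y))))))"
proof (rule exI[of _ "N_const (real CARD('n))"], rule exI[of _ "\<lambda>H. 2 ^ annuli_number (real CARD('n)) H"], intro conjI allI)
  have th: "0 < theta_const (real CARD('n))" by (simp add: theta_const_def)
  show Npos: "0 < N_const (real CARD('n)) p0" for p0
    unfolding N_const_def using th by (intro mult_pos_pos divide_pos_pos) auto
  show "(0::real) < 2 ^ annuli_number (real CARD('n)) s" for s by simp
  fix R :: real and \<Omega> :: "(real \<times> (real^'n)) set" and a :: "real \<times> (real^'n) \<Rightarrow> real^'n^'n" and b :: "real \<times> (real^'n) \<Rightarrow> real^'n"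
    and c r :: "real \<times> (real^'n) \<Rightarrow> real" and p0 q0 :: ennreal and h :: "real \<times> (real^'n) \<Rightarrow> real" and p q :: real
    and u ut :: "real \<times> (real^'n) \<Rightarrow> real" and Du :: "real \<times> (real^'n) \<Rightarrow> real^'n" and D2u :: "real \<times> (real^'n) \<Rightarrow> real^'n^'n"
  define d where "d = real CARD('n)"
  define \<nu>0 where "\<nu>0 = 1 - d * recip p0 - recip q0"
  define \<nu> where "\<nu> = 1 - d / p - 1 / q"
  define H where "H = enn2real (mixed_norm q0 p0 (\<lambda>z. ennreal \<bar>h z\<bar>))"
  define L where "L = parabolic_op a b c r u ut Du D2u"
  define C where "C = (if p0 > ennreal d
               then (R + H powr (if p0 = top then 1 else enn2real p0 / (enn2real p0 - d))) powr (d / p)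
               else 2 ^ annuli_number d H * R powr (d / p))"
  define W where "W = (\<lambda>y. indicator (\<Omega> \<inter> {y. L y < 0}) y * (epow (ennreal (c y)) (- \<nu>) * epow (ennreal (r y)) (- 1 / q) *
                 epow (ennreal (det (a y))) (- 1 / p) * ennreal (neg_part (L y))))"
  have main: "ereal (u z) \<le> (SUP y\<in>parabolic_boundary \<Omega>. ereal (pos_part (u y))) + ereal (N_const d p0 * C) * enn2ereal (mixed_norm (ennreal q) (ennreal p) W)"
    if hyp: "0 < R \<and> \<Omega> \<subseteq> UNIV \<times> ball 0 R \<and> open \<Omega> \<and> connected \<Omega> \<and> \<Omega> \<noteq> {} \<and> bounded \<Omega> \<and>
        a \<in> borel_measurable (restrict_space borel \<Omega>) \<and>
        b \<in> borel_measurable (restrict_space borel \<Omega>) \<and>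
        c \<in> borel_measurable (restrict_space borel \<Omega>) \<and>
        r \<in> borel_measurable (restrict_space borel \<Omega>) \<and>
        (\<forall>z\<in>\<Omega>. transpose (a z) = a z \<and> (\<forall>\<xi>. 0 \<le> \<xi> \<bullet> (a z *v \<xi>)) \<and> 0 \<le> c z \<and> 0 \<le> r z) \<and>
        1 \<le> p0 \<and> 1 \<le> q0 \<and> 0 \<le> \<nu>0 \<and>
        h \<in> mixed_L q0 p0 UNIV \<and>
        (\<forall>z\<in>\<Omega>. norm (b z) \<le>
          rpow (r z) (recip q0) * rpow (det (a z)) (recip p0) * rpow (c z) \<nu>0 * h z) \<and>
        (AE z in lborel. z \<in> \<Omega> \<longrightarrow> 0 < r z + trace (a z) + c z) \<and>
        1 < p \<and> 1 < q \<and> 0 \<le> \<nu> \<and>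
        u \<in> W12_loc (ennreal q) (ennreal p) \<Omega> \<and> continuous_on (closure \<Omega>) u \<and>
        sobolev_derivs \<Omega> u ut Du D2u" and z: "z \<in> \<Omega>" for z
  proof -
    let ?PB = "parabolic_boundary \<Omega>"
    have O: "open \<Omega>" "bounded \<Omega>" "\<Omega> \<noteq> {}" and cu: "continuous_on (closure \<Omega>) u" and R: "0 < R" and q: "1 < q" "1 < p"
      and pq: "1 \<le> p0" "1 \<le> q0" and hL: "h \<in> mixed_L q0 p0 UNIV" using hyp by blast+
    have d1: "1 \<le> d" by (simp add: d_def)
    have "R + H powr x \<noteq> 0" for x
    proof -
      have "0 < R + H powr x" using R by (intro add_pos_nonneg) auto
      then show ?thesis by simp
    qed
    then have "0 < (R + H powr x) powr y" for x y by (simp only: powr_gt_zero simp_thms)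
    moreover have "0 < 2 ^ annuli_number d H * R powr (d / p)" using R by simp
    ultimately have C: "0 < C" unfolding C_def by (cases "p0 > ennreal d") (simp_all only: if_True if_False)
    have hm: "h \<in> borel_measurable borel" and hH: "mixed_norm q0 p0 (\<lambda>z. ennreal \<bar>h z\<bar>) = ennreal H" and H0: "0 \<le> H"
      using hL by (auto simp: mixed_L_def mixed_norm_on_def H_def less_top[symmetric])
    define m0 where "m0 = (SUP y\<in>?PB. pos_part (u y))"
    have PBne: "?PB \<noteq> {}" by (rule parabolic_boundary_nonempty[OF O])
    have PBc: "?PB \<subseteq> closure \<Omega>" by (auto simp: parabolic_boundary_def frontier_def)
    have "compact (closure \<Omega>)" using O by simp
    then have "bounded (u ` closure \<Omega>)" using cu by (intro compact_imp_bounded compact_continuous_image)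
    then obtain B where B: "\<And>y. y \<in> closure \<Omega> \<Longrightarrow> \<bar>u y\<bar> \<le> B" unfolding bounded_iff by (auto simp: real_norm_def)
    have ub: "pos_part (u y) \<le> B" if "y \<in> ?PB" for y using B[OF subsetD[OF PBc that]] by (simp add: pos_part_def)
    have bdd: "bdd_above ((\<lambda>y. pos_part (u y)) ` ?PB)" using ub by (intro bdd_aboveI2)
    have up: "pos_part (u y) \<le> m0" if "y \<in> ?PB" for y unfolding m0_def by (rule cSUP_upper[OF that bdd])
    have uy: "u y \<le> m0" if "y \<in> ?PB" for y using up[OF that] by (simp add: pos_part_def)
    obtain y0 where "y0 \<in> ?PB" using PBne by blast
    then have m0: "0 \<le> m0" using up[of y0] by (simp add: pos_part_def)
    have sup: "(SUP y\<in>?PB. ereal (pos_part (u y))) = ereal m0"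
    proof -
      have "\<bar>SUP y\<in>?PB. ereal (pos_part (u y))\<bar> \<noteq> \<infinity>"
      proof -
        have "(SUP y\<in>?PB. ereal (pos_part (u y))) \<le> ereal B" using ub by (intro SUP_least) simp
        moreover have "ereal (pos_part (u y0)) \<le> (SUP y\<in>?PB. ereal (pos_part (u y)))" by (rule SUP_upper[OF \<open>y0 \<in> ?PB\<close>])
        ultimately show ?thesis by auto
      qed
      then show ?thesis unfolding m0_def by (rule ereal_SUP[symmetric])
    qed
    show ?thesis
    proof (cases "mixed_norm (ennreal q) (ennreal p) W")
      case top
      have "N_const d p0 \<noteq> 0" using Npos[of p0] by (simp add: d_def)
      then show ?thesis using C Npos[of p0] by (simp add: top sup d_def)
    next
      case (real K)
      \<comment> \<open>p0 / (p0 - d) = 1 / (1 - d/p0) for finite p0 > d; at p0 = \<infinity> both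
        are 1, since the reciprocal of \<infinity> is 0.\<close>
      have Ce: "C = (if p0 > ennreal d then (R + H powr (1 / (1 - d * recip p0))) powr (d / p)
        else 2 ^ annuli_number d H * R powr (d / p))"
      proof (cases rule: recip_cases[OF pq(1)])
        case 1
        then show ?thesis by (simp add: C_def)
      next
        case (2 P)
        have "1 / (1 - d * (1 / P)) = P / (P - d)" if "d < P" using that 2 d1 by (simp add: field_simps)
        then show ?thesis using 2 d1 by (simp add: C_def ennreal_less_iff)
      qed
      have "u z - m0 \<le> N_const d p0 * C * K"
      proof (rule estimate_at_point[where \<Omega> = \<Omega>, folded d_def, OF _ _ O(1,2) _ _ _ _ _ pq \<nu>0_def _ hm hH H0 _ _ q \<nu>_def _ _ cu _ L_def W_def real(2,1) z m0 uy Ce])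
        show "psd (a z) \<and> 0 \<le> c z \<and> 0 \<le> r z" if "z \<in> \<Omega>" for z using hyp that by (auto simp: psd_def)
        show "norm (b z) \<le> gexp (recip q0) (recip p0) \<nu>0 (r z) (det (a z)) (c z) * h z" if "z \<in> \<Omega>" for z
          using hyp that by (simp add: gexp_def)
      qed (use hyp in auto)
      then have "ereal (u z) \<le> ereal (m0 + N_const d p0 * C * K)" by simp
      also have "\<dots> = ereal m0 + ereal (N_const d p0 * C) * enn2ereal (ennreal K)" using real by (simp add: enn2ereal_ennreal)
      finally show ?thesis by (simp add: sup real)
    qed
  qed
  show "let d = real CARD('n);
          \<nu>0 = 1 - d * recip p0 - recip q0;
          \<nu> = 1 - d / p - 1 / q;
          H = enn2real (mixed_norm q0 p0 (\<lambda>z. ennreal \<bar>h z\<bar>));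
          L = parabolic_op a b c r u ut Du D2u;
          C = (if p0 > ennreal d
               then (R + H powr (if p0 = top then 1 else enn2real p0 / (enn2real p0 - d))) powr (d / p)
               else 2 ^ annuli_number (real CARD('n)) H * R powr (d / p))
      in 0 < R \<and> \<Omega> \<subseteq> UNIV \<times> ball 0 R \<and> open \<Omega> \<and> connected \<Omega> \<and> \<Omega> \<noteq> {} \<and> bounded \<Omega> \<and>
        a \<in> borel_measurable (restrict_space borel \<Omega>) \<and>
        b \<in> borel_measurable (restrict_space borel \<Omega>) \<and>
        c \<in> borel_measurable (restrict_space borel \<Omega>) \<and>
        r \<in> borel_measurable (restrict_space borel \<Omega>) \<and>
        (\<forall>z\<in>\<Omega>. transpose (a z) = a z \<and> (\<forall>\<xi>. 0 \<le> \<xi> \<bullet> (a z *v \<xi>)) \<and> 0 \<le> c z \<and> 0 \<le> r z) \<and>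
        1 \<le> p0 \<and> 1 \<le> q0 \<and> 0 \<le> \<nu>0 \<and>
        h \<in> mixed_L q0 p0 UNIV \<and>
        (\<forall>z\<in>\<Omega>. norm (b z) \<le>
          rpow (r z) (recip q0) * rpow (det (a z)) (recip p0) * rpow (c z) \<nu>0 * h z) \<and>
        (AE z in lborel. z \<in> \<Omega> \<longrightarrow> 0 < r z + trace (a z) + c z) \<and>
        1 < p \<and> 1 < q \<and> 0 \<le> \<nu> \<and>
        u \<in> W12_loc (ennreal q) (ennreal p) \<Omega> \<and> continuous_on (closure \<Omega>) u \<and>
        sobolev_derivs \<Omega> u ut Du D2u
        \<longrightarrow>
        (\<forall>z\<in>\<Omega>. ereal (u z) \<le>
          (SUP y\<in>parabolic_boundary \<Omega>. ereal (pos_part (u y))) +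
          ereal (N_const (real CARD('n)) p0 * C) *
          enn2ereal (mixed_norm_on (ennreal q) (ennreal p) (\<Omega> \<inter> {y. L y < 0})
            (\<lambda>y. epow (ennreal (c y)) (- \<nu>) * epow (ennreal (r y)) (- 1 / q) *
                 epow (ennreal (det (a y))) (- 1 / p) * ennreal (neg_part (L y)))))"
    using main unfolding Let_def d_def[symmetric] \<nu>0_def[symmetric] \<nu>_def[symmetric] H_def[symmetric] L_def[symmetric] C_def[symmetric]
      mixed_norm_on_def W_def[symmetric] by blast
qed

end
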